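(* For each $*\in\{0,\square,\ell\}$, let $\mathcal R_*(H):=\{\mathcal E\in\mathcal S_*(H)\mid r_{\mathcal E}\ge 1\}$. Then, as $H\to\infty$, $$\frac{\sharp\mathcal R_*(H)}{\sharp\mathcal S_*(H)}=O\left(H^{-1/3}(\log H\,\log\log H)^{2/3}\right).$$
   Context: For polynomials $A,B,C\in\mathbb Z[X]$ with $\deg(A),\deg(B),\deg(C-X^3)\le 2$, let $\mathcal E_{A,B,C}$ denote the curve over $\mathbb Q(T)$ given by $$\mathcal E_{A,B,C}:\quad Y^2=A(X)T^2+B(X)T+C(X).$$ Collecting powers of $X$, the right-hand side is $X^3+\alpha_2(T)X^2+\alpha_4(T)X+\alpha_6(T)$ with $\alpha_i\in\mathbb Z[T]$ of degree $\le 2$. The curve is called non-singular if the discriminant of this Weierstrass equation is not the zero polynomial in $T$; then it is an elliptic curve over $\mathbb Q(T)$, its group of $\mathbb Q(T)$-rational points is finitely generated, and $r_{\mathcal E_{A,B,C}}$ denotes the rank of $\mathcal E_{A,B,C}(\mathbb Q(T))$. For $P\in\mathbb Z[X]$, $\|P\|$ is the maximum of the absolute values of the coefficients of $P$, and $\|P_1,\dots,P_n\|:=\max(\|P_1\|,\dots,\|P_n\|)$. Conditions of the form $\deg(P)\le d$ allow $P=0$. With $A,B,C\in\mathbb Z[X]$, define - $\mathcal S_0(H)$: the set of non-singular $\mathcal E_{A,B,C}$ with $A=0$, $\deg(B)\le 2$, $\deg(C-X^3)\le 2$, $\|B,C\|\le H$; - $\mathcal S_\square(H)$: the set of non-singular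 $\mathcal E_{A^2,B,C}$ with $\deg(A)=0$ (so $A$ is a nonzero integer constant), $\deg(B)\le 2$, $\deg(C-X^3)\le 2$, $\|A,B,C\|\le H$; - $\mathcal S_\ell(H)$: the set of non-singular $\mathcal E_{A,B,C}$ with $\deg(A)\le1$, $\deg(B)\le1$, $\deg(C-X^3)\le 1$, $\|A,B,C\|\le H$. *)

theory Defs
  imports
    Complex_Main
    "HOL-Library.Extended_Nat"
    "HOL-Library.Landau_Symbols"
    "HOL-Computational_Algebra.Polynomial"
    "HOL-Computational_Algebra.Fraction_Field"
    "HOL-Algebra.FiniteProduct"
begin

section \<open>Rank of an abelian group\<close>

definition int_independent :: "('g, 'r) monoid_scheme \<Rightarrow> 'g set \<Rightarrow> bool" where
  "int_independent G S \<longleftrightarrow>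
     finite S \<and> S \<subseteq> carrier G \<and>
     (\<forall>n :: 'g \<Rightarrow> int.
        finprod G (\<lambda>P. P [^]\<^bsub>G\<^esub> n P) S = \<one>\<^bsub>G\<^esub> \<longrightarrow> (\<forall>P\<in>S. n P = 0))"

text \<open>The value is an extended natural number so that no finiteness theorem is needed
  to make sense of it; for a finitely generated abelian group it is finite.\<close>

definition ab_group_rank :: "('g, 'r) monoid_scheme \<Rightarrow> enat" where
  "ab_group_rank G = Sup {enat (card S) | S. int_independent G S}"


section \<open>Curves Y^2 = X^3 + a2 X^2 + a4 X + a6\<close>

datatype 'a wcurve = WCurve (wc_a2: 'a) (wc_a4: 'a) (wc_a6: 'a)

text \<open>The standard discriminant of the Weierstrass equation with a1 = a3 = 0, that is,
  16 times the discriminant of the cubic.\<close>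

definition discriminant :: "'a::comm_ring_1 wcurve \<Rightarrow> 'a" where
  "discriminant E = (case E of WCurve a2 a4 a6 \<Rightarrow>
     16 * (a2^2 * a4^2 - 4 * a4^3 - 4 * a2^3 * a6 + 18 * a2 * a4 * a6 - 27 * a6^2))"

datatype 'a point = PointAtInfinity | Affine 'a 'a

fun on_curve :: "'a::field wcurve \<Rightarrow> 'a point \<Rightarrow> bool" where
  "on_curve E PointAtInfinity \<longleftrightarrow> True"
| "on_curve E (Affine x y) \<longleftrightarrow> y^2 = x^3 + wc_a2 E * x^2 + wc_a4 E * x + wc_a6 E"

text \<open>Chord-and-tangent addition (characteristic different from 2).\<close>

fun point_add :: "'a::field wcurve \<Rightarrow> 'a point \<Rightarrow> 'a point \<Rightarrow> 'a point" where
  "point_add E PointAtInfinity Q = Q"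
| "point_add E P PointAtInfinity = P"
| "point_add E (Affine x1 y1) (Affine x2 y2) =
     (if x1 = x2 \<and> y1 = - y2 then PointAtInfinity
      else
        let s = (if x1 = x2
                 then (3 * x1^2 + 2 * wc_a2 E * x1 + wc_a4 E) / (2 * y1)
                 else (y2 - y1) / (x2 - x1));
            x3 = s^2 - wc_a2 E - x1 - x2
        in Affine x3 (s * (x1 - x3) - y1))"

definition point_group :: "'a::field wcurve \<Rightarrow> 'a point monoid" where
  "point_group E =
     \<lparr> carrier = {P. on_curve E P}, mult = point_add E, one = PointAtInfinity \<rparr>"

definition ec_rank :: "'a::field wcurve \<Rightarrow> enat" where
  "ec_rank E = ab_group_rank (point_group E)"


section \<open>The curves Y^2 = A(X) T^2 + B(X) T + C(X) over Q(T)\<close>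

text \<open>Integer polynomials serve both as elements of Z[X] (for A, B, C) and of Z[T] (for the
  Weierstrass coefficients); the type \<open>rat poly fract\<close> is Q(T). The coefficient of X^i in
  A(X) T^2 + B(X) T + C(X) is the following element of Z[T].\<close>

definition X_coeff :: "int poly \<Rightarrow> int poly \<Rightarrow> int poly \<Rightarrow> nat \<Rightarrow> int poly" where
  "X_coeff A B C i = [:coeff C i, coeff B i, coeff A i:]"

definition int_model :: "int poly \<Rightarrow> int poly \<Rightarrow> int poly \<Rightarrow> int poly wcurve" where
  "int_model A B C = WCurve (X_coeff A B C 2) (X_coeff A B C 1) (X_coeff A B C 0)"

lemma int_model_collects:
  fixes A B C :: "int poly" and x t :: int
  assumes "degree A \<le> 2" "degree B \<le> 2" "degree (C - monom 1 3) \<le> 2"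
  shows "poly A x * t^2 + poly B x * t + poly C x =
    x^3 + poly (wc_a2 (int_model A B C)) t * x^2
        + poly (wc_a4 (int_model A B C)) t * x + poly (wc_a6 (int_model A B C)) t"
proof -
  have quad: "poly P x = coeff P 0 + coeff P 1 * x + coeff P 2 * x^2"
    if "degree P \<le> 2" for P :: "int poly"
  proof -
    have "poly P x = (\<Sum>i\<le>2. coeff P i * x ^ i)"
      unfolding poly_altdef
      by (rule sum.mono_neutral_left) (use that in \<open>auto simp: coeff_eq_0\<close>)
    then show ?thesis
      by (simp add: numeral_2_eq_2)
  qed
  have "poly C x = poly (C - monom 1 3) x + x^3"
    by (simp add: poly_monom)
  also have "\<dots> = coeff C 0 + coeff C 1 * x + coeff C 2 * x^2 + x^3"
    by (subst quad[OF assms(3)]) simp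
  finally show ?thesis
    using quad[OF assms(1)] quad[OF assms(2)]
    by (simp add: int_model_def X_coeff_def algebra_simps power2_eq_square)
qed

definition to_QT :: "int poly \<Rightarrow> rat poly fract" where
  "to_QT p = Fract (map_poly of_int p) 1"

definition EC :: "int poly \<Rightarrow> int poly \<Rightarrow> int poly \<Rightarrow> rat poly fract wcurve" where
  "EC A B C = map_wcurve to_QT (int_model A B C)"

definition nonsingular :: "int poly \<Rightarrow> int poly \<Rightarrow> int poly \<Rightarrow> bool" where
  "nonsingular A B C \<longleftrightarrow> discriminant (int_model A B C) \<noteq> 0"


section \<open>The families\<close>

definition poly_height :: "int poly \<Rightarrow> int" where
  "poly_height P = Max ((\<lambda>i. \<bar>coeff P i\<bar>) ` {..degree P})"

definition heights :: "int poly list \<Rightarrow> int" where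
  "heights Ps = Max (poly_height ` set Ps)"

datatype family = Family_0 | Family_square | Family_l

text \<open>These are sets of curves rather than of triples (A, B, C); in \<open>Family_square\<close> the
  parameters A and -A give the same curve.\<close>

fun curves :: "family \<Rightarrow> real \<Rightarrow> rat poly fract wcurve set" where
  "curves Family_0 H = {EC 0 B C | B C.
     nonsingular 0 B C \<and> degree B \<le> 2 \<and> degree (C - monom 1 3) \<le> 2 \<and>
     of_int (heights [B, C]) \<le> H}"
| "curves Family_square H = {EC (A^2) B C | A B C.
     nonsingular (A^2) B C \<and> A \<noteq> 0 \<and> degree A = 0 \<and> degree B \<le> 2 \<and>
     degree (C - monom 1 3) \<le> 2 \<and> of_int (heights [A, B, C]) \<le> H}"
| "curves Family_l H = {EC A B C | A B C.
     nonsingular A B C \<and> degree A \<le> 1 \<and> degree B \<le> 1 \<and>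
     degree (C - monom 1 3) \<le> 1 \<and> of_int (heights [A, B, C]) \<le> H}"

lemma abs_coeff_le_poly_height: "\<bar>coeff P i\<bar> \<le> poly_height P"
proof (cases "i \<le> degree P")
  case True
  then show ?thesis by (auto simp: poly_height_def intro!: Max_ge)
next
  case False
  have "0 \<le> \<bar>coeff P 0\<bar>" by simp
  also have "\<dots> \<le> poly_height P" by (auto simp: poly_height_def intro!: Max_ge)
  finally show ?thesis using False by (simp add: coeff_eq_0)
qed

lemma poly_height_le_heights: "P \<in> set Ps \<Longrightarrow> poly_height P \<le> heights Ps"
  by (auto simp: heights_def intro!: Max_ge)

lemma finite_bounded_polys: "finite {P. degree P \<le> 3 \<and> of_int (poly_height P) \<le> (H::real)}"
proof -
  define I where "I = {- \<lfloor>H\<rfloor>..\<lfloor>H\<rfloor>}"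
  have "P \<in> (\<lambda>(a, b, c, d). [:a, b, c, d:]) ` (I \<times> I \<times> I \<times> I)"
    if "degree P \<le> 3" "of_int (poly_height P) \<le> H" for P
  proof -
    have "poly_height P \<le> \<lfloor>H\<rfloor>"
      using that(2) by (simp add: le_floor_iff)
    then have "coeff P i \<in> I" for i
      using abs_coeff_le_poly_height[of P i] by (auto simp: I_def)
    moreover have "P = [:coeff P 0, coeff P 1, coeff P 2, coeff P 3:]"
      using that(1)
      by (auto simp: poly_eq_iff coeff_pCons coeff_eq_0 numeral_2_eq_2 numeral_3_eq_3
          split: nat.splits)
    ultimately show ?thesis by (auto simp: image_iff) metis
  qed
  then have "{P. degree P \<le> 3 \<and> of_int (poly_height P) \<le> H}
      \<subseteq> (\<lambda>(a, b, c, d). [:a, b, c, d:]) ` (I \<times> I \<times> I \<times> I)"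
    by blast
  then show ?thesis
    by (rule finite_subset) (simp add: I_def)
qed

lemma finite_curves: "finite (curves fam H)"
proof -
  define F where "F = {P. degree P \<le> 3 \<and> of_int (poly_height P) \<le> H}"
  have fin: "finite F" unfolding F_def by (rule finite_bounded_polys)
  have mem: "P \<in> F" if "degree P \<le> 3" "P \<in> set Ps" "of_int (heights Ps) \<le> H" for P Ps
    using that poly_height_le_heights[of P Ps] by (auto simp: F_def)
  have deg: "degree C \<le> 3" if "degree (C - monom 1 3) \<le> 2" for C :: "int poly"
  proof -
    have "degree (C - monom 1 3 + monom 1 3) \<le> 3"
      by (rule degree_add_le) (use that in \<open>auto simp: degree_monom_eq\<close>)
    then show ?thesis by simp
  qed
  have "curves fam H \<subseteq> (\<lambda>(A, B, C). EC A B C) ` (insert 0 F \<times> F \<times> F)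
      \<union> (\<lambda>(A, B, C). EC (A^2) B C) ` (F \<times> F \<times> F)"
  proof (cases fam)
    case Family_0
    show ?thesis
    proof
      fix E assume "E \<in> curves fam H"
      then obtain B C where E: "E = EC 0 B C" and *: "degree B \<le> 2" "degree (C - monom 1 3) \<le> 2"
        "of_int (heights [B, C]) \<le> H" by (auto simp: Family_0)
      have "B \<in> F" "C \<in> F"
        using * deg[of C] by (auto intro!: mem[of _ "[B, C]"])
      then show "E \<in> (\<lambda>(A, B, C). EC A B C) ` (insert 0 F \<times> F \<times> F)
          \<union> (\<lambda>(A, B, C). EC (A^2) B C) ` (F \<times> F \<times> F)"
        unfolding E by force
    qed
  next
    case Family_square
    show ?thesis
    proof
      fix E assume "E \<in> curves fam H"
      then obtain A B C where E: "E = EC (A^2) B C" and *: "degree A = 0" "degree B \<le> 2"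
        "degree (C - monom 1 3) \<le> 2" "of_int (heights [A, B, C]) \<le> H"
        by (auto simp: Family_square)
      have "A \<in> F" "B \<in> F" "C \<in> F"
        using * deg[of C] by (auto intro!: mem[of _ "[A, B, C]"])
      then show "E \<in> (\<lambda>(A, B, C). EC A B C) ` (insert 0 F \<times> F \<times> F)
          \<union> (\<lambda>(A, B, C). EC (A^2) B C) ` (F \<times> F \<times> F)"
        unfolding E by force
    qed
  next
    case Family_l
    show ?thesis
    proof
      fix E assume "E \<in> curves fam H"
      then obtain A B C where E: "E = EC A B C" and *: "degree A \<le> 1" "degree B \<le> 1"
        "degree (C - monom 1 3) \<le> 1" "of_int (heights [A, B, C]) \<le> H"
        by (auto simp: Family_l)
      have "A \<in> F" "B \<in> F" "C \<in> F"
        using * deg[of C] by (auto intro!: mem[of _ "[A, B, C]"])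
      then show "E \<in> (\<lambda>(A, B, C). EC A B C) ` (insert 0 F \<times> F \<times> F)
          \<union> (\<lambda>(A, B, C). EC (A^2) B C) ` (F \<times> F \<times> F)"
        unfolding E by force
    qed
  qed
  then show ?thesis
    by (rule finite_subset) (use fin in auto)
qed

definition positive_rank_curves :: "family \<Rightarrow> real \<Rightarrow> rat poly fract wcurve set" where
  "positive_rank_curves fam H = {E \<in> curves fam H. ec_rank E \<ge> 1}"

end

theory Submission
  imports
    Defs
    "HOL-Computational_Algebra.Computational_Algebra"
    "HOL-Computational_Algebra.Field_as_Ring"
    "HOL-Real_Asymp.Real_Asymp"
    "HOL-Number_Theory.Cong"
begin

text \<open>A point \<open>(p / q\<^sup>2, r / q\<^sup>3)\<close> with \<open>p, q, r\<close> polynomials in \<open>T\<close> is a section of the cubic surface.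
  Completing the square in \<open>T\<close> turns the surface into \<open>W\<^sup>2 = D + 4 A F\<close> with \<open>D = B\<^sup>2 - 4 A C\<close>
  (or, if \<open>A = 0\<close>, into \<open>T = - C / B\<close>), and \<open>p - X q\<^sup>2\<close> becomes an element of a quadratic order
  over \<open>Q[X]\<close> which is almost a square. If \<open>D\<close> is irreducible (respectively, if \<open>B\<close> is irreducible and the norm
  of \<open>C\<close> from \<open>Q[X] / B\<close> is not a square), it is a square up to a constant, which means that the point
  is twice another point. Since the tangent construction makes the degree of the denominator grow,
  infinite divisibility is impossible; so there is no affine point at all and the rank is 0.

  The conditions on \<open>B\<close>, \<open>C\<close> and \<open>D\<close> follow from their analogues modulo a single prime \<open>p \<ge> 5\<close>, which hold for
  a positive proportion of the residue classes. By a large sieve of Turan's type (variance of the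
  number of good primes up to \<open>z\<close>), the proportion of exceptions is at most a constant times
  \<open>z\<^sup>2 / H + ln z / z\<close>, and \<open>z = (H ln H)\<^bsup>1/3\<^esup>\<close> balances the two terms.\<close>

text \<open>Modulo the cubic, \<open>p - X q\<^sup>2\<close> is at first a square only up to a
  constant and the primes at which the factorisation of \<open>r\<^sup>2\<close> can degenerate: D
  and A, or B if \<open>A = 0\<close>. D is removed by dividing by W, B by means of the norm of C,
  and A because it would make a polynomial of odd degree in T a square. The constant is harmless,
  since evaluation at x shows it to be a square. That the norm of \<open>p - X q\<^sup>2\<close> has
  even degree and square leading coefficient is information at infinity, obtained from limits as X
  grows; here one family needs its leading A to be a square and another needs
  \<open>- coeff A 1\<close> not to be one. The exceptions to the latter are few enough to be
  counted directly. The growth of denominators rests on smoothness, which puts the tangent formula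
  with its denominator \<open>4 r\<^sup>2 q\<^sup>2\<close> into lowest terms. The degree of q can
  then stagnate only if r is constant, and the pole at \<open>T = infinity\<close> prevents this
  from happening twice in succession.\<close>

section \<open>Lower bound for the number of primes\<close>

lemma leibniz_triangle:
  assumes "k < n"
  shows "1 / (real (n + 1) * real (n choose Suc k))
    = 1 / (real n * real ((n - 1) choose k)) - 1 / (real (n + 1) * real (n choose k))"
proof -
  obtain j where n: "n = k + Suc j"
    using assms less_imp_add_positive[of k n] by (metis Suc_pred)
  have a: "real (n choose Suc k) = fact n / (fact (Suc k) * fact j)"
    using binomial_fact[of "Suc k" n, where 'a=real] by (simp add: n)
  have b: "real (n choose k) = fact n / (fact k * fact (Suc j))"
    using binomial_fact[of k n, where 'a=real] by (simp add: n)
  have c: "real ((n - 1) choose k) = fact (n - 1) / (fact k * fact j)"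
    using binomial_fact[of k "n - 1", where 'a=real] by (simp add: n)
  have d: "fact n = real n * fact (n - 1)"
    using assms by (intro fact_reduce) simp
  have n0: "real n = real k + real j + 1" by (simp add: n)
  have pos: "real n > 0" using assms by simp
  show ?thesis
    unfolding a b c d fact_Suc using pos
    by (simp add: divide_simps) (simp add: n0 algebra_simps)
qed

text \<open>Unrolling the recurrence of the Leibniz harmonic triangle writes the reciprocal of
  \<open>(n + 1) * (n choose k)\<close> as an integer combination of unit fractions with
  denominators at most \<open>n + 1\<close>, and \<open>Lcm {1..n + 1}\<close> clears them.\<close>

lemma choose_mult_dvd_Lcm:
  assumes "k \<le> n"
  shows "(n + 1) * (n choose k) dvd Lcm {1..n + 1}"
proof -
  \<comment> \<open>The upper end \<open>N\<close> is kept fixed: the recurrence passes from row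
    \<open>n\<close> to row \<open>n - 1\<close>, and both rows must be cleared by the same
    \<open>Lcm\<close>.\<close>
  have *: "real (Lcm {1..N}) / (real (n + 1) * real (n choose k)) \<in> \<int>"
    if "k \<le> n" "n < N" for n k N :: nat
    using that
  proof (induction k arbitrary: n)
    case 0
    have "n + 1 dvd Lcm {1..N}" using 0 by (intro dvd_Lcm) auto
    then obtain m where "Lcm {1..N} = (n + 1) * m" by blast
    then have "real (Lcm {1..N}) = real (n + 1) * real m" by (metis of_nat_mult)
    then show ?case by simp
  next
    case (Suc k)
    have 1: "real (Lcm {1..N}) / (real n * real ((n - 1) choose k)) \<in> \<int>"
      using Suc.IH[of "n - 1"] Suc.prems by simp
    have 2: "real (Lcm {1..N}) / (real (n + 1) * real (n choose k)) \<in> \<int>"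
      using Suc.IH[of n] Suc.prems by simp
    have "real (Lcm {1..N}) / (real (n + 1) * real (n choose Suc k))
        = real (Lcm {1..N}) * (1 / (real (n + 1) * real (n choose Suc k)))" by simp
    also have "\<dots> = real (Lcm {1..N}) / (real n * real ((n - 1) choose k))
        - real (Lcm {1..N}) / (real (n + 1) * real (n choose k))"
      using Suc.prems by (subst leibniz_triangle) (simp_all add: right_diff_distrib)
    finally show ?case using 1 2 by (metis Ints_diff)
  qed
  have "real (Lcm {1..n + 1}) / real ((n + 1) * (n choose k)) \<in> \<int>"
    using *[of k n "n + 1"] assms by (simp add: distrib_right)
  moreover have "(n + 1) * (n choose k) \<noteq> 0" using assms by simp
  ultimately show ?thesis
    using of_int_div_of_int_in_Ints_iff[of "int (Lcm {1..n + 1})" "int ((n + 1) * (n choose k))", where 'a=real]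
    by (simp del: of_nat_mult of_nat_add of_nat_Suc add: of_nat_dvd_iff)
qed

text \<open>Each prime occurs in the least common multiple to a power that already divides some
  number up to \<open>N\<close>, so every one of these prime powers is at most
  \<open>N\<close>.\<close>

lemma Lcm_le_power_card_primes:
  "Lcm {1..N} \<le> N ^ card {p. prime p \<and> p \<le> N}" for N :: nat
proof -
  define P where "P = {p. prime p \<and> p \<le> N}"
  have finP: "finite P" unfolding P_def by (rule finite_subset[of _ "{..N}"]) auto
  define M where "M p = Max ((\<lambda>m. multiplicity p m) ` {1..N})" for p
  have pw: "p ^ M p \<le> N" if "p \<in> P" for p
  proof -
    have "N \<ge> 1" using that prime_ge_1_nat[of p] by (simp add: P_def)
    then have "M p \<in> (\<lambda>m. multiplicity p m) ` {1..N}" unfolding M_def by (intro Max_in) auto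
    then obtain m where m: "m \<in> {1..N}" "M p = multiplicity p m" by blast
    have "p ^ multiplicity p m dvd m" by (rule multiplicity_dvd)
    then show ?thesis using m dvd_imp_le[of "p ^ M p" m] by auto
  qed
  have "m dvd (\<Prod>p\<in>P. p ^ M p)" if "m \<in> {1..N}" for m
  proof -
    have m0: "m > 0" using that by simp
    have "m = (\<Prod>p\<in>prime_factors m. p ^ multiplicity p m)"
      using prime_factorization_nat[OF m0] .
    also have "\<dots> dvd (\<Prod>p\<in>prime_factors m. p ^ M p)"
      using that by (intro prod_dvd_prod le_imp_power_dvd) (auto simp: M_def)
    also have "\<dots> dvd (\<Prod>p\<in>P. p ^ M p)"
    proof (rule prod_dvd_prod_subset[OF finP])
      show "prime_factors m \<subseteq> P"
      proof
        fix q assume q: "q \<in> prime_factors m"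
        then have "q \<le> m" using m0 by (intro dvd_imp_le) auto
        then show "q \<in> P" using q that by (auto simp: P_def)
      qed
    qed
    finally show ?thesis .
  qed
  then have "Lcm {1..N} dvd (\<Prod>p\<in>P. p ^ M p)" by (rule Lcm_least)
  moreover have "(\<Prod>p\<in>P. p ^ M p) > 0" by (auto simp: P_def prime_gt_0_nat intro!: prod_pos)
  ultimately have "Lcm {1..N} \<le> (\<Prod>p\<in>P. p ^ M p)" by (rule dvd_imp_le)
  also have "\<dots> \<le> (\<Prod>p\<in>P. N)" by (rule prod_mono) (auto intro: pw)
  finally show ?thesis by (simp add: P_def)
qed

text \<open>Nair's argument: the central binomial coefficient is the largest of the
  \<open>2 * n + 1\<close> entries of its row, whose sum is \<open>4 ^ n\<close>, and the two
  preceding bounds for \<open>Lcm\<close> turn this into an upper bound for \<open>n * ln 4\<close>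
  by the number of primes times \<open>ln N\<close>.\<close>

lemma chebyshev_lower_bound:
  fixes z :: real
  assumes "z \<ge> 6"
  shows "real (card {p::nat. prime p \<and> real p \<le> z}) \<ge> z / (4 * ln z)"
proof -
  define N where "N = nat \<lfloor>z\<rfloor>"
  have N6: "N \<ge> 6" using assms unfolding N_def by linarith
  have Nz: "real N \<le> z" "z < real N + 1" using assms unfolding N_def by linarith+
  \<comment> \<open>The largest \<open>n\<close> with \<open>2 * n + 1 \<le> N\<close>. Then
    \<open>z < 2 * n + 3\<close> and \<open>n \<ge> 2\<close>, which gives
    \<open>z / 4 \<le> n\<close>.\<close>
  define n where "n = (N - 1) div 2"
  have n: "2 * n + 1 \<le> N" "N \<le> 2 * n + 2" using N6 unfolding n_def by linarith+
  have "(2 * n + 1) * ((2 * n) choose n) dvd Lcm {1..2 * n + 1}"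
    by (rule choose_mult_dvd_Lcm) simp
  moreover have "Lcm {1..2 * n + 1} dvd Lcm {1..N}" using n by (intro Lcm_subset) auto
  moreover have "Lcm {1..N} \<noteq> 0" by (simp add: Lcm_0_iff)
  ultimately have "(2 * n + 1) * ((2 * n) choose n) \<le> Lcm {1..N}"
    by (meson dvd_imp_le dvd_trans gr0I)
  moreover have "(4::nat) ^ n \<le> (2 * n + 1) * ((2 * n) choose n)"
  proof -
    have "(\<Sum>k\<le>2 * n. (2 * n) choose k) \<le> (\<Sum>k\<le>2 * n. (2 * n) choose n)"
      by (rule sum_mono) (rule binomial_maximum')
    then show ?thesis by (simp add: choose_row_sum power_mult)
  qed
  ultimately have "4 ^ n \<le> N ^ card {p. prime p \<and> p \<le> N}"
    using Lcm_le_power_card_primes[of N] by linarith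
  then have "real (4 ^ n) \<le> real (N ^ card {p. prime p \<and> p \<le> N})" by (rule of_nat_mono)
  then have "ln (4 ^ n) \<le> ln (real N ^ card {p. prime p \<and> p \<le> N})"
    using N6 by (subst ln_le_cancel_iff) auto
  then have le: "real n * ln 4 \<le> real (card {p. prime p \<and> p \<le> N}) * ln (real N)"
    using N6 by (simp add: ln_realpow)
  have "{p. prime p \<and> p \<le> N} = {p::nat. prime p \<and> real p \<le> z}"
    using assms unfolding N_def by (auto simp: le_nat_iff le_floor_iff)
  moreover have "real (card {p. prime p \<and> p \<le> N}) * ln (real N) \<le> real (card {p. prime p \<and> p \<le> N}) * ln z"
    using Nz N6 by (intro mult_left_mono) auto
  moreover have "z / 4 \<le> real n * ln 4"
  proof -
    have "(1::real) \<le> ln 4" using exp_le by (subst ln_ge_iff) auto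
    moreover have "z / 4 \<le> real n" using n Nz assms by linarith
    ultimately show ?thesis by (metis mult.right_neutral mult_left_mono of_nat_0_le_iff order_trans)
  qed
  ultimately have "z / 4 \<le> real (card {p::nat. prime p \<and> real p \<le> z}) * ln z" using le by simp
  then show ?thesis using assms by (simp add: field_simps)
qed

section \<open>Residue classes in boxes and the variance sieve\<close>

definition box :: "nat \<Rightarrow> int \<Rightarrow> (nat \<Rightarrow> int) set" where
  "box n K = PiE {..<n} (\<lambda>_. {-K..K})"

definition residue_vectors :: "nat \<Rightarrow> nat \<Rightarrow> ((nat \<Rightarrow> int) \<Rightarrow> bool) \<Rightarrow> (nat \<Rightarrow> int) set" where
  "residue_vectors n m P = {v \<in> PiE {..<n} (\<lambda>_. {0..<int m}). P v}"

text \<open>Coordinates from \<open>n\<close> on must not matter either, because the vectors of a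
  box are \<open>undefined\<close> there.\<close>

definition periodic :: "nat \<Rightarrow> nat \<Rightarrow> ((nat \<Rightarrow> int) \<Rightarrow> bool) \<Rightarrow> bool" where
  "periodic n m P \<longleftrightarrow> (\<forall>v w. (\<forall>i<n. v i mod int m = w i mod int m) \<longrightarrow> P v = P w)"

lemma periodic_restrict:
  assumes "periodic n m P"
  shows "P (\<lambda>i\<in>{..<n}. v i mod int m) = P v"
  using assms unfolding periodic_def by (elim allE[of _ "\<lambda>i\<in>{..<n}. v i mod int m"] allE[of _ v] impE) auto

lemma finite_box [simp]: "finite (box n K)"
  unfolding box_def by (intro finite_PiE) auto

lemma finite_residue_vectors [simp]: "finite (residue_vectors n m P)"
  unfolding residue_vectors_def by (rule finite_subset[of _ "PiE {..<n} (\<lambda>_. {0..<int m})"]) (auto intro: finite_PiE)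

lemma card_box: "K \<ge> 0 \<Longrightarrow> real (card (box n K)) = real_of_int (2 * K + 1) ^ n"
  unfolding box_def by (subst card_PiE) (auto simp: add.commute)

text \<open>The class is an arithmetic progression with difference \<open>m\<close>, and one floor
  division at each end gives the range \<open>{lo..hi}\<close> of its index.\<close>

lemma card_residue_class:
  fixes K r m :: int
  assumes "m > 0" "K \<ge> 0" "0 \<le> r" "r < m"
  shows "\<bar>real (card {x \<in> {-K..K}. x mod m = r}) - real_of_int (2 * K + 1) / m\<bar> \<le> 1"
proof -
  define lo where "lo = - ((K + r) div m)"
  define hi where "hi = (K - r) div m"
  have eq: "{x \<in> {-K..K}. x mod m = r} = (\<lambda>j. r + m * j) ` {lo..hi}"
  proof (intro equalityI subsetI)
    fix x assume x: "x \<in> {x \<in> {-K..K}. x mod m = r}"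
    define j where "j = x div m"
    have xj: "x = r + m * j" using x mod_mult_div_eq[of x m] unfolding j_def by simp
    have "m * j \<le> K - r" "m * (- j) \<le> K + r" using x xj by auto
    then have "m * j div m \<le> (K - r) div m" "m * (- j) div m \<le> (K + r) div m"
      using zdiv_mono1 assms(1) by blast+
    moreover have "m * j div m = j" "m * (- j) div m = - j"
      using nonzero_mult_div_cancel_left[of m j] nonzero_mult_div_cancel_left[of m "- j"] assms(1)
      by (auto simp del: mult_minus_right)
    ultimately have "j \<le> hi" "- j \<le> (K + r) div m"
      unfolding hi_def by simp_all
    then show "x \<in> (\<lambda>j. r + m * j) ` {lo..hi}" using xj unfolding lo_def by auto
  next
    fix x assume "x \<in> (\<lambda>j. r + m * j) ` {lo..hi}"
    then obtain j where j: "x = r + m * j" "lo \<le> j" "j \<le> hi"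
      unfolding image_iff by (elim bexE) (metis atLeastAtMost_iff)
    have "m * j \<le> m * ((K - r) div m)" "m * (- j) \<le> m * ((K + r) div m)"
      using j assms unfolding lo_def hi_def by (intro mult_left_mono; simp)+
    moreover have "m * ((K - r) div m) \<le> K - r" "m * ((K + r) div m) \<le> K + r"
      using assms by (simp_all add: minus_mod_eq_mult_div[symmetric])
    ultimately have "x \<in> {-K..K}" using j(1) by simp
    moreover have "x mod m = r" using j(1) assms by simp
    ultimately show "x \<in> {x \<in> {-K..K}. x mod m = r}" by simp
  qed
  have card: "card {x \<in> {-K..K}. x mod m = r} = nat (hi - lo + 1)"
    unfolding eq using assms by (subst card_image) (auto simp: inj_on_def)
  have eqs: "m * hi = K - r - (K - r) mod m" "m * (- lo) = K + r - (K + r) mod m"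
    unfolding hi_def lo_def by (simp_all add: minus_mod_eq_mult_div)
  have mods: "0 \<le> (K - r) mod m" "(K - r) mod m < m" "0 \<le> (K + r) mod m" "(K + r) mod m < m"
    using assms(1) by simp_all
  have "m * (hi - lo) = m * hi + m * (- lo)" by (simp add: algebra_simps)
  then have "m * (hi - lo) = 2 * K - (K - r) mod m - (K + r) mod m" using eqs by linarith
  moreover have "(K - r) mod m \<le> m - 1" "(K + r) mod m \<le> m - 1" using mods by linarith+
  ultimately have bounds: "m * (hi - lo) \<le> 2 * K" "2 * K - 2 * (m - 1) \<le> m * (hi - lo)"
    using mods by (linarith, simp only: right_diff_distrib)
  \<comment> \<open>An empty progression has \<open>hi - lo = - 1\<close> and never less, so that
    \<open>nat (hi - lo + 1)\<close> loses nothing.\<close>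
  have "m * (- 2) < m * (hi - lo)" using bounds(2) assms by simp
  then have "hi - lo + 1 \<ge> 0" using assms by (simp only: mult_less_cancel_left_pos)
  then have card': "real (card {x \<in> {-K..K}. x mod m = r}) = of_int (hi - lo) + 1"
    unfolding card by simp
  have "real_of_int (m * (hi - lo)) \<le> of_int (2 * K)"
    "real_of_int (2 * K - 2 * (m - 1)) \<le> of_int (m * (hi - lo))"
    using bounds by (simp_all only: of_int_le_iff)
  then have *: "real_of_int m * (of_int (hi - lo)) \<le> 2 * K"
    "2 * real_of_int K - 2 * (m - 1) \<le> real_of_int m * of_int (hi - lo)" by simp_all
  have "real_of_int m \<ge> 1" using assms by simp
  then show ?thesis unfolding card' abs_le_iff using *
    by (simp add: field_simps)
qed

text \<open>The right-hand side is the chord over \<open>[0, 1]\<close> of a convex function. It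
  keeps the error terms of the sieve linear in \<open>z\<^sup>2 / N\<close>.\<close>

lemma power_one_plus_le: "(1 + x) ^ n \<le> 1 + (2 ^ n - 1) * x" if "0 \<le> x" "x \<le> 1" for x :: real
proof (induction n)
  case (Suc n)
  have "(1 + x) ^ Suc n \<le> (1 + x) * (1 + (2 ^ n - 1) * x)"
    using Suc that by (simp add: mult_left_mono)
  also have "\<dots> = 1 + 2 ^ n * x + (2 ^ n - 1) * (x * x)" by (simp add: algebra_simps)
  also have "(2 ^ n - 1) * (x * x) \<le> (2 ^ n - 1) * (x * 1)"
    using that by (intro mult_left_mono) auto
  finally show ?case by (simp add: algebra_simps)
qed simp

lemma card_box_residues:
  assumes S: "S \<subseteq> PiE {..<n} (\<lambda>_. {0..<int m})" and m: "m > 0" and K: "K \<ge> 0"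
  shows "card {v \<in> box n K. (\<lambda>i\<in>{..<n}. v i mod int m) \<in> S}
    = (\<Sum>\<rho>\<in>S. \<Prod>i<n. card {x \<in> {-K..K}. x mod int m = \<rho> i})"
proof -
  have fin: "finite {x \<in> {-K..K}. Q x}" for Q
    by (rule finite_subset[of _ "{-K..K}"]) auto
  have finS: "finite S" using S by (rule finite_subset) (auto intro: finite_PiE)
  have "{v \<in> box n K. (\<lambda>i\<in>{..<n}. v i mod int m) \<in> S}
      = (\<Union>\<rho>\<in>S. PiE {..<n} (\<lambda>i. {x \<in> {-K..K}. x mod int m = \<rho> i}))"
  proof (intro equalityI subsetI)
    fix v assume "v \<in> {v \<in> box n K. (\<lambda>i\<in>{..<n}. v i mod int m) \<in> S}"
    then show "v \<in> (\<Union>\<rho>\<in>S. PiE {..<n} (\<lambda>i. {x \<in> {-K..K}. x mod int m = \<rho> i}))"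
      by (intro UN_I[of "\<lambda>i\<in>{..<n}. v i mod int m"]) (auto simp: box_def PiE_iff)
  next
    fix v assume "v \<in> (\<Union>\<rho>\<in>S. PiE {..<n} (\<lambda>i. {x \<in> {-K..K}. x mod int m = \<rho> i}))"
    then obtain \<rho> where \<rho>: "\<rho> \<in> S" "v \<in> PiE {..<n} (\<lambda>i. {x \<in> {-K..K}. x mod int m = \<rho> i})" by blast
    have "(\<lambda>i\<in>{..<n}. v i mod int m) = \<rho>"
    proof (rule ext)
      fix i show "(\<lambda>i\<in>{..<n}. v i mod int m) i = \<rho> i"
        using \<rho> S by (cases "i < n") (auto simp: PiE_iff extensional_def)
    qed
    then show "v \<in> {v \<in> box n K. (\<lambda>i\<in>{..<n}. v i mod int m) \<in> S}"
      using \<rho> by (auto simp: box_def PiE_iff)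
  qed
  also have "card \<dots> = (\<Sum>\<rho>\<in>S. card (PiE {..<n} (\<lambda>i. {x \<in> {-K..K}. x mod int m = \<rho> i})))"
  proof (rule card_UN_disjoint[OF finS])
    show "\<forall>\<rho>\<in>S. finite (PiE {..<n} (\<lambda>i. {x \<in> {-K..K}. x mod int m = \<rho> i}))"
      by (intro ballI finite_PiE fin) simp
    show "\<forall>\<rho>\<in>S. \<forall>\<sigma>\<in>S. \<rho> \<noteq> \<sigma> \<longrightarrow> PiE {..<n} (\<lambda>i. {x \<in> {-K..K}. x mod int m = \<rho> i})
        \<inter> PiE {..<n} (\<lambda>i. {x \<in> {-K..K}. x mod int m = \<sigma> i}) = {}"
    proof (intro ballI impI, rule ccontr)
      fix \<rho> \<sigma> assume *: "\<rho> \<in> S" "\<sigma> \<in> S" "\<rho> \<noteq> \<sigma>"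
        "PiE {..<n} (\<lambda>i. {x \<in> {-K..K}. x mod int m = \<rho> i})
        \<inter> PiE {..<n} (\<lambda>i. {x \<in> {-K..K}. x mod int m = \<sigma> i}) \<noteq> {}"
      then obtain v where v: "v \<in> PiE {..<n} (\<lambda>i. {x \<in> {-K..K}. x mod int m = \<rho> i})"
        "v \<in> PiE {..<n} (\<lambda>i. {x \<in> {-K..K}. x mod int m = \<sigma> i})" by blast
      have "\<rho> i = \<sigma> i" for i
      proof (cases "i < n")
        case False
        have "\<rho> \<in> PiE {..<n} (\<lambda>_. {0..<int m})" "\<sigma> \<in> PiE {..<n} (\<lambda>_. {0..<int m})"
          using *(1,2) S by blast+
        from this[THEN PiE_arb, of i] show ?thesis using False by simp
      next
        case True
        have "v i mod int m = \<rho> i" "v i mod int m = \<sigma> i"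
          using PiE_mem[OF v(1), of i] PiE_mem[OF v(2), of i] True by simp_all
        then show ?thesis by simp
      qed
      then show False using *(3) by blast
    qed
  qed
  also have "\<dots> = (\<Sum>\<rho>\<in>S. \<Prod>i<n. card {x \<in> {-K..K}. x mod int m = \<rho> i})"
    by (intro sum.cong refl) (subst card_PiE, auto)
  finally show ?thesis .
qed

text \<open>Each coordinate contributes a factor between \<open>N / m - 1\<close> and
  \<open>N / m + 1\<close>; since \<open>m\<close> is at most \<open>N\<close>, the lower one is
  non-negative and the inequalities may be multiplied.\<close>

lemma card_box_periodic:
  fixes K :: int
  assumes P: "periodic n m P" and m: "m > 0" and K: "K \<ge> 0" and mN: "int m \<le> 2 * K + 1"
  defines "N \<equiv> real_of_int (2 * K + 1)"
  defines "c \<equiv> real (card (residue_vectors n m P)) / real m ^ n"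
  shows "real (card {v \<in> box n K. P v}) \<le> c * N ^ n * (1 + m / N) ^ n"
    and "c * N ^ n * (1 - m / N) ^ n \<le> real (card {v \<in> box n K. P v})"
proof -
  define S where "S = residue_vectors n m P"
  have S: "S \<subseteq> PiE {..<n} (\<lambda>_. {0..<int m})" by (auto simp: S_def residue_vectors_def)
  have N: "N > 0" using K by (simp add: N_def)
  have "{v \<in> box n K. P v} = {v \<in> box n K. (\<lambda>i\<in>{..<n}. v i mod int m) \<in> S}"
  proof -
    have "P v \<longleftrightarrow> (\<lambda>i\<in>{..<n}. v i mod int m) \<in> S" for v
    proof -
      have "P v = P (\<lambda>i\<in>{..<n}. v i mod int m)"
        using periodic_restrict[OF P] by simp
      then show ?thesis using m by (auto simp: S_def residue_vectors_def)
    qed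
    then show ?thesis by simp
  qed
  then have card: "real (card {v \<in> box n K. P v})
      = (\<Sum>\<rho>\<in>S. \<Prod>i<n. real (card {x \<in> {-K..K}. x mod int m = \<rho> i}))"
    using card_box_residues[OF S m K] by (simp add: of_nat_sum of_nat_prod)
  have cnt: "\<bar>real (card {x \<in> {-K..K}. x mod int m = \<rho> i}) - N / m\<bar> \<le> 1"
    if "\<rho> \<in> S" "i < n" for \<rho> i
    using card_residue_class[of "int m" K "\<rho> i"] that S m K by (auto simp: N_def PiE_iff subset_iff)
  have lower: "0 \<le> N / m - 1" using mN m N by (simp add: N_def)
  have "real (card {v \<in> box n K. P v}) \<le> (\<Sum>\<rho>\<in>S. \<Prod>i<n. N / m + 1)"
    unfolding card by (intro sum_mono prod_mono) (use cnt in \<open>fastforce simp: abs_le_iff\<close>)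
  also have "\<dots> = real (card S) * (N / m + 1) ^ n" by simp
  also have "N / m + 1 = N / m * (1 + m / N)" using N m by (simp add: distrib_left)
  finally show "real (card {v \<in> box n K. P v}) \<le> c * N ^ n * (1 + m / N) ^ n"
    by (simp add: c_def S_def power_mult_distrib power_divide)
  have "(\<Sum>\<rho>\<in>S. \<Prod>i<n. N / m - 1) \<le> real (card {v \<in> box n K. P v})"
    unfolding card by (intro sum_mono prod_mono) (use cnt lower in \<open>fastforce simp: abs_le_iff\<close>)
  moreover have "(\<Sum>\<rho>\<in>S. \<Prod>i<n. N / m - 1) = real (card S) * (N / m - 1) ^ n" by simp
  moreover have "N / m - 1 = N / m * (1 - m / N)" using N m by (simp add: right_diff_distrib)
  ultimately show "c * N ^ n * (1 - m / N) ^ n \<le> real (card {v \<in> box n K. P v})"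
    by (simp add: c_def S_def power_mult_distrib power_divide)
qed

text \<open>Reduction modulo \<open>p\<close> and modulo \<open>q\<close> is jointly injective by
  the Chinese remainder theorem. The count enters only the second moment of the sieve, where an
  upper bound is wanted.\<close>

lemma card_residue_vectors_coprime:
  assumes pq: "coprime p q" "p > 0" "q > 0" and P: "periodic n p P" and Q: "periodic n q Q"
  shows "card (residue_vectors n (p * q) (\<lambda>v. P v \<and> Q v))
    \<le> card (residue_vectors n p P) * card (residue_vectors n q Q)"
proof -
  define f where "f v = ((\<lambda>i\<in>{..<n}. v i mod int p), (\<lambda>i\<in>{..<n}. v i mod int q))" for v :: "nat \<Rightarrow> int"
  have "card (residue_vectors n (p * q) (\<lambda>v. P v \<and> Q v))
      \<le> card (residue_vectors n p P \<times> residue_vectors n q Q)"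
  proof (rule card_inj_on_le)
    show "inj_on f (residue_vectors n (p * q) (\<lambda>v. P v \<and> Q v))"
    proof (rule inj_onI)
      fix v w assume v: "v \<in> residue_vectors n (p * q) (\<lambda>v. P v \<and> Q v)"
        and w: "w \<in> residue_vectors n (p * q) (\<lambda>v. P v \<and> Q v)" and eq: "f v = f w"
      show "v = w"
      proof (rule ext)
        fix i
        show "v i = w i"
        proof (cases "i < n")
          case True
          have "[v i = w i] (mod int p)" "[v i = w i] (mod int q)"
            using eq True by (auto simp: f_def cong_def fun_eq_iff restrict_def split: if_splits)
          then have "[v i = w i] (mod (int p * int q))"
            using pq by (intro coprime_cong_mult) auto
          moreover have "0 \<le> v i" "v i < int p * int q" "0 \<le> w i" "w i < int p * int q"
            using v w True by (auto simp: residue_vectors_def PiE_iff)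
          ultimately show ?thesis by (simp add: cong_def)
        next
          case False
          then show ?thesis using v w by (auto simp: residue_vectors_def PiE_iff extensional_def)
        qed
      qed
    qed
    have "f v \<in> residue_vectors n p P \<times> residue_vectors n q Q"
      if "v \<in> residue_vectors n (p * q) (\<lambda>v. P v \<and> Q v)" for v
    proof -
      have "P v = P (\<lambda>i\<in>{..<n}. v i mod int p)"
        using periodic_restrict[OF P] by simp
      moreover have "Q v = Q (\<lambda>i\<in>{..<n}. v i mod int q)"
        using periodic_restrict[OF Q] by simp
      ultimately show ?thesis using that pq by (auto simp: f_def residue_vectors_def)
    qed
    then show "f ` residue_vectors n (p * q) (\<lambda>v. P v \<and> Q v)
      \<subseteq> residue_vectors n p P \<times> residue_vectors n q Q" by blast
  qed simp
  then show ?thesis by (simp add: card_cartesian_product)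
qed

text \<open>\<open>X v\<close> counts the primes that are good for \<open>v\<close> and has mean
  close to \<open>E\<close>. On an exceptional vector it is 0, so each exception contributes
  \<open>E\<^sup>2\<close> to the sum of \<open>(X v - E)\<^sup>2\<close>, and this sum is bounded
  by means of the first two moments. A pair of primes has a modulus up to \<open>z\<^sup>2\<close>,
  whence the condition \<open>z\<^sup>2 \<le> N\<close>.\<close>

lemma turan_sieve:
  fixes K :: int and z \<delta> :: real and P :: "nat \<Rightarrow> (nat \<Rightarrow> int) \<Rightarrow> bool"
  defines "N \<equiv> real_of_int (2 * K + 1)"
  assumes K: "K \<ge> 0" and z: "z \<ge> 1" "z\<^sup>2 \<le> N" and \<delta>: "\<delta> > 0"
    and Ps: "finite Ps" "Ps \<noteq> {}" "\<And>p. p \<in> Ps \<Longrightarrow> prime p" "\<And>p. p \<in> Ps \<Longrightarrow> real p \<le> z"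
    and per: "\<And>p. p \<in> Ps \<Longrightarrow> periodic n p (P p)"
    and dens: "\<And>p. p \<in> Ps \<Longrightarrow> real (card (residue_vectors n p (P p))) \<ge> \<delta> * real p ^ n"
  shows "real (card {v \<in> box n K. \<forall>p\<in>Ps. \<not> P p v})
    \<le> N ^ n * ((2 ^ n + 2 * n) * (z\<^sup>2 / N) + 2 ^ n / (\<delta> * card Ps))"
proof -
  define d where "d p = real (card (residue_vectors n p (P p))) / real p ^ n" for p
  define E where "E = (\<Sum>p\<in>Ps. d p)"
  define ind where "ind p v = (if P p v then 1 else 0 :: real)" for p v
  define X where "X v = (\<Sum>p\<in>Ps. ind p v)" for v
  let ?B = "box n K"
  have N: "N > 0" using K by (simp add: N_def)
  have p0: "p > 0" if "p \<in> Ps" for p using Ps(3)[OF that] by (rule prime_gt_0_nat)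
  have d: "d p \<ge> \<delta>" if "p \<in> Ps" for p using dens[OF that] p0[OF that] by (simp add: d_def field_simps)
  have d0: "d p \<ge> 0" for p by (simp add: d_def)
  have "E \<ge> (\<Sum>p\<in>Ps. \<delta>)" unfolding E_def by (intro sum_mono d)
  then have E: "E \<ge> \<delta> * card Ps" by (simp add: mult.commute)
  have cP: "\<delta> * card Ps > 0" using \<delta> Ps by (simp add: card_gt_0_iff)
  have E0: "E > 0" using E cP by linarith
  have zN: "z \<le> N" using z power_increasing[of 1 2 z] by simp
  have pN: "int p \<le> 2 * K + 1" if "p \<in> Ps" for p
    using Ps(4)[OF that] zN unfolding N_def by linarith
  have pz: "real p / N \<le> z\<^sup>2 / N" if "p \<in> Ps" for p
    using Ps(4)[OF that] z N power_increasing[of 1 2 z] by (intro divide_right_mono) auto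
  have z1: "z\<^sup>2 / N \<le> 1" "0 \<le> z\<^sup>2 / N" using z N by auto
  have single: "(\<Sum>v\<in>?B. ind p v) = real (card {v \<in> ?B. P p v})" for p
    unfolding ind_def by (simp add: sum.If_cases Int_def conj_commute)
  have double: "(\<Sum>v\<in>?B. ind p v * ind q v) = real (card {v \<in> ?B. P p v \<and> P q v})" for p q
  proof -
    have "(\<Sum>v\<in>?B. ind p v * ind q v) = (\<Sum>v\<in>?B. if P p v \<and> P q v then 1 else 0)"
      by (intro sum.cong) (auto simp: ind_def)
    then show ?thesis by (simp add: sum.If_cases Int_def conj_commute)
  qed
  have lower: "(\<Sum>v\<in>?B. ind p v) \<ge> d p * N ^ n * (1 - n * (z\<^sup>2 / N))" if "p \<in> Ps" for p
  proof -
    have "1 - n * (z\<^sup>2 / N) \<le> 1 + real n * (- (real p / N))"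
      using mult_left_mono[OF pz[OF that], of "real n"] by simp
    also have "\<dots> \<le> (1 + (- (real p / N))) ^ n"
      using pz[OF that] z1 by (intro Bernoulli_inequality) linarith
    finally have *: "1 - n * (z\<^sup>2 / N) \<le> (1 - real p / N) ^ n" by simp
    have "d p * N ^ n * (1 - n * (z\<^sup>2 / N)) \<le> d p * N ^ n * (1 - real p / N) ^ n"
      using d0[of p] N * by (intro mult_left_mono) auto
    also have "\<dots> \<le> (\<Sum>v\<in>?B. ind p v)"
      using card_box_periodic(2)[OF per[OF that] p0[OF that] K pN[OF that]]
      unfolding single d_def N_def by simp
    finally show ?thesis .
  qed
  have diag: "(\<Sum>v\<in>?B. ind p v * ind p v) \<le> d p * N ^ n * 2 ^ n" if "p \<in> Ps" for p
  proof -
    have "(\<Sum>v\<in>?B. ind p v * ind p v) \<le> d p * N ^ n * (1 + real p / N) ^ n"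
      using card_box_periodic(1)[OF per[OF that] p0[OF that] K pN[OF that]]
      unfolding double d_def N_def by simp
    also have "\<dots> \<le> d p * N ^ n * 2 ^ n"
    proof (intro mult_left_mono power_mono)
      show "1 + real p / N \<le> 2" using pz[OF that] z1 by linarith
    qed (use d0[of p] N in auto)
    finally show ?thesis .
  qed
  have off: "(\<Sum>v\<in>?B. ind p v * ind q v) \<le> d p * d q * N ^ n * (1 + 2 ^ n * (z\<^sup>2 / N))"
    if pq: "p \<in> Ps" "q \<in> Ps" "p \<noteq> q" for p q
  proof -
    have cop: "coprime p q" using pq Ps(3) by (simp add: primes_coprime)
    have "real (p * q) \<le> z * z" using Ps(4)[OF pq(1)] Ps(4)[OF pq(2)] z by (simp add: mult_mono)
    then have le: "real (p * q) \<le> z\<^sup>2" by (simp add: power2_eq_square)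
    have pqN: "int (p * q) \<le> 2 * K + 1" using le z(2) unfolding N_def by linarith
    have per2: "periodic n (p * q) (\<lambda>v. P p v \<and> P q v)"
    proof -
      have *: "periodic n (a * b) Q" if "periodic n a Q" for a b Q
        unfolding periodic_def
      proof (intro allI impI)
        fix v w :: "nat \<Rightarrow> int" assume "\<forall>i<n. v i mod int (a * b) = w i mod int (a * b)"
        then have "\<forall>i<n. v i mod int a = w i mod int a"
          by (metis dvd_triv_left mod_mod_cancel of_nat_mult)
        then show "Q v = Q w" using that unfolding periodic_def by blast
      qed
      have "periodic n (p * q) (P p)" "periodic n (p * q) (P q)"
        using *[OF per[OF pq(1)], of q] *[OF per[OF pq(2)], of p] by (simp_all add: mult.commute)
      then show ?thesis unfolding periodic_def by blast
    qed
    have "(\<Sum>v\<in>?B. ind p v * ind q v) \<le> real (card (residue_vectors n (p * q) (\<lambda>v. P p v \<and> P q v)))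
        / real (p * q) ^ n * N ^ n * (1 + real (p * q) / N) ^ n"
      using card_box_periodic(1)[OF per2 _ K pqN] p0 pq unfolding double N_def by simp
    also have "\<dots> \<le> (d p * d q) * N ^ n * (1 + z\<^sup>2 / N) ^ n"
    proof (intro mult_mono power_mono divide_nonneg_nonneg mult_nonneg_nonneg zero_le_power)
      have "real (card (residue_vectors n (p * q) (\<lambda>v. P p v \<and> P q v)))
          \<le> real (card (residue_vectors n p (P p)) * card (residue_vectors n q (P q)))"
        by (intro of_nat_mono card_residue_vectors_coprime cop p0 per pq)
      then show "real (card (residue_vectors n (p * q) (\<lambda>v. P p v \<and> P q v))) / real (p * q) ^ n \<le> d p * d q"
        using p0[OF pq(1)] p0[OF pq(2)] by (simp add: d_def power_mult_distrib divide_right_mono)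
      show "1 + real (p * q) / N \<le> 1 + z\<^sup>2 / N" using le N by (simp add: divide_right_mono)
    qed (use N d0 in auto)
    also have "\<dots> \<le> d p * d q * N ^ n * (1 + 2 ^ n * (z\<^sup>2 / N))"
    proof (rule mult_left_mono)
      have "(1 + z\<^sup>2 / N) ^ n \<le> 1 + (2 ^ n - 1) * (z\<^sup>2 / N)" by (rule power_one_plus_le) (use z1 in auto)
      also have "\<dots> \<le> 1 + 2 ^ n * (z\<^sup>2 / N)" using mult_right_mono[of "2 ^ n - 1" "2 ^ n" "z\<^sup>2 / N"] z1 by simp
      finally show "(1 + z\<^sup>2 / N) ^ n \<le> 1 + 2 ^ n * (z\<^sup>2 / N)" .
    qed (use d0 N in auto)
    finally show ?thesis .
  qed
  define D2 where "D2 = N ^ n * (1 + 2 ^ n * (z\<^sup>2 / N))"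
  have D2: "D2 \<ge> 0" using N z1 by (simp add: D2_def)
  have "(\<Sum>v\<in>?B. (X v)\<^sup>2) = (\<Sum>v\<in>?B. \<Sum>p\<in>Ps. \<Sum>q\<in>Ps. ind p v * ind q v)"
    by (simp add: X_def power2_eq_square sum_product)
  also have "\<dots> = (\<Sum>p\<in>Ps. \<Sum>v\<in>?B. \<Sum>q\<in>Ps. ind p v * ind q v)" by (rule sum.swap)
  also have "\<dots> = (\<Sum>p\<in>Ps. \<Sum>q\<in>Ps. \<Sum>v\<in>?B. ind p v * ind q v)"
    by (intro sum.cong refl sum.swap)
  \<comment> \<open>The term \<open>d p * d q * D2\<close> is kept for \<open>p = q\<close> as well,
    so that the double sum factors as \<open>E\<^sup>2 * D2\<close>.\<close>
  also have "\<dots> \<le> (\<Sum>p\<in>Ps. \<Sum>q\<in>Ps. d p * d q * D2 + (if p = q then d p * N ^ n * 2 ^ n else 0))"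
  proof (intro sum_mono)
    fix p q assume pq: "p \<in> Ps" "q \<in> Ps"
    show "(\<Sum>v\<in>?B. ind p v * ind q v) \<le> d p * d q * D2 + (if p = q then d p * N ^ n * 2 ^ n else 0)"
    proof (cases "p = q")
      case True
      then show ?thesis using diag[OF pq(1)] d0[of p] D2 by (simp add: add_increasing)
    next
      case False
      then show ?thesis using off[OF pq False] by (simp add: D2_def mult.assoc)
    qed
  qed
  also have "\<dots> = E\<^sup>2 * D2 + E * (N ^ n * 2 ^ n)"
  proof -
    have "E\<^sup>2 * D2 = (\<Sum>p\<in>Ps. \<Sum>q\<in>Ps. d p * d q * D2)"
      unfolding E_def power2_eq_square sum_product by (simp only: sum_distrib_right)
    moreover have "E * (N ^ n * 2 ^ n) = (\<Sum>p\<in>Ps. d p * N ^ n * 2 ^ n)"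
      by (simp only: E_def sum_distrib_right mult.assoc)
    ultimately show ?thesis using Ps(1) by (simp add: sum.distrib)
  qed
  finally have sq: "(\<Sum>v\<in>?B. (X v)\<^sup>2) \<le> E\<^sup>2 * D2 + E * (N ^ n * 2 ^ n)" .
  have "(\<Sum>v\<in>?B. X v) = (\<Sum>p\<in>Ps. \<Sum>v\<in>?B. ind p v)" unfolding X_def by (rule sum.swap)
  also have "\<dots> \<ge> (\<Sum>p\<in>Ps. d p * N ^ n * (1 - n * (z\<^sup>2 / N)))" by (intro sum_mono lower)
  also have "(\<Sum>p\<in>Ps. d p * N ^ n * (1 - n * (z\<^sup>2 / N))) = E * (N ^ n * (1 - n * (z\<^sup>2 / N)))"
    by (simp add: E_def sum_distrib_right mult.assoc)
  finally have lin: "(\<Sum>v\<in>?B. X v) \<ge> E * (N ^ n * (1 - n * (z\<^sup>2 / N)))" .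
  define Ex where "Ex = {v \<in> ?B. \<forall>p\<in>Ps. \<not> P p v}"
  have "real (card Ex) * E\<^sup>2 = (\<Sum>v\<in>Ex. (X v - E)\<^sup>2)"
    by (simp add: Ex_def X_def ind_def)
  also have "\<dots> \<le> (\<Sum>v\<in>?B. (X v - E)\<^sup>2)" by (intro sum_mono2) (auto simp: Ex_def)
  also have "\<dots> = (\<Sum>v\<in>?B. (X v)\<^sup>2) - 2 * E * (\<Sum>v\<in>?B. X v) + E\<^sup>2 * N ^ n"
    by (simp add: power2_diff sum.distrib sum_subtractf sum_distrib_left card_box[OF K, folded N_def]
        mult.commute mult.left_commute)
  \<comment> \<open>The main terms combine with weights \<open>1 - 2 + 1\<close> and cancel. What
    remains is the relative error of order \<open>z\<^sup>2 / N\<close> and the diagonal.\<close>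
  also have "\<dots> \<le> E\<^sup>2 * D2 + E * (N ^ n * 2 ^ n) - 2 * E * (E * (N ^ n * (1 - n * (z\<^sup>2 / N)))) + E\<^sup>2 * N ^ n"
    using sq mult_left_mono[OF lin, of "2 * E"] E0 by linarith
  also have "\<dots> = E\<^sup>2 * (N ^ n * ((2 ^ n + 2 * n) * (z\<^sup>2 / N) + 2 ^ n / E))"
  proof -
    define q where "q = z\<^sup>2 / N"
    have "E\<^sup>2 * (N ^ n * (2 ^ n / E)) = E * (N ^ n * 2 ^ n)"
      using E0 by (simp add: power2_eq_square)
    then show ?thesis unfolding D2_def q_def[symmetric]
      by (simp add: power2_eq_square algebra_simps)
  qed
  finally have "real (card Ex) \<le> N ^ n * ((2 ^ n + 2 * n) * (z\<^sup>2 / N) + 2 ^ n / E)"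
    using E0 by (simp add: mult.commute)
  also have "\<dots> \<le> N ^ n * ((2 ^ n + 2 * n) * (z\<^sup>2 / N) + 2 ^ n / (\<delta> * card Ps))"
    using E cP N by (intro mult_left_mono add_left_mono divide_left_mono) auto
  finally show ?thesis unfolding Ex_def by simp
qed

section \<open>Counting modulo a prime\<close>

text \<open>A fibre of \<open>h\<close> without a fixed point of \<open>\<sigma>\<close> has at
  least two elements, and a fixed point is counted a second time on the right.\<close>

lemma card_image_involution:
  assumes X: "finite X" and \<sigma>: "\<And>x. x \<in> X \<Longrightarrow> \<sigma> x \<in> X" "\<And>x. x \<in> X \<Longrightarrow> h (\<sigma> x) = h x"
  shows "2 * card (h ` X) \<le> card X + card {x \<in> X. \<sigma> x = x}"
proof -
  define fib where "fib z = {x \<in> X. h x = z}" for z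
  define fx where "fx z = {x \<in> X. h x = z \<and> \<sigma> x = x}" for z
  have fin: "finite (fib z)" "finite (fx z)" for z using X by (simp_all add: fib_def fx_def)
  have ge: "2 \<le> card (fib z) + card (fx z)" if "z \<in> h ` X" for z
  proof -
    from that obtain x where x: "x \<in> X" "z = h x" by blast
    show ?thesis
    proof (cases "\<sigma> x = x")
      case True
      then have "x \<in> fib z" "x \<in> fx z" using x by (simp_all add: fib_def fx_def)
      then have "card (fib z) > 0" "card (fx z) > 0" using fin by (auto simp: card_gt_0_iff)
      then show ?thesis by linarith
    next
      case False
      have "{x, \<sigma> x} \<subseteq> fib z" using x \<sigma> by (auto simp: fib_def)
      then have "card {x, \<sigma> x} \<le> card (fib z)" by (rule card_mono[OF fin(1)])
      then show ?thesis using False by simp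
    qed
  qed
  have sumX: "card X = (\<Sum>z\<in>h ` X. card (fib z))"
  proof -
    have "X = (\<Union>z\<in>h ` X. fib z)" by (auto simp: fib_def)
    then have "card X = card (\<Union>z\<in>h ` X. fib z)" by simp
    also have "\<dots> = (\<Sum>z\<in>h ` X. card (fib z))"
      by (rule card_UN_disjoint) (use X fin in \<open>auto simp: fib_def\<close>)
    finally show ?thesis .
  qed
  have sumF: "card {x \<in> X. \<sigma> x = x} = (\<Sum>z\<in>h ` X. card (fx z))"
  proof -
    have "{x \<in> X. \<sigma> x = x} = (\<Union>z\<in>h ` X. fx z)" by (auto simp: fx_def)
    then have "card {x \<in> X. \<sigma> x = x} = card (\<Union>z\<in>h ` X. fx z)" by simp
    also have "\<dots> = (\<Sum>z\<in>h ` X. card (fx z))"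
      by (rule card_UN_disjoint) (use X fin in \<open>auto simp: fx_def\<close>)
    finally show ?thesis .
  qed
  have "2 * card (h ` X) = (\<Sum>z\<in>h ` X. 2)" by simp
  also have "\<dots> \<le> (\<Sum>z\<in>h ` X. card (fib z) + card (fx z))" by (rule sum_mono) (rule ge)
  finally show ?thesis by (simp only: sum.distrib sumX sumF)
qed

lemma card_filter_split:
  assumes "finite A"
  shows "card A = card {x \<in> A. Q x} + card {x \<in> A. \<not> Q x}"
proof -
  have "A = {x \<in> A. Q x} \<union> {x \<in> A. \<not> Q x}" by blast
  then have "card A = card ({x \<in> A. Q x} \<union> {x \<in> A. \<not> Q x})" by simp
  also have "\<dots> = card {x \<in> A. Q x} + card {x \<in> A. \<not> Q x}"
    by (rule card_Un_disjoint) (use assms in auto)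
  finally show ?thesis .
qed

text \<open>For injections that are given by equations rather than by a formula: \<open>R\<close>
  records how \<open>x\<close> is recovered from \<open>y\<close>, and the function itself comes
  from choice.\<close>

lemma card_le_rel:
  assumes "finite B" "\<And>x. x \<in> A \<Longrightarrow> \<exists>y\<in>B. R x y" "\<And>x x' y. x \<in> A \<Longrightarrow> x' \<in> A \<Longrightarrow> R x y \<Longrightarrow> R x' y \<Longrightarrow> x = x'"
  shows "card A \<le> card B"
proof -
  obtain f where f: "\<forall>x\<in>A. f x \<in> B \<and> R x (f x)" using bchoice[of A "\<lambda>x y. y \<in> B \<and> R x y"] assms(2) by blast
  show ?thesis
    by (rule card_inj_on_le[of f]) (use f assms in \<open>auto simp: inj_on_def, metis\<close>)
qed

lemma card_Sigma_ge:
  assumes "finite A" "\<And>x. x \<in> A \<Longrightarrow> finite (B x)" "\<And>x. x \<in> A \<Longrightarrow> k \<le> card (B x)"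
  shows "card A * k \<le> card (Sigma A B)"
proof -
  have "card A * k = (\<Sum>x\<in>A. k)" by simp
  also have "\<dots> \<le> (\<Sum>x\<in>A. card (B x))" by (rule sum_mono) (rule assms(3))
  also have "\<dots> = card (Sigma A B)" using assms by simp
  finally show ?thesis .
qed

text \<open>Zero counts as a square, so a \<open>nonsq\<close> residue modulo a prime is in
  particular a unit.\<close>

definition nonsq :: "int \<Rightarrow> int \<Rightarrow> bool" where
  "nonsq p x \<longleftrightarrow> (\<forall>y. \<not> [x = y\<^sup>2] (mod p))"

lemma nonsq_cong: "[x = y] (mod p) \<Longrightarrow> nonsq p x \<longleftrightarrow> nonsq p y"
  unfolding nonsq_def by (meson cong_sym cong_trans)

lemma nonsq_mod [simp]: "nonsq p (x mod p) \<longleftrightarrow> nonsq p x"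
  by (rule nonsq_cong) (simp add: cong_def)

text \<open>The bound 5 makes 2 and 3 units. The 3 enters through the binomial coefficient when the
  cubic C is translated.\<close>

locale odd_prime =
  fixes p :: int
  assumes prime: "prime p" and p5: "p \<ge> 5"
begin

lemma p0: "p > 0" using p5 by simp

lemma dvd_mult_iff: "p dvd a * b \<longleftrightarrow> p dvd a \<or> p dvd b"
  using prime by (simp add: prime_dvd_mult_iff)

lemma not_dvd_small: "0 < a \<Longrightarrow> a < p \<Longrightarrow> \<not> p dvd a"
  using zdvd_not_zless by blast

lemma not_dvd_unit: "a \<in> {1..<p} \<Longrightarrow> \<not> p dvd a"
  using not_dvd_small by simp

lemma not_dvd_numerals: "\<not> p dvd 2" "\<not> p dvd 3" "\<not> p dvd 4" "\<not> p dvd 12"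
proof -
  show 2: "\<not> p dvd 2" and 3: "\<not> p dvd 3" and 4: "\<not> p dvd 4"
    using p5 not_dvd_small[of 2] not_dvd_small[of 3] not_dvd_small[of 4] by simp_all
  have "\<not> p dvd 3 * 4" using 3 4 dvd_mult_iff by blast
  then show "\<not> p dvd 12" by simp
qed

lemma residue_eqI:
  assumes "x \<in> {0..<p}" "y \<in> {0..<p}" "[x = y] (mod p)"
  shows "x = y"
  using assms by (simp add: cong_def)

lemma cong_cancel:
  assumes "\<not> p dvd a" "[a * x = a * y] (mod p)"
  shows "[x = y] (mod p)"
proof -
  have "p dvd a * (x - y)" using assms(2) by (simp add: cong_iff_dvd_diff right_diff_distrib)
  then show ?thesis using assms(1) by (simp add: dvd_mult_iff cong_iff_dvd_diff)
qed

lemma linear_solve: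
  assumes "\<not> p dvd a"
  shows "\<exists>x\<in>{0..<p}. [a * x + c = t] (mod p)"
proof -
  have "coprime a p" using assms prime by (metis coprime_commute prime_imp_coprime)
  then obtain z where z: "[a * z = 1] (mod p)" using cong_solve_coprime_int by blast
  define x where "x = (z * (t - c)) mod p"
  have "[a * x + c = a * (z * (t - c)) + c] (mod p)"
    unfolding x_def by (intro cong_add cong_mult cong_refl) (simp add: cong_def)
  also have "a * (z * (t - c)) + c = (a * z) * (t - c) + c" by simp
  also have "[\<dots> = 1 * (t - c) + c] (mod p)" by (intro cong_add cong_mult cong_refl z)
  finally have "[a * x + c = t] (mod p)" by simp
  moreover have "x \<in> {0..<p}" unfolding x_def using p0 by simp
  ultimately show ?thesis by blast
qed

lemma linear_inj:
  assumes "\<not> p dvd a" "x \<in> {0..<p}" "y \<in> {0..<p}" "[a * x + c = a * y + c] (mod p)"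
  shows "x = y"
proof -
  have "[a * x = a * y] (mod p)" using assms(4) by (simp add: cong_add_rcancel)
  then show ?thesis using cong_cancel[OF assms(1)] residue_eqI assms by blast
qed

lemma card_affine:
  assumes a: "\<not> p dvd a" and Q: "\<And>x y. [x = y] (mod p) \<Longrightarrow> Q x = Q y"
  shows "card {x \<in> {0..<p}. Q (a * x + c)} = card {y \<in> {0..<p}. Q y}"
proof (rule bij_betw_same_card[of "\<lambda>x. (a * x + c) mod p"], rule bij_betw_imageI)
  show "inj_on (\<lambda>x. (a * x + c) mod p) {x \<in> {0..<p}. Q (a * x + c)}"
  proof (rule inj_onI)
    fix x y assume *: "x \<in> {x \<in> {0..<p}. Q (a * x + c)}" "y \<in> {x \<in> {0..<p}. Q (a * x + c)}"
      and "(a * x + c) mod p = (a * y + c) mod p"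
    then have "[a * x + c = a * y + c] (mod p)" by (simp add: cong_def)
    then show "x = y" using linear_inj[OF a] * by blast
  qed
  have Qm: "Q (x mod p) = Q x" for x by (rule Q) (simp add: cong_def)
  show "(\<lambda>x. (a * x + c) mod p) ` {x \<in> {0..<p}. Q (a * x + c)} = {y \<in> {0..<p}. Q y}"
  proof (intro equalityI subsetI)
    fix y assume "y \<in> (\<lambda>x. (a * x + c) mod p) ` {x \<in> {0..<p}. Q (a * x + c)}"
    then show "y \<in> {y \<in> {0..<p}. Q y}" using p0 Qm by auto
  next
    fix y assume y: "y \<in> {y \<in> {0..<p}. Q y}"
    obtain x where x: "x \<in> {0..<p}" "[a * x + c = y] (mod p)" using linear_solve[OF a] by blast
    then have "(a * x + c) mod p = y" using y by (simp add: cong_def)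
    moreover have "Q (a * x + c)" using Q[OF x(2)] y by blast
    ultimately show "y \<in> (\<lambda>x. (a * x + c) mod p) ` {x \<in> {0..<p}. Q (a * x + c)}" using x(1) by (intro image_eqI[of _ _ x]) auto
  qed
qed

definition half :: nat where "half = nat ((p - 1) div 2)"

lemma odd_p: "p = 2 * int half + 1"
proof -
  have "odd p" using prime p5 prime_odd_int by simp
  then show ?thesis unfolding half_def using p5 by (auto elim!: oddE)
qed

text \<open>Since \<open>y\<close> and \<open>p - y\<close> have the same square,
  \<open>{0..half}\<close> represents every square exactly once.\<close>

lemma card_squares: "card {x \<in> {0..<p}. \<not> nonsq p x} = half + 1"
proof -
  have "{x \<in> {0..<p}. \<not> nonsq p x} = (\<lambda>y. y\<^sup>2 mod p) ` {0..int half}"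
  proof (intro equalityI subsetI)
    fix x assume x: "x \<in> {x \<in> {0..<p}. \<not> nonsq p x}"
    then obtain y where y: "[x = y\<^sup>2] (mod p)" by (auto simp: nonsq_def)
    define z where "z = y mod p"
    have z: "z \<in> {0..<p}" "[z\<^sup>2 = y\<^sup>2] (mod p)" using p0 by (simp_all add: z_def cong_def power_mod)
    define u where "u = (if z \<le> int half then z else p - z)"
    have "u \<in> {0..int half}" using z(1) odd_p by (auto simp: u_def)
    moreover have "[u\<^sup>2 = z\<^sup>2] (mod p)"
    proof -
      have "(p - z)\<^sup>2 - z\<^sup>2 = p * (p - 2 * z)" by (simp add: power2_eq_square algebra_simps)
      then show ?thesis by (simp add: u_def cong_iff_dvd_diff)
    qed
    then have "[x = u\<^sup>2] (mod p)" using y z(2) by (meson cong_sym cong_trans)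
    then have "x = u\<^sup>2 mod p" using x by (simp add: cong_def)
    ultimately show "x \<in> (\<lambda>y. y\<^sup>2 mod p) ` {0..int half}" by blast
  next
    fix x assume "x \<in> (\<lambda>y. y\<^sup>2 mod p) ` {0..int half}"
    then obtain y where y: "x = y\<^sup>2 mod p" by blast
    then have "[x = y\<^sup>2] (mod p)" by (simp add: cong_def)
    then have "\<not> nonsq p x" by (auto simp only: nonsq_def)
    then show "x \<in> {x \<in> {0..<p}. \<not> nonsq p x}" using p0 y by simp
  qed
  moreover have "inj_on (\<lambda>y. y\<^sup>2 mod p) {0..int half}"
  proof (rule inj_onI)
    fix y z assume yz: "y \<in> {0..int half}" "z \<in> {0..int half}" "y\<^sup>2 mod p = z\<^sup>2 mod p"
    then have "p dvd y\<^sup>2 - z\<^sup>2" by (metis cong_def cong_iff_dvd_diff)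
    then have "p dvd (y - z) * (y + z)" by (simp add: power2_eq_square algebra_simps)
    then consider "p dvd y - z" | "p dvd y + z" using dvd_mult_iff by blast
    then show "y = z"
    proof cases
      case 1
      show ?thesis by (rule residue_eqI) (use yz odd_p 1 in \<open>auto simp: cong_iff_dvd_diff\<close>)
    next
      case 2
      then have "y + z = 0" using yz odd_p not_dvd_small[of "y + z"] by force
      then show ?thesis using yz by simp
    qed
  qed
  ultimately show ?thesis by (simp add: card_image)
qed

lemma card_nonsq: "card {x \<in> {0..<p}. nonsq p x} = half"
proof -
  have "card {0..<p} = card {x \<in> {0..<p}. nonsq p x} + card {x \<in> {0..<p}. \<not> nonsq p x}"
    by (rule card_filter_split) simp
  then show ?thesis using card_squares odd_p by simp
qed

text \<open>A solution of \<open>x\<^sup>2 - m = z\<^sup>2\<close> factors as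
  \<open>(x - z) * (x + z) = m\<close>, so that \<open>x\<close> is half of \<open>y + m / y\<close>
  for \<open>y = x - z\<close>. As \<open>y\<close> and \<open>m / y\<close> give the same
  \<open>x\<close>, and at most two \<open>y\<close> are equal to \<open>m / y\<close>, at most
  \<open>half + 1\<close> residues \<open>x\<close> arise in this way.\<close>

lemma card_square_minus:
  assumes m: "\<not> p dvd m"
  shows "half \<le> card {x \<in> {0..<p}. nonsq p (x\<^sup>2 - m)}"
proof -
  define T where "T = {x \<in> {0..<p}. \<not> nonsq p (x\<^sup>2 - m)}"
  have "\<forall>y\<in>{1..<p}. \<exists>z. z \<in> {0..<p} \<and> [y * z + 0 = m] (mod p)"
  proof
    fix y assume "y \<in> {1..<p}"
    then have "\<not> p dvd y" by (rule not_dvd_unit)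
    from linear_solve[OF this, of 0 m] show "\<exists>z. z \<in> {0..<p} \<and> [y * z + 0 = m] (mod p)" by blast
  qed
  \<comment> \<open>Modulo \<open>p\<close>, \<open>iv y\<close> is \<open>m / y\<close>, and
    \<open>hf y\<close> below is \<open>y / 2\<close>.\<close>
  from bchoice[OF this] obtain iv where "\<forall>y\<in>{1..<p}. iv y \<in> {0..<p} \<and> [y * iv y + 0 = m] (mod p)" ..
  then have iv: "iv y \<in> {0..<p} \<and> [y * iv y + 0 = m] (mod p)" if "y \<in> {1..<p}" for y using that by blast
  obtain hf where hf: "\<And>y. hf y \<in> {0..<p} \<and> [2 * hf y + 0 = y] (mod p)"
    using linear_solve[OF not_dvd_numerals(1), of 0] that[of "\<lambda>y. SOME z. z \<in> {0..<p} \<and> [2 * z + 0 = y] (mod p)"]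
      someI_ex[of "\<lambda>z. z \<in> {0..<p} \<and> [2 * z + 0 = _] (mod p)"] by blast
  define h where "h y = hf ((y + iv y) mod p)" for y
  have iv1: "iv y \<in> {1..<p}" if "y \<in> {1..<p}" for y
  proof -
    have "iv y \<noteq> 0"
    proof
      assume "iv y = 0"
      then have "[0 = m] (mod p)" using iv[OF that] by simp
      then show False using m cong_0_iff cong_sym by blast
    qed
    then show ?thesis using iv[OF that] by auto
  qed
  have inv: "iv (iv y) = y" if "y \<in> {1..<p}" for y
  proof (rule residue_eqI)
    show "iv (iv y) \<in> {0..<p}" using iv[OF iv1[OF that]] by blast
    show "y \<in> {0..<p}" using that by simp
    have "[iv y * iv (iv y) = m] (mod p)" using iv[OF iv1[OF that]] by simp
    moreover have "[iv y * y = m] (mod p)" using iv[OF that] by (simp add: mult.commute)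
    ultimately have "[iv y * iv (iv y) = iv y * y] (mod p)" by (meson cong_sym cong_trans)
    then show "[iv (iv y) = y] (mod p)" by (rule cong_cancel[OF not_dvd_unit[OF iv1[OF that]]])
  qed
  have "T \<subseteq> h ` {1..<p}"
  proof
    fix x assume "x \<in> T"
    then obtain z where x: "x \<in> {0..<p}" and z: "[x\<^sup>2 - m = z\<^sup>2] (mod p)" by (auto simp: T_def nonsq_def)
    define y where "y = (x - z) mod p"
    have y: "y \<in> {0..<p}" "[y = x - z] (mod p)" using p0 by (simp_all add: y_def cong_def)
    have xz: "[(x - z) * (x + z) = m] (mod p)"
      using z by (simp add: cong_iff_dvd_diff power2_eq_square algebra_simps)
    have "y \<noteq> 0"
    proof
      assume "y = 0"
  have "[x - z = 0] (mod p)" using cong_sym[OF y(2)] \<open>y = 0\<close> by simp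
      then have "p dvd x - z" by (simp add: cong_0_iff)
      then have "p dvd (x - z) * (x + z)" by simp
      then show False using xz m by (metis cong_dvd_iff)
    qed
    then have y1: "y \<in> {1..<p}" using y(1) by auto
    have "[y * iv y = m] (mod p)" using iv[OF y1] by simp
    moreover have "[y * (x + z) = m] (mod p)" using cong_trans[OF cong_mult[OF y(2) cong_refl] xz] .
    ultimately have "[y * iv y = y * (x + z)] (mod p)" by (meson cong_sym cong_trans)
    then have "[iv y = x + z] (mod p)" by (rule cong_cancel[OF not_dvd_unit[OF y1]])
    then have "[y + iv y = (x - z) + (x + z)] (mod p)" by (intro cong_add y(2))
    then have "[y + iv y = 2 * x] (mod p)" by simp
    moreover have "[2 * h y = y + iv y] (mod p)" using hf[of "(y + iv y) mod p"] by (simp add: h_def cong_def)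
    ultimately have "[2 * h y = 2 * x] (mod p)" by (meson cong_trans)
    then have "[h y = x] (mod p)" using not_dvd_numerals(1) by (rule cong_cancel[rotated])
    then have "h y = x" using hf x unfolding h_def by (intro residue_eqI) auto
    then show "x \<in> h ` {1..<p}" using y1 by blast
  qed
  then have "card T \<le> card (h ` {1..<p})" by (intro card_mono) auto
  moreover have "2 * card (h ` {1..<p}) \<le> card {1..<p} + card {y \<in> {1..<p}. iv y = y}"
  proof (rule card_image_involution)
    fix y assume y: "y \<in> {1..<p}"
    show "iv y \<in> {1..<p}" by (rule iv1[OF y])
    show "h (iv y) = h y" unfolding h_def inv[OF y] by (simp add: add.commute)
  qed simp
  moreover have "card {y \<in> {1..<p}. iv y = y} \<le> 2"
  proof (cases "{y \<in> {1..<p}. iv y = y} = {}")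
    case False
    then obtain y0 where y0: "y0 \<in> {1..<p}" "iv y0 = y0" by blast
    have "y \<in> {y0, p - y0}" if "y \<in> {1..<p}" "iv y = y" for y
    proof -
      have "[y * y = m] (mod p)" "[y0 * y0 = m] (mod p)" using iv[of y] iv[of y0] that y0 by simp_all
      then have "[y * y = y0 * y0] (mod p)" by (meson cong_sym cong_trans)
      then have "p dvd (y - y0) * (y + y0)" by (simp add: cong_iff_dvd_diff algebra_simps)
      then consider "p dvd y - y0" | "p dvd y + y0" using dvd_mult_iff by blast
      then show ?thesis
      proof cases
        case 1
        have "y = y0" by (rule residue_eqI) (use that y0 1 in \<open>auto simp: cong_iff_dvd_diff\<close>)
        then show ?thesis by simp
      next
        case 2
        then have "p dvd (y + y0) - p" by simp
        then have "[y = p - y0] (mod p)" by (simp add: cong_iff_dvd_diff algebra_simps)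
        then have "y = p - y0" by (rule residue_eqI[rotated 2]) (use that y0 in auto)
        then show ?thesis by simp
      qed
    qed
    then have "{y \<in> {1..<p}. iv y = y} \<subseteq> {y0, p - y0}" by blast
    then have "card {y \<in> {1..<p}. iv y = y} \<le> card {y0, p - y0}" by (rule card_mono[rotated]) simp
    also have "\<dots> \<le> 2" by (simp add: card_insert_if)
    finally show ?thesis .
  next
    case True
    then show ?thesis by (simp only: card.empty)
  qed
  moreover have "card {1..<p} = 2 * half" using odd_p by simp
  ultimately have T: "card T \<le> half + 1" by linarith
  have "card {0..<p} = card {x \<in> {0..<p}. nonsq p (x\<^sup>2 - m)} + card T"
    unfolding T_def by (rule card_filter_split) simp
  then show ?thesis using T odd_p by simp
qed

lemma nonsq_not_dvd: "nonsq p x \<Longrightarrow> \<not> p dvd x"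
  unfolding nonsq_def using cong_0_iff by (metis power_zero_numeral)

abbreviation U :: "int set" where "U \<equiv> {0..<p}"

lemma finite_residues [simp]: "finite {x. 0 \<le> x \<and> x < p \<and> Q x}"
  by (rule finite_subset[of _ U]) auto

lemma card_U: "card U = 2 * half + 1"
  using odd_p by simp

lemma half_ge_2: "half \<ge> 2"
  using odd_p p5 by linarith

lemma mod_U [simp]: "x mod p \<in> U"
  using p0 by simp

lemma card_units: "card {1..<p} = 2 * half"
  using odd_p by simp

lemma lagrange_bound:
  fixes f :: "int poly"
  assumes "\<not> p dvd lead_coeff f"
  shows "card {x \<in> U. p dvd poly f x} \<le> degree f"
  using assms
proof (induction "degree f" arbitrary: f)
  case 0
  then obtain c where c: "f = [:c:]" by (metis degree_eq_zeroE)
  have "{x \<in> U. p dvd poly f x} = {}" using 0(2) unfolding c by auto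
  then show ?case by (simp only: card.empty)
next
  case (Suc n)
  show ?case
  proof (cases "{x \<in> U. p dvd poly f x} = {}")
    case False
    then obtain a where a: "a \<in> U" "p dvd poly f a" by blast
    define g where "g = synthetic_div f a"
    have fg: "f + smult a g = pCons (poly f a) g" unfolding g_def by (rule synthetic_div_correct)
    have fx: "poly f x = (x - a) * poly g x + poly f a" for x
    proof -
      have "poly (f + smult a g) x = poly (pCons (poly f a) g) x" by (simp only: fg)
      then show ?thesis by (simp add: left_diff_distrib)
    qed
    have deg: "degree g = n" using Suc(2) by (simp add: g_def degree_synthetic_div)
    have "coeff g n = coeff f (Suc n)"
    proof -
      have "coeff (f + smult a g) (Suc n) = coeff (pCons (poly f a) g) (Suc n)" by (simp only: fg)
      moreover have "coeff g (Suc n) = 0" using deg by (simp add: coeff_eq_0)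
      ultimately show ?thesis by simp
    qed
    then have lead: "\<not> p dvd lead_coeff g" using Suc(2,3) deg by simp
    have IH: "card {x \<in> U. p dvd poly g x} \<le> n" using Suc(1)[of g] deg lead by simp
    have sub: "{x \<in> U. p dvd poly f x} \<subseteq> insert a {x \<in> U. p dvd poly g x}"
    proof
      fix x assume x: "x \<in> {x \<in> U. p dvd poly f x}"
      then have "p dvd (x - a) * poly g x + poly f a" unfolding fx[of x, symmetric] by simp
      then have "p dvd (x - a) * poly g x" using a(2) by (simp only: dvd_add_left_iff)
      then consider "p dvd x - a" | "p dvd poly g x" using dvd_mult_iff by blast
      then show "x \<in> insert a {x \<in> U. p dvd poly g x}"
      proof cases
        case 1
        have "x = a" by (rule residue_eqI) (use x a 1 in \<open>simp_all add: cong_iff_dvd_diff\<close>)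
        then show ?thesis by simp
      qed (use x in simp)
    qed
    have "card {x \<in> U. p dvd poly f x} \<le> card (insert a {x \<in> U. p dvd poly g x})"
      by (rule card_mono[OF _ sub]) simp
    also have "\<dots> \<le> Suc n" using IH by (simp add: card_insert_if)
    finally show ?thesis using Suc(2) by simp
  next
    case True
    then show ?thesis by (simp only: card.empty)
  qed
qed

section \<open>Irreducible quartics modulo p\<close>

definition quartic :: "int \<times> int \<times> int \<times> int \<Rightarrow> int \<Rightarrow> int" where
  "quartic = (\<lambda>(e1, e2, e3, e4) y. y ^ 4 + e1 * y ^ 3 + e2 * y\<^sup>2 + e3 * y + e4)"

text \<open>Irreducibility over the residue field expressed in integers: a proper factorisation has
  degrees 1 + 3 or 2 + 2, and the second kind is written out in coefficients.\<close>

definition irr :: "int \<times> int \<times> int \<times> int \<Rightarrow> bool" where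
  "irr = (\<lambda>(e1, e2, e3, e4). (\<forall>y. \<not> p dvd quartic (e1, e2, e3, e4) y) \<and>
     \<not> (\<exists>a b c d. [e1 = a + c] (mod p) \<and> [e2 = a * c + b + d] (mod p) \<and>
        [e3 = a * d + b * c] (mod p) \<and> [e4 = b * d] (mod p)))"

definition Q4 :: "(int \<times> int \<times> int \<times> int) set" where
  "Q4 = U \<times> U \<times> U \<times> U"

definition roots :: "int \<times> int \<times> int \<times> int \<Rightarrow> int set" where
  "roots e = {y \<in> U. p dvd quartic e y}"

lemma finite_roots [simp]: "finite (roots e)"
  unfolding roots_def by (rule finite_subset[of _ U]) auto

lemma finite_Q4 [simp]: "finite Q4" by (simp add: Q4_def)

lemma card_Q4: "card Q4 = (2 * half + 1) ^ 4"
  using card_U by (simp add: Q4_def card_cartesian_product power4_eq_xxxx mult.assoc)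

lemma card_roots: "card (roots e) \<le> 4"
proof -
  obtain e1 e2 e3 e4 where e: "e = (e1, e2, e3, e4)" by (metis prod_cases4)
  have "roots e = {x \<in> U. p dvd poly [:e4, e3, e2, e1, 1:] x}"
    by (simp add: roots_def quartic_def e algebra_simps power2_eq_square power3_eq_cube power4_eq_xxxx)
  moreover have "card {x \<in> U. p dvd poly [:e4, e3, e2, e1, 1:] x} \<le> degree [:e4, e3, e2, e1, 1:]"
    by (rule lagrange_bound) (use p5 in simp)
  ultimately show ?thesis by simp
qed

lemma quartic_cong: "[x = y] (mod p) \<Longrightarrow> [quartic e x = quartic e y] (mod p)"
  unfolding quartic_def by (cases e) (auto intro!: cong_add cong_mult cong_pow)

lemma roots_empty_iff: "roots e = {} \<longleftrightarrow> (\<forall>y. \<not> p dvd quartic e y)"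
proof
  assume r: "roots e = {}"
  show "\<forall>y. \<not> p dvd quartic e y"
  proof (intro allI notI)
    fix y assume "p dvd quartic e y"
    moreover have "[quartic e (y mod p) = quartic e y] (mod p)" by (rule quartic_cong) (simp add: cong_def)
    ultimately have "p dvd quartic e (y mod p)" using cong_dvd_iff by blast
    then have "y mod p \<in> roots e" by (simp only: roots_def mem_Collect_eq mod_U simp_thms)
    then show False using r by blast
  qed
qed (simp add: roots_def)

lemma sum_card_swap:
  assumes "finite A" "finite B"
  shows "(\<Sum>a\<in>A. card {b \<in> B. P a b}) = (\<Sum>b\<in>B. card {a \<in> A. P a b})"
proof -
  have *: "card {b \<in> B. P a b} = (\<Sum>b\<in>B. if P a b then 1 else 0)" for a
    using assms(2) by (simp add: sum.If_cases Int_def)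
  have **: "card {a \<in> A. P a b} = (\<Sum>a\<in>A. if P a b then 1 else 0)" for b
    using assms(1) by (simp add: sum.If_cases Int_def)
  show ?thesis unfolding * ** by (rule sum.swap)
qed

text \<open>Double counting: once a root \<open>y\<close> is prescribed, the first three
  coefficients determine the last one, so at most \<open>p ^ 3\<close> quartics vanish at
  \<open>y\<close>.\<close>

lemma sum_roots: "(\<Sum>e\<in>Q4. card (roots e)) \<le> (2 * half + 1) ^ 4"
proof -
  have fib: "card {e \<in> Q4. p dvd quartic e y} \<le> card (U \<times> U \<times> U)" for y
  proof (rule card_inj_on_le[of "\<lambda>(e1, e2, e3, e4). (e1, e2, e3)"])
    show "inj_on (\<lambda>(e1, e2, e3, e4). (e1, e2, e3)) {e \<in> Q4. p dvd quartic e y}"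
    proof (rule inj_onI)
      fix e f
      assume ef: "e \<in> {e \<in> Q4. p dvd quartic e y}" "f \<in> {e \<in> Q4. p dvd quartic e y}"
        and eq: "(case e of (e1, e2, e3, e4) \<Rightarrow> (e1, e2, e3)) = (case f of (e1, e2, e3, e4) \<Rightarrow> (e1, e2, e3))"
      obtain e1 e2 e3 e4 where e: "e = (e1, e2, e3, e4)" by (rule prod_cases4)
      obtain e4' where f: "f = (e1, e2, e3, e4')" using eq by (cases f) (simp add: e)
      have *: "(e1, e2, e3, e4) \<in> Q4" "(e1, e2, e3, e4') \<in> Q4"
        and d: "p dvd quartic (e1, e2, e3, e4) y" "p dvd quartic (e1, e2, e3, e4') y"
        using ef unfolding e f by simp_all
      have "p dvd e4 - e4'" using dvd_diff[OF d] by (simp add: quartic_def)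
      then have "e4 = e4'" using * by (intro residue_eqI) (simp_all add: cong_iff_dvd_diff Q4_def)
      then show "e = f" by (simp only: e f)
    qed
  qed (auto simp: Q4_def)
  have "(\<Sum>e\<in>Q4. card (roots e)) = (\<Sum>y\<in>U. card {e \<in> Q4. p dvd quartic e y})"
    unfolding roots_def by (rule sum_card_swap) simp_all
  also have "\<dots> \<le> (\<Sum>y\<in>U. card (U \<times> U \<times> U))" by (rule sum_mono) (rule fib)
  also have "\<dots> = (2 * half + 1) ^ 4"
    using card_U by (simp add: card_cartesian_product power4_eq_xxxx mult.assoc)
  finally show ?thesis .
qed

text \<open>Two distinct prescribed roots are two independent linear conditions; for arbitrary
  \<open>e1\<close> and \<open>e2\<close> they can be solved for \<open>e3\<close> and
  \<open>e4\<close>. There are \<open>p * (p - 1)\<close> ordered pairs of roots.\<close>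

lemma sum_root_pairs:
  "(2 * half + 1) ^ 3 * (2 * half) \<le> (\<Sum>e\<in>Q4. card (roots e) * (card (roots e) - 1))"
proof -
  define D where "D = {(y, z). y \<in> U \<and> z \<in> U \<and> y \<noteq> z}"
  have D: "card {(y, z). y \<in> A \<and> z \<in> A \<and> y \<noteq> z} = card A * (card A - 1)" if "finite A" for A :: "int set"
  proof -
    have "{(y, z). y \<in> A \<and> z \<in> A \<and> y \<noteq> z} = A \<times> A - (\<lambda>y. (y, y)) ` A" by auto
    moreover have "card (A \<times> A - (\<lambda>y. (y, y)) ` A) = card (A \<times> A) - card ((\<lambda>y. (y, y)) ` A)"
      by (rule card_Diff_subset) (use that in auto)
    moreover have "card ((\<lambda>y. (y, y)) ` A) = card A" by (rule card_image) (simp add: inj_on_def)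
    ultimately show ?thesis using that by (simp add: card_cartesian_product right_diff_distrib')
  qed
  have cD: "card D = (2 * half + 1) * (2 * half)" using D[of U] unfolding D_def card_U by simp
  have finD: "finite D"
    by (rule finite_subset[of _ "U \<times> U"]) (auto simp: D_def)
  have fib: "card (U \<times> U) \<le> card {e \<in> Q4. p dvd quartic e y \<and> p dvd quartic e z}"
    if yz: "(y, z) \<in> D" for y z
  proof (rule card_le_rel[where R = "\<lambda>(e1, e2) (f1, f2, f3, f4). e1 = f1 \<and> e2 = f2"])
    show "finite {e \<in> Q4. p dvd quartic e y \<and> p dvd quartic e z}" by simp
    fix x assume "x \<in> U \<times> U"
    then obtain e1 e2 where x: "x = (e1, e2)" "e1 \<in> U" "e2 \<in> U" by blast
    have nd: "\<not> p dvd y - z"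
    proof
      assume "p dvd y - z"
      then have "y = z" by (intro residue_eqI) (use yz in \<open>simp_all add: D_def cong_iff_dvd_diff\<close>)
      then show False using yz by (simp add: D_def)
    qed
    define c where "c t = t ^ 4 + e1 * t ^ 3 + e2 * t\<^sup>2" for t
    obtain e3 where e3: "e3 \<in> U" "[(y - z) * e3 + (c y - c z) = 0] (mod p)" using linear_solve[OF nd] by blast
    have "\<not> p dvd 1" using p5 by simp
    then obtain e4 where e4: "e4 \<in> U" "[1 * e4 + (c z + e3 * z) = 0] (mod p)" using linear_solve by blast
    have z: "p dvd quartic (e1, e2, e3, e4) z"
      using e4(2) by (simp add: quartic_def c_def cong_0_iff add.commute add.left_commute)
    have "quartic (e1, e2, e3, e4) y = quartic (e1, e2, e3, e4) z + ((y - z) * e3 + (c y - c z))"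
      by (simp add: quartic_def c_def algebra_simps)
    moreover have "p dvd (y - z) * e3 + (c y - c z)" using e3(2) by (simp only: cong_0_iff)
    ultimately have y: "p dvd quartic (e1, e2, e3, e4) y" using z by (simp only: dvd_add)
    have "(e1, e2, e3, e4) \<in> {e \<in> Q4. p dvd quartic e y \<and> p dvd quartic e z}"
      using x(2,3) e3(1) e4(1) y z unfolding Q4_def by blast
    then show "\<exists>f\<in>{e \<in> Q4. p dvd quartic e y \<and> p dvd quartic e z}. (case x of (e1, e2) \<Rightarrow> \<lambda>(f1, f2, f3, f4). e1 = f1 \<and> e2 = f2) f"
      by (rule bexI[rotated]) (simp add: x(1))
  qed auto
  have "(2 * half + 1) ^ 3 * (2 * half) = (\<Sum>d\<in>D. card (U \<times> U))"
    by (simp only: sum_constant cD card_cartesian_product card_U) (simp add: power3_eq_cube algebra_simps)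
  also have "\<dots> \<le> (\<Sum>(y, z)\<in>D. card {e \<in> Q4. p dvd quartic e y \<and> p dvd quartic e z})"
    by (rule sum_mono) (use fib in auto)
  also have "\<dots> = (\<Sum>d\<in>D. card {e \<in> Q4. p dvd quartic e (fst d) \<and> p dvd quartic e (snd d)})"
    by (simp add: case_prod_beta)
  also have "\<dots> = (\<Sum>e\<in>Q4. card {d \<in> D. p dvd quartic e (fst d) \<and> p dvd quartic e (snd d)})"
    by (rule sum_card_swap) (simp_all add: finD)
  also have "\<dots> = (\<Sum>e\<in>Q4. card (roots e) * (card (roots e) - 1))"
  proof (rule sum.cong[OF refl])
    fix e
    have "{d \<in> D. p dvd quartic e (fst d) \<and> p dvd quartic e (snd d)} =
        {(y, z). y \<in> roots e \<and> z \<in> roots e \<and> y \<noteq> z}" by (auto simp: D_def roots_def)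
    then show "card {d \<in> D. p dvd quartic e (fst d) \<and> p dvd quartic e (snd d)} = card (roots e) * (card (roots e) - 1)"
      using D[of "roots e"] by simp
  qed
  finally show ?thesis .
qed

text \<open>A monic quartic has \<open>r \<le> 4\<close> roots, and \<open>4 \<le> 4 * r - r * (r - 1)\<close> for \<open>1 \<le> r \<le> 4\<close>, so the
  first two moments of \<open>r\<close> bound the number of quartics with a root.\<close>

lemma card_with_root:
  "4 * card {e \<in> Q4. roots e \<noteq> {}} + (2 * half + 1) ^ 3 * (2 * half) \<le> 4 * (2 * half + 1) ^ 4"
proof -
  have pt: "4 * (if roots e \<noteq> {} then 1 else 0) + card (roots e) * (card (roots e) - 1) \<le> 4 * card (roots e)" for e
  proof (cases "roots e = {}")
    case False
    then have "card (roots e) > 0" by (simp add: card_gt_0_iff)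
    then have "card (roots e) \<in> {1, 2, 3, 4}" using card_roots[of e] by auto
    then show ?thesis using False by auto
  qed simp
  have "4 * card {e \<in> Q4. roots e \<noteq> {}} = (\<Sum>e\<in>Q4. 4 * (if roots e \<noteq> {} then 1 else 0))"
    by (simp add: sum_distrib_left[symmetric] sum.If_cases Int_def)
  then have "4 * card {e \<in> Q4. roots e \<noteq> {}} + (\<Sum>e\<in>Q4. card (roots e) * (card (roots e) - 1))
      = (\<Sum>e\<in>Q4. 4 * (if roots e \<noteq> {} then 1 else 0) + card (roots e) * (card (roots e) - 1))"
    by (simp only: sum.distrib)
  also have "\<dots> \<le> (\<Sum>e\<in>Q4. 4 * card (roots e))" by (rule sum_mono) (rule pt)
  also have "\<dots> = 4 * (\<Sum>e\<in>Q4. card (roots e))" by (simp add: sum_distrib_left)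
  finally show ?thesis using sum_roots sum_root_pairs by linarith
qed

definition rootless_quadratics :: "(int \<times> int) set" where
  "rootless_quadratics = {(a, b). a \<in> U \<and> b \<in> U \<and> (\<forall>y. \<not> p dvd y\<^sup>2 + a * y + b)}"

lemma finite_rootless [simp]: "finite rootless_quadratics"
  by (rule finite_subset[of _ "U \<times> U"]) (auto simp: rootless_quadratics_def)

text \<open>By completing the square, a rootless quadratic has a non-square discriminant
  \<open>a\<^sup>2 - 4 * b\<close>, and for fixed \<open>a\<close> this happens for exactly
  \<open>half\<close> values of \<open>b\<close>.\<close>

lemma card_rootless: "card rootless_quadratics \<le> (2 * half + 1) * half"
proof -
  have "rootless_quadratics \<subseteq> Sigma U (\<lambda>a. {b \<in> U. nonsq p ((- 4) * b + a\<^sup>2)})"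
  proof
    fix ab' assume "ab' \<in> rootless_quadratics"
    then obtain a b where ab': "ab' = (a, b)" and ab: "(a, b) \<in> rootless_quadratics" by (cases ab') simp
    have "nonsq p ((- 4) * b + a\<^sup>2)"
      unfolding nonsq_def
    proof (intro allI notI)
      fix z assume z: "[(- 4) * b + a\<^sup>2 = z\<^sup>2] (mod p)"
      obtain y where y: "[2 * y + a = z] (mod p)" using linear_solve[OF not_dvd_numerals(1)] by blast
      have "[(2 * y + a)\<^sup>2 = (- 4) * b + a\<^sup>2] (mod p)" using cong_trans[OF cong_pow[OF y] cong_sym[OF z]] .
      then have "p dvd (2 * y + a)\<^sup>2 - ((- 4) * b + a\<^sup>2)" by (simp only: cong_iff_dvd_diff)
      moreover have "(2 * y + a)\<^sup>2 - ((- 4) * b + a\<^sup>2) = 4 * (y\<^sup>2 + a * y + b)"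
        by (simp add: power2_eq_square algebra_simps)
      ultimately have "p dvd 4 * (y\<^sup>2 + a * y + b)" by (simp only:)
      then have "p dvd y\<^sup>2 + a * y + b" using not_dvd_numerals(3) dvd_mult_iff by blast
      then show False using ab unfolding rootless_quadratics_def by blast
    qed
    then show "ab' \<in> Sigma U (\<lambda>a. {b \<in> U. nonsq p ((- 4) * b + a\<^sup>2)})"
      using ab unfolding ab' rootless_quadratics_def by blast
  qed
  then have "card rootless_quadratics \<le> card (Sigma U (\<lambda>a. {b \<in> U. nonsq p ((- 4) * b + a\<^sup>2)}))"
    by (rule card_mono[rotated]) simp
  also have "\<dots> = (\<Sum>a\<in>U. card {b \<in> U. nonsq p ((- 4) * b + a\<^sup>2)})" by simp
  also have "\<dots> = (\<Sum>a\<in>U. half)"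
  proof (rule sum.cong[OF refl])
    fix a
    have "\<not> p dvd - 4" using not_dvd_numerals(3) by simp
    then have "card {b \<in> U. nonsq p ((- 4) * b + a\<^sup>2)} = card {y \<in> U. nonsq p y}"
      by (rule card_affine) (rule nonsq_cong)
    then show "card {b \<in> U. nonsq p ((- 4) * b + a\<^sup>2)} = half" by (simp only: card_nonsq)
  qed
  also have "\<dots> = (2 * half + 1) * half" using card_U by simp
  finally show ?thesis .
qed

lemma quartic_factor:
  assumes "[e1 = a + c] (mod p)" "[e2 = a * c + b + d] (mod p)"
    "[e3 = a * d + b * c] (mod p)" "[e4 = b * d] (mod p)"
  shows "[quartic (e1, e2, e3, e4) y = (y\<^sup>2 + a * y + b) * (y\<^sup>2 + c * y + d)] (mod p)"
proof -
  have "(y\<^sup>2 + a * y + b) * (y\<^sup>2 + c * y + d)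
      = y ^ 4 + (a + c) * y ^ 3 + (a * c + b + d) * y\<^sup>2 + (a * d + b * c) * y + b * d"
    by (simp add: power2_eq_square power3_eq_cube power4_eq_xxxx algebra_simps)
  then show ?thesis
    unfolding quartic_def prod.case by (simp only:) (intro cong_add cong_mult cong_refl assms)
qed

lemma mod_factor:
  "\<exists>a'\<in>U. \<exists>b'\<in>U. [a = a'] (mod p) \<and> [b = b'] (mod p)"
  by (intro bexI[of _ "a mod p"] bexI[of _ "b mod p"]) (simp_all add: cong_def p0)

text \<open>Such a quartic is a product of two rootless quadratics, and exchanging the factors is an
  involution on the pairs whose fixed points are the diagonal.\<close>

lemma card_reducible_rootless:
  defines "s \<equiv> (2 * half + 1) * half"
  shows "2 * card {e \<in> Q4. roots e = {} \<and> \<not> irr e} \<le> s\<^sup>2 + s"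
proof -
  have diag: "{x \<in> rootless_quadratics \<times> rootless_quadratics. prod.swap x = x} \<subseteq> (\<lambda>u. (u, u)) ` rootless_quadratics"
  proof
    fix x assume "x \<in> {x \<in> rootless_quadratics \<times> rootless_quadratics. prod.swap x = x}"
    then have x: "fst x \<in> rootless_quadratics" and "prod.swap x = x" by (simp_all only: mem_Collect_eq mem_Times_iff)
    from this(2) have "snd (prod.swap x) = snd x" by (rule arg_cong)
    then have "x = (fst x, fst x)" by (cases x) (simp only: swap_simp fst_conv snd_conv)
    then show "x \<in> (\<lambda>u. (u, u)) ` rootless_quadratics" using x(1) by (rule image_eqI)
  qed
  define h where "h = (\<lambda>((a, b), (c, d)). ((a + c) mod p, (a * c + b + d) mod p, (a * d + b * c) mod p, (b * d) mod p))"
  let ?S = "rootless_quadratics"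
  have "{e \<in> Q4. roots e = {} \<and> \<not> irr e} \<subseteq> h ` (?S \<times> ?S)"
  proof (rule subsetI, clarify)
    fix e1 e2 e3 e4
    assume e: "(e1, e2, e3, e4) \<in> Q4" "roots (e1, e2, e3, e4) = {}" "\<not> irr (e1, e2, e3, e4)"
    have "\<exists>a b c d. [e1 = a + c] (mod p) \<and> [e2 = a * c + b + d] (mod p) \<and>
        [e3 = a * d + b * c] (mod p) \<and> [e4 = b * d] (mod p)"
      using e(2,3) unfolding irr_def roots_empty_iff prod.case by (simp only: de_Morgan_conj not_not simp_thms)
    then obtain a0 b0 c0 d0 where f0: "[e1 = a0 + c0] (mod p)" "[e2 = a0 * c0 + b0 + d0] (mod p)"
      "[e3 = a0 * d0 + b0 * c0] (mod p)" "[e4 = b0 * d0] (mod p)" by (elim exE conjE)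
    obtain a b where ab: "a \<in> U" "b \<in> U" "[a0 = a] (mod p)" "[b0 = b] (mod p)" using mod_factor[of a0 b0] by blast
    obtain c d where cd: "c \<in> U" "d \<in> U" "[c0 = c] (mod p)" "[d0 = d] (mod p)" using mod_factor[of c0 d0] by blast
    have f: "[e1 = a + c] (mod p)" "[e2 = a * c + b + d] (mod p)"
      "[e3 = a * d + b * c] (mod p)" "[e4 = b * d] (mod p)"
    proof -
      show "[e1 = a + c] (mod p)" by (rule cong_trans[OF f0(1)]) (intro cong_add ab cd)
      show "[e2 = a * c + b + d] (mod p)" by (rule cong_trans[OF f0(2)]) (intro cong_add cong_mult ab cd)
      show "[e3 = a * d + b * c] (mod p)" by (rule cong_trans[OF f0(3)]) (intro cong_add cong_mult ab cd)
      show "[e4 = b * d] (mod p)" by (rule cong_trans[OF f0(4)]) (intro cong_mult ab cd)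
    qed
    have q: "\<not> p dvd (y\<^sup>2 + a * y + b) * (y\<^sup>2 + c * y + d)" for y
      using cong_dvd_iff[OF quartic_factor[OF f, of y]] e(2)[unfolded roots_empty_iff, rule_format, of y] by (simp only: simp_thms)
    have "(a, b) \<in> ?S" "(c, d) \<in> ?S"
      using ab(1,2) cd(1,2) q unfolding rootless_quadratics_def dvd_mult_iff by simp_all
    moreover have "(e1, e2, e3, e4) = h ((a, b), (c, d))"
      using e(1) f by (simp add: h_def Q4_def cong_def)
    ultimately show "(e1, e2, e3, e4) \<in> h ` (?S \<times> ?S)" by blast
  qed
  then have "card {e \<in> Q4. roots e = {} \<and> \<not> irr e} \<le> card (h ` (?S \<times> ?S))"
    by (rule card_mono[rotated]) simp
  moreover have "2 * card (h ` (?S \<times> ?S)) \<le> card (?S \<times> ?S) + card {x \<in> ?S \<times> ?S. prod.swap x = x}"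
  proof (rule card_image_involution)
    fix x assume "x \<in> ?S \<times> ?S"
    then show "prod.swap x \<in> ?S \<times> ?S" by auto
    show "h (prod.swap x) = h x"
      by (cases x) (auto simp: h_def add.commute mult.commute add.left_commute)
  qed simp
  moreover have "card {x \<in> ?S \<times> ?S. prod.swap x = x} \<le> card ?S"
    by (rule order_trans[OF card_mono[OF _ diag] card_image_le]) simp_all
  ultimately have "2 * card {e \<in> Q4. roots e = {} \<and> \<not> irr e} \<le> card ?S * card ?S + card ?S"
    unfolding card_cartesian_product by linarith
  also have "\<dots> \<le> s * s + s"
    unfolding s_def by (intro add_mono mult_mono card_rootless) simp_all
  finally show ?thesis by (simp add: power2_eq_square)
qed

text \<open>At most about 3/4 of all quartics have a root and at most about 1/8 are products of two
  rootless quadratics, which leaves about 1/8. The constant 16 absorbs the lower-order terms in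
  \<open>p\<close>.\<close>

lemma card_irr: "(2 * half + 1) ^ 4 \<le> 16 * card {e \<in> Q4. irr e}"
proof -
  define q where "q = int (2 * half + 1)"
  define h where "h = int half"
  let ?R = "{e \<in> Q4. roots e \<noteq> {}}" and ?N = "{e \<in> Q4. roots e = {} \<and> \<not> irr e}" and ?I = "{e \<in> Q4. irr e}"
  have "Q4 \<subseteq> ?R \<union> ?N \<union> ?I" by blast
  then have "card Q4 \<le> card (?R \<union> ?N \<union> ?I)" by (rule card_mono[rotated]) simp
  also have "\<dots> \<le> card ?R + card ?N + card ?I"
    using card_Un_le[of "?R \<union> ?N" ?I] card_Un_le[of ?R ?N] by linarith
  finally have 1: "q ^ 4 \<le> int (card ?R) + int (card ?N) + int (card ?I)"
    unfolding card_Q4 q_def of_nat_power[symmetric] of_nat_add[symmetric] of_nat_le_iff .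
  have "int (4 * card ?R + (2 * half + 1) ^ 3 * (2 * half)) \<le> int (4 * (2 * half + 1) ^ 4)"
    using card_with_root by (simp only: of_nat_le_iff)
  then have 2: "4 * int (card ?R) + q ^ 3 * (2 * h) \<le> 4 * q ^ 4" by (simp add: q_def h_def)
  have "int (2 * card ?N) \<le> int (((2 * half + 1) * half)\<^sup>2 + (2 * half + 1) * half)"
    using card_reducible_rootless by (simp only: of_nat_le_iff)
  then have 3: "2 * int (card ?N) \<le> (q * h)\<^sup>2 + q * h"
    unfolding q_def h_def of_nat_mult[symmetric] of_nat_power[symmetric] of_nat_add[symmetric] by (simp only: of_nat_mult of_nat_numeral)
  have q: "q = 2 * h + 1" by (simp add: q_def h_def)
  have h: "h \<ge> 0" by (simp add: h_def)
  have arith: "4 * X - 8 * Y \<le> 16 * I" if "W \<le> R + N + I" "4 * R + X \<le> 4 * W" "2 * N \<le> Y" for X Y W R N I :: int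
    using that by linarith
  have "4 * (q ^ 3 * (2 * h)) - 8 * ((q * h)\<^sup>2 + q * h) \<le> 16 * int (card ?I)" by (rule arith[OF 1 2 3])
  moreover have "4 * (q ^ 3 * (2 * h)) - 8 * ((q * h)\<^sup>2 + q * h) = q ^ 4 + q * (8 * h ^ 3 + 12 * h\<^sup>2 - 6 * h - 1)"
    unfolding q by (simp add: power2_eq_square power3_eq_cube power4_eq_xxxx algebra_simps)
  moreover have "q ^ 4 \<le> q ^ 4 + q * (8 * h ^ 3 + 12 * h\<^sup>2 - 6 * h - 1)"
  proof -
    have "h \<ge> 1" using half_ge_2 by (simp add: h_def)
    then have "h \<le> h ^ 3" "h \<le> h\<^sup>2" by (simp_all add: self_le_power)
    then have "0 \<le> 8 * h ^ 3 + 12 * h\<^sup>2 - 6 * h - 1" using \<open>h \<ge> 1\<close> by linarith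
    then show ?thesis using q h by simp
  qed
  ultimately have "q ^ 4 \<le> 16 * int (card ?I)" by (simp only: order_trans)
  then have "int ((2 * half + 1) ^ 4) \<le> int (16 * card ?I)" by (simp add: q_def)
  then show ?thesis by (simp only: of_nat_le_iff)
qed

end

section \<open>Trivial point groups and the halving of points\<close>

text \<open>A non-empty independent set would have to be \<open>{PointAtInfinity}\<close>, and the
  coefficient 1 shows that this set is dependent. The carrier is a singleton, for which the group
  axioms are immediate.\<close>

lemma point_group_rank_zero:
  assumes "\<And>x y. \<not> on_curve E (Affine x y)"
  shows "\<not> ec_rank E \<ge> 1"
proof
  assume "ec_rank E \<ge> 1"
  let ?G = "point_group E"
  have "\<exists>S. int_independent ?G S \<and> card S > 0"
  proof (rule ccontr)
    assume "\<not> ?thesis"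
    then have "Sup {enat (card S) |S. int_independent ?G S} \<le> 0"
      by (intro Sup_least) (auto simp: zero_enat_def)
    then show False using \<open>ec_rank E \<ge> 1\<close> by (simp add: ec_rank_def ab_group_rank_def)
  qed
  then obtain S where S: "int_independent ?G S" "card S > 0" by blast
  have carr: "carrier ?G = {PointAtInfinity}"
  proof -
    have "on_curve E P \<longleftrightarrow> P = PointAtInfinity" for P
      using assms by (cases P) auto
    then show ?thesis by (auto simp: point_group_def)
  qed
  interpret comm_group ?G
    by (rule comm_groupI) (simp_all only: carr, auto simp: point_group_def)
  have "S = {PointAtInfinity}"
  proof -
    have "S \<subseteq> {PointAtInfinity}" using S(1) carr by (simp add: int_independent_def)
    moreover have "S \<noteq> {}" using S(2) by auto
    ultimately show ?thesis using subset_singletonD by fastforce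
  qed
  moreover have "finprod ?G (\<lambda>P. P [^]\<^bsub>?G\<^esub> (1::int)) S \<in> carrier ?G"
    by (rule finprod_closed) (use S calculation carr in auto)
  then have "finprod ?G (\<lambda>P. P [^]\<^bsub>?G\<^esub> (1::int)) S = \<one>\<^bsub>?G\<^esub>"
    using carr one_closed by simp
  ultimately show False
    using S(1) unfolding int_independent_def by (auto dest!: spec[of _ "\<lambda>_. 1::int"])
qed

lemma cong_reduce_cubic:
  fixes F g :: "'a::field poly"
  assumes "F = [:a6, a4, a2, 1:]"
  obtains g0 g1 g2 where "F dvd g - [:g0, g1, g2:]"
proof -
  have "degree F = 3" using assms by simp
  then have "degree (g mod F) < 3"
    using degree_mod_less[of F g] assms by (metis degree_0 numeral_eq_Suc pCons_eq_0_iff zero_less_Suc zero_neq_one)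
  then have "g mod F = [:coeff (g mod F) 0, coeff (g mod F) 1, coeff (g mod F) 2:]"
    by (auto simp: poly_eq_iff coeff_pCons coeff_eq_0 numeral_2_eq_2 split: nat.splits)
  moreover have "F dvd g - g mod F" by (rule dvd_minus_mod)
  ultimately show ?thesis using that by metis
qed

lemma dvd_cubic_small_degree:
  fixes F g :: "'a::field poly"
  assumes "F dvd g" "degree g < degree F"
  shows "g = 0"
  using assms dvd_imp_degree_le leD by blast

text \<open>If \<open>x - X\<close> is a constant times a square modulo the cubic \<open>F\<close>, then multiplying the
  square root by a suitable linear polynomial makes it linear as well, and this exhibits a
  line that is tangent to the curve at a point \<open>(x', y')\<close> and meets it again above \<open>x\<close>.\<close>

lemma halving:
  fixes a2 a4 a6 x y c :: "'a::field"
  assumes two: "(2::'a) \<noteq> 0"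
    and F: "F = [:a6, a4, a2, 1:]"
    and curve: "y\<^sup>2 = x ^ 3 + a2 * x\<^sup>2 + a4 * x + a6" "y \<noteq> 0"
    and c: "c \<noteq> 0"
    and uv: "u * S + v * F = 1"
    and dvd: "F dvd smult c (S\<^sup>2 * [:x, -1:]) - g\<^sup>2"
  shows "\<exists>x' y'. y'\<^sup>2 = x' ^ 3 + a2 * x'\<^sup>2 + a4 * x' + a6 \<and>
    4 * y'\<^sup>2 * (x + a2 + 2 * x') = (3 * x'\<^sup>2 + 2 * a2 * x' + a4)\<^sup>2"
proof -
  have degF: "degree F = 3" and F0: "F \<noteq> 0" using F by auto
  obtain g0 g1 g2 where red: "F dvd g * u - [:g0, g1, g2:]"
    using cong_reduce_cubic[OF F] by blast
  let ?h = "[:g0, g1, g2:]"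
  have h: "F dvd smult c [:x, -1:] - ?h\<^sup>2"
  proof -
    define Q where "Q = smult c [:x, -1:]"
    obtain k where k: "S\<^sup>2 * Q - g\<^sup>2 = F * k"
    proof -
      have "smult c (S\<^sup>2 * [:x, -1:]) = S\<^sup>2 * Q" unfolding Q_def by (simp only: mult_smult_right)
      then show ?thesis using dvd that by (metis dvdE)
    qed
    obtain l where l: "g * u - ?h = F * l" using red by blast
    have h: "?h = g * u - F * l" using l by (simp add: algebra_simps)
    have "Q = Q * (u * S + v * F)\<^sup>2" using uv by simp
    also have "\<dots> = u\<^sup>2 * (S\<^sup>2 * Q) + F * (Q * (2 * u * S * v + v\<^sup>2 * F))"
      by (simp add: power2_eq_square algebra_simps)
    also have "S\<^sup>2 * Q = F * k + g\<^sup>2" using k by (simp add: algebra_simps)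
    finally have eq: "Q = u\<^sup>2 * (F * k + g\<^sup>2) + F * (Q * (2 * u * S * v + v\<^sup>2 * F))" .
    have "Q - ?h\<^sup>2 = F * (u\<^sup>2 * k + Q * (2 * u * S * v + v\<^sup>2 * F) + 2 * g * u * l - F * l\<^sup>2)"
      unfolding h by (subst eq) (simp add: power2_eq_square algebra_simps)
    then show ?thesis unfolding Q_def by (rule dvdI)
  qed
  \<comment> \<open>If \<open>g2 = 0\<close>, then \<open>c (x - X) - h\<^sup>2\<close> has degree
    at most 2 and is a multiple of \<open>F\<close>, hence zero; its quadratic coefficient then
    gives \<open>g1 = 0\<close> and its linear one \<open>c = 0\<close>.\<close>
  have g2: "g2 \<noteq> 0"
  proof
    assume "g2 = 0"
    have "smult c [:x, -1:] - ?h\<^sup>2 = 0"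
      using h by (rule dvd_cubic_small_degree)
        (use \<open>g2 = 0\<close> degF in \<open>auto simp: power2_eq_square\<close>)
    then have "[:c * x - g0\<^sup>2, - c - 2 * g0 * g1, - g1\<^sup>2:] = 0"
      using \<open>g2 = 0\<close> by (simp add: power2_eq_square)
    then have "g1 = 0" "- c = 2 * g0 * g1" by simp_all
    then show False using c by simp
  qed
  \<comment> \<open>The multiplier \<open>s0 + g2 X\<close> is chosen so that its product with
    \<open>h\<close> agrees with \<open>g2\<^sup>2 F\<close> in degrees 3 and 2. The difference is
    the linear polynomial \<open>t0 + t1 X\<close>.\<close>
  define s0 where "s0 = g2 * a2 - g1"
  define t1 where "t1 = s0 * g1 + g2 * g0 - g2\<^sup>2 * a4"
  define t0 where "t0 = s0 * g0 - g2\<^sup>2 * a6"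
  have st: "[:s0, g2:] * ?h = [:t0, t1:] + smult (g2\<^sup>2) F"
    by (simp add: F s0_def t1_def t0_def power2_eq_square algebra_simps)
  have dv: "F dvd [:s0, g2:]\<^sup>2 * smult c [:x, -1:] - [:t0, t1:]\<^sup>2"
  proof -
    obtain k where k: "smult c [:x, -1:] - ?h\<^sup>2 = F * k" using h by blast
    have t: "[:t0, t1:] = [:s0, g2:] * ?h - smult (g2\<^sup>2) F" using st by simp
    have "smult c [:x, -1:] = F * k + ?h\<^sup>2" using k by (simp add: algebra_simps)
    then have "[:s0, g2:]\<^sup>2 * smult c [:x, -1:] - [:t0, t1:]\<^sup>2
      = [:s0, g2:]\<^sup>2 * (F * k + ?h\<^sup>2) - ([:s0, g2:] * ?h - [:g2\<^sup>2:] * F)\<^sup>2" unfolding t by simp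
    also have "\<dots> = F * ([:s0, g2:]\<^sup>2 * k + 2 * [:s0, g2:] * ?h * [:g2\<^sup>2:] - [:g2\<^sup>2:]\<^sup>2 * F)"
    proof -
      have "A\<^sup>2 * (F * k + h\<^sup>2) - (A * h - G * F)\<^sup>2 = F * (A\<^sup>2 * k + 2 * A * h * G - G\<^sup>2 * F)"
        for A h G :: "'a poly" by (simp add: power2_eq_square algebra_simps)
      then show ?thesis .
    qed
    finally show ?thesis by (rule dvdI)
  qed
  have dg: "degree ([:s0, g2:]\<^sup>2 * smult c [:x, -1:] - [:t0, t1:]\<^sup>2 + smult (c * g2\<^sup>2) F) < 3"
  proof -
    have "[:s0, g2:]\<^sup>2 * smult c [:x, -1:] - [:t0, t1:]\<^sup>2 + smult (c * g2\<^sup>2) F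
      = [:c * s0\<^sup>2 * x - t0\<^sup>2 + c * g2\<^sup>2 * a6, 2 * c * s0 * g2 * x - c * s0\<^sup>2 - 2 * t0 * t1 + c * g2\<^sup>2 * a4,
         c * g2\<^sup>2 * x - 2 * c * s0 * g2 - t1\<^sup>2 + c * g2\<^sup>2 * a2:]"
      by (simp add: F power2_eq_square algebra_simps)
    also have "degree \<dots> < 3" by (simp add: degree_pCons_eq_if)
    finally show ?thesis .
  qed
  have "[:s0, g2:]\<^sup>2 * smult c [:x, -1:] - [:t0, t1:]\<^sup>2 + smult (c * g2\<^sup>2) F = 0"
    by (rule dvd_cubic_small_degree[OF dvd_add[OF dv dvd_smult[OF dvd_refl]]]) (use dg degF in simp)
  then have "[:c * s0\<^sup>2 * x - t0\<^sup>2 + c * g2\<^sup>2 * a6, 2 * c * s0 * g2 * x - c * s0\<^sup>2 - 2 * t0 * t1 + c * g2\<^sup>2 * a4,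
         c * g2\<^sup>2 * x - 2 * c * s0 * g2 - t1\<^sup>2 + c * g2\<^sup>2 * a2:] = 0"
    by (simp add: F power2_eq_square algebra_simps)
  then have e0: "t0\<^sup>2 = c * s0\<^sup>2 * x + c * g2\<^sup>2 * a6"
    and e1: "2 * t0 * t1 = 2 * c * s0 * g2 * x - c * s0\<^sup>2 + c * g2\<^sup>2 * a4"
    and e2: "t1\<^sup>2 = c * g2\<^sup>2 * x - 2 * c * s0 * g2 + c * g2\<^sup>2 * a2"
    by (simp_all add: algebra_simps)
  have tx: "(t0 + t1 * x)\<^sup>2 = c * (g2 * y)\<^sup>2"
  proof -
    have "(t0 + t1 * x)\<^sup>2 = t0\<^sup>2 + 2 * t0 * t1 * x + t1\<^sup>2 * x\<^sup>2" by (simp add: power2_eq_square algebra_simps)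
    also have "\<dots> = c * g2\<^sup>2 * (x ^ 3 + a2 * x\<^sup>2 + a4 * x + a6)"
      unfolding e0 e1 e2 by (simp add: power2_eq_square power3_eq_cube algebra_simps)
    finally show ?thesis using curve by (simp add: power_mult_distrib)
  qed
  \<comment> \<open>With \<open>s = s0 + g2 X\<close> and \<open>t = t0 + t1 X\<close>, the identity
    obtained is \<open>s\<^sup>2 c (x - X) - t\<^sup>2 = - c g2\<^sup>2 F\<close>. Its value at
    \<open>X = x\<close> shows that \<open>c\<close> is the square of \<open>d\<close>.\<close>
  define d where "d = (t0 + t1 * x) / (g2 * y)"
  have d: "c = d\<^sup>2" using tx g2 curve(2) by (simp add: d_def power_divide)
  have d0: "d \<noteq> 0" using d c by auto
  \<comment> \<open>Dividing by \<open>c g2\<^sup>2\<close> gives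
    \<open>(l0 + l1 X)\<^sup>2 = F - (X - x) (X - x')\<^sup>2\<close>: the line touches the curve
    above \<open>x'\<close> and meets it again above \<open>x\<close>.\<close>
  define x' where "x' = - s0 / g2"
  define l0 where "l0 = t0 / (d * g2)"
  define l1 where "l1 = t1 / (d * g2)"
  have s0: "s0 = - x' * g2" using g2 by (simp add: x'_def)
  have t: "t0 = l0 * (d * g2)" "t1 = l1 * (d * g2)" using d0 g2 by (simp_all add: l0_def l1_def)
  have nz: "d\<^sup>2 * g2\<^sup>2 \<noteq> 0" using d0 g2 by simp
  have "d\<^sup>2 * g2\<^sup>2 * l0\<^sup>2 = d\<^sup>2 * g2\<^sup>2 * (x'\<^sup>2 * x + a6)"
    using e0 unfolding t s0 d by (simp add: power2_eq_square algebra_simps)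
  then have f0: "l0\<^sup>2 = x'\<^sup>2 * x + a6" using nz by (metis mult_left_cancel)
  have "d\<^sup>2 * g2\<^sup>2 * (2 * l0 * l1) = d\<^sup>2 * g2\<^sup>2 * (a4 - 2 * x' * x - x'\<^sup>2)"
    using e1 unfolding t s0 d by (simp add: power2_eq_square algebra_simps)
  then have f1: "2 * l0 * l1 = a4 - 2 * x' * x - x'\<^sup>2" using nz by (metis mult_left_cancel)
  have "d\<^sup>2 * g2\<^sup>2 * l1\<^sup>2 = d\<^sup>2 * g2\<^sup>2 * (x + 2 * x' + a2)"
    using e2 unfolding t s0 d by (simp add: power2_eq_square algebra_simps)
  then have f2: "l1\<^sup>2 = x + 2 * x' + a2" using nz by (metis mult_left_cancel)
  define y' where "y' = l0 + l1 * x'"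
  have y': "y'\<^sup>2 = x' ^ 3 + a2 * x'\<^sup>2 + a4 * x' + a6"
  proof -
    have "y'\<^sup>2 = l0\<^sup>2 + 2 * l0 * l1 * x' + l1\<^sup>2 * x'\<^sup>2" by (simp add: y'_def power2_eq_square algebra_simps)
    then show ?thesis unfolding f0 f1 f2 by (simp add: power2_eq_square power3_eq_cube algebra_simps)
  qed
  have "2 * l1 * y' = 2 * l0 * l1 + 2 * l1\<^sup>2 * x'" by (simp add: y'_def power2_eq_square algebra_simps)
  also have "\<dots> = 3 * x'\<^sup>2 + 2 * a2 * x' + a4" unfolding f1 f2 by (simp add: power2_eq_square algebra_simps)
  finally have "3 * x'\<^sup>2 + 2 * a2 * x' + a4 = 2 * l1 * y'" ..
  then have "(3 * x'\<^sup>2 + 2 * a2 * x' + a4)\<^sup>2 = 4 * y'\<^sup>2 * l1\<^sup>2" by (simp add: power_mult_distrib mult_ac)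
  also have "l1\<^sup>2 = x + a2 + 2 * x'" using f2 by (simp add: add_ac)
  finally show ?thesis using y' by metis
qed

section \<open>Rational polynomials at complex points\<close>

text \<open>Divisibility in \<open>Q[X]\<close> is translated into common complex zeros, which the
  fundamental theorem of algebra provides.\<close>

definition ev :: "rat poly \<Rightarrow> complex \<Rightarrow> complex" where
  "ev p z = poly (map_poly of_rat p) z"

lemma ev_0 [simp]: "ev 0 z = 0" and ev_1 [simp]: "ev 1 z = 1"
  by (simp_all add: ev_def)

lemma ev_pCons [simp]: "ev (pCons a p) z = of_rat a + z * ev p z"
  by (simp add: ev_def map_poly_pCons)

lemma ev_add [simp]: "ev (p + q) z = ev p z + ev q z"
  by (induction p q rule: poly_induct2) (simp_all add: of_rat_add algebra_simps)

lemma ev_smult [simp]: "ev (smult a p) z = of_rat a * ev p z"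
  by (induction p) (simp_all add: of_rat_mult algebra_simps)

lemma ev_mult [simp]: "ev (p * q) z = ev p z * ev q z"
  by (induction p) (simp_all add: algebra_simps)

lemma ev_uminus [simp]: "ev (- p) z = - ev p z"
  using ev_smult[of "- 1" p z] by (simp add: of_rat_minus)

lemma ev_diff [simp]: "ev (p - q) z = ev p z - ev q z"
  using ev_add[of p "- q" z] by simp

lemma ev_power [simp]: "ev (p ^ n) z = ev p z ^ n"
  by (induction n) simp_all

lemma ev_numeral [simp]: "ev (numeral n) z = numeral n"
  by (simp add: numeral_poly)

lemma ev_of_rat: "ev p (of_rat x) = of_rat (poly p x)"
  by (induction p) (simp_all add: of_rat_add of_rat_mult)

lemma bezout_rat_poly:
  fixes p q :: "rat poly"
  assumes "coprime p q"
  obtains u v where "u * p + v * q = 1"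
  using bezout_coefficients_fst_snd[of p q] assms by (metis coprime_iff_gcd_eq_1)

lemma coprime_no_common_root:
  assumes "coprime p q" "ev p z = 0"
  shows "ev q z \<noteq> 0"
proof -
  obtain u v where "u * p + v * q = 1" using assms(1) by (rule bezout_rat_poly)
  then have "ev (u * p + v * q) z = 1" by simp
  then show ?thesis using assms(2) by auto
qed

lemma ev_root_exists:
  assumes "degree p > 0"
  shows "\<exists>z. ev p z = 0"
proof -
  have "degree (map_poly of_rat p :: complex poly) = degree p"
    by (rule degree_map_poly) simp
  then have "\<not> constant (poly (map_poly of_rat p :: complex poly))"
    using assms by (simp add: constant_degree)
  then show ?thesis unfolding ev_def by (rule fundamental_theorem_of_algebra)
qed

lemma no_common_root_imp_coprime:
  assumes "\<And>z. ev p z = 0 \<Longrightarrow> ev q z \<noteq> 0"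
  shows "coprime p q"
proof -
  have nz: "gcd p q \<noteq> 0" using assms[of 0] by auto
  have "degree (gcd p q) = 0"
  proof (rule ccontr)
    assume "degree (gcd p q) \<noteq> 0"
    then obtain z where z: "ev (gcd p q) z = 0" using ev_root_exists by blast
    have "p = gcd p q * (p div gcd p q)" "q = gcd p q * (q div gcd p q)" by simp_all
    then have "ev p z = 0" "ev q z = 0" using z by (metis ev_mult mult_zero_left)+
    then show False using assms by blast
  qed
  then have "is_unit (gcd p q)" using nz by (metis is_unit_iff_degree)
  then show ?thesis by (rule is_unit_gcd[THEN iffD1])
qed

lemma irreducible_dvd_of_common_root:
  assumes "irreducible p" "ev p z = 0" "ev q z = 0"
  shows "p dvd (q :: rat poly)"
proof (rule ccontr)
  assume "\<not> p dvd q"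
  then have "coprime p q"
    using assms(1) by (metis irreducible_imp_prime_elem prime_elem_imp_coprime)
  then show False using coprime_no_common_root assms by blast
qed

section \<open>Doubling in lowest terms and infinite descent\<close>

text \<open>The three equations say that the cubic and its derivatives by X and by T vanish. What is
  required is thus that the affine curve in the (X, T)-plane along which the double cover
  \<open>Y\<^sup>2 = cubic\<close> branches is smooth.\<close>

definition smooth_surface :: "rat poly \<Rightarrow> rat poly \<Rightarrow> rat poly \<Rightarrow> bool" where
  "smooth_surface a2 a4 a6 \<longleftrightarrow> (\<forall>X T.
     \<not> (X ^ 3 + ev a2 T * X\<^sup>2 + ev a4 T * X + ev a6 T = 0 \<and>
        3 * X\<^sup>2 + 2 * ev a2 T * X + ev a4 T = 0 \<and>
        ev (pderiv a2) T * X\<^sup>2 + ev (pderiv a4) T * X + ev (pderiv a6) T = 0))"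

definition triple :: "rat poly \<Rightarrow> rat poly \<Rightarrow> rat poly \<Rightarrow> rat poly \<Rightarrow> rat poly \<Rightarrow> rat poly \<Rightarrow> bool" where
  "triple a2 a4 a6 p q r \<longleftrightarrow> q \<noteq> 0 \<and> coprime p q \<and>
     r\<^sup>2 = p ^ 3 + a2 * p\<^sup>2 * q\<^sup>2 + a4 * p * q ^ 4 + a6 * q ^ 6"

text \<open>This is \<open>q ^ 4\<close> times the X-derivative of the cubic at
  \<open>p / q\<^sup>2\<close>.\<close>

definition tangent_num :: "rat poly \<Rightarrow> rat poly \<Rightarrow> rat poly \<Rightarrow> rat poly \<Rightarrow> rat poly" where
  "tangent_num a2 a4 p q = 3 * p\<^sup>2 + 2 * a2 * p * q\<^sup>2 + a4 * q ^ 4"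

text \<open>By the tangent formula, the double of the point has x-coordinate
  \<open>double_num / (4 r\<^sup>2 q\<^sup>2)\<close>.\<close>

definition double_num :: "rat poly \<Rightarrow> rat poly \<Rightarrow> rat poly \<Rightarrow> rat poly \<Rightarrow> rat poly \<Rightarrow> rat poly" where
  "double_num a2 a4 p q r = (tangent_num a2 a4 p q)\<^sup>2 - 4 * (a2 * q\<^sup>2 + 2 * p) * r\<^sup>2"

text \<open>At a zero of \<open>r\<close> the derivative of \<open>r\<^sup>2\<close> by T vanishes.
  If the X-derivative of the cubic vanishes there too, the chain rule makes the T-derivative vanish,
  and the section passes through a singular point of the branch curve.\<close>

lemma section_avoids_ramification:
  assumes smooth: "smooth_surface a2 a4 a6" and t: "triple a2 a4 a6 p q r"
    and r: "ev r T = 0"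
  shows "ev (tangent_num a2 a4 p q) T \<noteq> 0"
proof
  assume tan: "ev (tangent_num a2 a4 p q) T = 0"
  let ?P = "ev p T" and ?Q = "ev q T" and ?a = "ev a2 T" and ?b = "ev a4 T" and ?c = "ev a6 T"
  let ?P' = "ev (pderiv p) T" and ?Q' = "ev (pderiv q) T"
  let ?a' = "ev (pderiv a2) T" and ?b' = "ev (pderiv a4) T" and ?c' = "ev (pderiv a6) T"
  have eq: "r\<^sup>2 = p ^ 3 + a2 * p\<^sup>2 * q\<^sup>2 + a4 * p * q ^ 4 + a6 * q ^ 6"
    and cop: "coprime p q" using t by (auto simp: triple_def)
  have Q: "?Q \<noteq> 0"
  proof
    assume "?Q = 0"
    then have "?P = 0" using tan by (simp add: tangent_num_def)
    then show False using coprime_no_common_root[OF cop] \<open>?Q = 0\<close> by blast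
  qed
  define X where "X = ?P / ?Q\<^sup>2"
  have P: "?P = X * ?Q\<^sup>2" using Q by (simp add: X_def)
  have "ev (r\<^sup>2) T = 0" using r by simp
  then have "?Q ^ 6 * (X ^ 3 + ?a * X\<^sup>2 + ?b * X + ?c) = 0"
    unfolding eq by (simp add: P power2_eq_square power3_eq_cube eval_nat_numeral algebra_simps)
  then have F: "X ^ 3 + ?a * X\<^sup>2 + ?b * X + ?c = 0" using Q by simp
  have "?Q ^ 4 * (3 * X\<^sup>2 + 2 * ?a * X + ?b) = 0"
    using tan by (simp add: tangent_num_def P eval_nat_numeral algebra_simps)
  then have FX: "3 * X\<^sup>2 + 2 * ?a * X + ?b = 0" using Q by simp
  have "pderiv (r\<^sup>2) = pderiv (p ^ 3 + a2 * p\<^sup>2 * q\<^sup>2 + a4 * p * q ^ 4 + a6 * q ^ 6)" using eq by simp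
  then have "2 * r * pderiv r = 3 * p\<^sup>2 * pderiv p + pderiv a2 * p\<^sup>2 * q\<^sup>2
      + a2 * (2 * p * pderiv p * q\<^sup>2 + 2 * p\<^sup>2 * q * pderiv q)
      + pderiv a4 * p * q ^ 4 + a4 * (pderiv p * q ^ 4 + 4 * p * q ^ 3 * pderiv q)
      + pderiv a6 * q ^ 6 + 6 * a6 * q ^ 5 * pderiv q"
    by (simp add: eval_nat_numeral pderiv_mult pderiv_add algebra_simps)
  then have "ev (2 * r * pderiv r) T = ev (3 * p\<^sup>2 * pderiv p + pderiv a2 * p\<^sup>2 * q\<^sup>2
      + a2 * (2 * p * pderiv p * q\<^sup>2 + 2 * p\<^sup>2 * q * pderiv q)
      + pderiv a4 * p * q ^ 4 + a4 * (pderiv p * q ^ 4 + 4 * p * q ^ 3 * pderiv q)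
      + pderiv a6 * q ^ 6 + 6 * a6 * q ^ 5 * pderiv q) T" by simp
  then have "0 = 3 * ?P\<^sup>2 * ?P' + ?a' * ?P\<^sup>2 * ?Q\<^sup>2
      + ?a * (2 * ?P * ?P' * ?Q\<^sup>2 + 2 * ?P\<^sup>2 * ?Q * ?Q')
      + ?b' * ?P * ?Q ^ 4 + ?b * (?P' * ?Q ^ 4 + 4 * ?P * ?Q ^ 3 * ?Q')
      + ?c' * ?Q ^ 6 + 6 * ?c * ?Q ^ 5 * ?Q'" using r by simp
  \<comment> \<open>Sorted by \<open>p'\<close>, by the T-derivatives of the coefficients and by
    \<open>q'\<close>; the first and the last bracket vanish with the cubic and its
    X-derivative.\<close>
  also have "\<dots> = ?Q ^ 4 * ?P' * (3 * X\<^sup>2 + 2 * ?a * X + ?b)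
      + ?Q ^ 6 * (?a' * X\<^sup>2 + ?b' * X + ?c')
      + ?Q' * ?Q ^ 5 * (6 * (X ^ 3 + ?a * X\<^sup>2 + ?b * X + ?c) - 2 * X * (3 * X\<^sup>2 + 2 * ?a * X + ?b))"
    unfolding P by (simp add: eval_nat_numeral algebra_simps)
  finally have "?a' * X\<^sup>2 + ?b' * X + ?c' = 0" unfolding F FX using Q by simp
  then show False using smooth F FX unfolding smooth_surface_def by blast
qed

text \<open>The doubling formula is already in lowest terms. At a zero of \<open>q\<close> one has
  \<open>r\<^sup>2 = p ^ 3\<close>, and the numerator becomes \<open>p ^ 4\<close>; at a zero of
  \<open>r\<close> it becomes the square of \<open>tangent_num\<close>.\<close>

lemma double_num_coprime:
  assumes smooth: "smooth_surface a2 a4 a6" and t: "triple a2 a4 a6 p q r"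
  shows "coprime (double_num a2 a4 p q r) (2 * r * q)"
proof (rule no_common_root_imp_coprime, rule notI)
  fix T assume D: "ev (double_num a2 a4 p q r) T = 0" and "ev (2 * r * q) T = 0"
  then consider "ev q T = 0" | "ev r T = 0" by auto
  then show False
  proof cases
    case 1
    have "ev (r\<^sup>2) T = ev (p ^ 3 + a2 * p\<^sup>2 * q\<^sup>2 + a4 * p * q ^ 4 + a6 * q ^ 6) T"
      using t by (simp only: triple_def)
    then have r: "(ev r T)\<^sup>2 = ev p T ^ 3" using 1 by simp
    have "ev (double_num a2 a4 p q r) T = 9 * ev p T ^ 4 - 8 * ev p T * (ev r T)\<^sup>2"
      by (simp add: double_num_def tangent_num_def 1 power_mult_distrib flip: power_mult)
    then have "ev p T ^ 4 = 0" unfolding D r by (simp add: eval_nat_numeral)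
    then have "ev p T = 0" by simp
    then show False using coprime_no_common_root[of p q T] t 1 by (auto simp: triple_def)
  next
    case 2
    then have "ev (tangent_num a2 a4 p q) T = 0" using D by (simp add: double_num_def)
    then show False using section_avoids_ramification[OF smooth t 2] by simp
  qed
qed

text \<open>Two fractions in lowest terms represent the same function, so \<open>q\<close> and
  \<open>2 * r' * q'\<close> divide each other.\<close>

lemma double_degrees:
  assumes smooth: "smooth_surface a2 a4 a6"
    and t: "triple a2 a4 a6 p q r" and t': "triple a2 a4 a6 p' q' r'" and r': "r' \<noteq> 0"
    and eq: "4 * r'\<^sup>2 * q'\<^sup>2 * p = q\<^sup>2 * double_num a2 a4 p' q' r'"
  shows "degree q = degree r' + degree q'" and "degree p = degree (double_num a2 a4 p' q' r')"
proof -
  let ?N = "double_num a2 a4 p' q' r'" and ?d = "2 * r' * q'"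
  have q: "q \<noteq> 0" "q' \<noteq> 0" "coprime p q" using t t' by (auto simp: triple_def)
  have eq': "?d\<^sup>2 * p = q\<^sup>2 * ?N" using eq by (simp add: power_mult_distrib)
  have cop: "coprime ?N ?d" by (rule double_num_coprime[OF smooth t'])
  have "q\<^sup>2 dvd ?d\<^sup>2 * p" unfolding eq' by simp
  moreover have "coprime (q\<^sup>2) p" using q(3) by (simp add: coprime_commute)
  ultimately have "q\<^sup>2 dvd ?d\<^sup>2" by (simp add: coprime_dvd_mult_left_iff)
  then have "q dvd ?d" by simp
  have "?d\<^sup>2 dvd q\<^sup>2 * ?N" unfolding eq'[symmetric] by simp
  moreover have "coprime (?d\<^sup>2) ?N" using cop by (simp only: coprime_power_left_iff coprime_commute) simp
  ultimately have "?d\<^sup>2 dvd q\<^sup>2" by (simp add: coprime_dvd_mult_left_iff)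
  then have "?d dvd q" by (simp only: pow_divides_pow_iff)
  have d0: "?d \<noteq> 0" using r' q by simp
  have "degree q = degree ?d"
    using \<open>?d dvd q\<close> \<open>q dvd ?d\<close> d0 q by (simp add: dvd_imp_degree_le antisym)
  also have "?d = smult 2 (r' * q')" by (simp add: numeral_poly)
  finally show *: "degree q = degree r' + degree q'" using r' q by (simp add: degree_mult_eq)
  show "degree p = degree ?N"
  proof (cases "p = 0")
    case True
    then show ?thesis using eq' q by simp
  next
    case False
    then have "?N \<noteq> 0" using eq' d0 by auto
    have "degree (?d\<^sup>2 * p) = degree (q\<^sup>2 * ?N)" using eq' by simp
    then have "2 * degree ?d + degree p = 2 * degree q + degree ?N"
      using d0 q False \<open>?N \<noteq> 0\<close> by (simp add: degree_mult_eq degree_power_eq del: mult_numeral_1)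
    then show ?thesis using \<open>degree q = degree ?d\<close> by simp
  qed
qed

text \<open>A section with \<open>degree q\<close> minimal is halved twice. Minimality forces
  \<open>r1\<close> and \<open>r2\<close> to be constant; by \<open>low\<close>, the double of a
  section with constant \<open>r\<close> has a pole at \<open>T = infinity\<close> so large that
  \<open>high\<close> makes its own \<open>r\<close> non-constant, against the constancy of
  \<open>r1\<close>.\<close>

theorem no_sections:
  assumes smooth: "smooth_surface a2 a4 a6"
    and low: "\<And>p q r. triple a2 a4 a6 p q r \<Longrightarrow> degree r = 0 \<Longrightarrow>
      degree (double_num a2 a4 p q r) = 4 + 8 * degree q"
    and high: "\<And>p q r. triple a2 a4 a6 p q r \<Longrightarrow> degree p \<ge> 2 * degree q + 2 \<Longrightarrow>
      2 * degree r = 3 * degree p"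
    and half: "\<And>p q r. triple a2 a4 a6 p q r \<Longrightarrow> r \<noteq> 0 \<Longrightarrow>
      \<exists>p' q' r'. triple a2 a4 a6 p' q' r' \<and>
        4 * r'\<^sup>2 * q'\<^sup>2 * p = q\<^sup>2 * double_num a2 a4 p' q' r'"
  shows "\<not> triple a2 a4 a6 p q r"
proof
  assume t: "triple a2 a4 a6 p q r"
  \<comment> \<open>\<open>r = 0\<close> belongs to a point of order two. Then
    \<open>double_num\<close> is the square of \<open>tangent_num\<close>, which therefore has
    positive degree and a zero, and there \<open>r\<close> vanishes as well.\<close>
  have nz: "r \<noteq> 0" if t: "triple a2 a4 a6 p q r" for p q r
  proof
    assume r: "r = 0"
    let ?t = "tangent_num a2 a4 p q"
    have "degree (double_num a2 a4 p q r) = 4 + 8 * degree q" using low[OF t] r by simp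
    moreover have "double_num a2 a4 p q r = ?t\<^sup>2" by (simp add: double_num_def r)
    ultimately have "degree ?t > 0" by (metis add_gr_0 degree_0 gr0I power_zero_numeral
          degree_power_eq mult_0_right zero_less_numeral)
    then obtain T where "ev ?t T = 0" using ev_root_exists by blast
    then show False using section_avoids_ramification[OF smooth t] r by simp
  qed
  define S where "S n \<longleftrightarrow> (\<exists>p q r. triple a2 a4 a6 p q r \<and> degree q = n)" for n
  have "S (degree q)" using t by (auto simp: S_def)
  then have least: "S (LEAST n. S n)" by (rule LeastI)
  then obtain p0 q0 r0 where t0: "triple a2 a4 a6 p0 q0 r0" and q0: "degree q0 = (LEAST n. S n)"
    unfolding S_def[of "LEAST n. S n"] by blast
  have min: "degree q0 \<le> degree q" if "triple a2 a4 a6 p q r" for p q r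
    unfolding q0 using that by (intro Least_le) (auto simp: S_def)
  obtain p1 q1 r1 where t1: "triple a2 a4 a6 p1 q1 r1"
    and e1: "4 * r1\<^sup>2 * q1\<^sup>2 * p0 = q0\<^sup>2 * double_num a2 a4 p1 q1 r1"
    using half[OF t0 nz[OF t0]] by blast
  obtain p2 q2 r2 where t2: "triple a2 a4 a6 p2 q2 r2"
    and e2: "4 * r2\<^sup>2 * q2\<^sup>2 * p1 = q1\<^sup>2 * double_num a2 a4 p2 q2 r2"
    using half[OF t1 nz[OF t1]] by blast
  have d1: "degree q0 = degree r1 + degree q1"
    by (rule double_degrees(1)[OF smooth t0 t1 nz[OF t1] e1])
  have d2: "degree q1 = degree r2 + degree q2"
    by (rule double_degrees(1)[OF smooth t1 t2 nz[OF t2] e2])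
  have r: "degree r1 = 0" "degree r2 = 0" using d1 d2 min[OF t1] min[OF t2] by linarith+
  have "degree p1 = degree (double_num a2 a4 p2 q2 r2)"
    by (rule double_degrees(2)[OF smooth t1 t2 nz[OF t2] e2])
  also have "\<dots> = 4 + 8 * degree q2" by (rule low[OF t2 r(2)])
  finally have "degree p1 = 4 + 8 * degree q1" using d2 r by simp
  then show False using high[OF t1] r by simp
qed

section \<open>Points over Q(T) as triples of polynomials\<close>

lemma to_fract_power [simp]: "to_fract (x ^ n) = to_fract x ^ n"
  by (induction n) simp_all

text \<open>The equation makes \<open>e ^ 3\<close> and \<open>s\<^sup>2\<close> associated for the
  reduced denominators \<open>e\<close> of \<open>x\<close> and \<open>s\<close> of
  \<open>y\<close>. Hence \<open>s = e q\<close> with \<open>q\<^sup>2 = e k\<close> for a unit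
  \<open>k\<close>, and \<open>k\<close> is absorbed into the numerators.\<close>

lemma triple_of_point:
  fixes x y :: "rat poly fract"
  assumes "y\<^sup>2 = x ^ 3 + to_fract a2 * x\<^sup>2 + to_fract a4 * x + to_fract a6"
  obtains p q r where "triple a2 a4 a6 p q r"
    "x = to_fract p / to_fract q ^ 2" "y = to_fract r / to_fract q ^ 3"
proof -
  obtain u e where ue: "x = Fract u e" "e \<noteq> 0" "coprime u e"
    using that[of "fst (quot_of_fract x)" "snd (quot_of_fract x)"] by (simp add: coprime_quot_of_fract)
  obtain r s where rs: "y = Fract r s" "s \<noteq> 0" "coprime r s"
    using that[of "fst (quot_of_fract y)" "snd (quot_of_fract y)"] by (simp add: coprime_quot_of_fract)
  have x: "x = to_fract u / to_fract e" and y: "y = to_fract r / to_fract s"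
    using ue rs by (simp_all add: to_fract_def)
  have nz: "to_fract e \<noteq> 0" "to_fract s \<noteq> 0" using ue rs by simp_all
  have "to_fract (r\<^sup>2 * e ^ 3) = to_fract (s\<^sup>2 * (u ^ 3 + e * (a2 * u\<^sup>2 + a4 * u * e + a6 * e\<^sup>2)))"
  proof -
    have U: "to_fract u = x * to_fract e" and R: "to_fract r = y * to_fract s"
      using nz by (simp_all add: x y)
    have "to_fract (r\<^sup>2 * e ^ 3) = y\<^sup>2 * (to_fract s ^ 2 * to_fract e ^ 3)"
      by (simp add: R power_mult_distrib)
    also have "\<dots> = to_fract (s\<^sup>2 * (u ^ 3 + e * (a2 * u\<^sup>2 + a4 * u * e + a6 * e\<^sup>2)))"
      unfolding assms by (simp add: U power2_eq_square power3_eq_cube algebra_simps)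
    finally show ?thesis .
  qed
  then have eq: "r\<^sup>2 * e ^ 3 = s\<^sup>2 * (u ^ 3 + e * (a2 * u\<^sup>2 + a4 * u * e + a6 * e\<^sup>2))"
    by (simp only: to_fract_eq_iff)
  have "coprime (u ^ 3) e" using ue by simp
  then have "coprime (u ^ 3 + e * (a2 * u\<^sup>2 + a4 * u * e + a6 * e\<^sup>2)) e"
    by (metis coprime_iff_gcd_eq_1 gcd.commute gcd_add_mult mult.commute add.commute)
  then have cop: "coprime (e ^ 3) (u ^ 3 + e * (a2 * u\<^sup>2 + a4 * u * e + a6 * e\<^sup>2))"
    by (simp add: coprime_commute)
  have "e ^ 3 dvd s\<^sup>2 * (u ^ 3 + e * (a2 * u\<^sup>2 + a4 * u * e + a6 * e\<^sup>2))" unfolding eq[symmetric] by simp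
  then have 1: "e ^ 3 dvd s\<^sup>2" using cop coprime_dvd_mult_left_iff by blast
  have "s\<^sup>2 dvd r\<^sup>2 * e ^ 3" unfolding eq by simp
  moreover have "coprime (s\<^sup>2) (r\<^sup>2)" using rs(3) by (simp add: coprime_commute)
  ultimately have 2: "s\<^sup>2 dvd e ^ 3" using coprime_dvd_mult_right_iff by blast
  have "e\<^sup>2 dvd e ^ 3" by (rule le_imp_power_dvd) simp
  then have "e\<^sup>2 dvd s\<^sup>2" using 1 dvd_trans by blast
  then have "e dvd s" by simp
  then obtain q where q: "s = e * q" by blast
  obtain k where k: "s\<^sup>2 = e ^ 3 * k" using 1 by blast
  obtain l where l: "e ^ 3 = s\<^sup>2 * l" using 2 by blast
  have "e ^ 3 * (k * l) = e ^ 3 * 1" using k l by (metis mult.assoc mult.right_neutral)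
  then have kl: "k * l = 1" using ue(2) by (metis mult_left_cancel power_not_zero)
  have q2: "q\<^sup>2 = e * k"
  proof -
    have "e\<^sup>2 * q\<^sup>2 = e\<^sup>2 * (e * k)" using k unfolding q by (simp add: eval_nat_numeral algebra_simps)
    then show ?thesis using ue(2) by simp
  qed
  have q0: "q \<noteq> 0" and k0: "k \<noteq> 0" using rs(2) q kl by auto
  have "coprime (k * u) q"
  proof -
    have "coprime u (e * k)" using ue(3) kl by (metis coprime_mult_right_iff dvd_triv_left is_unit_right_imp_coprime)
    moreover have "coprime k (q\<^sup>2)" using kl by (metis dvd_triv_left is_unit_left_imp_coprime)
    ultimately show ?thesis unfolding q2[symmetric] by simp
  qed
  have nzk: "to_fract k \<noteq> 0" "to_fract q \<noteq> 0" using k0 q0 by simp_all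
  have tq: "to_fract q ^ 2 = to_fract e * to_fract k" by (metis q2 to_fract_power to_fract_mult)
  have x': "x = to_fract (k * u) / to_fract q ^ 2"
    using nz nzk unfolding tq x by simp
  have "to_fract q ^ 3 = to_fract e * to_fract k * to_fract q" using tq by (simp add: eval_nat_numeral)
  then have y': "y = to_fract (k * r) / to_fract q ^ 3"
    using nz nzk unfolding y q by simp
  have "to_fract ((k * r)\<^sup>2) = to_fract ((k * u) ^ 3 + a2 * (k * u)\<^sup>2 * q\<^sup>2 + a4 * (k * u) * q ^ 4 + a6 * q ^ 6)"
  proof -
    have U: "to_fract (k * u) = x * to_fract q ^ 2" and R: "to_fract (k * r) = y * to_fract q ^ 3"
      using nzk by (simp_all add: x' y')
    have "to_fract ((k * r)\<^sup>2) = y\<^sup>2 * to_fract q ^ 6"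
      unfolding to_fract_power R by (simp add: power_mult_distrib flip: power_mult)
    also have "\<dots> = to_fract ((k * u) ^ 3 + a2 * (k * u)\<^sup>2 * q\<^sup>2 + a4 * (k * u) * q ^ 4 + a6 * q ^ 6)"
      unfolding assms to_fract_add to_fract_mult[of _ "q ^ n" for n] to_fract_mult[of a2] to_fract_mult[of a4]
        to_fract_mult[of a6] to_fract_power U
      by (simp add: eval_nat_numeral algebra_simps)
    finally show ?thesis .
  qed
  then have "(k * r)\<^sup>2 = (k * u) ^ 3 + a2 * (k * u)\<^sup>2 * q\<^sup>2 + a4 * (k * u) * q ^ 4 + a6 * q ^ 6"
    by (simp only: to_fract_eq_iff)
  then have "triple a2 a4 a6 (k * u) q (k * r)"
    using \<open>coprime (k * u) q\<close> q0 by (simp add: triple_def)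
  then show ?thesis using x' y' that by blast
qed

section \<open>Square classes in Q[X] and in a quadratic order\<close>

text \<open>After division by the gcd, the square of what is left of \<open>d\<close> divides the
  irreducible \<open>D\<close> and must be a unit.\<close>

lemma square_dvd_irreducible_mult_square:
  fixes D d b :: "rat poly"
  assumes D: "irreducible D" and d: "d \<noteq> 0" and dvd: "d\<^sup>2 dvd D * b\<^sup>2"
  shows "d dvd b"
proof -
  define g where "g = gcd d b"
  have g0: "g \<noteq> 0" using d by (simp add: g_def)
  obtain d' b' where db: "d = d' * g" "b = b' * g" "coprime d' b'"
    using gcd_coprime_exists[of d b] g0 unfolding g_def by blast
  have "g\<^sup>2 * d'\<^sup>2 dvd g\<^sup>2 * (D * b'\<^sup>2)" using dvd unfolding db by (simp add: power_mult_distrib mult_ac)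
  then have "d'\<^sup>2 dvd D * b'\<^sup>2" using g0 by simp
  moreover have "coprime (d'\<^sup>2) (b'\<^sup>2)" using db(3) by simp
  ultimately have "d'\<^sup>2 dvd D" by (simp add: coprime_dvd_mult_left_iff)
  then obtain m where "D = d' * (d' * m)" by (auto simp: power2_eq_square mult.assoc dvd_def)
  then have "is_unit d' \<or> is_unit (d' * m)" by (rule irreducibleD[OF D])
  then have "is_unit d'" by (auto simp: is_unit_mult_iff)
  then have "d' dvd b'" by (rule unit_imp_dvd)
  then show ?thesis unfolding db by (rule mult_dvd_mono) (rule dvd_refl)
qed

lemma squarefree_decomposition:
  fixes e :: "rat poly"
  assumes "e \<noteq> 0"
  obtains eps E where "e = eps * E\<^sup>2" "\<And>\<pi>. irreducible \<pi> \<Longrightarrow> \<not> \<pi>\<^sup>2 dvd eps"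
proof -
  define S where "S n \<longleftrightarrow> (\<exists>eps E. e = eps * E\<^sup>2 \<and> degree eps = n)" for n
  have "e = e * 1\<^sup>2" by simp
  then have "S (degree e)" unfolding S_def by blast
  then have "S (LEAST n. S n)" by (rule LeastI)
  then obtain eps E where eps: "e = eps * E\<^sup>2" "degree eps = (LEAST n. S n)"
    unfolding S_def[of "LEAST n. S n"] by blast
  have "\<not> \<pi>\<^sup>2 dvd eps" if \<pi>: "irreducible \<pi>" for \<pi>
  proof
    assume "\<pi>\<^sup>2 dvd eps"
    then obtain m where m: "eps = \<pi>\<^sup>2 * m" by blast
    have m0: "m \<noteq> 0" "\<pi> \<noteq> 0" using assms eps(1) m \<pi> by auto
    have "degree \<pi> > 0" using \<pi> m0(2) by (metis gr0I irreducible_not_unit is_unit_iff_degree)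
    moreover have "degree eps = 2 * degree \<pi> + degree m"
      unfolding m using m0 by (simp add: degree_mult_eq degree_power_eq)
    moreover have "e = m * (\<pi> * E)\<^sup>2" using eps(1) m by (simp add: power_mult_distrib mult_ac)
    then have "S (degree m)" unfolding S_def by blast
    then have "(LEAST n. S n) \<le> degree m" by (rule Least_le)
    ultimately show False using eps(2) by simp
  qed
  then show ?thesis using eps(1) that by blast
qed

text \<open>For \<open>f = u + v W\<close> with \<open>W\<^sup>2 = D\<close> the hypotheses say that
  \<open>E\<^sup>2\<close> divides \<open>f\<^sup>2\<close>, and the conclusion that
  \<open>E\<close> divides \<open>f\<close>: the order is integrally closed. The norm of
  \<open>f\<^sup>2\<close> is the square of \<open>u\<^sup>2 - D v\<^sup>2\<close>, and this allows
  \<open>u\<^sup>2\<close> and \<open>D v\<^sup>2\<close> to be separated.\<close>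

lemma square_dvd_pair_square:
  fixes D E u v :: "rat poly"
  assumes D: "irreducible D" and E: "E \<noteq> 0" and dvd: "E\<^sup>2 dvd u\<^sup>2 + D * v\<^sup>2" "E\<^sup>2 dvd 2 * u * v"
  shows "E dvd u" "E dvd v"
proof -
  have "(u\<^sup>2 - D * v\<^sup>2)\<^sup>2 = (u\<^sup>2 + D * v\<^sup>2)\<^sup>2 - D * (2 * u * v)\<^sup>2"
    by (simp add: power2_eq_square algebra_simps)
  moreover have "(E\<^sup>2)\<^sup>2 dvd (u\<^sup>2 + D * v\<^sup>2)\<^sup>2 - D * (2 * u * v)\<^sup>2"
    using dvd_diff[OF dvd_power_same[OF dvd(1)] dvd_mult[OF dvd_power_same[OF dvd(2)]]] .
  ultimately have "E\<^sup>2 dvd u\<^sup>2 - D * v\<^sup>2" by (metis pow_divides_pow_iff zero_less_numeral)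
  with dvd(1) have "E\<^sup>2 dvd (u\<^sup>2 + D * v\<^sup>2) + (u\<^sup>2 - D * v\<^sup>2)" "E\<^sup>2 dvd (u\<^sup>2 + D * v\<^sup>2) - (u\<^sup>2 - D * v\<^sup>2)"
    by (blast intro: dvd_add dvd_diff)+
  then have "E\<^sup>2 dvd smult 2 (u\<^sup>2)" "E\<^sup>2 dvd smult 2 (D * v\<^sup>2)" by (simp_all add: numeral_poly algebra_simps)
  then have "E\<^sup>2 dvd u\<^sup>2" "E\<^sup>2 dvd D * v\<^sup>2" by (simp_all add: dvd_smult_iff)
  then show "E dvd u" "E dvd v" using square_dvd_irreducible_mult_square[OF D E] by simp_all
qed

text \<open>A prime that does not divide \<open>D\<close> is unramified in the order, so it divides
  \<open>u + v W\<close> as soon as it divides the square of this element.\<close>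

lemma irreducible_dvd_pair_square:
  fixes D \<pi> u v :: "rat poly"
  assumes \<pi>: "irreducible \<pi>" "\<not> \<pi> dvd D" and dvd: "\<pi> dvd u\<^sup>2 + D * v\<^sup>2" "\<pi> dvd 2 * u * v"
  shows "\<pi> dvd u" "\<pi> dvd v"
proof -
  have pr: "prime_elem \<pi>" using \<pi>(1) by (simp add: irreducible_imp_prime_elem)
  have "\<pi> dvd smult 2 (u * v)" using dvd(2) by (simp add: numeral_poly)
  then have "\<pi> dvd u * v" by (simp add: dvd_smult_iff)
  then consider "\<pi> dvd u" | "\<pi> dvd v" using pr prime_elem_dvd_mult_iff by blast
  then have "\<pi> dvd u \<and> \<pi> dvd v"
  proof cases
    case 1
    then have "\<pi> dvd D * v\<^sup>2" using dvd(1) by (simp add: dvd_add_right_iff dvd_power_same power2_eq_square)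
    then show ?thesis using 1 \<pi>(2) pr by (auto simp: prime_elem_dvd_mult_iff power2_eq_square)
  next
    case 2
    then have "\<pi> dvd u\<^sup>2" using dvd(1) by (simp add: dvd_add_left_iff power2_eq_square)
    then show ?thesis using 2 pr by (auto simp: prime_elem_dvd_mult_iff power2_eq_square)
  qed
  then show "\<pi> dvd u" "\<pi> dvd v" by blast+
qed

lemma degree_one_irreducible:
  fixes A :: "rat poly"
  assumes "degree A = 1"
  shows "irreducible A"
proof -
  have "A = [:coeff A 0, coeff A 1:]"
    using assms by (auto simp: poly_eq_iff coeff_pCons coeff_eq_0 split: nat.splits)
  moreover have "coeff A 1 \<noteq> 0" using assms by (metis leading_coeff_0_iff degree_0 zero_neq_one)
  ultimately show ?thesis by (metis irreducible_linear_field_poly)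
qed

lemma only_root_of_linear:
  fixes A w :: "rat poly"
  assumes A: "A \<noteq> 0" "degree A \<le> 1" and w: "w \<noteq> 0" and roots: "\<And>x. ev w x = 0 \<Longrightarrow> ev A x = 0"
  obtains c j where "c \<noteq> 0" "w = smult c (A ^ j)" "degree A = 0 \<longrightarrow> j = 0"
proof (cases "degree A = 0")
  case True
  have "degree w = 0"
  proof (rule ccontr)
    assume "degree w \<noteq> 0"
    then obtain x where "ev w x = 0" using ev_root_exists by blast
    then have "ev A x = 0" by (rule roots)
    moreover obtain a where "A = [:a:]" using True by (metis degree_eq_zeroE)
    ultimately show False using A by simp
  qed
  then obtain c where "w = [:c:]" by (metis degree_eq_zeroE)
  then show ?thesis using that[of c 0] w by simp
next
  case False
  then have A1: "degree A = 1" using A by simp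
  have irr: "irreducible A" using A1 by (intro degree_one_irreducible) simp
  obtain j w' where w': "w = A ^ j * w'" "\<not> A dvd w'"
    using multiplicity_decompose'[of w A] w irr by (metis irreducible_not_unit)
  have "degree w' = 0"
  proof (rule ccontr)
    assume "degree w' \<noteq> 0"
    then obtain x where x: "ev w' x = 0" using ev_root_exists by blast
    then have "ev A x = 0" by (intro roots) (simp add: w')
    then show False using irreducible_dvd_of_common_root[OF irr _ x] w' by blast
  qed
  then obtain c where "w' = [:c:]" by (metis degree_eq_zeroE)
  then show ?thesis using that[of c j] w w' False by (auto simp: mult.commute)
qed

text \<open>Descent on the quadratic order \<open>Q[X][W]\<close> with \<open>W\<^sup>2 = D\<close>: the pairs \<open>(U, V)\<close>, \<open>(U2, V2)\<close>,
  \<open>(\<rho>, \<sigma>)\<close> stand for elements \<open>f\<^sub>1\<close>, \<open>f\<^sub>2\<close>, \<open>r\<close> with \<open>f\<^sub>1 f\<^sub>2 = r\<^sup>2\<close> that have no common zero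
  away from the zero of \<open>A\<close>. Then the norm of \<open>f\<^sub>1\<close> is a square \<open>G\<^sup>2\<close> and
  \<open>(f\<^sub>1 + G)\<^sup>2 = 2 (U + G) f\<^sub>1\<close>, so that \<open>f\<^sub>1\<close> is a square up to the factor \<open>2 (U + G)\<close> in \<open>Q[X]\<close>,
  which can only ramify at \<open>D\<close> and \<open>A\<close>.\<close>

lemma quadratic_order_descent:
  fixes A D U V U2 V2 \<rho> \<sigma> :: "rat poly"
  assumes D: "irreducible D" and A: "A \<noteq> 0" "degree A \<le> 1"
    and prod1: "U * U2 + D * V * V2 = \<rho>\<^sup>2 + D * \<sigma>\<^sup>2"
    and prod2: "U * V2 + V * U2 = 2 * \<rho> * \<sigma>"
    and nocommon: "\<And>x w. w\<^sup>2 = ev D x \<Longrightarrow> ev A x \<noteq> 0 \<Longrightarrow>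
      ev U x + ev V x * w = 0 \<Longrightarrow> ev U2 x + ev V2 x * w \<noteq> 0"
    and N1: "N1 = U\<^sup>2 - D * V\<^sup>2" "N1 \<noteq> 0" "even (degree N1)" "lead_coeff N1 = s\<^sup>2"
  shows "\<exists>c i u v. c \<noteq> 0 \<and> i \<le> 1 \<and> (degree A = 0 \<longrightarrow> i = 0) \<and>
    smult c (A ^ i) * U = u\<^sup>2 + D * v\<^sup>2 \<and> smult c (A ^ i) * V = 2 * u * v"
proof -
  define N2 where "N2 = U2\<^sup>2 - D * V2\<^sup>2"
  define Nr where "Nr = \<rho>\<^sup>2 - D * \<sigma>\<^sup>2"
  \<comment> \<open>\<open>a + b W\<close> is the product of \<open>f\<^sub>1\<close> with the
    conjugate of \<open>r\<close>; its norm is \<open>N1 * Nr\<close>.\<close>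
  define a where "a = U * \<rho> - D * V * \<sigma>"
  define b where "b = V * \<rho> - U * \<sigma>"
  \<comment> \<open>\<open>d\<close> is the candidate for a square root of \<open>N1\<close>: the
    quotient \<open>w\<close> of \<open>d\<^sup>2\<close> by \<open>N1\<close> will turn out to have
    zeros only at the zero of \<open>A\<close>.\<close>
  define d where "d = gcd N1 (gcd Nr a)"
  have d0: "d \<noteq> 0" using N1(2) by (simp add: d_def)
  have P1: "(\<rho>\<^sup>2 + D * \<sigma>\<^sup>2) * U - 2 * \<rho> * \<sigma> * D * V = N1 * U2"
    unfolding prod1[symmetric] prod2[symmetric] N1 by (simp add: power2_eq_square algebra_simps)
  have P2: "(\<rho>\<^sup>2 + D * \<sigma>\<^sup>2) * V - 2 * \<rho> * \<sigma> * U = - (N1 * V2)"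
    unfolding prod1[symmetric] prod2[symmetric] N1 by (simp add: power2_eq_square algebra_simps)
  have "(U * U2 + D * V * V2)\<^sup>2 - D * (U * V2 + V * U2)\<^sup>2 = N1 * N2"
    unfolding N1 N2_def by (simp add: power2_eq_square algebra_simps)
  then have NN: "N1 * N2 = Nr\<^sup>2"
    unfolding prod1 prod2 Nr_def by (simp add: power2_eq_square algebra_simps)
  have ab: "a\<^sup>2 - D * b\<^sup>2 = N1 * Nr"
    unfolding a_def b_def N1 Nr_def by (simp add: power2_eq_square algebra_simps)
  have Nra: "Nr * a = N1 * (U2 * \<rho> - D * V2 * \<sigma>)"
  proof -
    have "N1 * (U2 * \<rho> - D * V2 * \<sigma>) = (N1 * U2) * \<rho> + D * \<sigma> * (- (N1 * V2))" by (simp add: algebra_simps)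
    also have "\<dots> = Nr * a" unfolding P1[symmetric] P2[symmetric] Nr_def a_def
      by (simp add: power2_eq_square algebra_simps)
    finally show ?thesis ..
  qed
  have UU: "N1 * (U * U2 - D * V * V2) = a\<^sup>2 + D * b\<^sup>2"
  proof -
    have "N1 * (U * U2 - D * V * V2) = U * (N1 * U2) + D * V * (- (N1 * V2))" by (simp add: algebra_simps)
    also have "\<dots> = a\<^sup>2 + D * b\<^sup>2" unfolding P1[symmetric] P2[symmetric] a_def b_def
      by (simp add: power2_eq_square algebra_simps)
    finally show ?thesis .
  qed
  have VU: "N1 * (V * U2 - U * V2) = 2 * a * b"
  proof -
    have "N1 * (V * U2 - U * V2) = V * (N1 * U2) + U * (- (N1 * V2))" by (simp add: algebra_simps)
    also have "\<dots> = 2 * a * b" unfolding P1[symmetric] P2[symmetric] a_def b_def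
      by (simp add: power2_eq_square algebra_simps)
    finally show ?thesis .
  qed
  have "d dvd N1" "d dvd Nr" "d dvd a" unfolding d_def by (meson gcd_dvd1 gcd_dvd2 dvd_trans)+
  then have "d\<^sup>2 dvd a\<^sup>2 - N1 * Nr" by (intro dvd_diff) (simp_all add: power2_eq_square mult_dvd_mono)
  then have "d\<^sup>2 dvd D * b\<^sup>2" using ab by (simp add: algebra_simps)
  then have "d dvd b" by (rule square_dvd_irreducible_mult_square[OF D d0])
  then obtain n1 n2 a' b' where n: "N1 = d * n1" "Nr = d * n2" "a = d * a'" "b = d * b'"
    using \<open>d dvd N1\<close> \<open>d dvd Nr\<close> \<open>d dvd a\<close> by (metis dvdE)
  have "N1 dvd d\<^sup>2"
  proof -
    obtain p1 p2 where p: "d = p1 * N1 + p2 * gcd Nr a"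
      using bezout_coefficients_fst_snd[of N1 "gcd Nr a"] unfolding d_def by metis
    obtain p3 p4 where p': "gcd Nr a = p3 * Nr + p4 * a"
      using bezout_coefficients_fst_snd[of Nr a] by metis
    have N1_1: "N1 dvd Nr * a" unfolding Nra by simp
    have N1_2: "N1 dvd Nr\<^sup>2" unfolding NN[symmetric] by simp
    have "2 * a\<^sup>2 = N1 * (U * U2 - D * V * V2) + N1 * Nr"
      unfolding UU ab[symmetric] by simp
    then have "N1 dvd smult 2 (a\<^sup>2)" by (simp add: numeral_poly)
    then have "N1 dvd a\<^sup>2" by (simp add: dvd_smult_iff)
    then have *: "N1 dvd p2\<^sup>2 * (p3\<^sup>2 * Nr\<^sup>2 + 2 * p3 * p4 * (Nr * a) + p4\<^sup>2 * a\<^sup>2)"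
      by (intro dvd_mult[OF dvd_add[OF dvd_add[OF dvd_mult[OF N1_2] dvd_mult[OF N1_1]] dvd_mult]])
    have "d\<^sup>2 = N1 * (p1\<^sup>2 * N1 + 2 * p1 * p2 * (p3 * Nr + p4 * a))
        + p2\<^sup>2 * (p3\<^sup>2 * Nr\<^sup>2 + 2 * p3 * p4 * (Nr * a) + p4\<^sup>2 * a\<^sup>2)"
      unfolding p p' by (simp add: power2_eq_square algebra_simps)
    then show ?thesis using * by simp
  qed
  then obtain w where w: "d\<^sup>2 = N1 * w" by blast
  have w0: "w \<noteq> 0" using w d0 by auto
  have dn: "d = n1 * w" using w d0 unfolding n(1) by (simp add: power2_eq_square)
  have N1w: "N1 = n1\<^sup>2 * w" using n(1) dn by (simp add: power2_eq_square mult_ac)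
  have N2w: "N2 = w * n2\<^sup>2"
  proof -
    have "N1 * N2 = N1 * (w * n2\<^sup>2)" unfolding NN n(2) using w by (simp add: power_mult_distrib mult_ac)
    then show ?thesis using N1(2) by simp
  qed
  have UUw: "U * U2 - D * V * V2 = w * (a'\<^sup>2 + D * b'\<^sup>2)"
  proof -
    have "N1 * (U * U2 - D * V * V2) = d\<^sup>2 * (a'\<^sup>2 + D * b'\<^sup>2)"
      unfolding UU n(3,4) by (simp add: power_mult_distrib algebra_simps)
    then show ?thesis using N1(2) w by (simp add: mult.assoc)
  qed
  have VUw: "V * U2 - U * V2 = w * (2 * a' * b')"
  proof -
    have "N1 * (V * U2 - U * V2) = d\<^sup>2 * (2 * a' * b')"
      unfolding VU n(3,4) by (simp add: power2_eq_square algebra_simps)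
    then show ?thesis using N1(2) w by (simp add: mult.assoc)
  qed
  \<comment> \<open>At a zero of \<open>w\<close> the norms of \<open>f\<^sub>1\<close> and
    \<open>f\<^sub>2\<close> vanish and so do both mixed products with a conjugate. In every case
    this makes \<open>f\<^sub>1\<close> and \<open>f\<^sub>2\<close> vanish at the same point above
    \<open>x\<close>.\<close>
  have wroots: "ev A x = 0" if "ev w x = 0" for x
  proof (rule ccontr)
    assume Ax: "ev A x \<noteq> 0"
    define t where "t = csqrt (ev D x)"
    have t: "t\<^sup>2 = ev D x" "(- t)\<^sup>2 = ev D x" by (simp_all add: t_def)
    define f where "f y = ev U x + ev V x * y" for y
    define g where "g y = ev U2 x + ev V2 x * y" for y
    have "f t * f (- t) = ev N1 x" unfolding N1 f_def by (simp add: t(1)[symmetric] power2_eq_square algebra_simps)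
    then have 1: "f t * f (- t) = 0" using that by (simp add: N1w)
    have "g t * g (- t) = ev N2 x" unfolding N2_def g_def by (simp add: t(1)[symmetric] power2_eq_square algebra_simps)
    then have 2: "g t * g (- t) = 0" using that by (simp add: N2w)
    have *: "ev (U * U2 - D * V * V2) x = 0" "ev (V * U2 - U * V2) x = 0"
      unfolding UUw VUw using that by simp_all
    have "f t * g (- t) = ev (U * U2 - D * V * V2) x + ev (V * U2 - U * V2) x * t"
      unfolding f_def g_def by (simp add: t(1)[symmetric] power2_eq_square algebra_simps)
    then have 3: "f t * g (- t) = 0" using * by simp
    have "f (- t) * g t = ev (U * U2 - D * V * V2) x - ev (V * U2 - U * V2) x * t"
      unfolding f_def g_def by (simp add: t(1)[symmetric] power2_eq_square algebra_simps)
    then have 4: "f (- t) * g t = 0" using * by simp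
    have "f t = 0 \<Longrightarrow> g t \<noteq> 0" "f (- t) = 0 \<Longrightarrow> g (- t) \<noteq> 0"
      unfolding f_def g_def using nocommon t Ax by blast+
    then show False using 1 2 3 4 by auto
  qed
  obtain c j where cj: "c \<noteq> 0" "w = smult c (A ^ j)" "degree A = 0 \<longrightarrow> j = 0"
    using only_root_of_linear[OF A w0 wroots] by blast
  have "even j"
  proof (cases "degree A = 0")
    case False
    then have "degree A = 1" using A by simp
    have "degree (d\<^sup>2) = degree (N1 * w)" using w by simp
    then have "2 * degree d = degree N1 + j"
      using d0 N1(2) w0 cj A \<open>degree A = 1\<close> by (simp add: degree_mult_eq degree_power_eq)
    then show ?thesis using N1(3) by presburger
  qed (use cj in simp)
  then obtain k where k: "j = 2 * k" by blast
  have "(A ^ k)\<^sup>2 dvd d\<^sup>2" unfolding w cj(2) k by (simp add: power_mult mult.commute dvd_smult)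
  then have "A ^ k dvd d" by simp
  then obtain G0 where G0: "d = A ^ k * G0" by blast
  have "(A ^ k)\<^sup>2 * G0\<^sup>2 = (A ^ k)\<^sup>2 * smult c N1"
    using w unfolding cj(2) k G0 by (simp add: power_mult_distrib mult_ac flip: power_mult)
  then have G0sq: "G0\<^sup>2 = smult c N1" using A(1) by (metis mult_left_cancel power_not_zero)
  define l where "l = lead_coeff G0"
  have "lead_coeff (G0\<^sup>2) = c * s\<^sup>2" unfolding G0sq using N1(4) by simp
  then have ls: "l\<^sup>2 = c * s\<^sup>2" by (simp add: l_def lead_coeff_power)
  have s0: "s \<noteq> 0" using N1(2,4) by auto
  have l0: "l \<noteq> 0" using ls cj(1) s0 by auto
  define G1 where "G1 = smult (s / l) G0"
  have G1sq: "G1\<^sup>2 = N1"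
  proof -
    have "G1\<^sup>2 = smult ((s / l)\<^sup>2 * c) N1" unfolding G1_def by (simp add: smult_power G0sq)
    also have "(s / l)\<^sup>2 * c = 1" using ls l0 s0 cj(1) by (simp add: power_divide)
    finally show ?thesis by simp
  qed
  \<comment> \<open>The sign of the square root is chosen so that \<open>U + G\<close>, half of the
    factor \<open>e0\<close> below, is non-zero.\<close>
  obtain G where G: "G\<^sup>2 = N1" "G dvd d" "U + G \<noteq> 0"
  proof (cases "U + G1 = 0")
    case False
    moreover have "G1 dvd d" unfolding G1_def G0 using s0 l0 by (simp add: smult_dvd_iff)
    ultimately show ?thesis using that G1sq by blast
  next
    case True
    then have G1U: "G1 = - U" by (simp add: add_eq_0_iff2)
    have "U \<noteq> 0"
    proof
      assume "U = 0"
      then have "N1 = 0" using G1sq G1U by simp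
      then show False using N1(2) by blast
    qed
    moreover have "U + - G1 = 2 * U" by (simp add: G1U)
    moreover have "- G1 dvd d" unfolding G1_def G0 using s0 l0 by (simp add: smult_dvd_iff)
    ultimately show ?thesis using that[of "- G1"] G1sq by (metis mult_eq_0_iff power2_minus zero_neq_numeral)
  qed
  define e0 where "e0 = 2 * (U + G)"
  have e00: "e0 \<noteq> 0" using G(3) by (simp add: e0_def)
  have GD: "U\<^sup>2 = G\<^sup>2 + D * V\<^sup>2" using G(1) N1(1) by simp
  have h1: "e0 * U = (U + G)\<^sup>2 + D * V\<^sup>2" "e0 * V = 2 * (U + G) * V"
    using GD unfolding e0_def by (simp_all add: power2_eq_square algebra_simps)
  have G0': "G \<noteq> 0" using G(1) N1(2) by auto
  obtain a1 b1 where a1: "a = G * a1" "b = G * b1"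
    using G(2) \<open>d dvd a\<close> \<open>d dvd b\<close> by (metis dvdE dvd_trans)
  \<comment> \<open>Since \<open>a1 - b1 W\<close> is \<open>conj(f\<^sub>1) r / G\<close>, the
    right-hand sides are the components of \<open>(r + conj(f\<^sub>1) r / G)\<^sup>2\<close>, which
    equals \<open>e0 f\<^sub>2\<close>. So the same factor makes \<open>f\<^sub>2\<close> a square,
    too.\<close>
  have h2: "e0 * U2 = (\<rho> + a1)\<^sup>2 + D * (\<sigma> - b1)\<^sup>2" "e0 * V2 = 2 * (\<rho> + a1) * (\<sigma> - b1)"
  proof -
    have ga: "G * (\<rho> + a1) = G * \<rho> + a" "G * (\<sigma> - b1) = G * \<sigma> - b"
      using a1 by (simp_all add: algebra_simps)
    have U2G: "G\<^sup>2 * U2 = (\<rho>\<^sup>2 + D * \<sigma>\<^sup>2) * U - 2 * \<rho> * \<sigma> * D * V" using P1 G(1) by simp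
    have V2G: "G\<^sup>2 * V2 = 2 * \<rho> * \<sigma> * U - (\<rho>\<^sup>2 + D * \<sigma>\<^sup>2) * V" using P2 G(1) by (simp add: algebra_simps)
    have "G\<^sup>2 * (e0 * U2) = e0 * (G\<^sup>2 * U2)" by simp
    also have "\<dots> = 2 * (U\<^sup>2 * (\<rho>\<^sup>2 + D * \<sigma>\<^sup>2)) + 2 * (G * (\<rho>\<^sup>2 + D * \<sigma>\<^sup>2) * U) - 4 * (\<rho> * \<sigma> * D * V * (U + G))"
      unfolding U2G e0_def by (simp add: power2_eq_square algebra_simps)
    also have "\<dots> = (G\<^sup>2 + D * V\<^sup>2 + U\<^sup>2) * (\<rho>\<^sup>2 + D * \<sigma>\<^sup>2) + 2 * (G * (\<rho>\<^sup>2 + D * \<sigma>\<^sup>2) * U) - 4 * (\<rho> * \<sigma> * D * V * (U + G))"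
      unfolding GD by (simp add: algebra_simps)
    also have "\<dots> = (G * \<rho> + a)\<^sup>2 + D * (G * \<sigma> - b)\<^sup>2"
      unfolding a_def b_def by (simp add: power2_eq_square algebra_simps)
    also have "\<dots> = G\<^sup>2 * ((\<rho> + a1)\<^sup>2 + D * (\<sigma> - b1)\<^sup>2)"
      unfolding ga[symmetric] by (simp add: power2_eq_square algebra_simps)
    finally show "e0 * U2 = (\<rho> + a1)\<^sup>2 + D * (\<sigma> - b1)\<^sup>2" using G0' by simp
    have "G\<^sup>2 * (e0 * V2) = e0 * (G\<^sup>2 * V2)" by simp
    also have "\<dots> = 4 * (\<rho> * \<sigma> * U\<^sup>2) - 2 * (\<rho>\<^sup>2 + D * \<sigma>\<^sup>2) * U * V + 4 * G * \<rho> * \<sigma> * U - 2 * G * V * (\<rho>\<^sup>2 + D * \<sigma>\<^sup>2)"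
      unfolding V2G e0_def by (simp add: power2_eq_square algebra_simps)
    also have "\<dots> = 2 * (\<rho> * \<sigma> * (G\<^sup>2 + D * V\<^sup>2 + U\<^sup>2)) - 2 * (\<rho>\<^sup>2 + D * \<sigma>\<^sup>2) * U * V + 4 * G * \<rho> * \<sigma> * U - 2 * G * V * (\<rho>\<^sup>2 + D * \<sigma>\<^sup>2)"
      unfolding GD by (simp add: algebra_simps)
    also have "\<dots> = 2 * (G * \<rho> + a) * (G * \<sigma> - b)"
      unfolding a_def b_def by (simp add: power2_eq_square algebra_simps)
    also have "\<dots> = G\<^sup>2 * (2 * (\<rho> + a1) * (\<sigma> - b1))"
      unfolding ga[symmetric] by (simp add: power2_eq_square algebra_simps)
    finally show "e0 * V2 = 2 * (\<rho> + a1) * (\<sigma> - b1)" using G0' by simp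
  qed
  obtain eps E where eps: "e0 = eps * E\<^sup>2" "\<And>\<pi>. irreducible \<pi> \<Longrightarrow> \<not> \<pi>\<^sup>2 dvd eps"
    using squarefree_decomposition[OF e00] by blast
  have E0: "E \<noteq> 0" "eps \<noteq> 0" using eps(1) e00 by auto
  have reduce: "\<exists>k l. eps * u = k\<^sup>2 + D * l\<^sup>2 \<and> eps * v = 2 * k * l"
    if e: "e0 * u = x\<^sup>2 + D * y\<^sup>2" "e0 * v = 2 * x * y" for u v x y
  proof -
    have "E\<^sup>2 dvd x\<^sup>2 + D * y\<^sup>2" "E\<^sup>2 dvd 2 * x * y"
      unfolding e[symmetric] eps(1) by simp_all
    then have "E dvd x" "E dvd y" using square_dvd_pair_square[OF D E0(1)] by blast+
    then obtain k l where kl: "x = E * k" "y = E * l" by (metis dvdE)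
    have "E\<^sup>2 * (eps * u) = E\<^sup>2 * (k\<^sup>2 + D * l\<^sup>2)" "E\<^sup>2 * (eps * v) = E\<^sup>2 * (2 * k * l)"
      using e unfolding eps(1) kl by (simp_all add: power2_eq_square algebra_simps)
    then show ?thesis using E0 by auto
  qed
  obtain x1 y1 where xy1: "eps * U = x1\<^sup>2 + D * y1\<^sup>2" "eps * V = 2 * x1 * y1" using reduce[OF h1] by blast
  obtain x2 y2 where xy2: "eps * U2 = x2\<^sup>2 + D * y2\<^sup>2" "eps * V2 = 2 * x2 * y2" using reduce[OF h2] by blast
  \<comment> \<open>Any other prime would divide both \<open>f\<^sub>1\<close> and
    \<open>f\<^sub>2\<close>, which have no common zero there; hence the second factor had to be
    carried along.\<close>
  have factor: "\<pi> dvd D \<or> (degree A = 1 \<and> \<pi> dvd A)" if \<pi>: "irreducible \<pi>" "\<pi> dvd eps" for \<pi>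
  proof (rule ccontr)
    assume not: "\<not> ?thesis"
    obtain m where m: "eps = \<pi> * m" using \<pi>(2) by blast
    have pm: "\<not> \<pi> dvd m"
    proof
      assume "\<pi> dvd m"
      then have "\<pi>\<^sup>2 dvd eps" unfolding m power2_eq_square by (intro mult_dvd_mono) simp_all
      then show False using eps(2)[OF \<pi>(1)] by blast
    qed
    have pi0: "\<pi> \<noteq> 0" "degree \<pi> > 0" using \<pi>(1) by (auto simp: irreducible_def is_unit_iff_degree intro: gr0I)
    obtain x where x: "ev \<pi> x = 0" using ev_root_exists[OF pi0(2)] by blast
    have mx: "ev m x \<noteq> 0" using irreducible_dvd_of_common_root[OF \<pi>(1) x] pm by blast
    have Ax: "ev A x \<noteq> 0"
    proof
      assume Ax: "ev A x = 0"
      then have "\<pi> dvd A" using irreducible_dvd_of_common_root[OF \<pi>(1) x] by blast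
      moreover have "degree A \<noteq> 0" using Ax A(1) by (metis degree_eq_zeroE ev_pCons ev_0 mult_zero_right add.right_neutral of_rat_eq_0_iff pCons_0_0)
      ultimately show False using not A by auto
    qed
    have zero: "ev u x + ev v x * t = 0" if e: "eps * u = k\<^sup>2 + D * l\<^sup>2" "eps * v = 2 * k * l" for u v k l t
    proof -
      have "\<pi> dvd k\<^sup>2 + D * l\<^sup>2" "\<pi> dvd 2 * k * l" unfolding e[symmetric] m by simp_all
      then have "\<pi> dvd k" "\<pi> dvd l" using irreducible_dvd_pair_square[OF \<pi>(1)] not by blast+
      then obtain k' l' where kl: "k = \<pi> * k'" "l = \<pi> * l'" by (metis dvdE)
      have "\<pi> * (m * u) = \<pi> * (\<pi> * (k'\<^sup>2 + D * l'\<^sup>2))" "\<pi> * (m * v) = \<pi> * (\<pi> * (2 * k' * l'))"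
        using e unfolding m kl by (simp_all add: power2_eq_square algebra_simps)
      then have "m * u = \<pi> * (k'\<^sup>2 + D * l'\<^sup>2)" "m * v = \<pi> * (2 * k' * l')" using pi0 by simp_all
      then have "ev (m * u) x = 0" "ev (m * v) x = 0" using x by simp_all
      then show ?thesis using mx by simp
    qed
    show False using nocommon[of "csqrt (ev D x)" x] Ax zero[OF xy1] zero[OF xy2] by simp
  qed
  \<comment> \<open>If \<open>D\<close> divides \<open>eps\<close>, then W divides the square root,
    and dividing the square by \<open>W\<^sup>2 = D\<close> removes this prime from
    \<open>eps\<close>.\<close>
  obtain eps' u v where e': "eps' dvd eps" "\<not> D dvd eps'" "eps' * U = u\<^sup>2 + D * v\<^sup>2" "eps' * V = 2 * u * v"
  proof (cases "D dvd eps")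
    case False
    from that[OF dvd_refl this xy1] show ?thesis .
  next
    case True
    then obtain m where m: "eps = D * m" by blast
    have D0: "D \<noteq> 0" using D by auto
    have "D dvd x1\<^sup>2 + D * y1\<^sup>2" unfolding xy1(1)[symmetric] m by simp
    then have "D dvd x1\<^sup>2" by (simp add: dvd_add_left_iff)
    then have "D dvd x1" using D by (metis irreducible_imp_prime_elem prime_elem_dvd_power)
    then obtain k where k: "x1 = D * k" by blast
    have "D * (m * U) = D * (y1\<^sup>2 + D * k\<^sup>2)" "D * (m * V) = D * (2 * y1 * k)"
      using xy1 unfolding m k by (simp_all add: power2_eq_square algebra_simps)
    moreover have "\<not> D dvd m" using eps(2)[OF D] D0 unfolding m by (simp add: power2_eq_square)
    ultimately show ?thesis using that[of m y1 k] D0 m by simp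
  qed
  have eps'0: "eps' \<noteq> 0" using e'(1) E0 by auto
  obtain i m where im: "eps' = A ^ i * m" "i \<le> 1" "degree A = 0 \<longrightarrow> i = 0" "degree A = 1 \<longrightarrow> \<not> A dvd m"
  proof (cases "degree A = 1 \<and> A dvd eps'")
    case False
    then show ?thesis using that[of 0 eps'] by auto
  next
    case True
    then obtain m where m: "eps' = A * m" by blast
    have "irreducible A" using True by (intro degree_one_irreducible) simp
    then have "\<not> A\<^sup>2 dvd eps'" using eps(2) e'(1) dvd_trans by blast
    then have "\<not> A dvd m" unfolding m using A(1) by (simp add: power2_eq_square)
    then show ?thesis using that[of 1 m] m True by simp
  qed
  have m0: "m \<noteq> 0" using eps'0 im by auto
  have "degree m = 0"
  proof (rule ccontr)
    assume "degree m \<noteq> 0"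
    then have "\<not> is_unit m" by (simp add: is_unit_iff_degree[OF m0])
    then obtain \<pi> where \<pi>: "prime_elem \<pi>" "\<pi> dvd m" using m0 prime_divisor_exists by (metis prime_def)
    then have irr: "irreducible \<pi>" by (simp add: prime_elem_imp_irreducible)
    have "\<pi> dvd eps" using \<pi>(2) im(1) e'(1) by (metis dvd_mult dvd_trans)
    then consider "\<pi> dvd D" | "degree A = 1" "\<pi> dvd A" using factor[OF irr] by blast
    then show False
    proof cases
      case 1
      then have "D dvd \<pi>" using D irr by (metis irreducibleD' irreducible_not_unit)
      then show False using e'(2) \<pi>(2) im(1) by (metis dvd_mult dvd_trans)
    next
      case 2
      have "irreducible A" using 2 by (intro degree_one_irreducible) simp
      then have "A dvd \<pi>" using 2 irr by (metis irreducibleD' irreducible_not_unit)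
      then show False using im(4) 2 \<pi>(2) dvd_trans by blast
    qed
  qed
  then obtain c where c: "m = [:c:]" by (metis degree_eq_zeroE)
  have "c \<noteq> 0" using m0 c by auto
  have eq: "eps' = smult c (A ^ i)" using im c by (simp add: mult.commute)
  show ?thesis
    by (rule exI[of _ c], rule exI[of _ i], rule exI[of _ u], rule exI[of _ v])
      (use \<open>c \<noteq> 0\<close> im(2,3) e'(3,4) in \<open>simp_all only: eq, simp_all\<close>)
qed

section \<open>Homomorphisms out of Q[X, T]\<close>

definition is_hom :: "('a::comm_ring_1 \<Rightarrow> 'b::comm_ring_1) \<Rightarrow> bool" where
  "is_hom h \<longleftrightarrow> h 0 = 0 \<and> h 1 = 1 \<and> (\<forall>x y. h (x + y) = h x + h y) \<and> (\<forall>x y. h (x * y) = h x * h y)"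

definition evh :: "('a::comm_ring_1 \<Rightarrow> 'b::comm_ring_1) \<Rightarrow> 'b \<Rightarrow> 'a poly \<Rightarrow> 'b" where
  "evh h t f = poly (map_poly h f) t"

lemma is_homD:
  assumes "is_hom h"
  shows "h 0 = 0" "h 1 = 1" "h (x + y) = h x + h y" "h (x * y) = h x * h y"
    "h (- x) = - h x" "h (x - y) = h x - h y" "h (x ^ n) = h x ^ n"
proof -
  show *: "h 0 = 0" "h 1 = 1" "h (x + y) = h x + h y" "h (x * y) = h x * h y" for x y
    using assms by (auto simp: is_hom_def)
  have "h (x + - x) = h x + h (- x)" for x by (rule *)
  then show neg: "h (- x) = - h x" for x using *(1) by (simp add: eq_neg_iff_add_eq_0 add.commute)
  show "h (x - y) = h x - h y" using *(3)[of x "- y"] neg by simp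
  show "h (x ^ n) = h x ^ n" by (induction n) (simp_all add: *)
qed

lemma evh_0 [simp]: "evh h t 0 = 0"
  by (simp add: evh_def)

lemma evh_pCons:
  assumes "is_hom h"
  shows "evh h t (pCons a f) = h a + t * evh h t f"
  by (simp add: evh_def map_poly_pCons is_homD[OF assms])

lemma is_hom_evh:
  assumes h: "is_hom h"
  shows "is_hom (evh h t)"
proof -
  have add: "evh h t (f + g) = evh h t f + evh h t g" for f g
    by (induction f g rule: poly_induct2) (simp_all add: evh_pCons[OF h] is_homD[OF h] algebra_simps)
  have smult: "evh h t (smult a f) = h a * evh h t f" for a f
    by (induction f) (simp_all add: evh_pCons[OF h] is_homD[OF h] algebra_simps)
  have "evh h t (f * g) = evh h t f * evh h t g" for f g
    by (induction f) (simp_all add: evh_pCons[OF h] is_homD[OF h] add smult algebra_simps)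
  moreover have "evh h t 1 = 1" unfolding one_pCons by (simp add: evh_pCons[OF h] is_homD[OF h])
  ultimately show ?thesis using add by (simp add: is_hom_def)
qed

lemma is_hom_compose: "is_hom g \<Longrightarrow> is_hom h \<Longrightarrow> is_hom (\<lambda>x. g (h x))"
  by (simp add: is_hom_def)

lemma is_hom_const: "is_hom (\<lambda>c. [:c:])"
  by (simp add: is_hom_def one_pCons)

lemma is_hom_to_fract: "is_hom to_fract"
  by (simp add: is_hom_def)

lemma is_hom_of_rat: "is_hom (of_rat :: rat \<Rightarrow> complex)"
  by (simp add: is_hom_def of_rat_add of_rat_mult)

text \<open>Elements of \<open>Q[X, T]\<close> are polynomials in \<open>T\<close> with coefficients in \<open>Q[X]\<close>; they are
  evaluated at points of \<open>C\<^sup>2\<close> and mapped to \<open>Q(T)[X]\<close>.\<close>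

definition inT :: "rat poly \<Rightarrow> rat poly poly" where
  "inT = evh (\<lambda>c. [:[:c:]:]) [:0, 1:]"

definition varX :: "rat poly poly" where
  "varX = [:[:0, 1:]:]"

definition ev2 :: "complex \<Rightarrow> complex \<Rightarrow> rat poly poly \<Rightarrow> complex" where
  "ev2 x t = evh (\<lambda>u. ev u x) t"

definition KX :: "rat poly \<Rightarrow> rat poly fract poly" where
  "KX = evh (\<lambda>c. [:to_fract [:c:]:]) [:0, 1:]"

definition toKX :: "rat poly poly \<Rightarrow> rat poly fract poly" where
  "toKX = evh KX [:to_fract [:0, 1:]:]"

lemma is_hom_inT: "is_hom inT"
  unfolding inT_def by (intro is_hom_evh is_hom_compose[of "\<lambda>c. [:c:]" "\<lambda>c. [:c:]"] is_hom_const)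

lemma is_hom_ev: "is_hom (\<lambda>u. ev u x)"
  by (simp add: is_hom_def)

lemma is_hom_ev2: "is_hom (ev2 x t)"
  unfolding ev2_def by (intro is_hom_evh is_hom_ev)

lemma is_hom_constK: "is_hom (\<lambda>c::rat. [:to_fract [:c:]:])"
proof -
  have "is_hom (\<lambda>c::rat. to_fract [:c:])"
    by (rule is_hom_compose[OF is_hom_to_fract is_hom_const])
  then show ?thesis by (rule is_hom_compose[OF is_hom_const])
qed

lemma is_hom_KX: "is_hom KX"
  unfolding KX_def by (intro is_hom_evh is_hom_constK)

lemma is_hom_toKX: "is_hom toKX"
  unfolding toKX_def by (intro is_hom_evh is_hom_KX)

lemmas inT_simps [simp] = is_homD[OF is_hom_inT]
lemmas ev2_simps [simp] = is_homD[OF is_hom_ev2]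
lemmas KX_simps [simp] = is_homD[OF is_hom_KX]
lemmas toKX_simps [simp] = is_homD[OF is_hom_toKX]

lemma ev2_pCons [simp]: "ev2 x t (pCons u f) = ev u x + t * ev2 x t f"
  by (simp add: ev2_def evh_pCons[OF is_hom_ev])

lemma KX_pCons [simp]: "KX (pCons c u) = [:to_fract [:c:]:] + [:0, 1:] * KX u"
  unfolding KX_def by (rule evh_pCons[OF is_hom_constK])

lemma toKX_pCons [simp]: "toKX (pCons u f) = KX u + [:to_fract [:0, 1:]:] * toKX f"
  unfolding toKX_def by (rule evh_pCons[OF is_hom_KX])

lemma inT_pCons [simp]: "inT (pCons c p) = pCons [:c:] (inT p)"
  unfolding inT_def by (subst evh_pCons[OF is_hom_compose[of "\<lambda>c. [:c:]" "\<lambda>c. [:c:]", OF is_hom_const is_hom_const]]) simp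

lemma coeff_inT: "coeff (inT p) n = [:coeff p n:]"
  by (induction p arbitrary: n) (auto simp: coeff_pCons split: nat.splits)

lemma degree_inT: "degree (inT p) \<le> degree p"
  by (rule degree_le) (simp add: coeff_inT coeff_eq_0)

lemma ev2_inT [simp]: "ev2 x t (inT p) = ev p t"
  by (induction p) simp_all

lemma toKX_inT [simp]: "toKX (inT p) = [:to_fract p:]"
proof (induction p)
  case (pCons c p)
  have "pCons c p = [:c:] + [:0, 1:] * p" by simp
  then have "to_fract (pCons c p) = to_fract [:c:] + to_fract [:0, 1:] * to_fract p"
    by (metis to_fract_add to_fract_mult)
  then show ?case using pCons by simp
qed simp

lemma ev2_varX [simp]: "ev2 x t varX = x"
  by (simp add: varX_def)

lemma toKX_varX [simp]: "toKX varX = [:0, 1:]"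
proof -
  have "to_fract [:1::rat:] = 1" by (metis one_pCons to_fract_1)
  then show ?thesis by (simp add: varX_def)
qed

section \<open>The factorisation attached to a section\<close>

definition sec1 :: "rat poly \<Rightarrow> rat poly \<Rightarrow> rat poly poly" where
  "sec1 p q = inT p - varX * inT (q\<^sup>2)"

text \<open>The cofactor of \<open>p - X q\<^sup>2\<close>: for \<open>x = p / q\<^sup>2\<close> and
  the cubic F it is \<open>q ^ 4\<close> times the difference quotient of F between \<open>x\<close>
  and \<open>X\<close>.\<close>

definition sec2 :: "rat poly \<Rightarrow> rat poly \<Rightarrow> rat poly \<Rightarrow> rat poly \<Rightarrow> rat poly poly" where
  "sec2 a2 a4 p q = inT (p\<^sup>2) + varX * inT (p * q\<^sup>2) + varX\<^sup>2 * inT (q ^ 4)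
     + inT (a2 * p * q\<^sup>2) + varX * inT (a2 * q ^ 4) + inT (a4 * q ^ 4)"

definition cubic :: "rat poly \<Rightarrow> rat poly \<Rightarrow> rat poly \<Rightarrow> rat poly poly" where
  "cubic a2 a4 a6 = varX ^ 3 + inT a2 * varX\<^sup>2 + inT a4 * varX + inT a6"

lemma sec1_mult_sec2:
  assumes "triple a2 a4 a6 p q r"
  shows "sec1 p q * sec2 a2 a4 p q = inT r ^ 2 - inT (q ^ 6) * cubic a2 a4 a6"
proof -
  have eq: "r\<^sup>2 = p ^ 3 + a2 * p\<^sup>2 * q\<^sup>2 + a4 * p * q ^ 4 + a6 * q ^ 6"
    using assms by (simp add: triple_def)
  have "inT r ^ 2 = inT (r\<^sup>2)" by simp
  also have "\<dots> - inT (q ^ 6) * cubic a2 a4 a6 = sec1 p q * sec2 a2 a4 p q"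
    unfolding eq sec1_def sec2_def cubic_def by (simp add: eval_nat_numeral algebra_simps)
  finally show ?thesis ..
qed

text \<open>Where the cubic and both factors vanish, \<open>r\<close> vanishes and
  \<open>p = X q\<^sup>2\<close>. There the difference quotient is the derivative, so that
  \<open>sec2\<close> takes the value of \<open>tangent_num\<close>.\<close>

lemma sec_no_common_zero:
  assumes smooth: "smooth_surface a2 a4 a6" and t: "triple a2 a4 a6 p q r"
    and F: "ev2 x t (cubic a2 a4 a6) = 0" and "ev2 x t (sec1 p q) = 0"
  shows "ev2 x t (sec2 a2 a4 p q) \<noteq> 0"
proof
  assume s2: "ev2 x t (sec2 a2 a4 p q) = 0"
  have "ev2 x t (inT r ^ 2 - inT (q ^ 6) * cubic a2 a4 a6) = 0"
    unfolding sec1_mult_sec2[OF t, symmetric] using s2 by simp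
  then have r: "ev r t = 0" using F by simp
  have p: "ev p t = x * (ev q t)\<^sup>2" using assms(4) by (simp add: sec1_def)
  have "ev (tangent_num a2 a4 p q) t = ev2 x t (sec2 a2 a4 p q)"
    by (simp add: tangent_num_def sec2_def p eval_nat_numeral algebra_simps)
  then show False using section_avoids_ramification[OF smooth t r] s2 by simp
qed

lemma degree_sec1: "degree (sec1 p q) \<le> max (degree p) (2 * degree q)"
  unfolding sec1_def varX_def
proof (rule degree_diff_le)
  show "degree (inT p) \<le> max (degree p) (2 * degree q)" using degree_inT[of p] by simp
  have "degree ([:[:0, 1:]:] * inT (q\<^sup>2)) \<le> degree (inT (q\<^sup>2))"
    using degree_mult_le[of "[:[:0, 1:]:]" "inT (q\<^sup>2)"] by (simp del: inT_simps)
  also have "\<dots> \<le> degree (q\<^sup>2)" by (rule degree_inT)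
  also have "\<dots> \<le> 2 * degree q" using degree_power_le[of q 2] by (simp add: mult.commute)
  finally show "degree ([:[:0, 1:]:] * inT (q\<^sup>2)) \<le> max (degree p) (2 * degree q)" by simp
qed

lemma degree_sec2:
  assumes "degree a2 \<le> e" "degree a4 \<le> e" "degree p \<le> n" "2 * degree q \<le> n"
  shows "degree (sec2 a2 a4 p q) \<le> 2 * n + e"
proof -
  have q2: "degree (q\<^sup>2) \<le> n" using degree_power_le[of q 2] assms by (simp add: mult.commute)
  have q4: "degree (q ^ 4) \<le> 2 * n" using degree_power_le[of q 4] assms by (simp add: mult.commute)
  have 1: "degree (p\<^sup>2) \<le> 2 * n" using degree_power_le[of p 2] assms by (simp add: mult.commute)
  have 2: "degree (p * q\<^sup>2) \<le> 2 * n" using degree_mult_le[of p "q\<^sup>2"] q2 assms by linarith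
  have 3: "degree (a2 * p * q\<^sup>2) \<le> 2 * n + e"
    using degree_mult_le[of a2 "p * q\<^sup>2"] 2 assms by (simp add: mult.assoc)
  have 4: "degree (a2 * q ^ 4) \<le> 2 * n + e" "degree (a4 * q ^ 4) \<le> 2 * n + e"
    using degree_mult_le[of a2 "q ^ 4"] degree_mult_le[of a4 "q ^ 4"] q4 assms by linarith+
  have in': "degree (inT f) \<le> 2 * n + e" if "degree f \<le> 2 * n + e" for f
    using degree_inT[of f] that by linarith
  have X: "degree (varX * f) \<le> 2 * n + e" "degree (varX\<^sup>2 * f) \<le> 2 * n + e"
    if "degree f \<le> 2 * n + e" for f
    using degree_mult_le[of varX f] degree_mult_le[of "varX\<^sup>2" f] that by (simp_all add: varX_def power2_eq_square)
  show ?thesis unfolding sec2_def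
    by (intro degree_add_le X in') (use 1 2 3 4 q4 in linarith)+
qed

lemma degree_triple_r:
  assumes t: "triple a2 a4 a6 p q r" and "degree a2 \<le> 2" "degree a4 \<le> 2" "degree a6 \<le> 2"
    and n: "degree p \<le> 2 * k" "degree q \<le> k"
  shows "degree r \<le> 3 * k + 1"
proof -
  have "degree (r\<^sup>2) \<le> 6 * k + 2"
  proof -
    have p: "degree (p ^ 3) \<le> 6 * k + 2" "degree (p\<^sup>2) \<le> 4 * k"
      using degree_power_le[of p 3] degree_power_le[of p 2] n by simp_all
    have q: "degree (q\<^sup>2) \<le> 2 * k" "degree (q ^ 4) \<le> 4 * k" "degree (q ^ 6) \<le> 6 * k"
      using degree_power_le[of q 2] degree_power_le[of q 4] degree_power_le[of q 6] n by simp_all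
    have 1: "degree (a2 * p\<^sup>2 * q\<^sup>2) \<le> 6 * k + 2"
      using degree_mult_le[of "a2 * p\<^sup>2" "q\<^sup>2"] degree_mult_le[of a2 "p\<^sup>2"] p q assms by linarith
    have 2: "degree (a4 * p * q ^ 4) \<le> 6 * k + 2"
      using degree_mult_le[of "a4 * p" "q ^ 4"] degree_mult_le[of a4 p] n q assms by linarith
    have 3: "degree (a6 * q ^ 6) \<le> 6 * k + 2"
      using degree_mult_le[of a6 "q ^ 6"] q assms by linarith
    have "r\<^sup>2 = p ^ 3 + a2 * p\<^sup>2 * q\<^sup>2 + a4 * p * q ^ 4 + a6 * q ^ 6" using t by (simp add: triple_def)
    then show ?thesis using p 1 2 3 by (simp add: degree_add_le)
  qed
  then show ?thesis by (cases "r = 0") (simp_all add: degree_power_eq)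
qed

lemma unit_mod_power:
  fixes a F u v :: "'a::comm_ring_1"
  assumes "u * a + v * F = 1"
  shows "\<exists>u' v'. u' * a ^ k + v' * F = 1"
proof (induction k)
  case 0
  show ?case by (intro exI[of _ 1] exI[of _ 0]) simp
next
  case (Suc k)
  then obtain u' v' where uv: "u' * a ^ k + v' * F = 1" by blast
  have "1 = (u * a + v * F) * (u' * a ^ k + v' * F)" unfolding assms uv by simp
  also have "\<dots> = (u * u') * a ^ Suc k + (u * a * v' + v * u' * a ^ k + v * v' * F) * F"
    by (simp add: algebra_simps)
  finally show ?case by metis
qed

lemma to_fract_numeral [simp]: "to_fract (numeral n :: 'a::idom) = numeral n"
proof (induction n rule: num_induct)
  case (inc n)
  have "numeral (Num.inc n) = (numeral n :: 'a) + 1" by (rule numeral_inc)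
  then show ?case using inc by (simp add: numeral_inc del: numeral_plus_one)
qed simp

lemma ev_zero_imp_zero:
  assumes "finite S" "\<And>t. t \<notin> S \<Longrightarrow> ev r t = 0"
  shows "r = 0"
proof (rule ccontr)
  assume "r \<noteq> 0"
  then have "map_poly of_rat r \<noteq> (0 :: complex poly)" by (simp add: map_poly_eq_0_iff)
  then have "finite {t. ev r t = 0}" unfolding ev_def by (rule poly_roots_finite)
  then have "finite (S \<union> {t. ev r t = 0})" using assms(1) by simp
  moreover have "S \<union> {t. ev r t = 0} = UNIV" using assms(2) by blast
  ultimately show False by (simp add: infinite_UNIV_char_0)
qed

lemma cubic_root_exists: "\<exists>x. ev2 x t (cubic a2 a4 a6) = 0"
proof -
  have "\<exists>x. poly [:ev a6 t, ev a4 t, ev a2 t, 1:] x = 0"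
    by (rule fundamental_theorem_of_algebra) (simp add: constant_degree)
  then obtain x where "poly [:ev a6 t, ev a4 t, ev a2 t, 1:] x = 0" by blast
  then show ?thesis by (intro exI[of _ x]) (simp add: cubic_def eval_nat_numeral algebra_simps)
qed

lemma squarefree_prime_divisor:
  fixes eps B :: "rat poly"
  assumes eps: "eps \<noteq> 0" "\<And>\<pi>. irreducible \<pi> \<Longrightarrow> \<not> \<pi>\<^sup>2 dvd eps"
    and B: "irreducible B" and only: "\<And>\<pi>. irreducible \<pi> \<Longrightarrow> \<pi> dvd eps \<Longrightarrow> \<pi> dvd B"
  obtains c i where "c \<noteq> 0" "eps = smult c (B ^ i)" "i \<le> 1"
proof -
  obtain m i where m: "eps = B ^ i * m" "i \<le> 1" "\<not> B dvd m"
  proof (cases "B dvd eps")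
    case True
    then obtain m where m: "eps = B * m" by blast
    have "\<not> B dvd m"
    proof
      assume "B dvd m"
      then have "B\<^sup>2 dvd eps" unfolding m power2_eq_square by (intro mult_dvd_mono) simp_all
      then show False using eps(2)[OF B] by blast
    qed
    then show ?thesis using that[of 1 m] m by simp
  qed (use that[of 0 eps] in simp)
  have m0: "m \<noteq> 0" using eps m by auto
  have "degree m = 0"
  proof (rule ccontr)
    assume "degree m \<noteq> 0"
    then have "\<not> is_unit m" by (simp add: is_unit_iff_degree[OF m0])
    then obtain \<pi> where \<pi>: "prime_elem \<pi>" "\<pi> dvd m" using m0 prime_divisor_exists by (metis prime_def)
    then have irr: "irreducible \<pi>" by (simp add: prime_elem_imp_irreducible)
    then have "\<pi> dvd B" using \<pi>(2) m(1) by (intro only) auto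
    then have "B dvd \<pi>" using B irr by (metis irreducibleD' irreducible_not_unit)
    then show False using m(3) \<pi>(2) dvd_trans by blast
  qed
  then obtain c where "m = [:c:]" by (metis degree_eq_zeroE)
  then show ?thesis using that[of c i] m m0 by (auto simp: mult.commute)
qed

text \<open>Parity of multiplicities: \<open>\<pi>\<close> occurs to an odd power in
  \<open>\<pi> * m * E\<^sup>2\<close> and to an even one in \<open>\<rho>\<^sup>2\<close>.\<close>

lemma odd_part_dvd:
  fixes \<pi> m E \<Phi> \<rho> :: "rat poly"
  assumes \<pi>: "prime_elem \<pi>" and m: "\<not> \<pi> dvd m" and E: "E \<noteq> 0" and eq: "\<pi> * m * E\<^sup>2 * \<Phi> = \<rho>\<^sup>2"
  shows "\<pi> dvd \<Phi>"
proof (rule ccontr)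
  assume n: "\<not> \<pi> dvd \<Phi>"
  then have nz: "\<pi> \<noteq> 0" "m \<noteq> 0" "\<Phi> \<noteq> 0" using \<pi> m by auto
  then have "\<rho> \<noteq> 0" using eq E by auto
  have "multiplicity \<pi> (\<pi> * m * E\<^sup>2 * \<Phi>) = 1 + 2 * multiplicity \<pi> E"
    using \<pi> nz E m n by (simp add: prime_elem_multiplicity_mult_distrib prime_elem_multiplicity_power_distrib
        not_dvd_imp_multiplicity_0)
  moreover have "multiplicity \<pi> (\<rho>\<^sup>2) = 2 * multiplicity \<pi> \<rho>"
    using \<pi> \<open>\<rho> \<noteq> 0\<close> by (simp add: prime_elem_multiplicity_power_distrib)
  ultimately show False unfolding eq by presburger
qed

text \<open>The congruence is carried from \<open>Q[X, T]\<close> to \<open>Q(T)[X]\<close>, where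
  \<open>E\<close> is a unit modulo the cubic and \<open>halving\<close> applies. The point obtained
  is put into lowest terms, and the tangent formula is cleared of denominators.\<close>

lemma half_section:
  assumes t: "triple a2 a4 a6 p q r" and r: "r \<noteq> 0" and c: "c \<noteq> 0"
    and eq: "[:smult c (E\<^sup>2):] * sec1 p q = H\<^sup>2 + cubic a2 a4 a6 * S"
    and unit: "u * KX E + v * toKX (cubic a2 a4 a6) = 1"
  shows "\<exists>p' q' r'. triple a2 a4 a6 p' q' r' \<and>
    4 * r'\<^sup>2 * q'\<^sup>2 * p = q\<^sup>2 * double_num a2 a4 p' q' r'"
proof -
  let ?f = "to_fract :: rat poly \<Rightarrow> rat poly fract"
  let ?F = "[:?f a6, ?f a4, ?f a2, 1:]"
  have F: "toKX (cubic a2 a4 a6) = ?F" by (simp add: cubic_def eval_nat_numeral algebra_simps)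
  have q: "q \<noteq> 0" "?f q \<noteq> 0" and
    r2: "r\<^sup>2 = p ^ 3 + a2 * p\<^sup>2 * q\<^sup>2 + a4 * p * q ^ 4 + a6 * q ^ 6" using t by (simp_all add: triple_def)
  define x where "x = ?f p / ?f q ^ 2"
  define y where "y = ?f r / ?f q ^ 3"
  have x: "?f p = x * ?f q ^ 2" using q by (simp add: x_def)
  have y: "?f r = y * ?f q ^ 3" using q by (simp add: y_def)
  have y0: "y \<noteq> 0" using r q by (simp add: y_def)
  have "?f (r\<^sup>2) = ?f q ^ 6 * (x ^ 3 + ?f a2 * x\<^sup>2 + ?f a4 * x + ?f a6)"
    unfolding r2 by (simp add: x eval_nat_numeral algebra_simps)
  moreover have "?f (r\<^sup>2) = ?f q ^ 6 * y\<^sup>2" by (simp add: y power_mult_distrib flip: power_mult)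
  ultimately have curve: "y\<^sup>2 = x ^ 3 + ?f a2 * x\<^sup>2 + ?f a4 * x + ?f a6" using q by simp
  have KXs: "KX (smult c e) = smult (?f [:c:]) (KX e)" for e
  proof -
    have "smult c e = [:c:] * e" by simp
    then have "KX (smult c e) = KX [:c:] * KX e" by (metis KX_simps(4))
    then show ?thesis by simp
  qed
  have "toKX [:smult c (E\<^sup>2):] * toKX (sec1 p q) = (toKX H)\<^sup>2 + toKX (cubic a2 a4 a6) * toKX S"
    using arg_cong[OF eq, of toKX] by (simp only: toKX_simps)
  moreover have "toKX [:smult c (E\<^sup>2):] = smult (?f [:c:]) ((KX E)\<^sup>2)" by (simp add: KXs)
  moreover have "toKX (sec1 p q) = [:?f p:] - [:0, 1:] * [:?f (q\<^sup>2):]"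
    by (simp only: sec1_def toKX_simps toKX_inT toKX_varX)
  ultimately have "smult (?f [:c:]) ((KX E)\<^sup>2) * ([:?f p:] - [:0, 1:] * [:?f (q\<^sup>2):]) = (toKX H)\<^sup>2 + ?F * toKX S"
    unfolding F by (simp only:)
  moreover have "[:?f p:] - [:0, 1:] * [:?f (q\<^sup>2):] = smult (?f (q\<^sup>2)) [:x, -1:]"
    by (simp add: x mult.commute)
  moreover have "smult (?f [:c:] * ?f (q\<^sup>2)) ((KX E)\<^sup>2 * [:x, -1:])
      = smult (?f [:c:]) ((KX E)\<^sup>2) * smult (?f (q\<^sup>2)) [:x, -1:]"
    by (simp only: mult_smult_left mult_smult_right smult_smult) (simp only: mult.commute)
  ultimately have dvd: "?F dvd smult (?f [:c:] * ?f (q\<^sup>2)) ((KX E)\<^sup>2 * [:x, -1:]) - (toKX H)\<^sup>2"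
    by (metis add_diff_cancel_left' dvd_triv_left)
  have two: "(2::rat poly fract) \<noteq> 0"
    by (metis to_fract_numeral to_fract_eq_0_iff zero_neq_numeral)
  have "?f [:c:] * ?f (q\<^sup>2) \<noteq> 0" using c q by simp
  from halving[OF two refl curve y0 this unit[unfolded F] dvd]
  obtain x' y' where xy': "y'\<^sup>2 = x' ^ 3 + ?f a2 * x'\<^sup>2 + ?f a4 * x' + ?f a6"
    "4 * y'\<^sup>2 * (x + ?f a2 + 2 * x') = (3 * x'\<^sup>2 + 2 * ?f a2 * x' + ?f a4)\<^sup>2" by blast
  obtain p' q' r' where t': "triple a2 a4 a6 p' q' r'"
    and pqr: "x' = ?f p' / ?f q' ^ 2" "y' = ?f r' / ?f q' ^ 3" using triple_of_point[OF xy'(1)] by blast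
  have q': "?f q' \<noteq> 0" using t' by (simp add: triple_def)
  have x': "?f p' = x' * ?f q' ^ 2" and y': "?f r' = y' * ?f q' ^ 3" using q' pqr by simp_all
  have "?f (q\<^sup>2 * double_num a2 a4 p' q' r') = ?f q ^ 2 * ?f q' ^ 8 *
      ((3 * x'\<^sup>2 + 2 * ?f a2 * x' + ?f a4)\<^sup>2 - 4 * (?f a2 + 2 * x') * y'\<^sup>2)"
    by (simp add: double_num_def tangent_num_def x' y') (simp add: eval_nat_numeral algebra_simps)
  also have "\<dots> = ?f q ^ 2 * ?f q' ^ 8 * (4 * y'\<^sup>2 * x)"
    unfolding xy'(2)[symmetric] by (simp add: algebra_simps)
  also have "\<dots> = ?f (4 * r'\<^sup>2 * q'\<^sup>2 * p)"
    by (simp add: x y') (simp add: eval_nat_numeral algebra_simps)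
  finally have "4 * r'\<^sup>2 * q'\<^sup>2 * p = q\<^sup>2 * double_num a2 a4 p' q' r'" by (simp only: to_fract_eq_iff)
  then show ?thesis using t' by blast
qed

section \<open>The case A = 0\<close>

text \<open>This is \<open>B ^ n\<close> times the value of \<open>f\<close> at
  \<open>T = - C / B\<close>, if \<open>f\<close> has degree at most \<open>n\<close> in T.\<close>

fun substC :: "rat poly \<Rightarrow> rat poly \<Rightarrow> nat \<Rightarrow> rat poly poly \<Rightarrow> rat poly" where
  "substC B C 0 f = coeff f 0"
| "substC B C (Suc n) f = coeff f (Suc n) * (- C) ^ Suc n + B * substC B C n f"

lemma substC_cong: "(\<And>i. i \<le> n \<Longrightarrow> coeff f i = coeff g i) \<Longrightarrow> substC B C n f = substC B C n g"
  by (induction n) auto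

lemma substC_reduces:
  assumes "degree f \<le> n"
  shows "\<exists>S. [:B ^ n:] * f = [:substC B C n f:] + [:C, B:] * S"
  using assms
proof (induction n arbitrary: f)
  case 0
  then obtain u where "f = [:u:]" by (metis degree_eq_zeroE le_zero_eq)
  then show ?case by (intro exI[of _ 0]) simp
next
  case (Suc n)
  define c where "c = coeff f (Suc n)"
  define g where "g = f - monom c (Suc n)"
  have "degree g \<le> n"
  proof (rule degree_le, intro allI impI)
    fix i assume "n < i"
    then show "coeff g i = 0" using Suc.prems by (cases "i = Suc n") (auto simp: g_def c_def coeff_eq_0)
  qed
  then obtain S where S: "[:B ^ n:] * g = [:substC B C n g:] + [:C, B:] * S" using Suc.IH by blast
  have gf: "substC B C n g = substC B C n f" by (rule substC_cong) (simp add: g_def)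
  have "[:C, B:] dvd [:0, B:] ^ Suc n - [:- C:] ^ Suc n"
  proof -
    have "[:0, B:] - [:- C:] dvd [:0, B:] ^ Suc n - [:- C:] ^ Suc n"
      by (subst power_diff_sumr2) (rule dvd_triv_left)
    moreover have "[:0, B:] - [:- C:] = [:C, B:]" by simp
    ultimately show ?thesis by (simp only:)
  qed
  then obtain S' where S': "[:0, B:] ^ Suc n - [:- C:] ^ Suc n = [:C, B:] * S'" by blast
  then have pw: "[:0, B:] ^ Suc n = [:- C:] ^ Suc n + [:C, B:] * S'"
    by (simp only: diff_eq_eq add.commute)
  have mon: "[:B ^ Suc n:] * monom c (Suc n) = [:c:] * [:0, B:] ^ Suc n"
  proof -
    have "[:0, B:] = monom B 1" by (simp add: monom_Suc monom_0)
    then have "[:0, B:] ^ Suc n = monom (B ^ Suc n) (Suc n)" by (simp only: monom_power mult_1)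
    then show ?thesis by (simp add: smult_monom mult.commute)
  qed
  have "[:B ^ Suc n:] * f = [:B:] * ([:B ^ n:] * g) + [:B ^ Suc n:] * monom c (Suc n)"
    by (simp add: g_def algebra_simps)
  also have "\<dots> = [:B:] * ([:substC B C n f:] + [:C, B:] * S) + [:c:] * ([:- C:] ^ Suc n + [:C, B:] * S')"
    unfolding S gf mon pw ..
  also have "\<dots> = [:substC B C (Suc n) f:] + [:C, B:] * ([:B:] * S + [:c:] * S')"
  proof -
    have "b * (s + F * x) + c' * (m + F * y) = (b * s + c' * m) + F * (b * x + c' * y)"
      for b s F x c' m y :: "rat poly poly" by (simp add: algebra_simps)
    moreover have "[:substC B C (Suc n) f:] = [:B:] * [:substC B C n f:] + [:c:] * [:- C:] ^ Suc n"
      by (simp only: poly_const_pow) (simp add: c_def)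
    ultimately show ?thesis by (simp only:)
  qed
  finally show ?case by blast
qed

lemma const_dvd_linear:
  fixes B C u :: "rat poly"
  assumes "B \<noteq> 0" "[:u:] = [:C, B:] * S"
  shows "u = 0"
proof (rule ccontr)
  assume "u \<noteq> 0"
  then have "S \<noteq> 0" using assms by auto
  then have "degree ([:C, B:] * S) = 1 + degree S" using assms(1) by (subst degree_mult_eq) auto
  then show False unfolding assms(2)[symmetric] by simp
qed

lemma quadratic_poly_eq:
  assumes "degree P \<le> 2"
  shows "P = [:coeff P 0, coeff P 1, coeff P 2:]"
  using assms by (auto simp: poly_eq_iff coeff_pCons coeff_eq_0 numeral_2_eq_2 split: nat.splits)

lemma monic_cubic_eq:
  fixes C :: "'a::comm_ring_1 poly"
  assumes "degree (C - monom 1 3) \<le> 2"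
  shows "C = [:coeff C 0, coeff C 1, coeff C 2, 1:]"
proof -
  have "C - monom 1 3 = [:coeff C 0, coeff C 1, coeff C 2:]"
    using quadratic_poly_eq[OF assms] by simp
  then have "C = [:coeff C 0, coeff C 1, coeff C 2:] + monom 1 3" by (metis diff_add_cancel)
  also have "monom 1 3 = [:0, 0, 0, 1:]" by (simp add: eval_nat_numeral monom_Suc monom_0)
  finally show ?thesis by simp
qed

text \<open>One polynomial, collected by powers of X on the left and by powers of T on the
  right.\<close>

lemma cubic_surf:
  assumes "degree A \<le> 2" "degree B \<le> 2" "degree (C - monom 1 3) \<le> 2"
  shows "cubic [:coeff C 2, coeff B 2, coeff A 2:] [:coeff C 1, coeff B 1, coeff A 1:]
    [:coeff C 0, coeff B 0, coeff A 0:] = [:C, B, A:]"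
proof -
  have A: "A = [:coeff A 0, coeff A 1, coeff A 2:]" by (rule quadratic_poly_eq[OF assms(1)])
  have B: "B = [:coeff B 0, coeff B 1, coeff B 2:]" by (rule quadratic_poly_eq[OF assms(2)])
  have C: "C = [:coeff C 0, coeff C 1, coeff C 2, 1:]" by (rule monic_cubic_eq[OF assms(3)])
  show ?thesis
    by (subst (4) C, subst (4) B, subst (4) A) (simp add: cubic_def varX_def eval_nat_numeral)
qed

text \<open>On \<open>C + B T = 0\<close> the factors become polynomials in X alone with
  \<open>\<Phi> * \<Phi>2 = \<rho>\<^sup>2\<close>, and \<open>B\<close> is the only prime they can
  share. Hence \<open>\<Phi>\<close> is a constant times a square or \<open>B\<close> times such a
  polynomial, and the second possibility contradicts \<open>nosq\<close>.\<close>

lemma descent_A0: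
  fixes B C :: "rat poly"
  defines "a2 \<equiv> [:coeff C 2, coeff B 2:]" and "a4 \<equiv> [:coeff C 1, coeff B 1:]"
    and "a6 \<equiv> [:coeff C 0, coeff B 0:]"
  assumes B: "irreducible B" "degree B = 2" and C: "degree (C - monom 1 3) \<le> 2"
    and BC: "\<not> B dvd C"
    and nosq: "\<And>c g h. B dvd h\<^sup>2 * C - smult c (g\<^sup>2) \<Longrightarrow> B dvd h"
    and smooth: "smooth_surface a2 a4 a6" and t: "triple a2 a4 a6 p q r" and r: "r \<noteq> 0"
  shows "\<exists>p' q' r'. triple a2 a4 a6 p' q' r' \<and>
    4 * r'\<^sup>2 * q'\<^sup>2 * p = q\<^sup>2 * double_num a2 a4 p' q' r'"
proof -
  have F: "cubic a2 a4 a6 = [:C, B:]" using cubic_surf[of 0 B C] B C by (simp add: a2_def a4_def a6_def)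
  have B0: "B \<noteq> 0" using B by auto
  have prB: "prime_elem B" using B(1) by (rule irreducible_imp_prime_elem)
  have cop: "coprime B C" using prB BC by (rule prime_elem_imp_coprime)
  \<comment> \<open>\<open>k\<close> is as small as the degrees permit. If \<open>B\<close> divides
    \<open>\<Phi>\<close> to an odd power, this minimality will give
    \<open>degree p = 2 * k - 1\<close>.\<close>
  define k where "k = max (degree q) ((degree p + 1) div 2)"
  have pk: "degree p \<le> 2 * k" and qk: "degree q \<le> k" proof -
    have "(degree p + 1) div 2 \<le> k" "degree q \<le> k" unfolding k_def by simp_all
    then show "degree p \<le> 2 * k" "degree q \<le> k" by linarith+
  qed
  define n where "n = 2 * k"
  \<comment> \<open>The exponents satisfy \<open>n + n2 = 2 * n3\<close>, so that the powers of
    \<open>B\<close> match in \<open>\<Phi> * \<Phi>2 = \<rho>\<^sup>2\<close>.\<close>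
  define n2 where "n2 = 4 * k + 2"
  define n3 where "n3 = 3 * k + 1"
  let ?s1 = "sec1 p q" and ?s2 = "sec2 a2 a4 p q"
  have d1: "degree ?s1 \<le> n" using degree_sec1[of p q] pk qk by (simp add: n_def)
  have d2: "degree ?s2 \<le> n2" using degree_sec2[of a2 2 a4 p "2 * k" q] pk qk
    by (simp add: n2_def a2_def a4_def degree_pCons_eq_if)
  have dega: "degree a2 \<le> 2" "degree a4 \<le> 2" "degree a6 \<le> 2"
    by (simp_all add: a2_def a4_def a6_def degree_pCons_eq_if)
  have d3: "degree (inT r) \<le> n3"
    using degree_triple_r[OF t dega pk qk] degree_inT[of r] by (simp add: n3_def)
  define \<Phi> where "\<Phi> = substC B C n ?s1"
  obtain S1 where S1: "[:B ^ n:] * ?s1 = [:\<Phi>:] + [:C, B:] * S1"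
    using substC_reduces[OF d1, of B C] by (auto simp: \<Phi>_def)
  obtain \<Phi>2 S2 where S2: "[:B ^ n2:] * ?s2 = [:\<Phi>2:] + [:C, B:] * S2"
    using substC_reduces[OF d2, of B C] by blast
  obtain \<rho> S3 where S3: "[:B ^ n3:] * inT r = [:\<rho>:] + [:C, B:] * S3"
    using substC_reduces[OF d3, of B C] by blast
  have prod: "\<Phi> * \<Phi>2 = \<rho>\<^sup>2"
  proof -
    have n: "B ^ n * B ^ n2 = (B ^ n3)\<^sup>2"
      unfolding n_def n2_def n3_def power_add[symmetric] power_mult[symmetric] by (rule arg_cong) simp
    have "([:B ^ n:] * ?s1) * ([:B ^ n2:] * ?s2) = [:B ^ n * B ^ n2:] * (?s1 * ?s2)"
      by (simp add: mult_ac)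
    also have "\<dots> = ([:B ^ n3:] * inT r)\<^sup>2 - [:C, B:] * ([:B ^ n * B ^ n2:] * inT (q ^ 6))"
    proof -
      have "k\<^sup>2 * (y\<^sup>2 - w * G) = (k * y)\<^sup>2 - G * (k\<^sup>2 * w)" for k y w G :: "rat poly poly"
        by (simp add: power2_eq_square algebra_simps)
      moreover have "[:B ^ n * B ^ n2:] = [:B ^ n3:]\<^sup>2" by (simp only: n poly_const_pow)
      ultimately show ?thesis unfolding sec1_mult_sec2[OF t] F by (simp only:)
    qed
    finally have "([:\<Phi>:] + [:C, B:] * S1) * ([:\<Phi>2:] + [:C, B:] * S2)
        = ([:\<rho>:] + [:C, B:] * S3)\<^sup>2 - [:C, B:] * ([:B ^ n * B ^ n2:] * inT (q ^ 6))"
      unfolding S1 S2 S3 .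
    moreover have "[:\<Phi> * \<Phi>2 - \<rho>\<^sup>2:] = [:\<Phi>:] * [:\<Phi>2:] - [:\<rho>:]\<^sup>2" by (simp add: power2_eq_square)
    moreover have "x * y - z\<^sup>2 = G * (2 * z * u3 + G * u3\<^sup>2 - w - x * u2 - y * u1 - G * u1 * u2)"
      if "(x + G * u1) * (y + G * u2) = (z + G * u3)\<^sup>2 - G * w" for x y z G u1 u2 u3 w :: "rat poly poly"
      using that by (simp add: power2_eq_square algebra_simps)
    ultimately have "\<exists>S. [:\<Phi> * \<Phi>2 - \<rho>\<^sup>2:] = [:C, B:] * S" by metis
    then show ?thesis using const_dvd_linear[OF B0] by (metis eq_iff_diff_eq_0)
  qed
  have nocommon: "ev \<Phi>2 x \<noteq> 0" if "ev \<Phi> x = 0" "ev B x \<noteq> 0" for x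
  proof
    assume "ev \<Phi>2 x = 0"
    define s where "s = - ev C x / ev B x"
    have zF: "ev2 x s [:C, B:] = 0" using that(2) by (simp add: s_def)
    have "ev B x ^ n * ev2 x s ?s1 = 0"
      using arg_cong[OF S1, of "ev2 x s"] zF that(1) by (simp only: ev2_simps ev2_pCons) simp
    moreover have "ev B x ^ n2 * ev2 x s ?s2 = 0"
      using arg_cong[OF S2, of "ev2 x s"] zF \<open>ev \<Phi>2 x = 0\<close> by (simp only: ev2_simps ev2_pCons) simp
    ultimately show False using sec_no_common_zero[OF smooth t, of x s] zF that(2) by (simp add: F)
  qed
  have \<Phi>0: "\<Phi> \<noteq> 0"
  proof
    assume z: "\<Phi> = 0"
    then have "\<rho> = 0" using prod by simp
    have "ev r s = 0" for s
    proof -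
      obtain x where x: "ev2 x s (cubic a2 a4 a6) = 0" using cubic_root_exists by blast
      then have zF: "ev2 x s [:C, B:] = 0" by (simp only: F)
      have "ev B x \<noteq> 0" using zF coprime_no_common_root[OF cop, of x] by auto
      moreover have "ev B x ^ n3 * ev r s = 0"
        using arg_cong[OF S3, of "ev2 x s"] zF \<open>\<rho> = 0\<close> by (simp only: ev2_simps ev2_pCons ev2_inT) simp
      ultimately show ?thesis by simp
    qed
    then have "r = 0" by (intro ev_zero_imp_zero[of "{}"]) auto
    then show False using r by simp
  qed
  obtain eps E where eps: "\<Phi> = eps * E\<^sup>2" "\<And>\<pi>. irreducible \<pi> \<Longrightarrow> \<not> \<pi>\<^sup>2 dvd eps"
    using squarefree_decomposition[OF \<Phi>0] by blast
  have E0: "E \<noteq> 0" "eps \<noteq> 0" using eps(1) \<Phi>0 by auto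
  have "\<pi> dvd B" if \<pi>: "irreducible \<pi>" "\<pi> dvd eps" for \<pi>
  proof -
    obtain m where m: "eps = \<pi> * m" using \<pi>(2) by blast
    have "\<not> \<pi> dvd m"
    proof
      assume "\<pi> dvd m"
      then have "\<pi>\<^sup>2 dvd eps" unfolding m power2_eq_square by (intro mult_dvd_mono) simp_all
      then show False using eps(2)[OF \<pi>(1)] by blast
    qed
    then have "\<pi> dvd \<Phi>2"
      using odd_part_dvd[of \<pi> m E \<Phi>2 \<rho>] \<pi>(1) E0 prod unfolding eps(1) m
      by (simp add: irreducible_imp_prime_elem)
    moreover have "\<pi> dvd \<Phi>" unfolding eps(1) m by simp
    moreover have pi0: "\<pi> \<noteq> 0" "degree \<pi> > 0" using \<pi>(1) by (auto simp: irreducible_def is_unit_iff_degree intro: gr0I)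
    then obtain x where x: "ev \<pi> x = 0" using ev_root_exists by blast
    ultimately have "ev \<Phi> x = 0" "ev \<Phi>2 x = 0" by (auto elim!: dvdE)
    then have "ev B x = 0" using nocommon by blast
    then show ?thesis using irreducible_dvd_of_common_root[OF \<pi>(1) x] by blast
  qed
  then obtain c e where ce: "c \<noteq> 0" "eps = smult c (B ^ e)" "e \<le> 1"
    using squarefree_prime_divisor[OF E0(2) eps(2) B(1)] by blast
  \<comment> \<open>If \<open>B\<close> divides \<open>\<Phi>\<close>, it divides the coefficient of
    \<open>T ^ n\<close> in \<open>sec1\<close>, which has degree at most 1 in X and is therefore
    zero. The next coefficient is a constant \<open>l\<close>, and after one factor \<open>B\<close>
    is cancelled, \<open>c E\<^sup>2\<close> is congruent modulo \<open>B\<close> to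
    \<open>- l C ^ (2 k - 1)\<close>. So \<open>C\<close> times a square is a constant times a
    square modulo \<open>B\<close>.\<close>
  have "e = 0"
  proof (rule ccontr)
    assume "e \<noteq> 0"
    then have e1: "\<Phi> = B * smult c (E\<^sup>2)" using ce eps(1) by (simp add: le_Suc_eq)
    have coeff1: "coeff ?s1 i = [:coeff p i, - coeff (q\<^sup>2) i:]" for i
      by (simp add: sec1_def varX_def coeff_inT del: inT_simps)
    have "\<exists>R. \<Phi> = coeff ?s1 n * (- C) ^ n + B * R"
      unfolding \<Phi>_def by (cases n) (auto intro: exI[of _ 0])
    then have "B dvd coeff ?s1 n * (- C) ^ n" using e1 by (metis dvd_add_left_iff dvd_triv_left)
    moreover have "coprime B ((- C) ^ n)" using cop by simp
    ultimately have "B dvd coeff ?s1 n" by (simp add: coprime_dvd_mult_left_iff)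
    moreover have "degree (coeff ?s1 n) < degree B" unfolding coeff1 B(2) by (simp add: degree_pCons_eq_if)
    ultimately have "coeff ?s1 n = 0" using dvd_imp_degree_le leD by blast
    then have z: "coeff p n = 0" "coeff (q\<^sup>2) n = 0" unfolding coeff1 by simp_all
    have "degree q \<noteq> k"
    proof
      assume "degree q = k"
      then have "coeff (q\<^sup>2) n = (lead_coeff q)\<^sup>2"
        using coeff_mult_degree_sum[of q q] by (simp add: power2_eq_square n_def mult_2)
      then show False using z t by (simp add: triple_def)
    qed
    then have qk': "degree q < k" using qk by simp
    then have "k = (degree p + 1) div 2" unfolding k_def by (simp add: max_def split: if_splits)
    moreover have "degree p \<noteq> 2 * k" using z(1) qk' by (metis n_def leading_coeff_0_iff degree_0 mult_is_0 not_less_zero zero_neq_numeral)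
    ultimately have dp: "degree p = 2 * k - 1" using pk qk' by presburger
    define l where "l = coeff p (2 * k - 1)"
    have l: "l \<noteq> 0" using dp qk' unfolding l_def
      by (metis One_nat_def degree_0 diff_is_0_eq leD leading_coeff_0_iff less_nat_zero_code nat_mult_eq_1_iff nat_le_linear mult_2 add_gr_0 not_less_eq_eq zero_less_diff  le_add1 le_neq_implies_less less_one plus_1_eq_Suc)
    have q2: "coeff (q\<^sup>2) (2 * k - 1) = 0"
    proof (rule coeff_eq_0)
      have "degree (q\<^sup>2) \<le> 2 * degree q" using degree_power_le[of q 2] by (simp add: mult.commute)
      then show "degree (q\<^sup>2) < 2 * k - 1" using qk' by linarith
    qed
    obtain k' where k': "k = Suc k'" using qk' by (cases k) auto
    have nk: "n = Suc (Suc (2 * k'))" "2 * k - 1 = Suc (2 * k')" by (simp_all add: n_def k')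
    have "\<Phi> = B * substC B C (Suc (2 * k')) ?s1"
      unfolding \<Phi>_def nk(1) substC.simps(2)[of B C "Suc (2 * k')"] using \<open>coeff ?s1 n = 0\<close> nk(1) by (simp del: substC.simps)
    then have "smult c (E\<^sup>2) = substC B C (Suc (2 * k')) ?s1" using e1 B0 by (metis mult_left_cancel)
    also have "\<dots> = [:l:] * (- C) ^ Suc (2 * k') + B * substC B C (2 * k') ?s1"
    proof -
      have "coeff ?s1 (Suc (2 * k')) = [:l:]" unfolding nk(2)[symmetric] coeff1 q2 l_def by simp
      then show ?thesis by (simp only: substC.simps)
    qed
    finally have "smult c (E\<^sup>2) = [:l:] * (- C) ^ Suc (2 * k') + B * substC B C (2 * k') ?s1" .
    moreover have "(- C) ^ Suc (2 * k') = - ((C ^ k')\<^sup>2 * C)" by (simp add: mult.commute flip: power_mult)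
    moreover have "[:l:] * (- X) + Y = Y - smult l X" for X Y by simp
    ultimately have e: "smult c (E\<^sup>2) = B * R - smult l ((C ^ k')\<^sup>2 * C)"
      if "R = substC B C (2 * k') ?s1" for R unfolding that by (simp only:)
    define R where "R = substC B C (2 * k') ?s1"
    have "(C ^ k')\<^sup>2 * C - smult (- c / l) (E\<^sup>2) = (C ^ k')\<^sup>2 * C + smult (1 / l) (smult c (E\<^sup>2))"
      by simp
    also have "\<dots> = B * smult (1 / l) R"
      unfolding e[OF R_def] using l by (simp add: smult_diff_right)
    finally have "(C ^ k')\<^sup>2 * C - smult (- c / l) (E\<^sup>2) = B * smult (1 / l) R" .
    then have "B dvd (C ^ k')\<^sup>2 * C - smult (- c / l) (E\<^sup>2)" by (metis dvd_triv_left)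
    then have "B dvd C ^ k'" by (rule nosq)
    then show False using BC prB prime_elem_dvd_power by blast
  qed
  then have \<Phi>E: "\<Phi> = smult c (E\<^sup>2)" using ce eps(1) by simp
  have "[:smult (1 / c) ((B ^ k)\<^sup>2):] * ?s1 = [:[:1 / c:]:] * ([:B ^ n:] * ?s1)"
    by (simp add: n_def mult.commute flip: power_mult)
  also have "\<dots> = [:E:]\<^sup>2 + cubic a2 a4 a6 * ([:[:1 / c:]:] * S1)"
  proof -
    have "[:[:1 / c:]:] * [:smult c (E\<^sup>2):] = [:E:]\<^sup>2" using ce(1) by (simp add: power2_eq_square)
    then show ?thesis unfolding S1 F \<Phi>E by (simp only: distrib_left mult.left_commute)
  qed
  finally have eq: "[:smult (1 / c) ((B ^ k)\<^sup>2):] * ?s1 = [:E:]\<^sup>2 + cubic a2 a4 a6 * ([:[:1 / c:]:] * S1)" .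
  obtain u v where uv: "u * B + v * C = 1" using cop by (rule bezout_rat_poly)
  let ?T = "[:to_fract [:0, 1:]:]"
  \<comment> \<open>\<open>B\<close> is a unit modulo the cubic F: insert \<open>C = F - B T\<close>
    into \<open>u B + v C = 1\<close>.\<close>
  have "(KX u - KX v * ?T) * KX B + KX v * toKX (cubic a2 a4 a6) = KX u * KX B + KX v * KX C"
    unfolding F by (simp only: toKX_pCons toKX_simps) (simp add: algebra_simps)
  also have "\<dots> = KX (u * B + v * C)" by (simp only: KX_simps)
  also have "\<dots> = 1" unfolding uv by simp
  finally obtain u' v' where "u' * KX B ^ k + v' * toKX (cubic a2 a4 a6) = 1"
    using unit_mod_power by blast
  then have unit: "u' * KX (B ^ k) + v' * toKX (cubic a2 a4 a6) = 1" by (simp only: KX_simps)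
  show ?thesis by (rule half_section[OF t r _ eq unit]) (use ce in simp)
qed

section \<open>The case A \<noteq> 0\<close>

text \<open>The multiplier has two coefficients, and only the quadratic coefficient of the remainder
  has to vanish.\<close>

lemma linear_multiplier:
  fixes F g :: "'a::field poly"
  assumes F: "F = [:a6, a4, a2, 1:]"
  obtains s0 s1 t0 t1 where "s0 \<noteq> 0 \<or> s1 \<noteq> 0" "F dvd [:s0, s1:] * g - [:t0, t1:]"
proof -
  obtain g0 g1 g2 where "F dvd g - [:g0, g1, g2:]" using cong_reduce_cubic[OF F] by blast
  then obtain k where k: "g = [:g0, g1, g2:] + F * k" by (metis dvdE diff_eq_eq add.commute)
  show ?thesis
  proof (cases "g2 = 0")
    case True
    have "[:1, 0:] * g - [:g0, g1:] = F * k" using k True by simp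
    then show ?thesis using that[of 1 0 g0 g1] by (metis dvd_triv_left zero_neq_one)
  next
    case False
    define s0 where "s0 = g2 * a2 - g1"
    define t1 where "t1 = s0 * g1 + g2 * g0 - g2\<^sup>2 * a4"
    define t0 where "t0 = s0 * g0 - g2\<^sup>2 * a6"
    have st: "[:s0, g2:] * [:g0, g1, g2:] = [:t0, t1:] + F * [:g2\<^sup>2:]"
      by (simp add: F s0_def t1_def t0_def power2_eq_square algebra_simps)
    have "[:s0, g2:] * g - [:t0, t1:] = F * ([:g2\<^sup>2:] + [:s0, g2:] * k)"
      unfolding k distrib_left st by (simp only: distrib_left mult.left_commute) simp
    then show ?thesis using that[of s0 g2 t0 t1] False by (metis dvd_triv_left)
  qed
qed

lemma linear_unit:
  fixes F :: "'a::field poly"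
  assumes "poly F x0 \<noteq> 0"
  shows "\<exists>u v. u * [:-x0, 1:] + v * F = 1"
proof -
  define d where "d = poly F x0"
  have "poly (F - [:d:]) x0 = 0" by (simp add: d_def)
  then obtain Q where Q: "F - [:d:] = [:-x0, 1:] * Q" unfolding poly_eq_0_iff_dvd by blast
  then have "[:d:] = F - [:-x0, 1:] * Q" by (simp only: diff_eq_eq) simp
  then have "[:1 / d:] * [:d:] = [:1 / d:] * (F - [:-x0, 1:] * Q)" by simp
  moreover have "[:1 / d:] * [:d:] = 1" using assms by (simp add: one_pCons d_def)
  moreover have "e * (F - A * Q) = (- (e * Q)) * A + e * F" for e A :: "'a poly" by (simp add: algebra_simps)
  ultimately show ?thesis by metis
qed

text \<open>Treats the class of \<open>x - X\<close> modulo squares when a factor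
  \<open>X - x0\<close> is left over. Multiplication by a linear \<open>s\<close> gives
  \<open>s\<^sup>2 c (x - X) - (X - x0) t\<^sup>2 = l F\<close> with linear \<open>t\<close> and, by
  degrees, constant \<open>l\<close>; the values at \<open>x\<close> and at \<open>x0\<close> give
  two expressions for \<open>l\<close>, which are compared.\<close>

lemma twisted_class:
  fixes a2 a4 a6 x y c x0 \<delta> :: "'a::field"
  assumes F: "F = [:a6, a4, a2, 1:]"
    and curve: "y\<^sup>2 = x ^ 3 + a2 * x\<^sup>2 + a4 * x + a6" "y \<noteq> 0"
    and c: "c \<noteq> 0" and \<delta>: "\<delta> = poly F x0" "\<delta> \<noteq> 0"
    and dvd: "F dvd smult c ([:-x0, 1:] ^ Suc (2 * k) * [:x, -1:]) - g\<^sup>2"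
  shows "(\<exists>z. \<delta> = z\<^sup>2) \<or> (\<exists>z. - c * \<delta> = z\<^sup>2)"
proof (cases "x = x0")
  case True
  have "\<delta> = y\<^sup>2" unfolding \<delta> curve F True by (simp add: eval_nat_numeral algebra_simps)
  then show ?thesis by blast
next
  case False
  let ?A = "[:-x0, 1:]"
  have "poly F x0 \<noteq> 0" using \<delta> by simp
  then obtain u0 v0 where "u0 * ?A + v0 * F = 1" using linear_unit by blast
  then obtain u v where uv: "u * ?A ^ Suc k + v * F = 1" using unit_mod_power by blast
  define P where "P = smult c [:x, -1:]"
  have e1: "smult c (?A ^ Suc (2 * k) * [:x, -1:]) = ?A ^ Suc (2 * k) * P"
    unfolding P_def by (simp only: mult_smult_right)
  have "(?A ^ Suc k)\<^sup>2 * P = ?A * (?A ^ Suc (2 * k) * P)"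
  proof -
    have "(A ^ Suc k)\<^sup>2 * P = A * (A ^ Suc (2 * k) * P)" for A :: "'a poly"
    proof -
      have "A ^ Suc (2 * k) = A * (A ^ k * A ^ k)" by (simp add: mult_2 power_add)
      then show ?thesis by (simp only: power2_eq_square power_Suc mult_ac)
    qed
    then show ?thesis .
  qed
  moreover have "F dvd ?A * (?A ^ Suc (2 * k) * P) - ?A * g\<^sup>2"
    using dvd unfolding e1 right_diff_distrib[symmetric] by (rule dvd_mult)
  ultimately have d1: "F dvd (?A ^ Suc k)\<^sup>2 * P - ?A * g\<^sup>2" by simp
  have d2: "F dvd P - ?A * (g * u)\<^sup>2"
  proof -
    obtain m where m: "(?A ^ Suc k)\<^sup>2 * P - ?A * g\<^sup>2 = F * m" using d1 by blast
    have gen: "P - A * (g * u)\<^sup>2 = F * (u\<^sup>2 * m + P * (2 * u * B * v + v\<^sup>2 * F))"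
      if "B\<^sup>2 * P = F * m + A * g\<^sup>2" "u * B + v * F = 1" for A B :: "'a poly"
    proof -
      have "P = P * (u * B + v * F)\<^sup>2" using that by simp
      also have "\<dots> = u\<^sup>2 * (B\<^sup>2 * P) + F * (P * (2 * u * B * v + v\<^sup>2 * F))"
        by (simp add: power2_eq_square algebra_simps)
      finally show ?thesis unfolding that(1) by (simp add: power2_eq_square algebra_simps)
    qed
    have "(?A ^ Suc k)\<^sup>2 * P = F * m + ?A * g\<^sup>2" using m by (simp only: diff_eq_eq)
    from gen[OF this uv] show ?thesis by (rule dvdI)
  qed
  obtain s0 s1 t0 t1 where st: "s0 \<noteq> 0 \<or> s1 \<noteq> 0" "F dvd [:s0, s1:] * (g * u) - [:t0, t1:]"
    using linear_multiplier[OF F] by blast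
  let ?s = "[:s0, s1:]" and ?t = "[:t0, t1:]"
  have "F dvd ?s\<^sup>2 * P - ?A * ?t\<^sup>2"
  proof -
    obtain m where m: "P - ?A * (g * u)\<^sup>2 = F * m" using d2 by blast
    obtain l where l: "?s * (g * u) - ?t = F * l" using st(2) by blast
    have gen: "s\<^sup>2 * P - A * t\<^sup>2 = F * (s\<^sup>2 * m + A * (2 * t * l + F * l\<^sup>2))"
      if "P = A * h\<^sup>2 + F * m" "s * h = t + F * l" for s t A h :: "'a poly"
    proof -
      have "s\<^sup>2 * P - A * t\<^sup>2 = A * (s * h)\<^sup>2 + s\<^sup>2 * F * m - A * t\<^sup>2"
        unfolding that(1) by (simp add: power2_eq_square algebra_simps)
      then show ?thesis unfolding that(2) by (simp add: power2_eq_square algebra_simps)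
    qed
    have "P = ?A * (g * u)\<^sup>2 + F * m" "?s * (g * u) = ?t + F * l"
      using m l by (simp_all only: diff_eq_eq add.commute)
    from gen[OF this] show ?thesis by (rule dvdI)
  qed
  then obtain \<kappa> where \<kappa>: "?s\<^sup>2 * P - ?A * ?t\<^sup>2 = F * \<kappa>" by blast
  have "degree \<kappa> = 0"
  proof (cases "\<kappa> = 0")
    case False
    have "degree (F * \<kappa>) = 3 + degree \<kappa>" using False F by (subst degree_mult_eq) auto
    moreover have "degree (?s\<^sup>2 * P) \<le> 3"
    proof -
      have "degree (?s\<^sup>2) \<le> 2" using degree_power_le[of ?s 2] degree_pCons_le[of s0 "[:s1:]"] by simp
      moreover have "degree P \<le> 1" unfolding P_def by (simp add: degree_pCons_eq_if)
      ultimately show ?thesis using degree_mult_le[of "?s\<^sup>2" P] by linarith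
    qed
    moreover have "degree (?A * ?t\<^sup>2) \<le> 3"
    proof -
      have "degree (?t\<^sup>2) \<le> 2" using degree_power_le[of ?t 2] degree_pCons_le[of t0 "[:t1:]"] by simp
      then show ?thesis using degree_mult_le[of ?A "?t\<^sup>2"] by simp
    qed
    ultimately show ?thesis unfolding \<kappa>[symmetric] using degree_diff_le[of "?s\<^sup>2 * P" 3 "?A * ?t\<^sup>2"] by linarith
  qed simp
  then obtain l where l: "\<kappa> = [:l:]" by (metis degree_eq_zeroE)
  define tx where "tx = t0 + t1 * x"
  define sx where "sx = s0 + s1 * x0"
  have "poly (?s\<^sup>2 * P - ?A * ?t\<^sup>2) x = poly (F * \<kappa>) x" using \<kappa> by simp
  then have 1: "- ((x - x0) * tx\<^sup>2) = l * y\<^sup>2"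
    unfolding curve by (simp add: P_def F l tx_def eval_nat_numeral algebra_simps)
  have "poly (?s\<^sup>2 * P - ?A * ?t\<^sup>2) x0 = poly (F * \<kappa>) x0" using \<kappa> by simp
  then have 2: "c * sx\<^sup>2 * (x - x0) = l * \<delta>"
    unfolding \<delta> by (simp add: P_def l sx_def algebra_simps)
  have l': "l = - ((x - x0) * (tx / y)\<^sup>2)" using 1 curve(2) by (simp add: power_divide field_simps)
  have nz: "x - x0 \<noteq> 0" using False by simp
  have "(x - x0) * (c * sx\<^sup>2) = c * sx\<^sup>2 * (x - x0)" by (simp only: mult.commute)
  also have "\<dots> = (x - x0) * (- (\<delta> * (tx / y)\<^sup>2))"
    unfolding 2 l' by (simp only: mult_ac mult_minus_right mult_minus_left)
  finally have 3: "c * sx\<^sup>2 = - (\<delta> * (tx / y)\<^sup>2)" unfolding mult_left_cancel[OF nz] .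
  show ?thesis
  proof (cases "sx = 0")
    case False
    have "- c * \<delta> * sx\<^sup>2 = - \<delta> * (c * sx\<^sup>2)" by simp
    also have "\<dots> = (\<delta> * (tx / y))\<^sup>2" unfolding 3 by (simp add: power2_eq_square)
    finally have "- c * \<delta> = (\<delta> * (tx / y))\<^sup>2 / sx\<^sup>2"
      using nonzero_eq_divide_eq[of "sx\<^sup>2" "- c * \<delta>" "(\<delta> * (tx / y))\<^sup>2"] False by simp
    then have "- c * \<delta> = (\<delta> * (tx / y) / sx)\<^sup>2" by (simp only: power_divide)
    then show ?thesis by blast
  next
    \<comment> \<open>Now \<open>t\<close> vanishes at \<open>x\<close> and \<open>l = 0\<close>, so
      \<open>s\<close> and \<open>t\<close> are multiples of \<open>X - x0\<close> and
      \<open>X - x\<close>. The vanishing combination then forces \<open>s = 0\<close>, which the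
      choice of the multiplier excludes.\<close>
    case True
    then have tx0: "tx = 0" using 3 \<delta>(2) curve(2) by simp
    then have "l = 0" using l' by simp
    have s: "?s = smult s1 ?A" using True by (simp add: sx_def eq_neg_iff_add_eq_0 mult.commute)
    have t: "?t = smult t1 [:-x, 1:]" using tx0 by (simp add: tx_def eq_neg_iff_add_eq_0 mult.commute)
    have "?s\<^sup>2 * P - ?A * ?t\<^sup>2 = 0" using \<kappa> \<open>l = 0\<close> l by simp
    moreover have "?s\<^sup>2 * P - ?A * ?t\<^sup>2 = - ([:-x0, 1:] * ([:-x, 1:] * (smult (c * s1\<^sup>2) [:-x0, 1:] + smult (t1\<^sup>2) [:-x, 1:])))"
      unfolding s t P_def by (simp add: power2_eq_square algebra_simps)
    ultimately have "[:-x0, 1:] * ([:-x, 1:] * (smult (c * s1\<^sup>2) [:-x0, 1:] + smult (t1\<^sup>2) [:-x, 1:])) = 0"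
      by (metis neg_equal_0_iff_equal)
    then have "smult (c * s1\<^sup>2) [:-x0, 1:] + smult (t1\<^sup>2) [:-x, 1:] = 0" by (simp only: mult_eq_0_iff) simp
    then have "poly (smult (c * s1\<^sup>2) [:-x0, 1:] + smult (t1\<^sup>2) [:-x, 1:]) x = 0" by simp
    then have "(c * s1\<^sup>2) * (x - x0) = 0" by (simp add: algebra_simps)
    then have "s1 = 0" using c False by simp
    then show ?thesis using st(1) s by simp
  qed
qed

definition disc_AC :: "rat poly \<Rightarrow> rat poly \<Rightarrow> rat poly \<Rightarrow> rat poly" where
  "disc_AC A B C = B\<^sup>2 - smult 4 (A * C)"

definition surf :: "rat poly \<Rightarrow> rat poly \<Rightarrow> rat poly \<Rightarrow> rat poly poly" where
  "surf A B C = [:C, B, A:]"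

text \<open>The derivative \<open>2 A T + B\<close> of the surface equation by T. On the surface it
  is a square root of D.\<close>

definition ramW :: "rat poly \<Rightarrow> rat poly \<Rightarrow> rat poly poly" where
  "ramW A B = [:B, smult 2 A:]"

lemma ramW_square: "(ramW A B)\<^sup>2 = [:disc_AC A B C:] + surf A B C * [:smult 4 A:]"
  by (simp add: ramW_def disc_AC_def surf_def power2_eq_square algebra_simps) (simp add: numeral_poly)

text \<open>On the surface \<open>T = (W - B) / (2 A)\<close>, so that each power of T costs one
  factor \<open>A\<close>.\<close>

lemma pseudo_reduce:
  assumes "degree f \<le> n"
  shows "\<exists>U V S. [:A ^ n:] * f = [:U:] + [:V:] * ramW A B + surf A B C * S"
  using assms
proof (induction n arbitrary: f)
  case 0
  then obtain u where "f = [:u:]" by (metis degree_eq_zeroE le_zero_eq)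
  then show ?case by (intro exI[of _ u] exI[of _ 0]) simp
next
  case (Suc n)
  obtain u g where f: "f = pCons u g" by (cases f) auto
  have "degree g \<le> n" using Suc.prems by (auto simp: f degree_pCons_eq_if split: if_splits)
  then obtain U V S where IH: "[:A ^ n:] * g = [:U:] + [:V:] * ramW A B + surf A B C * S"
    using Suc.IH by blast
  let ?D = "disc_AC A B C" and ?W = "ramW A B" and ?F = "surf A B C"
  have AT: "[:0, A:] = [:[:1/2:]:] * (?W - [:B:])" by (simp add: ramW_def)
  have WW: "?W * ?W = [:?D:] + ?F * [:smult 4 A:]" using ramW_square[of A B C] by (simp add: power2_eq_square)
  have gen: "a * u' + (h * (W - B')) * (U' + V' * W + F * S)
      = (a * u' + h * (V' * D' - B' * U')) + (h * (U' - B' * V')) * W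
        + F * (h * V' * f' + h * (W - B') * S)"
    if "W * W = D' + F * f'" for a u' h W B' U' V' F D' f' :: "rat poly poly"
  proof -
    have "a * u' + (h * (W - B')) * (U' + V' * W + F * S)
      = a * u' + h * (V' * (W * W) - B' * U') + (h * (U' - B' * V')) * W + h * (W - B') * (F * S)"
      by (simp add: algebra_simps)
    then show ?thesis unfolding that by (simp add: algebra_simps)
  qed
  have "[:A ^ Suc n:] * f = [:A ^ Suc n:] * [:u:] + [:0, A:] * ([:A ^ n:] * g)" by (simp add: f mult.commute)
  also have "\<dots> = ([:A ^ Suc n:] * [:u:] + [:[:1/2:]:] * ([:V:] * [:?D:] - [:B:] * [:U:]))
      + ([:[:1/2:]:] * ([:U:] - [:B:] * [:V:])) * ?W
      + ?F * ([:[:1/2:]:] * [:V:] * [:smult 4 A:] + [:[:1/2:]:] * (?W - [:B:]) * S)"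
    unfolding IH AT by (rule gen[OF WW])
  also have "[:A ^ Suc n:] * [:u:] + [:[:1/2:]:] * ([:V:] * [:?D:] - [:B:] * [:U:])
      = [:A ^ Suc n * u + smult (1/2) (V * ?D - B * U):]" by (simp add: mult.commute)
  also have "[:[:1/2:]:] * ([:U:] - [:B:] * [:V:]) = [:smult (1/2) (U - B * V):]" by (simp add: mult.commute)
  finally show ?case by blast
qed

lemma reduce_unique:
  assumes A: "A \<noteq> 0" and eq: "[:u:] + [:v:] * ramW A B = surf A B C * S"
  shows "u = 0" "v = 0"
proof -
  have S: "S = 0"
  proof (rule ccontr)
    assume S: "S \<noteq> 0"
    have "degree (surf A B C) = 2" using A by (simp add: surf_def)
    then have "degree (surf A B C * S) = 2 + degree S"
      using S A by (subst degree_mult_eq) (auto simp: surf_def)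
    moreover have "degree ([:u:] + [:v:] * ramW A B) \<le> 1" by (simp add: ramW_def degree_pCons_eq_if)
    ultimately show False unfolding eq by simp
  qed
  have "[:u + v * B, smult 2 (v * A):] = 0" using eq S by (simp add: ramW_def mult.commute)
  then show "u = 0" "v = 0" using A by auto
qed

text \<open>Representatives \<open>U + V W\<close> are unique, so products in the order may be
  compared component by component.\<close>

lemma reduce_product:
  assumes A: "A \<noteq> 0"
    and 1: "[:a1:] * f1 = [:U1:] + [:V1:] * ramW A B + surf A B C * S1"
    and 2: "[:a2:] * f2 = [:U2:] + [:V2:] * ramW A B + surf A B C * S2"
    and 3: "[:a3:] * f3 = [:U3:] + [:V3:] * ramW A B + surf A B C * S3"
    and f: "f1 * f2 = f3\<^sup>2 - h * surf A B C" and a: "a1 * a2 = a3\<^sup>2"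
  shows "U1 * U2 + disc_AC A B C * V1 * V2 = U3\<^sup>2 + disc_AC A B C * V3\<^sup>2"
    "U1 * V2 + V1 * U2 = 2 * U3 * V3"
proof -
  let ?D = "disc_AC A B C" and ?W = "ramW A B" and ?F = "surf A B C"
  have WW: "?W * ?W = [:?D:] + ?F * [:smult 4 A:]" using ramW_square[of A B C] by (simp add: power2_eq_square)
  have gen: "\<exists>S. (u1 * u2 + D * v1 * v2 - (u3\<^sup>2 + D * v3\<^sup>2)) + (u1 * v2 + v1 * u2 - 2 * u3 * v3) * W = F * S"
    if e: "b1 * f1 = u1 + v1 * W + F * S1" "b2 * f2 = u2 + v2 * W + F * S2" "b3 * f3 = u3 + v3 * W + F * S3"
      and f': "f1 * f2 = f3\<^sup>2 - h * F" and b: "b1 * b2 = b3\<^sup>2" and W: "W * W = D + F * g"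
    for b1 b2 b3 u1 u2 u3 v1 v2 v3 W F D g :: "rat poly poly"
  proof -
    have "(b1 * f1) * (b2 * f2) = (b1 * b2) * (f1 * f2)" by (simp add: mult_ac)
    also have "\<dots> = (b3 * f3)\<^sup>2 - b3\<^sup>2 * h * F" unfolding b f' by (simp add: power2_eq_square algebra_simps)
    finally have E: "(u1 + v1 * W + F * S1) * (u2 + v2 * W + F * S2) = (u3 + v3 * W + F * S3)\<^sup>2 - b3\<^sup>2 * h * F"
      unfolding e .
    have "(u1 + v1 * W + F * S1) * (u2 + v2 * W + F * S2)
        = u1 * u2 + v1 * v2 * (W * W) + (u1 * v2 + v1 * u2) * W + F * (S1 * (u2 + v2 * W + F * S2) + S2 * (u1 + v1 * W))"
      by (simp add: algebra_simps)
    moreover have "(u3 + v3 * W + F * S3)\<^sup>2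
        = u3\<^sup>2 + v3\<^sup>2 * (W * W) + (2 * u3 * v3) * W + F * (S3 * (u3 + v3 * W + F * S3) + S3 * (u3 + v3 * W))"
      by (simp add: power2_eq_square algebra_simps)
    ultimately have "u1 * u2 + v1 * v2 * (W * W) + (u1 * v2 + v1 * u2) * W + F * (S1 * (u2 + v2 * W + F * S2) + S2 * (u1 + v1 * W))
      = u3\<^sup>2 + v3\<^sup>2 * (W * W) + (2 * u3 * v3) * W + F * (S3 * (u3 + v3 * W + F * S3) + S3 * (u3 + v3 * W)) - b3\<^sup>2 * h * F"
      using E by simp
    then have "(u1 * u2 + D * v1 * v2 - (u3\<^sup>2 + D * v3\<^sup>2)) + (u1 * v2 + v1 * u2 - 2 * u3 * v3) * W
      = F * (S3 * (u3 + v3 * W + F * S3) + S3 * (u3 + v3 * W) - b3\<^sup>2 * h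
          - (S1 * (u2 + v2 * W + F * S2) + S2 * (u1 + v1 * W)) + v3\<^sup>2 * g - v1 * v2 * g)"
      unfolding W by (simp add: algebra_simps)
    then show ?thesis by blast
  qed
  have b: "[:a1:] * [:a2:] = [:a3:]\<^sup>2" using a by (simp add: power2_eq_square mult.commute)
  obtain S where S: "([:U1:] * [:U2:] + [:?D:] * [:V1:] * [:V2:] - ([:U3:]\<^sup>2 + [:?D:] * [:V3:]\<^sup>2))
      + ([:U1:] * [:V2:] + [:V1:] * [:U2:] - 2 * [:U3:] * [:V3:]) * ?W = ?F * S"
    using gen[OF 1 2 3 f b WW] by blast
  have two: "(2::rat poly poly) = [:2:]" by (simp add: numeral_poly)
  have "[:U1 * U2 + ?D * V1 * V2 - (U3\<^sup>2 + ?D * V3\<^sup>2):] + [:U1 * V2 + V1 * U2 - 2 * U3 * V3:] * ?W = ?F * S"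
    using S unfolding two by (simp add: power2_eq_square mult_ac)
  from reduce_unique[OF A this] show "U1 * U2 + ?D * V1 * V2 = U3\<^sup>2 + ?D * V3\<^sup>2" "U1 * V2 + V1 * U2 = 2 * U3 * V3"
    by simp_all
qed

lemma ev2_reduce:
  assumes "[:A ^ n:] * f = [:U:] + [:V:] * ramW A B + surf A B C * S"
    and w: "w\<^sup>2 = ev (disc_AC A B C) x" and A: "ev A x \<noteq> 0"
  defines "t \<equiv> (w - ev B x) / (2 * ev A x)"
  shows "ev2 x t (surf A B C) = 0" "ev U x + ev V x * w = ev A x ^ n * ev2 x t f"
proof -
  have At: "2 * ev A x * t = w - ev B x" using A by (simp add: t_def)
  have "4 * ev A x * ev2 x t (surf A B C) = (2 * ev A x * t + ev B x)\<^sup>2 - (ev B x ^ 2 - 4 * ev A x * ev C x)"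
    by (simp add: surf_def power2_eq_square algebra_simps)
  also have "\<dots> = 0" unfolding At using w by (simp add: disc_AC_def)
  finally show F: "ev2 x t (surf A B C) = 0" using A by simp
  have W: "ev2 x t (ramW A B) = w" using At by (simp add: ramW_def algebra_simps)
  show "ev U x + ev V x * w = ev A x ^ n * ev2 x t f"
    using arg_cong[OF assms(1), of "ev2 x t"] F W by (simp only: ev2_simps ev2_pCons) simp
qed

lemma odd_degree_not_square:
  fixes z :: "rat poly fract"
  assumes "odd (degree d)"
  shows "to_fract d \<noteq> z\<^sup>2"
proof
  assume eq: "to_fract d = z\<^sup>2"
  obtain a b where ab: "z = to_fract a / to_fract b" "b \<noteq> 0"
    by (metis Fract_conv_to_fract Fract_quot_of_fract snd_quot_of_fract_nonzero)
  have "to_fract (d * b\<^sup>2) = to_fract (a\<^sup>2)" using eq ab by (simp add: power_divide)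
  then have e: "d * b\<^sup>2 = a\<^sup>2" by (simp only: to_fract_eq_iff)
  have "d \<noteq> 0" using assms by auto
  then have "degree d + 2 * degree b = 2 * degree a"
    using arg_cong[OF e, of degree] ab(2) by (cases "a = 0") (simp_all add: degree_mult_eq degree_power_eq)
  then show False using assms by presburger
qed

lemma norm_nonzero:
  fixes D U V :: "rat poly"
  assumes D: "irreducible D" and "U\<^sup>2 - D * V\<^sup>2 = 0"
  shows "U = 0" "V = 0"
proof -
  have eq: "U\<^sup>2 = D * V\<^sup>2" using assms(2) by simp
  then have "V\<^sup>2 dvd U\<^sup>2" by simp
  then have "V dvd U" by simp
  then obtain m where m: "U = V * m" by blast
  show "V = 0"
  proof (rule ccontr)
    assume "V \<noteq> 0"
    then have "D = m * m" using eq unfolding m by (simp add: power2_eq_square)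
    then have "is_unit m" using irreducibleD[OF D] by blast
    then have "is_unit D" using \<open>D = m * m\<close> by (simp add: is_unit_mult_iff)
    then show False using D irreducible_not_unit by blast
  qed
  then show "U = 0" by (simp add: m)
qed

lemma KX_smult: "KX (smult c e) = smult (to_fract [:c:]) (KX e)"
proof -
  have "smult c e = [:c:] * e" by simp
  then have "KX (smult c e) = KX [:c:] * KX e" by (metis KX_simps(4))
  then show ?thesis by simp
qed

text \<open>The descent in the quadratic order leaves a constant times \<open>A ^ i\<close> with
  \<open>i \<le> 1\<close>. For \<open>i = 0\<close> the section is halved; for
  \<open>i = 1\<close>, \<open>twisted_class\<close> would make a polynomial of odd degree in T a
  square. The assumption \<open>lead\<close> collects what has to be known at infinity and is
  supplied for each family separately.\<close>

lemma descent_A: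
  fixes A B C :: "rat poly"
  defines "a2 \<equiv> [:coeff C 2, coeff B 2, coeff A 2:]" and "a4 \<equiv> [:coeff C 1, coeff B 1, coeff A 1:]"
    and "a6 \<equiv> [:coeff C 0, coeff B 0, coeff A 0:]"
  defines "D \<equiv> disc_AC A B C"
  assumes A: "A \<noteq> 0" "degree A \<le> 1" and BC: "degree B \<le> 2" "degree (C - monom 1 3) \<le> 2"
    and D: "irreducible D" "degree D > 1"
    and smooth: "smooth_surface a2 a4 a6" and t: "triple a2 a4 a6 p q r" and r: "r \<noteq> 0"
    and lead: "\<And>n U V S. even n \<Longrightarrow> [:A ^ n:] * sec1 p q = [:U:] + [:V:] * ramW A B + surf A B C * S \<Longrightarrow>
      even (degree (U\<^sup>2 - D * V\<^sup>2)) \<and> (\<exists>s. lead_coeff (U\<^sup>2 - D * V\<^sup>2) = s\<^sup>2)"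
  shows "\<exists>p' q' r'. triple a2 a4 a6 p' q' r' \<and>
    4 * r'\<^sup>2 * q'\<^sup>2 * p = q\<^sup>2 * double_num a2 a4 p' q' r'"
proof -
  let ?F = "surf A B C" and ?W = "ramW A B" and ?f = "to_fract :: rat poly \<Rightarrow> rat poly fract"
  have F: "cubic a2 a4 a6 = ?F" unfolding a2_def a4_def a6_def surf_def using A BC by (intro cubic_surf) auto
  define k where "k = degree p + degree q"
  define n where "n = 2 * k"
  define n2 where "n2 = 4 * k + 2"
  define n3 where "n3 = 3 * k + 1"
  let ?s1 = "sec1 p q" and ?s2 = "sec2 a2 a4 p q"
  have pk: "degree p \<le> 2 * k" "degree q \<le> k" by (simp_all add: k_def)
  have dega: "degree a2 \<le> 2" "degree a4 \<le> 2" "degree a6 \<le> 2"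
    by (simp_all add: a2_def a4_def a6_def degree_pCons_eq_if)
  have d1: "degree ?s1 \<le> n" using degree_sec1[of p q] pk by (simp add: n_def)
  have d2: "degree ?s2 \<le> n2" using degree_sec2[OF dega(1,2), of p "2 * k" q] pk by (simp add: n2_def)
  have d3: "degree (inT r) \<le> n3"
    using degree_triple_r[OF t dega pk] degree_inT[of r] by (simp add: n3_def)
  obtain U V S1 where S1: "[:A ^ n:] * ?s1 = [:U:] + [:V:] * ?W + ?F * S1"
    using pseudo_reduce[OF d1] by blast
  obtain U2 V2 S2 where S2: "[:A ^ n2:] * ?s2 = [:U2:] + [:V2:] * ?W + ?F * S2"
    using pseudo_reduce[OF d2] by blast
  obtain \<rho> \<sigma> S3 where S3: "[:A ^ n3:] * inT r = [:\<rho>:] + [:\<sigma>:] * ?W + ?F * S3"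
    using pseudo_reduce[OF d3] by blast
  have nn: "A ^ n * A ^ n2 = (A ^ n3)\<^sup>2"
    unfolding n_def n2_def n3_def power_add[symmetric] power_mult[symmetric] by (rule arg_cong) simp
  have prod: "U * U2 + D * V * V2 = \<rho>\<^sup>2 + D * \<sigma>\<^sup>2" "U * V2 + V * U2 = 2 * \<rho> * \<sigma>"
    using reduce_product[OF A(1) S1 S2 S3 sec1_mult_sec2[OF t, unfolded F] nn] by (simp_all add: D_def)
  have nocommon: "ev U2 x + ev V2 x * w \<noteq> 0"
    if "w\<^sup>2 = ev D x" "ev A x \<noteq> 0" "ev U x + ev V x * w = 0" for x w
  proof
    assume z: "ev U2 x + ev V2 x * w = 0"
    define s where "s = (w - ev B x) / (2 * ev A x)"
    note w = that(1)[unfolded D_def]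
    have "ev2 x s ?F = 0" using ev2_reduce(1)[OF S1 w that(2)] by (simp add: s_def)
    moreover have "ev2 x s ?s1 = 0" using ev2_reduce(2)[OF S1 w that(2)] that by (simp add: s_def)
    moreover have "ev2 x s ?s2 = 0" using ev2_reduce(2)[OF S2 w that(2)] that z by (simp add: s_def)
    ultimately show False using sec_no_common_zero[OF smooth t, of x s] by (simp add: F)
  qed
  \<comment> \<open>A common zero of \<open>A\<close> and \<open>B\<close> is a zero of the
    irreducible \<open>D\<close>, which would then divide \<open>A\<close> in spite of its larger
    degree.\<close>
  have Broot: "ev B x \<noteq> 0" if "ev A x = 0" for x
  proof
    assume "ev B x = 0"
    then have "ev D x = 0" using that by (simp add: D_def disc_AC_def)
    then have "D dvd A" using irreducible_dvd_of_common_root[OF D(1)] that by blast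
    then have "degree D \<le> degree A" using A(1) by (rule dvd_imp_degree_le)
    then show False using D(2) A(2) by simp
  qed
  define N1 where "N1 = U\<^sup>2 - D * V\<^sup>2"
  \<comment> \<open>If the norm vanishes, then so do \<open>\<rho>\<close> and
    \<open>\<sigma>\<close>, hence \<open>r\<close> vanishes on the surface away from the zero of
    \<open>A\<close>. This covers all values of T but finitely many.\<close>
  have N1: "N1 \<noteq> 0"
  proof
    assume "N1 = 0"
    then have UV: "U = 0" "V = 0" using norm_nonzero[OF D(1)] unfolding N1_def by blast+
    have D0: "D \<noteq> 0" using D(1) by auto
    have "\<rho>\<^sup>2 + D * \<sigma>\<^sup>2 = 0" "\<rho> * \<sigma> = 0" using prod UV by simp_all
    then have z: "\<rho> = 0" "\<sigma> = 0" using D0 by auto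
    have "ev r s = 0" if s: "s \<notin> (\<lambda>x. - ev C x / ev B x) ` {x. ev A x = 0}" for s
    proof -
      obtain x where x: "ev2 x s ?F = 0" using cubic_root_exists F by metis
      have Ax: "ev A x \<noteq> 0"
      proof
        assume Ax: "ev A x = 0"
        then have "ev C x + s * ev B x = 0" using x by (simp add: surf_def)
        then have "s = - ev C x / ev B x" using Broot[OF Ax] by (simp add: field_simps add_eq_0_iff)
        then show False using s Ax by blast
      qed
      define w where "w = ev B x + 2 * ev A x * s"
      have "w\<^sup>2 = ev D x + 4 * ev A x * ev2 x s ?F"
        by (simp add: w_def D_def disc_AC_def surf_def power2_eq_square algebra_simps)
      then have w: "w\<^sup>2 = ev (disc_AC A B C) x" using x by (simp add: D_def)
      have "(w - ev B x) / (2 * ev A x) = s" using Ax by (simp add: w_def)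
      then have "ev A x ^ n3 * ev r s = 0" using ev2_reduce(2)[OF S3 w Ax] z by simp
      then show ?thesis using Ax by simp
    qed
    moreover have "finite {x. ev A x = 0}"
    proof -
      have "map_poly of_rat A \<noteq> (0 :: complex poly)" using A(1) by (simp add: map_poly_eq_0_iff)
      then show ?thesis unfolding ev_def by (rule poly_roots_finite)
    qed
    ultimately have "r = 0" by (intro ev_zero_imp_zero[of "(\<lambda>x. - ev C x / ev B x) ` {x. ev A x = 0}"]) auto
    then show False using r by simp
  qed
  have "even n" by (simp add: n_def)
  from lead[OF this S1] obtain s where s: "even (degree N1)" "lead_coeff N1 = s\<^sup>2"
    unfolding N1_def by blast
  obtain c i u v where c: "c \<noteq> 0" "i \<le> 1" "degree A = 0 \<longrightarrow> i = 0"
    and uv: "smult c (A ^ i) * U = u\<^sup>2 + D * v\<^sup>2" "smult c (A ^ i) * V = 2 * u * v"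
  proof -
    have "\<exists>c i u v. c \<noteq> 0 \<and> i \<le> 1 \<and> (degree A = 0 \<longrightarrow> i = 0) \<and>
      smult c (A ^ i) * U = u\<^sup>2 + D * v\<^sup>2 \<and> smult c (A ^ i) * V = 2 * u * v"
      by (rule quadratic_order_descent[OF D(1) A prod nocommon N1_def N1 s])
    then show ?thesis using that by (elim exE conjE)
  qed
  define H where "H = [:u:] + [:v:] * ?W"
  define S where "S = [:smult c (A ^ i):] * S1 - [:v\<^sup>2:] * [:smult 4 A:]"
  have eq: "[:smult c (A ^ i):] * ([:A ^ n:] * ?s1) = H\<^sup>2 + ?F * S"
  proof -
    have gen: "a * (U' + V' * W + G * S1) = (u' + v' * W)\<^sup>2 + G * (a * S1 - v'\<^sup>2 * g)"
      if "a * U' = u'\<^sup>2 + D' * v'\<^sup>2" "a * V' = 2 * u' * v'" "W\<^sup>2 = D' + G * g"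
      for a U' V' W G u' v' D' g :: "rat poly poly"
    proof -
      have "a * (U' + V' * W + G * S1) = a * U' + (a * V') * W + G * (a * S1)" by (simp add: algebra_simps)
      also have "\<dots> = u'\<^sup>2 + (W\<^sup>2 - G * g) * v'\<^sup>2 + 2 * u' * v' * W + G * (a * S1)"
        unfolding that(1,2) that(3) by (simp add: algebra_simps)
      finally show ?thesis by (simp add: power2_eq_square algebra_simps)
    qed
    have two: "(2::rat poly poly) = [:2:]" by (simp add: numeral_poly)
    have "[:smult c (A ^ i):] * [:U:] = [:u:]\<^sup>2 + [:D:] * [:v:]\<^sup>2" "[:smult c (A ^ i):] * [:V:] = 2 * [:u:] * [:v:]"
      using uv unfolding two by (simp_all add: power2_eq_square mult.commute)
    from gen[OF this ramW_square[of A B C, folded D_def]] show ?thesis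
      unfolding S1 H_def S_def by (simp add: power2_eq_square)
  qed
  let ?FK = "[:?f a6, ?f a4, ?f a2, 1:]"
  have FK: "toKX (cubic a2 a4 a6) = ?FK" by (simp add: cubic_def eval_nat_numeral algebra_simps)
  \<comment> \<open>At the zero \<open>x0\<close> of \<open>A\<close> the cubic has the value
    \<open>C(x0) + B(x0) T\<close>, of degree one in T. It is non-zero, which makes \<open>A\<close>
    a unit modulo the cubic, and it is no square.\<close>
  have linear: "\<exists>b x0. b \<noteq> 0 \<and> KX A = smult (?f [:b:]) [:- ?f [:x0:], 1:] \<and>
      poly ?FK (?f [:x0:]) = ?f [:poly C x0, poly B x0:] \<and> poly B x0 \<noteq> 0" if A1: "degree A = 1"
  proof -
    define b where "b = coeff A 1"
    define x0 where "x0 = - coeff A 0 / b"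
    have b: "b \<noteq> 0" using A1 unfolding b_def by (metis leading_coeff_0_iff degree_0 zero_neq_one)
    have A': "A = [:- x0 * b, b:]"
      using A1 b by (auto simp: poly_eq_iff coeff_pCons coeff_eq_0 b_def x0_def split: nat.splits)
    have KA: "KX A = smult (?f [:b:]) [:- ?f [:x0:], 1:]"
    proof -
      have "[:- x0 * b, b:] = smult b [:- x0, 1:]" by simp
      moreover have "?f [:1::rat:] = 1" by (metis one_pCons to_fract_1)
      moreover have "?f [:- x0:] = - ?f [:x0:]" by (metis minus_pCons minus_zero to_fract_uminus)
      ultimately show ?thesis unfolding A' by (simp only: KX_smult KX_pCons KX_simps) simp
    qed
    have rt: "poly A x0 = 0" unfolding A' by simp
    have B: "poly B x0 = coeff B 0 + x0 * (coeff B 1 + x0 * coeff B 2)"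
      by (subst quadratic_poly_eq[OF BC(1)]) simp
    have Cx: "poly C x0 = coeff C 0 + x0 * (coeff C 1 + x0 * (coeff C 2 + x0))"
      by (subst monic_cubic_eq[OF BC(2)]) simp
    have A2: "coeff A 2 = 0" using A1 by (simp add: coeff_eq_0)
    have "a6 + [:x0:] * (a4 + [:x0:] * (a2 + [:x0:])) = [:poly C x0, poly B x0, poly A x0:]"
      unfolding a2_def a4_def a6_def B Cx A2 using A2 by (simp add: A' algebra_simps)
    then have "?f (a6 + [:x0:] * (a4 + [:x0:] * (a2 + [:x0:]))) = ?f [:poly C x0, poly B x0:]"
      by (simp add: rt)
    moreover have "poly ?FK z = ?f a6 + z * (?f a4 + z * (?f a2 + z))" for z by simp
    ultimately have P: "poly ?FK (?f [:x0:]) = ?f [:poly C x0, poly B x0:]"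
      by (simp only: to_fract_add to_fract_mult)
    have "ev A (of_rat x0) = 0" by (simp add: ev_of_rat rt)
    then have "ev B (of_rat x0) \<noteq> 0" by (rule Broot)
    then have "poly B x0 \<noteq> 0" by (simp add: ev_of_rat)
    then show ?thesis using b KA P by blast
  qed
  show ?thesis
  proof (cases "i = 0")
    case True
    have "[:smult c ((A ^ k)\<^sup>2):] * ?s1 = [:smult c (A ^ i):] * ([:A ^ n:] * ?s1)"
      using True by (simp add: n_def mult.commute flip: power_mult)
    then have eq': "[:smult c ((A ^ k)\<^sup>2):] * ?s1 = H\<^sup>2 + cubic a2 a4 a6 * S" using eq F by simp
    have "\<exists>u v. u * KX A + v * toKX (cubic a2 a4 a6) = 1"
    proof (cases "degree A = 0")
      case True
      then obtain a where a: "A = [:a:]" by (metis degree_eq_zeroE)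
      then have "[:?f [:1 / a:]:] * KX A + 0 * toKX (cubic a2 a4 a6) = [:?f ([:1 / a:] * [:a:]):]"
        by (simp only: to_fract_mult) simp
      also have "\<dots> = 1" using A(1) a by (simp add: one_pCons[symmetric])
      finally show ?thesis by blast
    next
      case False
      then have A1: "degree A = 1" using A by simp
      obtain b x0 where b: "b \<noteq> 0" "KX A = smult (?f [:b:]) [:- ?f [:x0:], 1:]"
        "poly ?FK (?f [:x0:]) = ?f [:poly C x0, poly B x0:]" "poly B x0 \<noteq> 0" using linear[OF A1] by blast
      have "poly ?FK (?f [:x0:]) \<noteq> 0" unfolding b(3) using b(4) by (simp only: to_fract_eq_0_iff) simp
      then obtain u1 v1 where uv1: "u1 * [:- ?f [:x0:], 1:] + v1 * ?FK = 1" using linear_unit by blast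
      have "smult (1 / ?f [:b:]) u1 * KX A = u1 * [:- ?f [:x0:], 1:]"
        unfolding b(2) using b(1) by (simp only: mult_smult_left mult_smult_right smult_smult) simp
      then have "smult (1 / ?f [:b:]) u1 * KX A + v1 * toKX (cubic a2 a4 a6) = 1"
        unfolding FK using uv1 by (simp only:)
      then show ?thesis by blast
    qed
    then obtain u' v' where "u' * KX A ^ k + v' * toKX (cubic a2 a4 a6) = 1"
      using unit_mod_power by blast
    then have unit: "u' * KX (A ^ k) + v' * toKX (cubic a2 a4 a6) = 1" by (simp only: KX_simps)
    show ?thesis by (rule half_section[OF t r c(1) eq' unit])
  next
    case False
    then have i1: "i = 1" "degree A = 1" using c(2,3) A(2) by linarith+
    obtain b x0 where b: "b \<noteq> 0" "KX A = smult (?f [:b:]) [:- ?f [:x0:], 1:]"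
      "poly ?FK (?f [:x0:]) = ?f [:poly C x0, poly B x0:]" "poly B x0 \<noteq> 0" using linear[OF i1(2)] by blast
    let ?L = "[:- ?f [:x0:], 1:]" and ?d = "[:poly C x0, poly B x0:]"
    have q: "q \<noteq> 0" "?f q \<noteq> 0" and
      r2: "r\<^sup>2 = p ^ 3 + a2 * p\<^sup>2 * q\<^sup>2 + a4 * p * q ^ 4 + a6 * q ^ 6" using t by (simp_all add: triple_def)
    define x where "x = ?f p / ?f q ^ 2"
    define y where "y = ?f r / ?f q ^ 3"
    have x: "?f p = x * ?f q ^ 2" using q by (simp add: x_def)
    have y: "?f r = y * ?f q ^ 3" using q by (simp add: y_def)
    have y0: "y \<noteq> 0" using r q by (simp add: y_def)
    have "?f (r\<^sup>2) = ?f q ^ 6 * (x ^ 3 + ?f a2 * x\<^sup>2 + ?f a4 * x + ?f a6)"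
      unfolding r2 by (simp add: x eval_nat_numeral algebra_simps)
    moreover have "?f (r\<^sup>2) = ?f q ^ 6 * y\<^sup>2" by (simp add: y power_mult_distrib flip: power_mult)
    ultimately have curve: "y\<^sup>2 = x ^ 3 + ?f a2 * x\<^sup>2 + ?f a4 * x + ?f a6" using q by simp
    define e where "e = smult (c * b ^ Suc (2 * k)) (q\<^sup>2)"
    have e0: "e \<noteq> 0" using c(1) b(1) q by (simp add: e_def)
    have "toKX [:smult c (A ^ i):] * (toKX [:A ^ n:] * toKX ?s1) = (toKX H)\<^sup>2 + toKX ?F * toKX S"
      using arg_cong[OF eq, of toKX] by (simp only: toKX_simps)
    moreover have "toKX ?s1 = smult (?f (q\<^sup>2)) [:x, -1:]"
      by (simp only: sec1_def toKX_simps toKX_inT toKX_varX) (simp add: x mult.commute)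
    moreover have "toKX [:smult c (A ^ i):] = smult (?f [:c:]) (KX A)" by (simp add: KX_smult i1)
    moreover have "toKX [:A ^ n:] = KX A ^ n" by simp
    moreover have "smult (?f [:c:]) (KX A) * (KX A ^ n * smult (?f (q\<^sup>2)) [:x, -1:])
        = smult (?f e) (?L ^ Suc (2 * k) * [:x, -1:])"
    proof -
      have "?f (smult z (q\<^sup>2)) = ?f [:z:] * ?f (q\<^sup>2)" for z
        by (metis (no_types) mult_pCons_left mult_zero_left pCons_0_0 add.right_neutral to_fract_mult)
      then have "?f e = ?f [:c * b ^ Suc (2 * k):] * ?f (q\<^sup>2)" by (simp only: e_def)
      also have "[:c * b ^ Suc (2 * k):] = [:c:] * [:b:] ^ Suc (2 * k)" by (simp add: poly_const_pow)
      finally have fe: "?f e = ?f [:c:] * ?f [:b:] ^ Suc (2 * k) * ?f (q\<^sup>2)" by (simp only: to_fract_mult to_fract_power)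
      have "smult c' M * (M ^ n * smult z Y) = smult (c' * z) (M ^ Suc (2 * k) * Y)" for c' z :: "rat poly fract" and M Y
        by (simp add: n_def mult_ac)
      moreover have "KX A ^ Suc (2 * k) = smult (?f [:b:] ^ Suc (2 * k)) (?L ^ Suc (2 * k))"
        unfolding b(2) by (rule smult_power)
      ultimately have "smult (?f [:c:]) (KX A) * (KX A ^ n * smult (?f (q\<^sup>2)) [:x, -1:])
          = smult (?f [:c:] * ?f (q\<^sup>2) * ?f [:b:] ^ Suc (2 * k)) (?L ^ Suc (2 * k) * [:x, -1:])"
        by (simp only: mult_smult_left smult_smult)
      also have "?f [:c:] * ?f (q\<^sup>2) * ?f [:b:] ^ Suc (2 * k) = ?f e"
        using fe by (simp only: mult_ac)
      finally show ?thesis .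
    qed
    ultimately have "smult (?f e) (?L ^ Suc (2 * k) * [:x, -1:]) = (toKX H)\<^sup>2 + ?FK * toKX S"
      unfolding FK[symmetric] F by (simp only:)
    then have dvd: "?FK dvd smult (?f e) (?L ^ Suc (2 * k) * [:x, -1:]) - (toKX H)\<^sup>2"
      by (metis add_diff_cancel_left' dvd_triv_left)
    have d0: "?f ?d \<noteq> 0" using b(4) by (simp only: to_fract_eq_0_iff) simp
    have "?f e \<noteq> 0" using e0 by simp
    from twisted_class[OF refl curve y0 this b(3)[symmetric] d0 dvd]
    have "(\<exists>z. ?f ?d = z\<^sup>2) \<or> (\<exists>z. ?f (- e * ?d) = z\<^sup>2)" by (simp only: to_fract_mult to_fract_uminus)
    moreover have "odd (degree ?d)" using b(4) by simp
    \<comment> \<open>\<open>e\<close> is a constant times \<open>q\<^sup>2\<close> and does not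
      change the parity of the degree.\<close>
    moreover have "odd (degree (- e * ?d))"
    proof -
      have "degree (- e * ?d) = degree e + 1" using e0 b(4) by (subst degree_mult_eq) auto
      moreover have "degree e = 2 * degree q" using c(1) b(1) q by (simp add: e_def degree_power_eq)
      ultimately show ?thesis by simp
    qed
    ultimately show ?thesis using odd_degree_not_square by blast
  qed
qed

section \<open>Leading terms of sections at T = infinity\<close>

text \<open>\<open>c\<close> may be zero, so leading terms can be added and multiplied before it is
  known whether they cancel.\<close>

definition top :: "nat \<Rightarrow> rat poly \<Rightarrow> rat \<Rightarrow> bool" where
  "top n f c \<longleftrightarrow> degree f \<le> n \<and> coeff f n = c"

lemma top_mult:
  assumes "top m f c" "top n g d"
  shows "top (m + n) (f * g) (c * d)"
proof -
  have deg: "degree (f * g) \<le> m + n"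
    using degree_mult_le[of f g] assms by (simp add: top_def)
  have "coeff (f * g) (m + n) = c * d"
  proof (cases "degree f = m \<and> degree g = n")
    case True
    then show ?thesis using coeff_mult_degree_sum[of f g] assms by (auto simp: top_def)
  next
    case False
    then have "degree f < m \<or> degree g < n" using assms by (auto simp: top_def)
    moreover have "degree (f * g) < m + n"
      using degree_mult_le[of f g] calculation assms by (auto simp: top_def)
    ultimately show ?thesis using assms by (auto simp: top_def coeff_eq_0)
  qed
  then show ?thesis using deg by (simp add: top_def)
qed

lemma top_add: "top n f c \<Longrightarrow> top n g d \<Longrightarrow> top n (f + g) (c + d)"
  by (simp add: top_def degree_add_le)

lemma top_diff: "top n f c \<Longrightarrow> top n g d \<Longrightarrow> top n (f - g) (c - d)"
  by (simp add: top_def degree_diff_le)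

lemma top_power: "top m f c \<Longrightarrow> top (k * m) (f ^ k) (c ^ k)"
proof (induction k)
  case 0
  then show ?case by (simp add: top_def)
next
  case (Suc k)
  from top_mult[OF Suc.prems Suc.IH[OF Suc.prems]] show ?case by simp
qed

lemma top_raise: "top m f c \<Longrightarrow> m < n \<Longrightarrow> top n f 0"
  by (auto simp: top_def coeff_eq_0)

lemma top_cast: "top m f c \<Longrightarrow> m = n \<Longrightarrow> c = d \<Longrightarrow> top n f d"
  by simp

lemma top_lead: "top (degree f) f (lead_coeff f)"
  by (simp add: top_def)

lemma top_numeral_mult: "top m f c \<Longrightarrow> top m (numeral k * f) (numeral k * c)"
  using top_mult[of 0 "numeral k" "numeral k" m f c] by (simp add: top_def numeral_poly)

lemma top_unique: "top m f c \<Longrightarrow> top m f d \<Longrightarrow> c = d"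
  by (simp add: top_def)

lemma top_nonzero: "top m f c \<Longrightarrow> c \<noteq> 0 \<Longrightarrow> degree f = m"
  by (simp add: top_def le_antisym le_degree)

lemma tripleD:
  assumes "triple a2 a4 a6 p q r"
  shows "q \<noteq> 0" "coprime p q" "r\<^sup>2 = p ^ 3 + a2 * p\<^sup>2 * q\<^sup>2 + a4 * p * q ^ 4 + a6 * q ^ 6"
  using assms by (simp_all add: triple_def)

text \<open>If \<open>p / q\<^sup>2\<close> has at least a double pole at infinity,
  \<open>p ^ 3\<close> dominates the other terms.\<close>

lemma degree_r_high:
  assumes t: "triple a2 a4 a6 p q r" and a: "degree a2 \<le> 1" "degree a4 \<le> 2" "degree a6 \<le> 2"
    and p: "degree p \<ge> 2 * degree q + 2"
  shows "2 * degree r = 3 * degree p"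
proof -
  let ?d = "degree p" and ?e = "degree q"
  have A: "top 1 a2 (coeff a2 1)" "top 2 a4 (coeff a4 2)" "top 2 a6 (coeff a6 2)"
    using a by (simp_all add: top_def)
  note P = top_lead[of p] and Q = top_lead[of q]
  have 1: "top (3 * ?d) (p ^ 3) (lead_coeff p ^ 3)" by (rule top_power[OF P])
  have 2: "top (3 * ?d) (a2 * p\<^sup>2 * q\<^sup>2) 0"
    by (rule top_raise[OF top_mult[OF top_mult[OF A(1) top_power[OF P]] top_power[OF Q]]]) (use p in simp)
  have 3: "top (3 * ?d) (a4 * p * q ^ 4) 0"
    by (rule top_raise[OF top_mult[OF top_mult[OF A(2) P] top_power[OF Q]]]) (use p in simp)
  have 4: "top (3 * ?d) (a6 * q ^ 6) 0"
    by (rule top_raise[OF top_mult[OF A(3) top_power[OF Q]]]) (use p in simp)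
  have "top (3 * ?d) (r\<^sup>2) (lead_coeff p ^ 3)"
    unfolding tripleD(3)[OF t] using top_add[OF top_add[OF top_add[OF 1 2] 3] 4] by simp
  moreover have "lead_coeff p ^ 3 \<noteq> 0" using p by auto
  ultimately have "degree (r\<^sup>2) = 3 * ?d" by (rule top_nonzero)
  moreover have "r \<noteq> 0" using \<open>degree (r\<^sup>2) = 3 * ?d\<close> p by auto
  ultimately show ?thesis by (simp add: degree_power_eq)
qed

text \<open>If the pole is at most simple, the first three terms can all reach degree
  \<open>6 * degree q + 3\<close>, while the term with \<open>a6\<close> stays below.\<close>

lemma top_r_square:
  assumes t: "triple a2 a4 a6 p q r"
    and a: "top 1 a2 b2" "top 2 a4 a1" "degree a6 \<le> 2"
    and p: "top (2 * degree q + 1) p l"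
  shows "top (6 * degree q + 3) (r\<^sup>2) (l ^ 3 + b2 * l\<^sup>2 * (lead_coeff q)\<^sup>2 + a1 * l * lead_coeff q ^ 4)"
proof -
  let ?e = "degree q" and ?m = "lead_coeff q"
  note Q = top_lead[of q]
  have A: "top 2 a6 (coeff a6 2)" using a by (simp add: top_def)
  have 1: "top (6 * ?e + 3) (p ^ 3) (l ^ 3)" by (rule top_cast[OF top_power[OF p]]) simp_all
  have 2: "top (6 * ?e + 3) (a2 * p\<^sup>2 * q\<^sup>2) (b2 * l\<^sup>2 * ?m\<^sup>2)"
    by (rule top_cast[OF top_mult[OF top_mult[OF a(1) top_power[OF p]] top_power[OF Q]]]) simp_all
  have 3: "top (6 * ?e + 3) (a4 * p * q ^ 4) (a1 * l * ?m ^ 4)"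
    by (rule top_cast[OF top_mult[OF top_mult[OF a(2) p] top_power[OF Q]]]) simp_all
  have 4: "top (6 * ?e + 3) (a6 * q ^ 6) 0"
    by (rule top_raise[OF top_mult[OF A top_power[OF Q]]]) simp
  show ?thesis
    unfolding tripleD(3)[OF t] using top_add[OF top_add[OF top_add[OF 1 2] 3] 4] by simp
qed

lemma degree_double_low:
  assumes t: "triple a2 a4 a6 p q r"
    and a: "top 1 a2 b2" "top 2 a4 a1"
    and p: "top (2 * degree q + 1) p l" and r: "degree r = 0"
    and nz: "3 * l\<^sup>2 + 2 * b2 * l * (lead_coeff q)\<^sup>2 + a1 * lead_coeff q ^ 4 \<noteq> 0"
  shows "degree (double_num a2 a4 p q r) = 4 + 8 * degree q"
proof -
  let ?e = "degree q" and ?m = "lead_coeff q"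
  note Q = top_lead[of q]
  let ?t = "3 * l\<^sup>2 + 2 * b2 * l * ?m\<^sup>2 + a1 * ?m ^ 4"
  have 1: "top (4 * ?e + 2) (3 * p\<^sup>2) (3 * l\<^sup>2)"
    by (rule top_cast[OF top_numeral_mult[OF top_power[OF p]]]) simp_all
  have 2: "top (4 * ?e + 2) (2 * a2 * p * q\<^sup>2) (2 * b2 * l * ?m\<^sup>2)"
    by (rule top_cast[OF top_mult[OF top_mult[OF top_numeral_mult[OF a(1)] p] top_power[OF Q]]]) simp_all
  have 3: "top (4 * ?e + 2) (a4 * q ^ 4) (a1 * ?m ^ 4)"
    by (rule top_cast[OF top_mult[OF a(2) top_power[OF Q]]]) simp_all
  have tan: "top (4 * ?e + 2) (tangent_num a2 a4 p q) ?t"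
    unfolding tangent_num_def by (rule top_add[OF top_add[OF 1 2] 3])
  have 4: "top (8 * ?e + 4) ((tangent_num a2 a4 p q)\<^sup>2) (?t\<^sup>2)"
    by (rule top_cast[OF top_power[OF tan]]) simp_all
  have 5: "top (2 * ?e + 1) (a2 * q\<^sup>2) (b2 * ?m\<^sup>2)"
    by (rule top_cast[OF top_mult[OF a(1) top_power[OF Q]]]) simp_all
  have 6: "top (2 * ?e + 1) (2 * p) (2 * l)" by (rule top_numeral_mult[OF p])
  have 7: "top 0 r (coeff r 0)" using r by (simp add: top_def)
  have 8: "top (8 * ?e + 4) (4 * (a2 * q\<^sup>2 + 2 * p) * r\<^sup>2) 0"
    by (rule top_raise[OF top_mult[OF top_numeral_mult[OF top_add[OF 5 6]] top_power[OF 7]]]) simp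
  have "top (8 * ?e + 4) (double_num a2 a4 p q r) (?t\<^sup>2)"
    unfolding double_num_def using top_diff[OF 4 8] by simp
  then have "degree (double_num a2 a4 p q r) = 8 * ?e + 4" by (rule top_nonzero) (use nz in simp)
  then show ?thesis by simp
qed

text \<open>A constant \<open>r\<close> contributes nothing in degree
  \<open>6 * degree q + 3\<close>, so the leading form of the right-hand side must vanish at
  \<open>l\<close>.\<close>

lemma low_cases:
  assumes t: "triple a2 a4 a6 p q r" and a: "top 1 a2 b2" "top 2 a4 a1" "degree a6 \<le> 2"
    and r: "degree r = 0"
  obtains l where "top (2 * degree q + 1) p l" "l * (l\<^sup>2 + b2 * l * (lead_coeff q)\<^sup>2 + a1 * lead_coeff q ^ 4) = 0"
proof -
  have "\<not> degree p \<ge> 2 * degree q + 2"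
    using degree_r_high[OF t] a r by (auto simp: top_def)
  then have "top (2 * degree q + 1) p (coeff p (2 * degree q + 1))" by (simp add: top_def)
  note p = this
  have "top 0 r (coeff r 0)" using r by (simp add: top_def)
  from top_raise[OF top_power[OF this], of 2 "6 * degree q + 3"]
  have "top (6 * degree q + 3) (r\<^sup>2) 0" by simp
  from top_unique[OF top_r_square[OF t a p] this] show ?thesis
    using that[OF p] by (simp add: algebra_simps power2_eq_square power3_eq_cube)
qed

text \<open>A non-zero \<open>l\<close> would make \<open>- a1\<close> the square of
  \<open>l / m\<^sup>2\<close> for \<open>m = lead_coeff q\<close>. With \<open>l = 0\<close> the
  leading coefficient of \<open>tangent_num\<close> is \<open>a1 * m ^ 4\<close>.\<close>

lemma low_linear:
  assumes t: "triple a2 a4 a6 p q r" and a: "top 1 a2 0" "top 2 a4 a1" "degree a6 \<le> 2"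
    and a1: "\<And>s. - a1 \<noteq> s\<^sup>2" and r: "degree r = 0"
  shows "degree (double_num a2 a4 p q r) = 4 + 8 * degree q"
proof -
  obtain l where p: "top (2 * degree q + 1) p l" and l: "l * (l\<^sup>2 + a1 * lead_coeff q ^ 4) = 0"
    using low_cases[OF t a r] by auto
  have q: "lead_coeff q \<noteq> 0" using tripleD(1)[OF t] by simp
  have "l = 0"
  proof (rule ccontr)
    assume "l \<noteq> 0"
    then have "l\<^sup>2 = - a1 * lead_coeff q ^ 4" using l by (simp add: eq_neg_iff_add_eq_0)
    then have "- a1 = l\<^sup>2 / lead_coeff q ^ 4" using q nonzero_eq_divide_eq[of "lead_coeff q ^ 4"] by simp
    then have "- a1 = (l / (lead_coeff q)\<^sup>2)\<^sup>2" by (simp add: power_divide flip: power_mult)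
    then show False using a1 by blast
  qed
  moreover have "a1 \<noteq> 0" using a1[of 0] by auto
  ultimately show ?thesis using degree_double_low[OF t a(1,2) p r] q by simp
qed

text \<open>Here \<open>l\<close> is 0 or \<open>- b2 * m\<^sup>2\<close> with
  \<open>m = lead_coeff q\<close>. The second value gives \<open>tangent_num\<close> the leading
  coefficient \<open>b2\<^sup>2 * m ^ 4\<close>. The first lowers the degree of \<open>p\<close>,
  and then a coefficient of \<open>r\<^sup>2\<close> in positive degree is non-zero, against the
  constancy of \<open>r\<close>: it comes from \<open>a6\<close> if this has degree 2, and otherwise
  from a value of the quadratic polynomial in \<open>a6\<close>.\<close>

lemma low_quadratic:
  assumes t: "triple a2 a4 a6 p q r" and a: "top 1 a2 b2" "top 1 a4 b1" "degree a6 \<le> 2" "b2 \<noteq> 0"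
    and a6: "\<And>x. coeff a6 2 = 0 \<Longrightarrow> b2 * x\<^sup>2 + b1 * x + coeff a6 1 \<noteq> 0"
    and r: "degree r = 0"
  shows "degree (double_num a2 a4 p q r) = 4 + 8 * degree q"
proof -
  let ?e = "degree q" and ?m = "lead_coeff q"
  have a4: "top 2 a4 0" by (rule top_raise[OF a(2)]) simp
  obtain l where p: "top (2 * ?e + 1) p l" and l: "l * (l\<^sup>2 + b2 * l * ?m\<^sup>2) = 0"
    using low_cases[OF t a(1) a4 a(3) r] by auto
  have q: "?m \<noteq> 0" using tripleD(1)[OF t] by simp
  have r0: "top 0 r (coeff r 0)" using r by (simp add: top_def)
  show ?thesis
  proof (cases "l = 0")
    case False
    then have "l\<^sup>2 + b2 * l * ?m\<^sup>2 = 0" using l by simp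
    then have "l * (l + b2 * ?m\<^sup>2) = 0" by (simp add: power2_eq_square algebra_simps)
    then have l': "l = - (b2 * ?m\<^sup>2)" using False by (simp add: eq_neg_iff_add_eq_0)
    have "3 * l\<^sup>2 + 2 * b2 * l * ?m\<^sup>2 + 0 * ?m ^ 4 = (b2 * ?m\<^sup>2)\<^sup>2"
      unfolding l' by (simp add: power2_eq_square algebra_simps)
    also have "\<dots> \<noteq> 0" using q a(4) by simp
    finally show ?thesis by (rule degree_double_low[OF t a(1) a4 p r])
  next
    case True
    have "degree p \<le> 2 * ?e"
    proof (rule ccontr)
      assume "\<not> degree p \<le> 2 * ?e"
      then have "degree p = 2 * ?e + 1" using p by (simp add: top_def)
      then have "lead_coeff p = 0" using p True by (simp add: top_def)
      then have "p = 0" by (simp only: leading_coeff_0_iff)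
      then show False using \<open>degree p = 2 * ?e + 1\<close> by simp
    qed
    then have p': "top (2 * ?e) p (coeff p (2 * ?e))" by (simp add: top_def)
    let ?x = "coeff p (2 * ?e)"
    note Q = top_lead[of q]
    show ?thesis
    proof (cases "coeff a6 2 = 0")
      case False
      have A: "top 2 a6 (coeff a6 2)" using a by (simp add: top_def)
      have 1: "top (6 * ?e + 2) (p ^ 3) 0" by (rule top_raise[OF top_power[OF p']]) simp
      have 2: "top (6 * ?e + 2) (a2 * p\<^sup>2 * q\<^sup>2) 0"
        by (rule top_raise[OF top_mult[OF top_mult[OF a(1) top_power[OF p']] top_power[OF Q]]]) simp
      have 3: "top (6 * ?e + 2) (a4 * p * q ^ 4) 0"
        by (rule top_raise[OF top_mult[OF top_mult[OF a(2) p'] top_power[OF Q]]]) simp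
      have 4: "top (6 * ?e + 2) (a6 * q ^ 6) (coeff a6 2 * ?m ^ 6)"
        by (rule top_cast[OF top_mult[OF A top_power[OF Q]]]) simp_all
      have "top (6 * ?e + 2) (r\<^sup>2) (coeff a6 2 * ?m ^ 6)"
        unfolding tripleD(3)[OF t] using top_add[OF top_add[OF top_add[OF 1 2] 3] 4] by simp
      moreover have "top (6 * ?e + 2) (r\<^sup>2) 0" by (rule top_raise[OF top_power[OF r0]]) simp
      ultimately have "coeff a6 2 * ?m ^ 6 = 0" by (rule top_unique)
      then show ?thesis using False q by simp
    next
      case True
      have "degree a6 \<le> 1"
      proof (rule ccontr)
        assume "\<not> degree a6 \<le> 1"
        then have "degree a6 = 2" using a(3) by simp
        then have "lead_coeff a6 = 0" using True by simp
        then have "a6 = 0" by (simp only: leading_coeff_0_iff)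
        then show False using \<open>degree a6 = 2\<close> by simp
      qed
      then have A: "top 1 a6 (coeff a6 1)" by (simp add: top_def)
      have 1: "top (6 * ?e + 1) (p ^ 3) 0" by (rule top_raise[OF top_power[OF p']]) simp
      have 2: "top (6 * ?e + 1) (a2 * p\<^sup>2 * q\<^sup>2) (b2 * ?x\<^sup>2 * ?m\<^sup>2)"
        by (rule top_cast[OF top_mult[OF top_mult[OF a(1) top_power[OF p']] top_power[OF Q]]]) simp_all
      have 3: "top (6 * ?e + 1) (a4 * p * q ^ 4) (b1 * ?x * ?m ^ 4)"
        by (rule top_cast[OF top_mult[OF top_mult[OF a(2) p'] top_power[OF Q]]]) simp_all
      have 4: "top (6 * ?e + 1) (a6 * q ^ 6) (coeff a6 1 * ?m ^ 6)"
        by (rule top_cast[OF top_mult[OF A top_power[OF Q]]]) simp_all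
      have "top (6 * ?e + 1) (r\<^sup>2) (b2 * ?x\<^sup>2 * ?m\<^sup>2 + b1 * ?x * ?m ^ 4 + coeff a6 1 * ?m ^ 6)"
        unfolding tripleD(3)[OF t] using top_add[OF top_add[OF top_add[OF 1 2] 3] 4] by simp
      moreover have "top (6 * ?e + 1) (r\<^sup>2) 0" by (rule top_raise[OF top_power[OF r0]]) simp
      ultimately have z: "b2 * ?x\<^sup>2 * ?m\<^sup>2 + b1 * ?x * ?m ^ 4 + coeff a6 1 * ?m ^ 6 = 0" by (rule top_unique)
      define y where "y = ?x / ?m\<^sup>2"
      have x: "?x = y * ?m\<^sup>2" using q by (simp add: y_def)
      have "?m ^ 6 * (b2 * y\<^sup>2 + b1 * y + coeff a6 1) = 0"
        using z unfolding x by (simp add: eval_nat_numeral algebra_simps)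
      then show ?thesis using a6[OF True, of y] q by simp
    qed
  qed
qed

section \<open>Smoothness of the generic surface\<close>

lemma ev_quadratic: "degree P \<le> 2 \<Longrightarrow>
    ev P x = of_rat (coeff P 0) + of_rat (coeff P 1) * x + of_rat (coeff P 2) * x\<^sup>2"
  by (subst quadratic_poly_eq[of P]) (simp_all add: power2_eq_square algebra_simps)

lemma ev_monic_cubic: "degree (C - monom 1 3) \<le> 2 \<Longrightarrow>
    ev C x = of_rat (coeff C 0) + of_rat (coeff C 1) * x + of_rat (coeff C 2) * x\<^sup>2 + x ^ 3"
  by (subst monic_cubic_eq[of C]) (simp_all add: power2_eq_square power3_eq_cube algebra_simps)

lemma ev_pderiv_quadratic: "degree P \<le> 2 \<Longrightarrow>
    ev (pderiv P) x = of_rat (coeff P 1) + 2 * of_rat (coeff P 2) * x"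
  by (subst quadratic_poly_eq[of P]) (simp_all add: pderiv_pCons of_rat_add of_rat_mult algebra_simps)

lemma ev_pderiv_monic_cubic: "degree (C - monom 1 3) \<le> 2 \<Longrightarrow>
    ev (pderiv C) x = of_rat (coeff C 1) + 2 * of_rat (coeff C 2) * x + 3 * x\<^sup>2"
  by (subst monic_cubic_eq[of C]) (simp_all add: pderiv_pCons of_rat_add of_rat_mult power2_eq_square algebra_simps)

lemma smooth_surface_iff:
  assumes "degree A \<le> 2" "degree B \<le> 2" "degree (C - monom 1 3) \<le> 2"
  shows "smooth_surface [:coeff C 2, coeff B 2, coeff A 2:] [:coeff C 1, coeff B 1, coeff A 1:]
      [:coeff C 0, coeff B 0, coeff A 0:] \<longleftrightarrow>
    (\<forall>x t. \<not> (ev A x * t\<^sup>2 + ev B x * t + ev C x = 0 \<and>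
      ev (pderiv A) x * t\<^sup>2 + ev (pderiv B) x * t + ev (pderiv C) x = 0 \<and>
      2 * ev A x * t + ev B x = 0))"
proof -
  have "x ^ 3 + ev [:coeff C 2, coeff B 2, coeff A 2:] t * x\<^sup>2 + ev [:coeff C 1, coeff B 1, coeff A 1:] t * x
      + ev [:coeff C 0, coeff B 0, coeff A 0:] t = ev A x * t\<^sup>2 + ev B x * t + ev C x" for x t
    using assms by (simp add: ev_quadratic ev_monic_cubic power2_eq_square algebra_simps)
  moreover have "3 * x\<^sup>2 + 2 * ev [:coeff C 2, coeff B 2, coeff A 2:] t * x + ev [:coeff C 1, coeff B 1, coeff A 1:] t
      = ev (pderiv A) x * t\<^sup>2 + ev (pderiv B) x * t + ev (pderiv C) x" for x t
    using assms by (simp add: ev_pderiv_quadratic ev_pderiv_monic_cubic power2_eq_square algebra_simps)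
  moreover have "ev (pderiv [:coeff C 2, coeff B 2, coeff A 2:]) t * x\<^sup>2 + ev (pderiv [:coeff C 1, coeff B 1, coeff A 1:]) t * x
      + ev (pderiv [:coeff C 0, coeff B 0, coeff A 0:]) t = 2 * ev A x * t + ev B x" for x t
    using assms by (simp add: ev_quadratic pderiv_pCons of_rat_add of_rat_mult power2_eq_square algebra_simps)
  ultimately show ?thesis unfolding smooth_surface_def by (simp only:)
qed

lemma irreducible_no_double_root:
  assumes D: "irreducible D" and x: "ev D x = 0"
  shows "ev (pderiv D) x \<noteq> 0"
proof
  assume "ev (pderiv D) x = 0"
  then have dvd: "D dvd pderiv D" by (rule irreducible_dvd_of_common_root[OF D x])
  have "D \<noteq> 0" "\<not> is_unit D" using D irreducible_not_unit by auto
  then have "degree D \<noteq> 0" by (simp add: is_unit_iff_degree)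
  then have "pderiv D \<noteq> 0" by (simp add: pderiv_eq_0_iff)
  from dvd_imp_degree_le[OF dvd this] show False using \<open>degree D \<noteq> 0\<close> by (simp add: degree_pderiv)
qed

text \<open>In \<open>D = W\<^sup>2 - 4 A F\<close> the function W is the T-derivative of F, so a
  singular point of \<open>F = 0\<close> lies above a double zero of \<open>D\<close>.\<close>

lemma smooth_of_disc:
  assumes "degree A \<le> 2" "degree B \<le> 2" "degree (C - monom 1 3) \<le> 2"
    and D: "irreducible (disc_AC A B C)"
  shows "smooth_surface [:coeff C 2, coeff B 2, coeff A 2:] [:coeff C 1, coeff B 1, coeff A 1:]
      [:coeff C 0, coeff B 0, coeff A 0:]"
  unfolding smooth_surface_iff[OF assms(1-3)]
proof (intro allI notI, elim conjE)
  fix x t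
  assume F: "ev A x * t\<^sup>2 + ev B x * t + ev C x = 0"
    and FX: "ev (pderiv A) x * t\<^sup>2 + ev (pderiv B) x * t + ev (pderiv C) x = 0"
    and FT: "2 * ev A x * t + ev B x = 0"
  have B: "ev B x = - 2 * ev A x * t" using FT by (simp add: eq_neg_iff_add_eq_0 add.commute)
  have C: "ev C x = ev A x * t\<^sup>2" using F unfolding B by (simp add: power2_eq_square algebra_simps)
  have C': "ev (pderiv C) x = - (ev (pderiv A) x * t\<^sup>2 + ev (pderiv B) x * t)"
    by (rule minus_unique[OF FX, symmetric])
  have "ev (disc_AC A B C) x = 0"
    by (simp add: disc_AC_def B C power2_eq_square)
  moreover have "ev (pderiv (disc_AC A B C)) x = 0"
    by (simp add: disc_AC_def pderiv_diff pderiv_smult pderiv_mult power2_eq_square[of B] B C C')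
      (simp add: power2_eq_square algebra_simps)
  ultimately show False using irreducible_no_double_root[OF D] by blast
qed

text \<open>For \<open>A = 0\<close> the T-derivative is \<open>B\<close>; where it vanishes
  together with \<open>C + B T\<close>, so does \<open>C\<close>.\<close>

lemma smooth_of_coprime:
  assumes "degree B \<le> 2" "degree (C - monom 1 3) \<le> 2" and cop: "coprime B C"
  shows "smooth_surface [:coeff C 2, coeff B 2:] [:coeff C 1, coeff B 1:] [:coeff C 0, coeff B 0:]"
proof -
  have "smooth_surface [:coeff C 2, coeff B 2, coeff 0 2:] [:coeff C 1, coeff B 1, coeff 0 1:]
      [:coeff C 0, coeff B 0, coeff 0 0:]"
    using assms(1,2) coprime_no_common_root[OF cop] by (subst smooth_surface_iff) auto
  then show ?thesis by simp
qed

section \<open>Leading coefficients of norms\<close>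

lemma tendsto_poly_quotient:
  assumes "filterlim t at_infinity F"
  shows "((\<lambda>x. ev p (t x) / t x ^ degree p) \<longlongrightarrow> of_rat (lead_coeff p)) F"
proof (induction p)
  case (pCons a p)
  have inv: "((\<lambda>x. inverse (t x)) \<longlongrightarrow> 0) F"
    using filterlim_compose[OF tendsto_inverse_0 assms] .
  have ne: "eventually (\<lambda>x. t x \<noteq> 0) F"
    using filterlim_at_infinity_imp_eventually_ne[OF assms] .
  show ?case
  proof (cases "p = 0")
    case False
    have "((\<lambda>x. of_rat a * inverse (t x) ^ Suc (degree p) + ev p (t x) / t x ^ degree p)
        \<longlongrightarrow> of_rat a * 0 ^ Suc (degree p) + of_rat (lead_coeff p)) F"
      by (intro tendsto_intros inv pCons.IH)
    then have "((\<lambda>x. of_rat a * inverse (t x) ^ Suc (degree p) + ev p (t x) / t x ^ degree p)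
        \<longlongrightarrow> of_rat (lead_coeff (pCons a p))) F" using False by simp
    then show ?thesis
    proof (rule Lim_transform_eventually)
      show "eventually (\<lambda>x. of_rat a * inverse (t x) ^ Suc (degree p) + ev p (t x) / t x ^ degree p
          = ev (pCons a p) (t x) / t x ^ degree (pCons a p)) F"
        using ne
      proof eventually_elim
        case (elim x)
        have "(of_rat a + t x * ev p (t x)) / (t x * t x ^ degree p)
            = of_rat a / (t x * t x ^ degree p) + ev p (t x) / t x ^ degree p"
          using elim by (simp add: add_divide_distrib)
        moreover have "of_rat a / (t x * t x ^ degree p) = of_rat a * inverse (t x) ^ Suc (degree p)"
          by (simp add: divide_inverse power_inverse)
        ultimately show ?case using False by simp
      qed
    qed
  qed simp
qed simp

lemma tendsto_poly_quotient_le: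
  assumes "filterlim t at_infinity F" "degree p \<le> n"
  shows "((\<lambda>x. ev p (t x) / t x ^ n) \<longlongrightarrow> of_rat (coeff p n)) F"
proof -
  have inv: "((\<lambda>x. inverse (t x)) \<longlongrightarrow> 0) F"
    using filterlim_compose[OF tendsto_inverse_0 assms(1)] .
  have ne: "eventually (\<lambda>x. t x \<noteq> 0) F"
    using filterlim_at_infinity_imp_eventually_ne[OF assms(1)] .
  have "((\<lambda>x. ev p (t x) / t x ^ degree p * inverse (t x) ^ (n - degree p))
      \<longlongrightarrow> of_rat (lead_coeff p) * 0 ^ (n - degree p)) F"
    by (intro tendsto_intros inv tendsto_poly_quotient assms(1))
  also have "of_rat (lead_coeff p) * 0 ^ (n - degree p) = (of_rat (coeff p n) :: complex)"
    using assms(2) by (cases "degree p = n") (auto simp: coeff_eq_0 power_0_left)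
  finally show ?thesis
  proof (rule Lim_transform_eventually)
    have *: "e / z ^ degree p * inverse z ^ (n - degree p) = e / z ^ n" if "z \<noteq> 0" for e z :: complex
    proof -
      have "z ^ n = z ^ degree p * z ^ (n - degree p)" using assms(2) by (simp flip: power_add)
      then show ?thesis by (simp add: divide_inverse power_inverse)
    qed
    show "eventually (\<lambda>x. ev p (t x) / t x ^ degree p * inverse (t x) ^ (n - degree p) = ev p (t x) / t x ^ n) F"
      using ne by eventually_elim (rule *)
  qed
qed

definition cx :: "real \<Rightarrow> complex" where "cx x = of_real x"

lemma cx_at_infinity: "filterlim cx at_infinity at_top"
  unfolding cx_def by (rule filterlim_of_real_at_infinity)

lemma cx_ne: "eventually (\<lambda>x. cx x \<noteq> 0) at_top"
  using filterlim_at_infinity_imp_eventually_ne[OF cx_at_infinity] .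

lemmas cx_quotient = tendsto_poly_quotient_le[OF cx_at_infinity]

lemma ev_ne_eventually:
  assumes "p \<noteq> 0"
  shows "eventually (\<lambda>x. ev p (cx x) \<noteq> 0) at_top"
proof -
  have "((\<lambda>x. ev p (cx x) / cx x ^ degree p) \<longlongrightarrow> of_rat (lead_coeff p)) at_top"
    by (rule tendsto_poly_quotient[OF cx_at_infinity])
  moreover have "(of_rat (lead_coeff p) :: complex) \<noteq> 0" using assms by simp
  ultimately have "eventually (\<lambda>x. ev p (cx x) / cx x ^ degree p \<noteq> 0) at_top"
    by (rule tendsto_imp_eventually_ne)
  then show ?thesis by eventually_elim auto
qed

text \<open>After division by a power of \<open>x\<close> that fits both polynomials, the limits
  compare coefficients. This bounds one degree by the other, and the reciprocal ratio gives the
  reverse bound.\<close>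

lemma ratio_limit:
  assumes f: "f \<noteq> 0" and g: "g \<noteq> 0" and L: "L \<noteq> 0"
    and lim: "((\<lambda>x. ev f (cx x) / ev g (cx x)) \<longlongrightarrow> of_rat L) at_top"
  shows "degree f = degree g" "lead_coeff f = L * lead_coeff g"
proof -
  have inv: "((\<lambda>x. inverse (cx x)) \<longlongrightarrow> 0) at_top"
    using filterlim_compose[OF tendsto_inverse_0 cx_at_infinity] .
  have main: "degree h \<ge> degree k \<and> (degree h = degree k \<longrightarrow> lead_coeff h = M * lead_coeff k)"
    if "h \<noteq> 0" "k \<noteq> 0" "M \<noteq> 0" and lim: "((\<lambda>x. ev h (cx x) / ev k (cx x)) \<longlongrightarrow> of_rat M) at_top" for h k M
  proof -
    let ?n = "max (degree h) (degree k)"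
    have "((\<lambda>x. ev h (cx x) / ev k (cx x) * (ev k (cx x) / cx x ^ ?n)) \<longlongrightarrow> of_rat M * of_rat (coeff k ?n)) at_top"
      by (intro tendsto_intros lim cx_quotient) simp
    then have "((\<lambda>x. ev h (cx x) / cx x ^ ?n) \<longlongrightarrow> of_rat M * of_rat (coeff k ?n)) at_top"
    proof (rule Lim_transform_eventually)
      show "eventually (\<lambda>x. ev h (cx x) / ev k (cx x) * (ev k (cx x) / cx x ^ ?n) = ev h (cx x) / cx x ^ ?n) at_top"
        using ev_ne_eventually[OF that(2)] by eventually_elim simp
    qed
    moreover have "((\<lambda>x. ev h (cx x) / cx x ^ ?n) \<longlongrightarrow> of_rat (coeff h ?n)) at_top"
      by (intro cx_quotient) simp
    ultimately have "of_rat (coeff h ?n) = (of_rat M * of_rat (coeff k ?n) :: complex)"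
      by (rule tendsto_unique[OF trivial_limit_at_top_linorder, symmetric])
    then have e: "coeff h ?n = M * coeff k ?n" by (metis of_rat_mult of_rat_eq_iff)
    show ?thesis
    proof (cases "degree h < degree k")
      case True
      then have "coeff h (degree k) = 0" "?n = degree k" by (simp_all add: coeff_eq_0)
      then show ?thesis using e that by simp
    next
      case False
      then show ?thesis using e by auto
    qed
  qed
  have "((\<lambda>x. inverse (ev f (cx x) / ev g (cx x))) \<longlongrightarrow> inverse (of_rat L)) at_top"
    by (intro tendsto_inverse lim) (use L in simp)
  then have "((\<lambda>x. ev g (cx x) / ev f (cx x)) \<longlongrightarrow> of_rat (inverse L)) at_top"
    by (simp add: of_rat_inverse)
  then have "degree g \<ge> degree f" using main[of g f "inverse L"] f g L by simp
  then show "degree f = degree g" "lead_coeff f = L * lead_coeff g"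
    using main[OF f g L lim] by auto
qed

text \<open>The norm of \<open>U + V W\<close>, evaluated at real \<open>x\<close>, is the product of the values at the two
  points \<open>(x, t)\<close> of the surface above \<open>x\<close>, up to a power of \<open>A\<close>.\<close>

lemma norm_value:
  assumes eq: "[:A ^ n:] * f = [:U:] + [:V:] * ramW A B + surf A B C * S"
    and w: "w\<^sup>2 = ev (disc_AC A B C) x" and A: "ev A x \<noteq> 0"
  shows "ev (U\<^sup>2 - disc_AC A B C * V\<^sup>2) x
    = ev A x ^ (2 * n) * (ev2 x ((w - ev B x) / (2 * ev A x)) f * ev2 x ((- w - ev B x) / (2 * ev A x)) f)"
proof -
  have w': "(- w)\<^sup>2 = ev (disc_AC A B C) x" using w by simp
  have "ev (U\<^sup>2 - disc_AC A B C * V\<^sup>2) x = (ev U x + ev V x * w) * (ev U x + ev V x * (- w))"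
    by (simp add: w[symmetric] power2_eq_square algebra_simps)
  moreover have "a ^ (2 * n) = a ^ n * a ^ n" for a :: complex by (simp only: mult_2 power_add)
  ultimately show ?thesis
    unfolding ev2_reduce(2)[OF eq w A] ev2_reduce(2)[OF eq w' A] by (simp only: mult_ac)
qed

lemma root_product:
  assumes w: "w\<^sup>2 = ev (disc_AC A B C) x" and A: "ev A x \<noteq> 0"
  shows "((w - ev B x) / (2 * ev A x)) * ((- w - ev B x) / (2 * ev A x)) = ev C x / ev A x"
proof -
  have "(w - ev B x) * (- w - ev B x) = (ev B x)\<^sup>2 - w\<^sup>2" by (simp add: power2_eq_square algebra_simps)
  also have "\<dots> = 4 * ev A x * ev C x" unfolding w by (simp add: disc_AC_def)
  finally have "((w - ev B x) / (2 * ev A x)) * ((- w - ev B x) / (2 * ev A x)) = (4 * ev A x * ev C x) / ((2 * ev A x) * (2 * ev A x))"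
    by (simp only: times_divide_times_eq)
  then show ?thesis using A by (simp add: divide_simps)
qed

lemma monic_cubic_degree:
  fixes C :: "'a::comm_ring_1 poly"
  assumes "degree (C - monom 1 3) \<le> 2"
  shows "degree C = 3" "lead_coeff C = 1" "C \<noteq> 0"
proof -
  note C = monic_cubic_eq[OF assms]
  show d: "degree C = 3" by (subst C) simp
  show "lead_coeff C = 1" unfolding d by (subst C) (simp add: eval_nat_numeral)
  show "C \<noteq> 0" using d by auto
qed

text \<open>The two roots T above \<open>x\<close> have product \<open>C / A\<close> with
  \<open>C\<close> of order \<open>x ^ 3\<close>, while the numerator \<open>- w - B\<close> of the
  conjugate root is at most of order \<open>x\<^sup>2\<close>, as \<open>D\<close> has degree at
  most 4. So neither root is of smaller order than \<open>x\<close>.\<close>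

lemma bounded_over_root:
  assumes A: "A \<noteq> 0" and deg: "degree A \<le> 1" "degree B \<le> 2" "degree (C - monom 1 3) \<le> 2"
  shows "\<exists>K > 0. eventually (\<lambda>x. \<forall>w. w\<^sup>2 = ev (disc_AC A B C) (cx x) \<longrightarrow>
    norm (cx x) \<le> K * norm ((w - ev B (cx x)) / (2 * ev A (cx x)))) at_top"
proof -
  have degC: "degree C \<le> 3" "coeff C 3 = 1" using monic_cubic_degree[OF deg(3)] by simp_all
  have degD: "degree (disc_AC A B C) \<le> 4"
  proof -
    have "degree (B\<^sup>2) \<le> 4" using degree_power_le[of B 2] deg(2) by simp
    moreover have "degree (smult 4 (A * C)) \<le> 4" using degree_mult_le[of A C] deg(1) degC(1) by simp
    ultimately show ?thesis unfolding disc_AC_def by (intro degree_diff_le)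
  qed
  have bd: "\<exists>K>0. eventually (\<lambda>x. norm (ev p (cx x)) \<le> K * norm (cx x) ^ n) at_top" if "degree p \<le> n" for p n
  proof -
    have "((\<lambda>x. norm (ev p (cx x) / cx x ^ n)) \<longlongrightarrow> norm (of_rat (coeff p n) :: complex)) at_top"
      by (intro tendsto_norm cx_quotient that)
    then have "eventually (\<lambda>x. norm (ev p (cx x) / cx x ^ n) < norm (of_rat (coeff p n) :: complex) + 1) at_top"
      by (rule order_tendstoD) simp
    then have "eventually (\<lambda>x. norm (ev p (cx x)) \<le> (norm (of_rat (coeff p n) :: complex) + 1) * norm (cx x) ^ n) at_top"
      using cx_ne by eventually_elim (simp add: norm_divide norm_power divide_simps)
    moreover have "norm (of_rat (coeff p n) :: complex) + 1 > 0" by (simp add: add_nonneg_pos)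
    ultimately show ?thesis by blast
  qed
  obtain KB where KB: "KB > 0" "eventually (\<lambda>x. norm (ev B (cx x)) \<le> KB * norm (cx x) ^ 2) at_top" using bd[OF deg(2)] by blast
  obtain KD where KD: "KD > 0" "eventually (\<lambda>x. norm (ev (disc_AC A B C) (cx x)) \<le> KD * norm (cx x) ^ 4) at_top" using bd[OF degD] by blast
  have "((\<lambda>x. norm (ev C (cx x) / cx x ^ 3)) \<longlongrightarrow> norm (of_rat (coeff C 3) :: complex)) at_top"
    by (intro tendsto_norm cx_quotient degC)
  then have "eventually (\<lambda>x. norm (ev C (cx x) / cx x ^ 3) > 1 / 2) at_top"
    by (rule order_tendstoD) (simp add: degC)
  then have C2: "eventually (\<lambda>x. norm (cx x) ^ 3 \<le> 2 * norm (ev C (cx x))) at_top"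
    using cx_ne by eventually_elim (simp add: norm_divide norm_power divide_simps)
  define K where "K = sqrt KD + KB"
  have K: "K > 0" using KB(1) KD(1) by (simp add: K_def add_pos_pos)
  have "eventually (\<lambda>x. \<forall>w. w\<^sup>2 = ev (disc_AC A B C) (cx x) \<longrightarrow>
    norm (cx x) \<le> K * norm ((w - ev B (cx x)) / (2 * ev A (cx x)))) at_top"
    using KB(2) KD(2) C2 cx_ne ev_ne_eventually[OF A]
  proof eventually_elim
    case (elim x)
    show ?case
    proof (intro allI impI)
      fix w assume w: "w\<^sup>2 = ev (disc_AC A B C) (cx x)"
      define X where "X = norm (cx x)"
      define t where "t = (w - ev B (cx x)) / (2 * ev A (cx x))"
      define t' where "t' = (- w - ev B (cx x)) / (2 * ev A (cx x))"
      have X: "X > 0" using elim by (simp add: X_def)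
      have "norm w ^ 2 \<le> (sqrt KD * X\<^sup>2)\<^sup>2"
        using elim(2) KD(1) by (simp add: w[symmetric] norm_power X_def power_mult_distrib flip: power_mult)
      then have "norm w \<le> sqrt KD * X\<^sup>2" by (rule power2_le_imp_le) (use KD(1) in simp)
      then have "norm (- w - ev B (cx x)) \<le> K * X\<^sup>2"
        using norm_triangle_ineq4[of "- w" "ev B (cx x)"] elim(1) by (simp add: K_def X_def distrib_right)
      then have t': "norm t' * (2 * norm (ev A (cx x))) \<le> K * X\<^sup>2"
        using elim(5) by (simp add: t'_def norm_divide norm_mult)
      have "t * t' = ev C (cx x) / ev A (cx x)"
        unfolding t_def t'_def by (rule root_product[OF w elim(5)])
      then have "norm t * norm t' * norm (ev A (cx x)) = norm (ev C (cx x))"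
        using elim(5) by (metis norm_mult nonzero_eq_divide_eq)
      then have "X ^ 3 \<le> norm t * (norm t' * (2 * norm (ev A (cx x))))" using elim(3) by (simp add: X_def mult_ac)
      also have "\<dots> \<le> norm t * (K * X\<^sup>2)" by (rule mult_left_mono[OF t']) simp
      finally have "X\<^sup>2 * X \<le> X\<^sup>2 * (K * norm t)" by (simp add: power3_eq_cube power2_eq_square mult_ac)
      then show "norm (cx x) \<le> K * norm ((w - ev B (cx x)) / (2 * ev A (cx x)))"
        using X unfolding t_def[symmetric] X_def[symmetric] by (simp only: mult_le_cancel_left_pos zero_less_power)
    qed
  qed
  then show ?thesis using K by blast
qed

lemma root_functions:
  assumes A: "A \<noteq> 0" and deg: "degree A \<le> 1" "degree B \<le> 2" "degree (C - monom 1 3) \<le> 2"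
    and w: "\<And>x. (w x)\<^sup>2 = ev (disc_AC A B C) (cx x)"
  defines "t \<equiv> (\<lambda>x. (w x - ev B (cx x)) / (2 * ev A (cx x)))"
  shows "filterlim t at_infinity at_top" "\<exists>K. eventually (\<lambda>x. norm (cx x / t x) \<le> K) at_top"
proof -
  obtain K where K: "K > 0" "eventually (\<lambda>x. norm (cx x) \<le> K * norm (t x)) at_top"
  proof -
    obtain K where K: "K > 0" "eventually (\<lambda>x. \<forall>w. w\<^sup>2 = ev (disc_AC A B C) (cx x) \<longrightarrow>
      norm (cx x) \<le> K * norm ((w - ev B (cx x)) / (2 * ev A (cx x)))) at_top"
      using bounded_over_root[OF A deg] by blast
    have "eventually (\<lambda>x. norm (cx x) \<le> K * norm (t x)) at_top"
      using K(2) by eventually_elim (use w in \<open>simp add: t_def\<close>)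
    then show ?thesis using that K(1) by blast
  qed
  show "filterlim t at_infinity at_top"
  proof (rule filterlim_norm_at_top_imp_at_infinity, rule filterlim_at_top_mono)
    show "filterlim (\<lambda>x. inverse K * norm (cx x)) at_top at_top"
      by (rule filterlim_tendsto_pos_mult_at_top[OF tendsto_const _ filterlim_at_infinity_imp_norm_at_top[OF cx_at_infinity]])
        (use K in simp)
    show "eventually (\<lambda>x. inverse K * norm (cx x) \<le> norm (t x)) at_top"
      using K(2)
    proof eventually_elim
      case (elim x)
      then have "inverse K * norm (cx x) \<le> inverse K * (K * norm (t x))" using K(1) by (intro mult_left_mono) auto
      also have "\<dots> = norm (t x)" using K(1) by simp
      finally show ?case .
    qed
  qed
  have "eventually (\<lambda>x. norm (cx x / t x) \<le> K) at_top"
    using K(2) cx_ne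
  proof eventually_elim
    case (elim x)
    then have "t x \<noteq> 0" by auto
    then show ?case using elim by (simp add: norm_divide divide_le_eq)
  qed
  then show "\<exists>K. eventually (\<lambda>x. norm (cx x / t x) \<le> K) at_top" by blast
qed

lemma ev2_sec1: "ev2 x t (sec1 p q) = ev p t - x * (ev q t)\<^sup>2"
  by (simp add: sec1_def)

text \<open>As \<open>X / T\<close> stays bounded, \<open>X q(T)\<^sup>2\<close> has at most the
  order of \<open>T ^ (2 * degree q + 1)\<close>, and \<open>p\<close> dominates.\<close>

lemma sec1_limit_high:
  assumes t: "filterlim t at_infinity F" and K: "eventually (\<lambda>x. norm (X x / t x) \<le> K) F"
    and deg: "degree p \<ge> 2 * degree q + 2"
  shows "((\<lambda>x. ev2 (X x) (t x) (sec1 p q) / t x ^ degree p) \<longlongrightarrow> of_rat (lead_coeff p)) F"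
proof -
  have inv: "((\<lambda>x. inverse (t x)) \<longlongrightarrow> 0) F"
    using filterlim_compose[OF tendsto_inverse_0 t] .
  have ne: "eventually (\<lambda>x. t x \<noteq> 0) F" using filterlim_at_infinity_imp_eventually_ne[OF t] .
  define k where "k = degree p - 2 * degree q - 1"
  have k: "k > 0" "degree p = Suc (2 * degree q + k)" using deg by (simp_all add: k_def)
  have "((\<lambda>x. (ev q (t x) / t x ^ degree q)\<^sup>2 * inverse (t x) ^ k) \<longlongrightarrow> (of_rat (lead_coeff q))\<^sup>2 * 0 ^ k) F"
    by (intro tendsto_intros inv tendsto_poly_quotient t)
  then have "((\<lambda>x. (ev q (t x) / t x ^ degree q)\<^sup>2 * inverse (t x) ^ k) \<longlongrightarrow> 0) F"
    using k(1) by (simp only: zero_power mult_zero_right)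
  then have z: "((\<lambda>x. X x / t x * ((ev q (t x) / t x ^ degree q)\<^sup>2 * inverse (t x) ^ k)) \<longlongrightarrow> 0) F"
  proof (rule tendsto_0_le)
    show "eventually (\<lambda>x. norm (X x / t x * ((ev q (t x) / t x ^ degree q)\<^sup>2 * inverse (t x) ^ k))
      \<le> norm ((ev q (t x) / t x ^ degree q)\<^sup>2 * inverse (t x) ^ k) * K) F"
      using K by eventually_elim (metis mult.commute mult_left_mono norm_ge_zero norm_mult)
  qed
  have "((\<lambda>x. ev p (t x) / t x ^ degree p - X x / t x * ((ev q (t x) / t x ^ degree q)\<^sup>2 * inverse (t x) ^ k))
      \<longlongrightarrow> of_rat (lead_coeff p) - 0) F"
    by (intro tendsto_diff z tendsto_poly_quotient t)
  then have l: "((\<lambda>x. ev p (t x) / t x ^ degree p - X x / t x * ((ev q (t x) / t x ^ degree q)\<^sup>2 * inverse (t x) ^ k))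
      \<longlongrightarrow> of_rat (lead_coeff p)) F" by simp
  have e: "a / z ^ degree p - x / z * ((b / z ^ degree q)\<^sup>2 * inverse z ^ k) = (a - x * b\<^sup>2) / z ^ degree p"
    if "z \<noteq> 0" for a b x z :: complex
  proof -
    have "z ^ degree p = z * ((z ^ degree q)\<^sup>2 * z ^ k)" unfolding k(2) by (simp add: power_add mult.commute flip: power_mult)
    then show ?thesis by (simp add: divide_inverse power_inverse power_mult_distrib left_diff_distrib right_diff_distrib mult_ac)
  qed
  show ?thesis
  proof (rule Lim_transform_eventually[OF l])
    show "eventually (\<lambda>x. ev p (t x) / t x ^ degree p - X x / t x * ((ev q (t x) / t x ^ degree q)\<^sup>2 * inverse (t x) ^ k)
        = ev2 (X x) (t x) (sec1 p q) / t x ^ degree p) F"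
      using ne
    proof eventually_elim
      case (elim x)
      from e[OF elim] show ?case by (simp only: ev2_sec1)
    qed
  qed
qed

text \<open>Here \<open>p\<close> is at most of the order of \<open>q\<^sup>2\<close>, and the
  factor \<open>X\<close>, which tends to infinity, decides.\<close>

lemma sec1_limit_low:
  assumes t: "filterlim t at_infinity F" and X: "filterlim X at_infinity F"
    and deg: "degree p \<le> 2 * degree q"
  shows "((\<lambda>x. ev2 (X x) (t x) (sec1 p q) / (X x * t x ^ (2 * degree q))) \<longlongrightarrow> - of_rat ((lead_coeff q)\<^sup>2)) F"
proof -
  have inv: "((\<lambda>x. inverse (X x)) \<longlongrightarrow> 0) F" using filterlim_compose[OF tendsto_inverse_0 X] .
  have ne: "eventually (\<lambda>x. X x \<noteq> 0) F" using filterlim_at_infinity_imp_eventually_ne[OF X] .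
  have "((\<lambda>x. inverse (X x) * (ev p (t x) / t x ^ (2 * degree q)) - (ev q (t x) / t x ^ degree q)\<^sup>2)
      \<longlongrightarrow> 0 * of_rat (coeff p (2 * degree q)) - (of_rat (lead_coeff q))\<^sup>2) F"
    by (intro tendsto_intros inv tendsto_poly_quotient tendsto_poly_quotient_le t deg)
  then have l: "((\<lambda>x. inverse (X x) * (ev p (t x) / t x ^ (2 * degree q)) - (ev q (t x) / t x ^ degree q)\<^sup>2)
      \<longlongrightarrow> - of_rat ((lead_coeff q)\<^sup>2)) F" by (simp add: of_rat_power)
  have e: "inverse x * (a / z ^ (2 * degree q)) - (b / z ^ degree q)\<^sup>2 = (a - x * b\<^sup>2) / (x * z ^ (2 * degree q))"
    if "x \<noteq> 0" for a b x z :: complex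
  proof -
    have "z ^ (2 * degree q) = (z ^ degree q)\<^sup>2" by (simp add: mult.commute flip: power_mult)
    then show ?thesis using that
      by (simp add: divide_inverse power_inverse power_mult_distrib left_diff_distrib right_diff_distrib mult_ac)
  qed
  show ?thesis
  proof (rule Lim_transform_eventually[OF l])
    show "eventually (\<lambda>x. inverse (X x) * (ev p (t x) / t x ^ (2 * degree q)) - (ev q (t x) / t x ^ degree q)\<^sup>2
        = ev2 (X x) (t x) (sec1 p q) / (X x * t x ^ (2 * degree q))) F"
      using ne
    proof eventually_elim
      case (elim x)
      from e[OF elim] show ?case by (simp only: ev2_sec1)
    qed
  qed
qed

lemma square_mult_cancel:
  fixes x c d :: rat
  assumes "x * c\<^sup>2 = d\<^sup>2" "c \<noteq> 0"
  shows "\<exists>s. x = s\<^sup>2"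
proof -
  have "x = d\<^sup>2 / c\<^sup>2" using assms nonzero_eq_divide_eq[of "c\<^sup>2" x "d\<^sup>2"] by simp
  then show ?thesis by (metis power_divide)
qed

text \<open>The leading terms at the two conjugate points multiply to an even power of
  \<open>t1 t2 = C / A\<close> times a square, with a further factor \<open>x\<^sup>2\<close> in the
  second case. Since \<open>C\<close> is monic, only squares are left in the leading coefficient of
  the norm.\<close>

lemma norm_leading_coeff:
  assumes A: "A \<noteq> 0" and deg: "degree A \<le> 1" "degree B \<le> 2" "degree (C - monom 1 3) \<le> 2"
    and q: "q \<noteq> 0" and cases: "(degree p \<ge> 2 * degree q + 2 \<and> even (degree p)) \<or> degree p \<le> 2 * degree q"
    and eq: "[:A ^ n:] * sec1 p q = [:U:] + [:V:] * ramW A B + surf A B C * S"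
  defines "N1 \<equiv> U\<^sup>2 - disc_AC A B C * V\<^sup>2"
  shows "even (degree N1) \<and> (\<exists>s. lead_coeff N1 = s\<^sup>2)"
proof (cases "N1 = 0")
  case False
  define w where "w x = csqrt (ev (disc_AC A B C) (cx x))" for x
  define t1 where "t1 x = (w x - ev B (cx x)) / (2 * ev A (cx x))" for x
  define t2 where "t2 x = (- w x - ev B (cx x)) / (2 * ev A (cx x))" for x
  have w: "(w x)\<^sup>2 = ev (disc_AC A B C) (cx x)" "(- w x)\<^sup>2 = ev (disc_AC A B C) (cx x)" for x
    by (simp_all add: w_def)
  have t1: "filterlim t1 at_infinity at_top" "\<exists>K. eventually (\<lambda>x. norm (cx x / t1 x) \<le> K) at_top"
    using root_functions[OF A deg, of w] w(1) unfolding t1_def by blast+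
  have t2: "filterlim t2 at_infinity at_top" "\<exists>K. eventually (\<lambda>x. norm (cx x / t2 x) \<le> K) at_top"
    using root_functions[OF A deg, of "\<lambda>x. - w x"] w(2) unfolding t2_def by blast+
  note C3 = monic_cubic_degree[OF deg(3)]
  have val: "eventually (\<lambda>x. ev A (cx x) \<noteq> 0 \<and> t1 x * t2 x = ev C (cx x) / ev A (cx x) \<and>
      ev N1 (cx x) = ev A (cx x) ^ (2 * n) * (ev2 (cx x) (t1 x) (sec1 p q) * ev2 (cx x) (t2 x) (sec1 p q))) at_top"
    using ev_ne_eventually[OF A]
    by eventually_elim (use norm_value[OF eq w(1)] root_product[OF w(1)] in \<open>simp add: N1_def t1_def t2_def\<close>)
  have An: "lead_coeff A \<noteq> 0" using A by simp
  show ?thesis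
    using cases
  proof
    assume p: "degree p \<ge> 2 * degree q + 2 \<and> even (degree p)"
    then obtain e where e: "degree p = 2 * e" by blast
    have p0: "lead_coeff p \<noteq> 0" using p by auto
    have "((\<lambda>x. ev2 (cx x) (t1 x) (sec1 p q) / t1 x ^ degree p * (ev2 (cx x) (t2 x) (sec1 p q) / t2 x ^ degree p))
        \<longlongrightarrow> of_rat (lead_coeff p) * of_rat (lead_coeff p)) at_top"
      using t1 t2 p by (intro tendsto_mult) (blast intro: sec1_limit_high)+
    moreover have "eventually (\<lambda>x. ev2 (cx x) (t1 x) (sec1 p q) / t1 x ^ degree p * (ev2 (cx x) (t2 x) (sec1 p q) / t2 x ^ degree p)
        = ev (N1 * A ^ degree p) (cx x) / ev (A ^ (2 * n) * C ^ degree p) (cx x)) at_top"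
      using val
    proof eventually_elim
      case (elim x)
      have "ev2 (cx x) (t1 x) (sec1 p q) / t1 x ^ degree p * (ev2 (cx x) (t2 x) (sec1 p q) / t2 x ^ degree p)
        = (ev2 (cx x) (t1 x) (sec1 p q) * ev2 (cx x) (t2 x) (sec1 p q)) / (ev C (cx x) / ev A (cx x)) ^ degree p"
        using elim by (simp add: power_mult_distrib[symmetric])
      then show ?case using elim by (simp add: power_divide)
    qed
    ultimately have "((\<lambda>x. ev (N1 * A ^ degree p) (cx x) / ev (A ^ (2 * n) * C ^ degree p) (cx x))
        \<longlongrightarrow> of_rat ((lead_coeff p)\<^sup>2)) at_top"
      by (simp only: of_rat_mult power2_eq_square) (rule Lim_transform_eventually)
    from ratio_limit[OF _ _ _ this] False A C3(3) p0
    have r: "degree (N1 * A ^ degree p) = degree (A ^ (2 * n) * C ^ degree p)"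
      "lead_coeff (N1 * A ^ degree p) = (lead_coeff p)\<^sup>2 * lead_coeff (A ^ (2 * n) * C ^ degree p)" by simp_all
    have "degree N1 + degree p * degree A = 2 * n * degree A + degree p * 3"
      using r(1) False A C3 by (simp add: degree_mult_eq degree_power_eq)
    then have "degree N1 + 2 * (e * degree A) = 2 * (n * degree A + e * 3)" unfolding e by simp
    then have "even (degree N1 + 2 * (e * degree A))" by (rule ssubst) simp
    then have 1: "even (degree N1)" by simp
    have "lead_coeff N1 * (lead_coeff A ^ e)\<^sup>2 = (lead_coeff p * lead_coeff A ^ n)\<^sup>2"
      using r(2) C3(2) unfolding e by (simp add: lead_coeff_mult lead_coeff_power power_mult_distrib mult.commute flip: power_mult)
    then have "\<exists>s. lead_coeff N1 = s\<^sup>2" by (rule square_mult_cancel) (use An in simp)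
    then show ?thesis using 1 by blast
  next
    assume p: "degree p \<le> 2 * degree q"
    let ?m = "2 * degree q"
    have "((\<lambda>x. ev2 (cx x) (t1 x) (sec1 p q) / (cx x * t1 x ^ ?m) * (ev2 (cx x) (t2 x) (sec1 p q) / (cx x * t2 x ^ ?m)))
        \<longlongrightarrow> (- of_rat ((lead_coeff q)\<^sup>2)) * (- of_rat ((lead_coeff q)\<^sup>2))) at_top"
      using t1 t2 p by (intro tendsto_mult sec1_limit_low cx_at_infinity)
    moreover have "eventually (\<lambda>x. ev2 (cx x) (t1 x) (sec1 p q) / (cx x * t1 x ^ ?m) * (ev2 (cx x) (t2 x) (sec1 p q) / (cx x * t2 x ^ ?m))
        = ev (N1 * A ^ ?m) (cx x) / ev (A ^ (2 * n) * C ^ ?m * [:0, 1:]\<^sup>2) (cx x)) at_top"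
      using val
    proof eventually_elim
      case (elim x)
      have "ev2 (cx x) (t1 x) (sec1 p q) / (cx x * t1 x ^ ?m) * (ev2 (cx x) (t2 x) (sec1 p q) / (cx x * t2 x ^ ?m))
        = (ev2 (cx x) (t1 x) (sec1 p q) * ev2 (cx x) (t2 x) (sec1 p q)) / ((cx x)\<^sup>2 * (t1 x * t2 x) ^ ?m)"
        by (simp add: power_mult_distrib power2_eq_square mult_ac)
      then show ?case using elim by (simp add: power_divide mult_ac)
    qed
    ultimately have "((\<lambda>x. ev (N1 * A ^ ?m) (cx x) / ev (A ^ (2 * n) * C ^ ?m * [:0, 1:]\<^sup>2) (cx x))
        \<longlongrightarrow> of_rat (((lead_coeff q)\<^sup>2)\<^sup>2)) at_top"
      by (simp only: of_rat_mult power2_eq_square minus_mult_minus) (rule Lim_transform_eventually)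
    from ratio_limit[OF _ _ _ this] False A C3(3) q
    have r: "degree (N1 * A ^ ?m) = degree (A ^ (2 * n) * C ^ ?m * [:0, 1:]\<^sup>2)"
      "lead_coeff (N1 * A ^ ?m) = ((lead_coeff q)\<^sup>2)\<^sup>2 * lead_coeff (A ^ (2 * n) * C ^ ?m * [:0, 1:]\<^sup>2)" by simp_all
    have "degree N1 + ?m * degree A = 2 * n * degree A + ?m * 3 + 2"
      using r(1) False A C3 by (simp add: degree_mult_eq degree_power_eq)
    then have "degree N1 + 2 * (degree q * degree A) = 2 * (n * degree A + degree q * 3 + 1)" by simp
    then have "even (degree N1 + 2 * (degree q * degree A))" by (rule ssubst) simp
    then have 1: "even (degree N1)" by simp
    have "lead_coeff N1 * (lead_coeff A ^ degree q)\<^sup>2 = ((lead_coeff q)\<^sup>2 * lead_coeff A ^ n)\<^sup>2"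
      using r(2) C3(2) by (simp add: lead_coeff_mult lead_coeff_power power_mult_distrib mult.commute flip: power_mult)
    then have "\<exists>s. lead_coeff N1 = s\<^sup>2" by (rule square_mult_cancel) (use An in simp)
    then show ?thesis using 1 by blast
  qed
qed auto

text \<open>If \<open>x\<close> has a simple pole at \<open>T = \<infinity>\<close>, the leading terms of \<open>p(T) - X q(T)\<^sup>2\<close> cancel at the
  place with \<open>T \<sim> - X / b\<^sub>2\<close>; there the leading coefficient is read off from \<open>f\<^sub>1 = r\<^sup>2 / f\<^sub>2\<close>.\<close>

lemma norm_leading_coeff_pole:
  fixes a :: rat and B C p q r U V :: "rat poly"
  defines "A \<equiv> [:a\<^sup>2:]"
  defines "a2 \<equiv> [:coeff C 2, coeff B 2, coeff A 2:]" and "a4 \<equiv> [:coeff C 1, coeff B 1, coeff A 1:]"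
    and "a6 \<equiv> [:coeff C 0, coeff B 0, coeff A 0:]"
  assumes a: "a \<noteq> 0" and B: "degree B = 2" and C: "degree (C - monom 1 3) \<le> 2"
    and t: "triple a2 a4 a6 p q r" and r: "r \<noteq> 0" and p: "degree p = 2 * degree q + 1"
    and eq: "[:A ^ n:] * sec1 p q = [:U:] + [:V:] * ramW A B + surf A B C * S"
  defines "N1 \<equiv> U\<^sup>2 - disc_AC A B C * V\<^sup>2"
  shows "even (degree N1) \<and> (\<exists>s. lead_coeff N1 = s\<^sup>2)"
proof (cases "N1 = 0")
  case False
  define b2 where "b2 = coeff B 2"
  define \<alpha> where "\<alpha> = a\<^sup>2"
  define l where "l = lead_coeff p"
  define m where "m = lead_coeff q"
  define dq where "dq = degree q"
  define dr where "dr = degree r"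
  have b2: "b2 \<noteq> 0" using B by (metis b2_def leading_coeff_0_iff degree_0 zero_neq_numeral)
  have \<alpha>: "\<alpha> \<noteq> 0" using a by (simp add: \<alpha>_def)
  have q: "q \<noteq> 0" and m: "m \<noteq> 0" using tripleD(1)[OF t] by (simp_all add: m_def)
  have a2: "a2 = [:coeff C 2, b2:]" and a4: "a4 = [:coeff C 1, coeff B 1:]"
    by (simp_all add: a2_def a4_def A_def b2_def numeral_2_eq_2)
  \<comment> \<open>The degree of \<open>r\<^sup>2\<close> is even, so the leading form in the odd
    degree \<open>6 * degree q + 3\<close> has to vanish.\<close>
  have l: "l = - (b2 * m\<^sup>2)"
  proof -
    have P: "top (2 * degree q + 1) p l" using p by (simp add: top_def l_def)
    have A2: "top 1 a2 b2" "top 2 a4 0" "degree a6 \<le> 2"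
      unfolding a2 a4 a6_def by (simp_all add: top_def degree_pCons_eq_if coeff_pCons split: nat.splits)
    have T: "top (6 * degree q + 3) (r\<^sup>2) (l ^ 3 + b2 * l\<^sup>2 * m\<^sup>2)"
      using top_r_square[OF t A2 P] by (simp add: m_def)
    have "l ^ 3 + b2 * l\<^sup>2 * m\<^sup>2 = 0"
    proof (rule ccontr)
      assume "l ^ 3 + b2 * l\<^sup>2 * m\<^sup>2 \<noteq> 0"
      with T have "degree (r\<^sup>2) = 6 * degree q + 3" by (rule top_nonzero)
      then have "2 * degree r = 6 * degree q + 3" using r by (simp add: degree_power_eq)
      then show False by presburger
    qed
    then have "l\<^sup>2 * (l + b2 * m\<^sup>2) = 0" by (simp add: power2_eq_square power3_eq_cube algebra_simps)
    moreover have "p \<noteq> 0" using p by auto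
    then have "l \<noteq> 0" by (simp add: l_def)
    ultimately have "l + b2 * m\<^sup>2 = 0" by simp
    then show ?thesis by (simp add: eq_neg_iff_add_eq_0)
  qed
  have degA: "A \<noteq> 0" "degree A \<le> 1" and degB: "degree B \<le> 2" using a B by (simp_all add: A_def)
  have evA: "ev A x = of_rat \<alpha>" for x by (simp add: A_def \<alpha>_def)
  define w0 where "w0 x = csqrt (ev (disc_AC A B C) (cx x))" for x
  \<comment> \<open>The sign makes \<open>t1\<close> the larger root. It is of order
    \<open>x\<^sup>2\<close> like \<open>B\<close>, and the other one is of order \<open>x\<close>,
    because their product is of order \<open>x ^ 3\<close>.\<close>
  define w where "w x = (if norm (w0 x - ev B (cx x)) \<ge> norm (- w0 x - ev B (cx x)) then w0 x else - w0 x)" for x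
  define t1 where "t1 x = (w x - ev B (cx x)) / (2 * of_rat \<alpha>)" for x
  define t2 where "t2 x = (- w x - ev B (cx x)) / (2 * of_rat \<alpha>)" for x
  have w: "(w x)\<^sup>2 = ev (disc_AC A B C) (cx x)" "(- w x)\<^sup>2 = ev (disc_AC A B C) (cx x)" for x
    by (simp_all add: w_def w0_def)
  have big: "norm (t2 x) \<le> norm (t1 x)" for x
    unfolding t1_def t2_def w_def by (auto simp: norm_divide intro!: divide_right_mono)
  have "filterlim (\<lambda>x. (w x - ev B (cx x)) / (2 * ev A (cx x))) at_infinity at_top"
    by (rule root_functions(1)[OF degA degB C w(1)])
  then have t1: "filterlim t1 at_infinity at_top" by (simp only: evA t1_def[abs_def])
  have "filterlim (\<lambda>x. (- w x - ev B (cx x)) / (2 * ev A (cx x))) at_infinity at_top"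
    by (rule root_functions(1)[OF degA degB C w(2)])
  then have t2: "filterlim t2 at_infinity at_top" by (simp only: evA t2_def[abs_def])
  have ne1: "eventually (\<lambda>x. t1 x \<noteq> 0) at_top" and ne2: "eventually (\<lambda>x. t2 x \<noteq> 0) at_top"
    using filterlim_at_infinity_imp_eventually_ne t1 t2 by blast+
  have \<alpha>C: "(of_rat \<alpha> :: complex) \<noteq> 0" using \<alpha> by simp
  have sum: "t1 x + t2 x = - (ev B (cx x) / of_rat \<alpha>)" for x
    using \<alpha>C by (simp add: t1_def t2_def add_divide_distrib[symmetric])
  have prod: "t1 x * t2 x = ev C (cx x) / of_rat \<alpha>" for x
    using root_product[OF w(1), of x] \<alpha>C unfolding evA by (simp add: t1_def t2_def)
  have invx: "((\<lambda>x. inverse (cx x)) \<longlongrightarrow> 0) at_top"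
    using filterlim_compose[OF tendsto_inverse_0 cx_at_infinity] .
  have Blim: "((\<lambda>x. ev B (cx x) / cx x ^ 2) \<longlongrightarrow> of_rat b2) at_top"
    unfolding b2_def by (rule cx_quotient) (use B in simp)
  have Clim: "((\<lambda>x. ev C (cx x) / cx x ^ 3) \<longlongrightarrow> 1) at_top"
  proof -
    have "((\<lambda>x. ev C (cx x) / cx x ^ 3) \<longlongrightarrow> of_rat (coeff C 3)) at_top"
      by (rule cx_quotient) (use monic_cubic_degree[OF C] in simp)
    then show ?thesis using monic_cubic_degree[OF C] by simp
  qed
  have xt1: "((\<lambda>x. cx x / t1 x) \<longlongrightarrow> 0) at_top"
  proof (rule tendsto_0_le[OF invx])
    define c where "c = norm (of_rat b2 / of_rat \<alpha> :: complex) / 4"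
    have c: "c > 0" using b2 \<alpha> by (simp add: c_def)
    have "((\<lambda>x. norm (ev B (cx x) / cx x ^ 2 / of_rat \<alpha>)) \<longlongrightarrow> norm (of_rat b2 / of_rat \<alpha> :: complex)) at_top"
      by (intro tendsto_intros Blim \<alpha>C)
    then have "eventually (\<lambda>x. norm (ev B (cx x) / cx x ^ 2 / of_rat \<alpha>) > 2 * c) at_top"
      by (rule order_tendstoD) (use c in \<open>simp add: c_def\<close>)
    then show "eventually (\<lambda>x. norm (cx x / t1 x) \<le> norm (inverse (cx x)) * inverse c) at_top"
      using cx_ne ne1
    proof eventually_elim
      case (elim x)
      have X: "norm (cx x) > 0" using elim by simp
      have "norm (ev B (cx x) / of_rat \<alpha>) \<le> 2 * norm (t1 x)"
        using norm_triangle_ineq[of "t1 x" "t2 x"] big[of x] unfolding sum by simp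
      moreover have "ev B (cx x) / of_rat \<alpha> = (ev B (cx x) / cx x ^ 2 / of_rat \<alpha>) * cx x ^ 2"
        using elim by simp
      then have "norm (ev B (cx x) / of_rat \<alpha>) = norm (ev B (cx x) / cx x ^ 2 / of_rat \<alpha>) * norm (cx x) ^ 2"
        by (simp only: norm_mult norm_power)
      moreover have "2 * c * norm (cx x) ^ 2 \<le> norm (ev B (cx x) / cx x ^ 2 / of_rat \<alpha>) * norm (cx x) ^ 2"
        using elim by (intro mult_right_mono) auto
      ultimately have "c * norm (cx x) * norm (cx x) \<le> norm (t1 x)" by (simp add: power2_eq_square)
      then have "norm (cx x) / norm (t1 x) \<le> norm (cx x) / (c * norm (cx x) * norm (cx x))"
        using X c elim by (intro divide_left_mono) (auto intro!: mult_pos_pos)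
      also have "\<dots> = norm (inverse (cx x)) * inverse c"
        using X c by (simp add: norm_inverse divide_inverse)
      finally show ?case by (simp only: norm_divide)
    qed
  qed
  have t2x: "((\<lambda>x. t2 x / cx x ^ 2) \<longlongrightarrow> 0) at_top"
  proof -
    have "((\<lambda>x. ev C (cx x) / cx x ^ 3 / of_rat \<alpha> * (cx x / t1 x)) \<longlongrightarrow> 1 / of_rat \<alpha> * 0) at_top"
      by (intro tendsto_intros Clim xt1 \<alpha>C)
    then have L: "((\<lambda>x. ev C (cx x) / cx x ^ 3 / of_rat \<alpha> * (cx x / t1 x)) \<longlongrightarrow> 0) at_top" by simp
    show ?thesis
    proof (rule Lim_transform_eventually[OF L])
      show "eventually (\<lambda>x. ev C (cx x) / cx x ^ 3 / of_rat \<alpha> * (cx x / t1 x) = t2 x / cx x ^ 2) at_top"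
        using cx_ne ne1
      proof eventually_elim
        case (elim x)
        have "ev C (cx x) = of_rat \<alpha> * (t1 x * t2 x)" using prod[of x] \<alpha>C by simp
        then show ?case using elim \<alpha>C by (simp add: power2_eq_square power3_eq_cube)
      qed
    qed
  qed
  have t1x: "((\<lambda>x. t1 x / cx x ^ 2) \<longlongrightarrow> - (of_rat b2 / of_rat \<alpha>)) at_top"
  proof -
    have "((\<lambda>x. - (ev B (cx x) / cx x ^ 2 / of_rat \<alpha>) - t2 x / cx x ^ 2) \<longlongrightarrow> - (of_rat b2 / of_rat \<alpha>) - 0) at_top"
      by (intro tendsto_intros Blim t2x \<alpha>C)
    moreover have "- (ev B (cx x) / cx x ^ 2 / of_rat \<alpha>) - t2 x / cx x ^ 2 = t1 x / cx x ^ 2" for x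
    proof -
      have "t1 x = - (ev B (cx x) / of_rat \<alpha>) - t2 x" using sum[of x] by (simp add: eq_diff_eq)
      then show ?thesis by (simp add: diff_divide_distrib mult.commute)
    qed
    ultimately show ?thesis by simp
  qed
  \<comment> \<open>\<open>T = \<beta> x\<close> is the zero of the leading part
    \<open>x ^ 3 + b2 x\<^sup>2 T\<close> of \<open>C + B T\<close>.\<close>
  define \<beta> where "\<beta> = - 1 / b2"
  have \<beta>: "\<beta> \<noteq> 0" using b2 by (simp add: \<beta>_def)
  have xi: "((\<lambda>x. t2 x / cx x) \<longlongrightarrow> of_rat \<beta>) at_top"
  proof -
    have "((\<lambda>x. ev C (cx x) / cx x ^ 3 / of_rat \<alpha> / (t1 x / cx x ^ 2)) \<longlongrightarrow> 1 / of_rat \<alpha> / (- (of_rat b2 / of_rat \<alpha>))) at_top"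
      by (intro tendsto_intros Clim t1x) (use b2 \<alpha> in simp_all)
    moreover have "1 / of_rat \<alpha> / (- (of_rat b2 / of_rat \<alpha>)) = (of_rat \<beta> :: complex)"
      using \<alpha> b2 by (simp add: \<beta>_def of_rat_divide of_rat_minus)
    ultimately have L: "((\<lambda>x. ev C (cx x) / cx x ^ 3 / of_rat \<alpha> / (t1 x / cx x ^ 2)) \<longlongrightarrow> of_rat \<beta>) at_top" by simp
    show ?thesis
    proof (rule Lim_transform_eventually[OF L])
      show "eventually (\<lambda>x. ev C (cx x) / cx x ^ 3 / of_rat \<alpha> / (t1 x / cx x ^ 2) = t2 x / cx x) at_top"
        using cx_ne ne1
      proof eventually_elim
        case (elim x)
        have "ev C (cx x) = of_rat \<alpha> * (t1 x * t2 x)" using prod[of x] \<alpha>C by simp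
        then show ?case using elim \<alpha>C by (simp add: power2_eq_square power3_eq_cube)
      qed
    qed
  qed
  have F1: "((\<lambda>x. ev2 (cx x) (t1 x) (sec1 p q) / cx x ^ (2 * degree p))
      \<longlongrightarrow> of_rat (l * (- (b2 / \<alpha>)) ^ degree p)) at_top"
  proof -
    have "((\<lambda>x. (ev p (t1 x) / t1 x ^ degree p - cx x / t1 x * (ev q (t1 x) / t1 x ^ dq)\<^sup>2) * (t1 x / cx x ^ 2) ^ degree p)
        \<longlongrightarrow> (of_rat l - 0 * (of_rat m)\<^sup>2) * (- (of_rat b2 / of_rat \<alpha>)) ^ degree p) at_top"
      unfolding l_def m_def dq_def by (intro tendsto_intros xt1 t1x tendsto_poly_quotient t1)
    moreover have "(of_rat l - 0 * (of_rat m)\<^sup>2) * (- (of_rat b2 / of_rat \<alpha>)) ^ degree p = (of_rat (l * (- (b2 / \<alpha>)) ^ degree p) :: complex)"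
      by (simp add: of_rat_mult of_rat_power of_rat_minus of_rat_divide)
    ultimately have L: "((\<lambda>x. (ev p (t1 x) / t1 x ^ degree p - cx x / t1 x * (ev q (t1 x) / t1 x ^ dq)\<^sup>2) * (t1 x / cx x ^ 2) ^ degree p)
        \<longlongrightarrow> of_rat (l * (- (b2 / \<alpha>)) ^ degree p)) at_top" by (simp only:)
    show ?thesis
    proof (rule Lim_transform_eventually[OF L])
      show "eventually (\<lambda>x. (ev p (t1 x) / t1 x ^ degree p - cx x / t1 x * (ev q (t1 x) / t1 x ^ dq)\<^sup>2) * (t1 x / cx x ^ 2) ^ degree p
          = ev2 (cx x) (t1 x) (sec1 p q) / cx x ^ (2 * degree p)) at_top"
        using ne1
      proof eventually_elim
        case (elim x)
        define z where "z = t1 x"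
        have z: "z \<noteq> 0" using elim by (simp add: z_def)
        have zp: "z ^ degree p = z * (z ^ dq)\<^sup>2" unfolding p dq_def by (simp add: mult.commute flip: power_mult)
        have "ev p z / z ^ degree p - cx x / z * (ev q z / z ^ dq)\<^sup>2 = (ev p z - cx x * (ev q z)\<^sup>2) / z ^ degree p"
          unfolding zp by (simp add: power_divide diff_divide_distrib)
        moreover have "(z / cx x ^ 2) ^ degree p = z ^ degree p / cx x ^ (2 * degree p)"
          by (simp add: power_divide flip: power_mult)
        ultimately show ?case using z unfolding z_def[symmetric] ev2_sec1 by simp
      qed
    qed
  qed
  \<comment> \<open>At \<open>t2\<close> the leading terms of \<open>sec1\<close> cancel, but those
    of its cofactor do not: with \<open>l \<beta> = m\<^sup>2\<close> and
    \<open>b2 \<beta> = - 1\<close> they sum to \<open>m ^ 4\<close>.\<close>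
  define G where "G x = ev2 (cx x) (t2 x) (sec2 a2 a4 p q) / (t2 x ^ (4 * dq) * cx x ^ 2)" for x
  have Glim: "(G \<longlongrightarrow> of_rat (m ^ 4)) at_top"
  proof -
    define P where "P x = ev p (t2 x) / t2 x ^ degree p" for x
    define Q where "Q x = ev q (t2 x) / t2 x ^ dq" for x
    define A2 where "A2 x = ev a2 (t2 x) / t2 x ^ 1" for x
    define A4 where "A4 x = ev a4 (t2 x) / t2 x ^ 1" for x
    define \<xi> where "\<xi> x = t2 x / cx x" for x
    have P: "(P \<longlongrightarrow> of_rat l) at_top" and Q: "(Q \<longlongrightarrow> of_rat m) at_top"
      unfolding P_def[abs_def] Q_def[abs_def] l_def m_def dq_def by (intro tendsto_poly_quotient t2)+
    have A2: "(A2 \<longlongrightarrow> of_rat b2) at_top"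
      using tendsto_poly_quotient_le[OF t2, of a2 1] by (simp add: A2_def[abs_def] a2 degree_pCons_eq_if)
    have A4: "(A4 \<longlongrightarrow> of_rat (coeff B 1)) at_top"
      using tendsto_poly_quotient_le[OF t2, of a4 1] by (simp add: A4_def[abs_def] a4 degree_pCons_eq_if)
    have xi': "(\<xi> \<longlongrightarrow> of_rat \<beta>) at_top" unfolding \<xi>_def[abs_def] by (rule xi)
    have "((\<lambda>x. (P x)\<^sup>2 * (\<xi> x)\<^sup>2 + P x * (Q x)\<^sup>2 * \<xi> x + Q x ^ 4 + A2 x * P x * (Q x)\<^sup>2 * (\<xi> x)\<^sup>2 + A2 x * \<xi> x * Q x ^ 4
          + A4 x * \<xi> x * Q x ^ 4 * inverse (cx x))
        \<longlongrightarrow> (of_rat l)\<^sup>2 * (of_rat \<beta>)\<^sup>2 + of_rat l * (of_rat m)\<^sup>2 * of_rat \<beta> + of_rat m ^ 4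
          + of_rat b2 * of_rat l * (of_rat m)\<^sup>2 * (of_rat \<beta>)\<^sup>2 + of_rat b2 * of_rat \<beta> * of_rat m ^ 4
          + of_rat (coeff B 1) * of_rat \<beta> * of_rat m ^ 4 * 0) at_top"
      by (intro tendsto_intros P Q A2 A4 xi' invx)
    moreover have "(of_rat l)\<^sup>2 * (of_rat \<beta>)\<^sup>2 + of_rat l * (of_rat m)\<^sup>2 * of_rat \<beta> + of_rat m ^ 4
          + of_rat b2 * of_rat l * (of_rat m)\<^sup>2 * (of_rat \<beta>)\<^sup>2 + of_rat b2 * of_rat \<beta> * of_rat m ^ 4
          + of_rat (coeff B 1) * of_rat \<beta> * of_rat m ^ 4 * 0
        = (of_rat (l\<^sup>2 * \<beta>\<^sup>2 + l * m\<^sup>2 * \<beta> + m ^ 4 + b2 * l * m\<^sup>2 * \<beta>\<^sup>2 + b2 * \<beta> * m ^ 4) :: complex)"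
      by (simp add: of_rat_add of_rat_mult of_rat_power)
    moreover have "l\<^sup>2 * \<beta>\<^sup>2 + l * m\<^sup>2 * \<beta> + m ^ 4 + b2 * l * m\<^sup>2 * \<beta>\<^sup>2 + b2 * \<beta> * m ^ 4 = m ^ 4"
    proof -
      have b: "b2 * \<beta> = - 1" using b2 by (simp add: \<beta>_def)
      have lb: "l * \<beta> = m\<^sup>2" using b2 by (simp add: l \<beta>_def)
      have "l\<^sup>2 * \<beta>\<^sup>2 + l * m\<^sup>2 * \<beta> + m ^ 4 + b2 * l * m\<^sup>2 * \<beta>\<^sup>2 + b2 * \<beta> * m ^ 4
        = (l * \<beta>)\<^sup>2 + (l * \<beta>) * m\<^sup>2 + m ^ 4 + (b2 * \<beta>) * (l * \<beta>) * m\<^sup>2 + (b2 * \<beta>) * m ^ 4"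
        by (simp add: power2_eq_square mult_ac)
      then show ?thesis unfolding b lb by (simp flip: power_add power_mult add: power2_eq_square eval_nat_numeral)
    qed
    ultimately have L: "((\<lambda>x. (P x)\<^sup>2 * (\<xi> x)\<^sup>2 + P x * (Q x)\<^sup>2 * \<xi> x + Q x ^ 4 + A2 x * P x * (Q x)\<^sup>2 * (\<xi> x)\<^sup>2 + A2 x * \<xi> x * Q x ^ 4
          + A4 x * \<xi> x * Q x ^ 4 * inverse (cx x)) \<longlongrightarrow> of_rat (m ^ 4)) at_top" by (simp only:)
    show ?thesis
    proof (rule Lim_transform_eventually[OF L])
      show "eventually (\<lambda>x. (P x)\<^sup>2 * (\<xi> x)\<^sup>2 + P x * (Q x)\<^sup>2 * \<xi> x + Q x ^ 4 + A2 x * P x * (Q x)\<^sup>2 * (\<xi> x)\<^sup>2 + A2 x * \<xi> x * Q x ^ 4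
          + A4 x * \<xi> x * Q x ^ 4 * inverse (cx x) = G x) at_top"
        using ne2 cx_ne
      proof eventually_elim
        case (elim x)
        define z where "z = t2 x"
        define y where "y = cx x"
        define Z where "Z = z ^ dq"
        have nz: "z \<noteq> 0" "y \<noteq> 0" "Z \<noteq> 0" using elim by (simp_all add: z_def y_def Z_def)
        have zp: "z ^ degree p = z * Z\<^sup>2" unfolding p Z_def dq_def by (simp add: mult.commute flip: power_mult)
        have z4: "z ^ (4 * dq) = Z ^ 4" unfolding Z_def by (simp add: mult.commute flip: power_mult)
        have e: "ev p z = P x * (z * Z\<^sup>2)" "ev q z = Q x * Z" "ev a2 z = A2 x * z" "ev a4 z = A4 x * z"
          using nz unfolding P_def Q_def A2_def A4_def z_def[symmetric] zp Z_def[symmetric] by simp_all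
        have z: "z = \<xi> x * y" using nz by (simp add: \<xi>_def z_def y_def)
        have "G x = (ev p z ^ 2 + y * (ev p z * (ev q z)\<^sup>2) + y\<^sup>2 * ev q z ^ 4 + ev a2 z * ev p z * (ev q z)\<^sup>2
            + y * (ev a2 z * ev q z ^ 4) + ev a4 z * ev q z ^ 4) / (Z ^ 4 * y\<^sup>2)"
          unfolding G_def z_def[symmetric] y_def[symmetric] z4 by (simp add: sec2_def)
        also have "\<dots> = (P x * P x * \<xi> x * \<xi> x + P x * (Q x * Q x) * \<xi> x + Q x ^ 4 + A2 x * P x * (Q x * Q x) * (\<xi> x * \<xi> x) + A2 x * \<xi> x * Q x ^ 4
          + A4 x * \<xi> x * Q x ^ 4 * inverse y) * (Z ^ 4 * y\<^sup>2) / (Z ^ 4 * y\<^sup>2)"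
        proof -
          have i: "inverse y * (y * y) = y" using nz by simp
          have "ev p z ^ 2 + y * (ev p z * (ev q z)\<^sup>2) + y\<^sup>2 * ev q z ^ 4 + ev a2 z * ev p z * (ev q z)\<^sup>2
            + y * (ev a2 z * ev q z ^ 4) + ev a4 z * ev q z ^ 4
            = (P x * P x * \<xi> x * \<xi> x + P x * (Q x * Q x) * \<xi> x + Q x ^ 4 + A2 x * P x * (Q x * Q x) * (\<xi> x * \<xi> x) + A2 x * \<xi> x * Q x ^ 4) * (Z ^ 4 * y\<^sup>2)
              + A4 x * \<xi> x * Q x ^ 4 * Z ^ 4 * (inverse y * (y * y))"
            unfolding i unfolding e unfolding z by (simp add: power2_eq_square eval_nat_numeral algebra_simps)
          then show ?thesis by (simp add: power2_eq_square algebra_simps)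
        qed
        also have "\<dots> = P x * P x * \<xi> x * \<xi> x + P x * (Q x * Q x) * \<xi> x + Q x ^ 4 + A2 x * P x * (Q x * Q x) * (\<xi> x * \<xi> x) + A2 x * \<xi> x * Q x ^ 4
          + A4 x * \<xi> x * Q x ^ 4 * inverse y" using nz by simp
        finally show ?case by (simp add: power2_eq_square y_def mult_ac)
      qed
    qed
  qed
  have F2: "((\<lambda>x. ev2 (cx x) (t2 x) (sec1 p q) * cx x ^ (2 + 4 * dq) / cx x ^ (2 * dr))
      \<longlongrightarrow> of_rat ((lead_coeff r)\<^sup>2 * \<beta> ^ (2 * dr) / (m ^ 4 * \<beta> ^ (4 * dq)))) at_top"
  proof -
    have "((\<lambda>x. (ev r (t2 x) / t2 x ^ dr)\<^sup>2 * (t2 x / cx x) ^ (2 * dr) / (G x * (t2 x / cx x) ^ (4 * dq)))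
        \<longlongrightarrow> (of_rat (lead_coeff r))\<^sup>2 * of_rat \<beta> ^ (2 * dr) / (of_rat (m ^ 4) * of_rat \<beta> ^ (4 * dq))) at_top"
      unfolding dr_def by (intro tendsto_intros Glim xi tendsto_poly_quotient t2) (use m \<beta> in simp)
    then have L: "((\<lambda>x. (ev r (t2 x) / t2 x ^ dr)\<^sup>2 * (t2 x / cx x) ^ (2 * dr) / (G x * (t2 x / cx x) ^ (4 * dq)))
        \<longlongrightarrow> of_rat ((lead_coeff r)\<^sup>2 * \<beta> ^ (2 * dr) / (m ^ 4 * \<beta> ^ (4 * dq)))) at_top"
      by (simp only: of_rat_mult of_rat_power of_rat_divide)
    have Gne: "eventually (\<lambda>x. G x \<noteq> 0) at_top"
      by (rule tendsto_imp_eventually_ne[OF Glim]) (use m in simp)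
    show ?thesis
    proof (rule Lim_transform_eventually[OF L])
      show "eventually (\<lambda>x. (ev r (t2 x) / t2 x ^ dr)\<^sup>2 * (t2 x / cx x) ^ (2 * dr) / (G x * (t2 x / cx x) ^ (4 * dq))
          = ev2 (cx x) (t2 x) (sec1 p q) * cx x ^ (2 + 4 * dq) / cx x ^ (2 * dr)) at_top"
        using ne2 cx_ne Gne
      proof eventually_elim
        case (elim x)
        define z where "z = t2 x"
        define y where "y = cx x"
        define f1 where "f1 = ev2 y z (sec1 p q)"
        define f2 where "f2 = ev2 y z (sec2 a2 a4 p q)"
        have nz: "z \<noteq> 0" "y \<noteq> 0" using elim by (simp_all add: z_def y_def)
        have Gx: "G x = f2 / (z ^ (4 * dq) * y\<^sup>2)" by (simp add: G_def f2_def z_def y_def)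
        then have f2: "f2 \<noteq> 0" using elim by auto
        have "ev2 y z (surf A B C) = 0"
          using ev2_reduce(1)[OF eq w(2), of x] \<alpha>C unfolding evA by (simp add: z_def y_def t2_def)
        moreover have "cubic a2 a4 a6 = surf A B C"
          unfolding a2_def a4_def a6_def surf_def using degA degB C by (intro cubic_surf) auto
        ultimately have f12: "f1 * f2 = (ev r z)\<^sup>2"
          using arg_cong[OF sec1_mult_sec2[OF t], of "ev2 y z"] by (simp add: f1_def f2_def del: inT_simps)
        have z2: "(z ^ dr)\<^sup>2 = z ^ (2 * dr)" by (simp add: mult.commute flip: power_mult)
        have "(ev r z / z ^ dr)\<^sup>2 * (z / y) ^ (2 * dr) / (G x * (z / y) ^ (4 * dq))
          = (f1 * f2 / z ^ (2 * dr)) * (z ^ (2 * dr) / y ^ (2 * dr)) / (f2 / (z ^ (4 * dq) * y\<^sup>2) * (z ^ (4 * dq) / y ^ (4 * dq)))"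
          unfolding Gx f12 z2[symmetric] by (simp only: power_divide) (simp only: z2)
        also have "\<dots> = (f1 * f2 / y ^ (2 * dr)) / (f2 / (y\<^sup>2 * y ^ (4 * dq)))" using nz by simp
        also have "\<dots> = f1 * y ^ (2 + 4 * dq) / y ^ (2 * dr)" using f2 nz by (simp add: power_add power2_eq_square)
        finally show ?case by (simp only: z_def y_def f1_def)
      qed
    qed
  qed
  define L where "L = \<alpha> ^ (2 * n) * ((l * (- (b2 / \<alpha>)) ^ degree p) * ((lead_coeff r)\<^sup>2 * \<beta> ^ (2 * dr) / (m ^ 4 * \<beta> ^ (4 * dq))))"
  \<comment> \<open>All exponents are even except in \<open>l * (- (b2 / \<alpha>))\<close>, which
    equals \<open>(b2 m)\<^sup>2 / \<alpha>\<close>. It is a square because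
    \<open>\<alpha> = a\<^sup>2\<close>, and this is where the family has to have a square leading
    coefficient.\<close>
  have Lsq: "L = (\<alpha> ^ n * (b2 / a * m * (b2 / \<alpha>) ^ dq * lead_coeff r * \<beta> ^ dr / (m\<^sup>2 * \<beta> ^ (2 * dq))))\<^sup>2"
  proof -
    have "(- (b2 / \<alpha>)) ^ degree p = - (b2 / \<alpha>) * ((b2 / \<alpha>) ^ dq)\<^sup>2"
      unfolding p dq_def by (simp add: mult.commute flip: power_mult)
    then have "l * (- (b2 / \<alpha>)) ^ degree p = (b2 / a * m * (b2 / \<alpha>) ^ dq)\<^sup>2"
      unfolding l by (simp add: \<alpha>_def power2_eq_square)
    moreover have "\<alpha> ^ (2 * n) = (\<alpha> ^ n)\<^sup>2" "\<beta> ^ (2 * dr) = (\<beta> ^ dr)\<^sup>2" "\<beta> ^ (4 * dq) = (\<beta> ^ (2 * dq))\<^sup>2" "m ^ 4 = (m\<^sup>2)\<^sup>2"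
      by (simp_all add: mult.commute flip: power_mult)
    ultimately show ?thesis unfolding L_def by (simp only: power_mult_distrib power_divide times_divide_eq_right mult_ac)
  qed
  have L0: "L \<noteq> 0" using \<alpha> b2 m \<beta> r l by (simp add: L_def)
  have "((\<lambda>x. of_rat \<alpha> ^ (2 * n) * (ev2 (cx x) (t1 x) (sec1 p q) / cx x ^ (2 * degree p)
      * (ev2 (cx x) (t2 x) (sec1 p q) * cx x ^ (2 + 4 * dq) / cx x ^ (2 * dr)))) \<longlongrightarrow> of_rat L) at_top"
    unfolding L_def of_rat_mult[of "\<alpha> ^ (2 * n)"] of_rat_mult[of "l * (- (b2 / \<alpha>)) ^ degree p"] of_rat_power
    by (intro tendsto_mult F1 F2 tendsto_const)
  moreover have "of_rat \<alpha> ^ (2 * n) * (ev2 (cx x) (t1 x) (sec1 p q) / cx x ^ (2 * degree p)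
      * (ev2 (cx x) (t2 x) (sec1 p q) * cx x ^ (2 + 4 * dq) / cx x ^ (2 * dr)))
      = ev (N1 * [:0, 1:] ^ (2 + 4 * dq)) (cx x) / ev ([:0, 1:] ^ (2 * degree p + 2 * dr)) (cx x)" for x
  proof -
    have N: "ev N1 (cx x) = of_rat \<alpha> ^ (2 * n) * (ev2 (cx x) (t1 x) (sec1 p q) * ev2 (cx x) (t2 x) (sec1 p q))"
      using norm_value[OF eq w(1), of x] \<alpha>C unfolding evA by (simp add: N1_def t1_def t2_def)
    have "ev (N1 * [:0, 1:] ^ (2 + 4 * dq)) (cx x) = ev N1 (cx x) * cx x ^ (2 + 4 * dq)"
      "ev ([:0, 1:] ^ (2 * degree p + 2 * dr)) (cx x) = cx x ^ (2 * degree p) * cx x ^ (2 * dr)"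
      by (simp_all only: ev_mult ev_power power_add) simp_all
    then show ?thesis unfolding N by (simp only: times_divide_eq_right times_divide_eq_left divide_divide_eq_left mult_ac)
  qed
  ultimately have lim: "((\<lambda>x. ev (N1 * [:0, 1:] ^ (2 + 4 * dq)) (cx x) / ev ([:0, 1:] ^ (2 * degree p + 2 * dr)) (cx x)) \<longlongrightarrow> of_rat L) at_top"
    by (simp only:)
  have X: "[:0, 1::rat:] ^ k \<noteq> 0" "degree ([:0, 1::rat:] ^ k) = k" "lead_coeff ([:0, 1::rat:] ^ k) = 1" for k
  proof -
    show "lead_coeff ([:0, 1::rat:] ^ k) = 1" by (simp only: lead_coeff_power) simp
  qed (simp_all add: degree_power_eq)
  have "N1 * [:0, 1:] ^ (2 + 4 * dq) \<noteq> 0" using False X(1) by (simp only: mult_eq_0_iff) simp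
  note rl = ratio_limit[OF this X(1) L0 lim]
  have "degree N1 + (2 + 4 * dq) = 2 * degree p + 2 * dr"
    using rl(1) unfolding degree_mult_eq[OF False X(1)] X(2) .
  then have "even (degree N1)" by presburger
  moreover have "lead_coeff N1 = L" using rl(2) unfolding lead_coeff_mult X(3) by simp
  ultimately show ?thesis using Lsq by blast
qed auto

section \<open>Generic curves have no points\<close>

lemma irreducible_quadratic:
  fixes B :: "rat poly"
  assumes deg: "degree B = 2" and disc: "\<And>s. (coeff B 1)\<^sup>2 - 4 * coeff B 0 * coeff B 2 \<noteq> s\<^sup>2"
  shows "irreducible B" "\<And>x. poly B x \<noteq> 0"
proof -
  have B: "B = [:coeff B 0, coeff B 1, coeff B 2:]" by (rule quadratic_poly_eq) (use deg in simp)
  have b2: "coeff B 2 \<noteq> 0" using deg by (metis leading_coeff_0_iff degree_0 zero_neq_numeral)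
  show nr: "poly B x \<noteq> 0" for x
  proof
    assume "poly B x = 0"
    then have "coeff B 0 + x * (coeff B 1 + x * coeff B 2) = 0" by (subst (asm) B) simp
    moreover have "(coeff B 1)\<^sup>2 - 4 * coeff B 0 * coeff B 2
      = (2 * coeff B 2 * x + coeff B 1)\<^sup>2 - 4 * coeff B 2 * (coeff B 0 + x * (coeff B 1 + x * coeff B 2))"
      by (simp add: power2_eq_square algebra_simps)
    ultimately show False using disc[of "2 * coeff B 2 * x + coeff B 1"] by simp
  qed
  have B0: "B \<noteq> 0" using deg by auto
  show "irreducible B"
  proof (rule irreducibleI)
    show "B \<noteq> 0" by (rule B0)
    show "\<not> is_unit B" using deg B0 by (simp add: is_unit_iff_degree)
    fix f g assume fg: "B = f * g"
    then have nz: "f \<noteq> 0" "g \<noteq> 0" using B0 by auto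
    have no1: "degree h \<noteq> 1" if "h dvd B" for h
    proof
      assume h: "degree h = 1"
      define c where "c = coeff h 1"
      have c: "c \<noteq> 0" unfolding c_def using h by (metis leading_coeff_0_iff degree_0 zero_neq_one)
      have "h = [:coeff h 0, c:]"
        using h by (auto simp: poly_eq_iff coeff_pCons coeff_eq_0 c_def split: nat.splits)
      then have "poly h (- coeff h 0 / c) = 0" using c by (metis (no_types) add.right_inverse mult_zero_right nonzero_mult_div_cancel_right poly_0 poly_pCons minus_divide_left mult.commute add.right_neutral times_divide_eq_left mult_minus_left)
      then show False using that nr by (metis dvdE mult_zero_left poly_mult)
    qed
    have "degree f + degree g = 2" using fg nz deg by (simp add: degree_mult_eq)
    moreover have "degree f \<noteq> 1" "degree g \<noteq> 1" using no1 fg by auto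
    ultimately have "degree f = 0 \<or> degree g = 0" by linarith
    then show "is_unit f \<or> is_unit g" using nz by (auto simp: is_unit_iff_degree)
  qed
qed

lemma conjugate_norm_rational:
  fixes B f :: "rat poly"
  assumes deg: "degree B = 2" and th: "ev B \<theta> = 0" "ev B \<theta>' = 0"
    and sum: "\<theta> + \<theta>' = of_rat s" and prod: "\<theta> * \<theta>' = of_rat n"
  shows "\<exists>N. ev f \<theta> * ev f \<theta>' = of_rat N"
proof -
  define g where "g = f mod B"
  have "B \<noteq> 0" using deg by auto
  then have "degree g \<le> 1" using degree_mod_less[of B f] deg by (auto simp: g_def)
  then have g: "g = [:coeff g 0, coeff g 1:]"
    by (auto simp: poly_eq_iff coeff_pCons coeff_eq_0 split: nat.splits)
  have f: "f = g + B * (f div B)" by (simp add: g_def)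
  have e: "ev f x = of_rat (coeff g 0) + of_rat (coeff g 1) * x" if "ev B x = 0" for x
    by (subst f, subst g) (simp add: that mult.commute)
  have "ev f \<theta> * ev f \<theta>' = of_rat ((coeff g 0)\<^sup>2) + of_rat (coeff g 0 * coeff g 1) * (\<theta> + \<theta>') + of_rat ((coeff g 1)\<^sup>2) * (\<theta> * \<theta>')"
    unfolding e[OF th(1)] e[OF th(2)] by (simp add: of_rat_mult of_rat_power power2_eq_square algebra_simps)
  also have "\<dots> = of_rat ((coeff g 0)\<^sup>2 + coeff g 0 * coeff g 1 * s + (coeff g 1)\<^sup>2 * n)"
    unfolding sum prod by (simp add: of_rat_add of_rat_mult)
  finally show ?thesis by blast
qed

definition normBC :: "'a::comm_ring_1 \<Rightarrow> 'a \<Rightarrow> 'a \<Rightarrow> 'a \<Rightarrow> 'a \<Rightarrow> 'a \<Rightarrow> 'a" where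
  "normBC b0 b1 b2 c0 c1 c2 =
    (2 * b2 * (b0 * b1 - c2 * b0 * b2 + c0 * b2\<^sup>2) - b1 * (b1\<^sup>2 - b0 * b2 - c2 * b1 * b2 + c1 * b2\<^sup>2))\<^sup>2
      - (b1\<^sup>2 - 4 * b0 * b2) * (b1\<^sup>2 - b0 * b2 - c2 * b1 * b2 + c1 * b2\<^sup>2)\<^sup>2"

text \<open>\<open>normBC\<close> is \<open>4 b\<^sub>2\<^sup>6\<close> times the norm of \<open>C(\<theta>)\<close> for a root \<open>\<theta>\<close> of \<open>B\<close>.\<close>

lemma not_square_residue:
  fixes B C :: "rat poly"
  assumes B: "irreducible B" "degree B = 2" and C: "degree (C - monom 1 3) \<le> 2"
    and nsq: "\<And>s. normBC (coeff B 0) (coeff B 1) (coeff B 2) (coeff C 0) (coeff C 1) (coeff C 2) \<noteq> s\<^sup>2"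
    and dvd: "B dvd h\<^sup>2 * C - smult c (g\<^sup>2)"
  shows "B dvd h"
proof (rule ccontr)
  assume h: "\<not> B dvd h"
  let ?b = "\<lambda>i. of_rat (coeff B i) :: complex" and ?c = "\<lambda>i. of_rat (coeff C i) :: complex"
  have b2: "coeff B 2 \<noteq> 0" using B(2) by (metis leading_coeff_0_iff degree_0 zero_neq_numeral)
  then have b2c: "?b 2 \<noteq> 0" by simp
  have evB: "ev B x = ?b 0 + ?b 1 * x + ?b 2 * x\<^sup>2" for x by (rule ev_quadratic) (use B in simp)
  obtain \<theta> where th: "ev B \<theta> = 0" using ev_root_exists[of B] B(2) by auto
  define \<theta>' where "\<theta>' = - (?b 1 / ?b 2) - \<theta>"
  have e: "?b 2 * \<theta>' = - ?b 1 - ?b 2 * \<theta>" using b2c by (simp add: \<theta>'_def right_diff_distrib)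
  have th0: "?b 0 + ?b 1 * \<theta> + ?b 2 * \<theta>\<^sup>2 = 0" using th by (simp add: evB)
  have pr: "?b 2 * (\<theta> * \<theta>') = ?b 0"
  proof -
    have "?b 2 * (\<theta> * \<theta>') = \<theta> * (?b 2 * \<theta>')" by simp
    also have "\<dots> = ?b 0 - (?b 0 + ?b 1 * \<theta> + ?b 2 * \<theta>\<^sup>2)" unfolding e by (simp add: power2_eq_square algebra_simps)
    finally show ?thesis unfolding th0 by simp
  qed
  have "?b 2 * ev B \<theta>' = ?b 2 * ?b 0 + ?b 1 * (?b 2 * \<theta>') + (?b 2 * \<theta>')\<^sup>2"
    unfolding evB by (simp add: power2_eq_square algebra_simps)
  also have "\<dots> = ?b 2 * (?b 0 + ?b 1 * \<theta> + ?b 2 * \<theta>\<^sup>2)" unfolding e by (simp add: power2_eq_square algebra_simps)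
  finally have th': "ev B \<theta>' = 0" using th0 b2c by simp
  have sum: "\<theta> + \<theta>' = of_rat (- coeff B 1 / coeff B 2)" by (simp add: \<theta>'_def of_rat_divide of_rat_minus)
  have prod: "\<theta> * \<theta>' = of_rat (coeff B 0 / coeff B 2)"
    using pr b2c by (simp add: of_rat_divide nonzero_eq_divide_eq mult.commute)
  note nr = conjugate_norm_rational[OF B(2) th th' sum prod]
  obtain Nh Ng NC where N: "ev h \<theta> * ev h \<theta>' = of_rat Nh" "ev g \<theta> * ev g \<theta>' = of_rat Ng" "ev C \<theta> * ev C \<theta>' = of_rat NC"
    using nr[of h] nr[of g] nr[of C] by blast
  have rel: "(ev h x)\<^sup>2 * ev C x = of_rat c * (ev g x)\<^sup>2" if "ev B x = 0" for x
  proof -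
    obtain m where m: "h\<^sup>2 * C - smult c (g\<^sup>2) = B * m" using dvd by blast
    show ?thesis using arg_cong[OF m, of "\<lambda>f. ev f x"] that by simp
  qed
  \<comment> \<open>Taking norms from \<open>Q[X] / B\<close> replaces the unknown constant
    \<open>c\<close> by its square, so that the norm of \<open>C\<close> becomes a square.\<close>
  have "of_rat (Nh\<^sup>2 * NC) = (ev h \<theta> * ev h \<theta>')\<^sup>2 * (ev C \<theta> * ev C \<theta>')"
    unfolding N by (simp add: of_rat_mult of_rat_power)
  also have "\<dots> = ((ev h \<theta>)\<^sup>2 * ev C \<theta>) * ((ev h \<theta>')\<^sup>2 * ev C \<theta>')" by (simp add: power_mult_distrib mult_ac)
  also have "\<dots> = (of_rat c * (ev g \<theta> * ev g \<theta>'))\<^sup>2" unfolding rel[OF th] rel[OF th'] by (simp add: power2_eq_square mult_ac)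
  also have "\<dots> = of_rat ((c * Ng)\<^sup>2)" unfolding N by (simp add: of_rat_mult of_rat_power)
  finally have "Nh\<^sup>2 * NC = (c * Ng)\<^sup>2" by (simp only: of_rat_eq_iff)
  moreover have "Nh \<noteq> 0"
  proof
    assume "Nh = 0"
    then have "ev h \<theta> = 0 \<or> ev h \<theta>' = 0" using N(1) by simp
    then show False using irreducible_dvd_of_common_root[OF B(1) th] irreducible_dvd_of_common_root[OF B(1) th'] h by blast
  qed
  ultimately have "\<exists>s. NC = s\<^sup>2" using square_mult_cancel[of NC Nh "c * Ng"] by (simp add: mult.commute)
  then obtain s where s: "NC = s\<^sup>2" by blast
  \<comment> \<open>\<open>\<tau> X + \<sigma>\<close> is \<open>b2\<^sup>2\<close> times the
    remainder of \<open>C\<close> modulo \<open>B\<close>.\<close>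
  define \<tau> where "\<tau> = ?b 1 ^ 2 - ?b 0 * ?b 2 - ?c 2 * ?b 1 * ?b 2 + ?c 1 * ?b 2 ^ 2"
  define \<sigma> where "\<sigma> = ?b 0 * ?b 1 - ?c 2 * ?b 0 * ?b 2 + ?c 0 * ?b 2 ^ 2"
  have Cx: "?b 2 ^ 2 * ev C x = \<tau> * x + \<sigma>" if "ev B x = 0" for x
  proof -
    have "?b 2 ^ 2 * ev C x - (\<tau> * x + \<sigma>) = (?b 2 * x + ?c 2 * ?b 2 - ?b 1) * (?b 0 + ?b 1 * x + ?b 2 * x\<^sup>2)"
      unfolding ev_monic_cubic[OF C] \<tau>_def \<sigma>_def by (simp add: power2_eq_square power3_eq_cube algebra_simps)
    then show ?thesis using that by (simp add: evB)
  qed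
  have "4 * ?b 2 ^ 6 * (ev C \<theta> * ev C \<theta>') = 4 * ?b 2 ^ 2 * ((?b 2 ^ 2 * ev C \<theta>) * (?b 2 ^ 2 * ev C \<theta>'))"
    by (simp add: eval_nat_numeral mult_ac)
  also have "\<dots> = 4 * ?b 2 * (\<tau>\<^sup>2 * (?b 2 * (\<theta> * \<theta>')) + \<tau> * \<sigma> * (?b 2 * \<theta> + ?b 2 * \<theta>') + ?b 2 * \<sigma>\<^sup>2)"
    unfolding Cx[OF th] Cx[OF th'] by (simp add: power2_eq_square algebra_simps)
  also have "\<dots> = (2 * ?b 2 * \<sigma> - ?b 1 * \<tau>)\<^sup>2 - (?b 1 ^ 2 - 4 * ?b 0 * ?b 2) * \<tau>\<^sup>2"
    unfolding pr e by (simp add: power2_eq_square algebra_simps)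
  also have "\<dots> = of_rat (normBC (coeff B 0) (coeff B 1) (coeff B 2) (coeff C 0) (coeff C 1) (coeff C 2))"
    unfolding normBC_def \<tau>_def \<sigma>_def by (simp add: of_rat_add of_rat_diff of_rat_mult of_rat_power)
  also have "4 * ?b 2 ^ 6 * (ev C \<theta> * ev C \<theta>') = of_rat ((2 * coeff B 2 ^ 3 * s)\<^sup>2)"
    unfolding N s by (simp add: of_rat_mult of_rat_power power_mult_distrib flip: power_mult)
  finally show False using nsq by (simp only: of_rat_eq_iff) metis
qed

theorem no_triple_A0:
  fixes B C :: "rat poly"
  assumes B: "degree B = 2" and C: "degree (C - monom 1 3) \<le> 2"
    and disc: "\<And>s. (coeff B 1)\<^sup>2 - 4 * coeff B 0 * coeff B 2 \<noteq> s\<^sup>2"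
    and nsq: "\<And>s. normBC (coeff B 0) (coeff B 1) (coeff B 2) (coeff C 0) (coeff C 1) (coeff C 2) \<noteq> s\<^sup>2"
  shows "\<not> triple [:coeff C 2, coeff B 2:] [:coeff C 1, coeff B 1:] [:coeff C 0, coeff B 0:] p q r"
proof -
  let ?a2 = "[:coeff C 2, coeff B 2:]" and ?a4 = "[:coeff C 1, coeff B 1:]" and ?a6 = "[:coeff C 0, coeff B 0:]"
  note irr = irreducible_quadratic[OF B disc]
  have nosq: "B dvd h" if "B dvd h\<^sup>2 * C - smult c (g\<^sup>2)" for c g h
    by (rule not_square_residue[OF irr(1) B C nsq that])
  have BC: "\<not> B dvd C"
  proof
    assume "B dvd C"
    then have "B dvd 1\<^sup>2 * C - smult 0 (0\<^sup>2)" by simp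
    then have "B dvd 1" by (rule nosq)
    then show False using irr(1) irreducible_not_unit by blast
  qed
  have cop: "coprime B C" using irr(1) BC by (simp add: irreducible_imp_prime_elem prime_elem_imp_coprime)
  have degB: "degree B \<le> 2" using B by simp
  have smooth: "smooth_surface ?a2 ?a4 ?a6" by (rule smooth_of_coprime[OF degB C cop])
  have b2: "coeff B 2 \<noteq> 0" using B by (metis leading_coeff_0_iff degree_0 zero_neq_numeral)
  have a: "top 1 ?a2 (coeff B 2)" "top 1 ?a4 (coeff B 1)" "degree ?a6 \<le> 2"
    by (simp_all add: top_def degree_pCons_eq_if)
  have a': "degree ?a2 \<le> 1" "degree ?a4 \<le> 2" "degree ?a6 \<le> 2" by (simp_all add: degree_pCons_eq_if)
  have root: "coeff B 2 * x\<^sup>2 + coeff B 1 * x + coeff ?a6 1 \<noteq> 0" for x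
    using irr(2)[of x] by (subst (asm) quadratic_poly_eq[OF degB]) (simp add: power2_eq_square algebra_simps)
  show ?thesis
  proof (rule no_sections[OF smooth])
    fix p q r assume t: "triple ?a2 ?a4 ?a6 p q r" and "degree r = 0"
    then show "degree (double_num ?a2 ?a4 p q r) = 4 + 8 * degree q"
      by (intro low_quadratic[OF t a b2 root])
  next
    fix p q r assume t: "triple ?a2 ?a4 ?a6 p q r" and "2 * degree q + 2 \<le> degree p"
    then show "2 * degree r = 3 * degree p" by (intro degree_r_high[OF t a'])
  next
    fix p q r assume t: "triple ?a2 ?a4 ?a6 p q r" and r: "r \<noteq> 0"
    show "\<exists>p' q' r'. triple ?a2 ?a4 ?a6 p' q' r' \<and>
        4 * r'\<^sup>2 * q'\<^sup>2 * p = q\<^sup>2 * double_num ?a2 ?a4 p' q' r'"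
      by (rule descent_A0[OF irr(1) B C BC nosq smooth t r])
  qed
qed

text \<open>The norm at infinity is treated by the order of the pole of
  \<open>p / q\<^sup>2\<close>: a simple pole is the case of cancellation, and for a larger one
  \<open>2 * degree r = 3 * degree p\<close> makes \<open>degree p\<close> even.\<close>

theorem no_triple_square:
  fixes a :: rat and B C :: "rat poly"
  defines "A \<equiv> [:a\<^sup>2:]"
  assumes a: "a \<noteq> 0" and B: "degree B = 2" and C: "degree (C - monom 1 3) \<le> 2"
    and D: "irreducible (disc_AC A B C)" "degree (disc_AC A B C) > 1"
  shows "\<not> triple [:coeff C 2, coeff B 2, coeff A 2:] [:coeff C 1, coeff B 1, coeff A 1:] [:coeff C 0, coeff B 0, coeff A 0:] p q r"
proof -
  let ?a2 = "[:coeff C 2, coeff B 2, coeff A 2:]" and ?a4 = "[:coeff C 1, coeff B 1, coeff A 1:]"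
    and ?a6 = "[:coeff C 0, coeff B 0, coeff A 0:]"
  have A: "A \<noteq> 0" "degree A \<le> 1" "degree A \<le> 2" and degB: "degree B \<le> 2" using a B by (simp_all add: A_def)
  have cA: "coeff A 2 = 0" "coeff A 1 = 0" "coeff A 0 = a\<^sup>2" by (simp_all add: A_def numeral_2_eq_2)
  have smooth: "smooth_surface ?a2 ?a4 ?a6" by (rule smooth_of_disc[OF A(3) degB C D(1)])
  have b2: "coeff B 2 \<noteq> 0" using B by (metis leading_coeff_0_iff degree_0 zero_neq_numeral)
  have a': "top 1 ?a2 (coeff B 2)" "top 1 ?a4 (coeff B 1)" "degree ?a6 \<le> 2"
    unfolding cA by (simp_all add: top_def degree_pCons_eq_if)
  have a'': "degree ?a2 \<le> 1" "degree ?a4 \<le> 2" "degree ?a6 \<le> 2"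
    unfolding cA by (simp_all add: degree_pCons_eq_if)
  have nz6: "coeff ?a6 2 \<noteq> 0" unfolding cA using a by (simp add: numeral_2_eq_2)
  show ?thesis
  proof (rule no_sections[OF smooth])
    fix p q r assume t: "triple ?a2 ?a4 ?a6 p q r" and "degree r = 0"
    then show "degree (double_num ?a2 ?a4 p q r) = 4 + 8 * degree q"
      using nz6 by (intro low_quadratic[OF t a' b2]) blast+
  next
    fix p q r assume t: "triple ?a2 ?a4 ?a6 p q r" and "2 * degree q + 2 \<le> degree p"
    then show "2 * degree r = 3 * degree p" by (intro degree_r_high[OF t a''])
  next
    fix p q r assume t: "triple ?a2 ?a4 ?a6 p q r" and r: "r \<noteq> 0"
    show "\<exists>p' q' r'. triple ?a2 ?a4 ?a6 p' q' r' \<and>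
        4 * r'\<^sup>2 * q'\<^sup>2 * p = q\<^sup>2 * double_num ?a2 ?a4 p' q' r'"
    proof (rule descent_A[OF A(1,2) degB C D smooth t r])
      fix n U V S assume eq: "[:A ^ n:] * sec1 p q = [:U:] + [:V:] * ramW A B + surf A B C * S"
      consider "degree p \<le> 2 * degree q" | "degree p = 2 * degree q + 1" | "degree p \<ge> 2 * degree q + 2" by linarith
      then show "even (degree (U\<^sup>2 - disc_AC A B C * V\<^sup>2)) \<and> (\<exists>s. lead_coeff (U\<^sup>2 - disc_AC A B C * V\<^sup>2) = s\<^sup>2)"
      proof cases
        case 2
        then show ?thesis
          using norm_leading_coeff_pole[OF a B C _ r 2 eq[unfolded A_def]] t unfolding A_def by blast
      next
        case 3
        then have "2 * degree r = 3 * degree p" by (rule degree_r_high[OF t a''])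
        then have "even (degree p)" by presburger
        then show ?thesis using norm_leading_coeff[OF A(1,2) degB C tripleD(1)[OF t] _ eq] 3 by blast
      qed (use norm_leading_coeff[OF A(1,2) degB C tripleD(1)[OF t] _ eq] in blast)
    qed
  qed
qed

text \<open>The case of a simple pole does not occur: its leading form would give
  \<open>l\<^sup>2 = - a1 m ^ 4\<close> with \<open>a1 = coeff A 1\<close>, the leading coefficient
  \<open>l\<close> of \<open>p\<close> and \<open>m\<close> of \<open>q\<close>.\<close>

theorem no_triple_linear:
  fixes A B C :: "rat poly"
  assumes deg: "degree A \<le> 1" "degree B \<le> 1" "degree (C - monom 1 3) \<le> 1"
    and a1: "\<And>s. - coeff A 1 \<noteq> s\<^sup>2"
    and D: "irreducible (disc_AC A B C)" "degree (disc_AC A B C) > 1"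
  shows "\<not> triple [:coeff C 2, coeff B 2, coeff A 2:] [:coeff C 1, coeff B 1, coeff A 1:] [:coeff C 0, coeff B 0, coeff A 0:] p q r"
proof -
  let ?a2 = "[:coeff C 2, coeff B 2, coeff A 2:]" and ?a4 = "[:coeff C 1, coeff B 1, coeff A 1:]"
    and ?a6 = "[:coeff C 0, coeff B 0, coeff A 0:]"
  have A0: "A \<noteq> 0" using a1[of 0] by auto
  have deg2: "degree A \<le> 2" "degree B \<le> 2" "degree (C - monom 1 3) \<le> 2" using deg by simp_all
  have "coeff (C - monom 1 3) 2 = 0" using deg(3) by (intro coeff_eq_0) simp
  then have c0: "coeff A 2 = 0" "coeff B 2 = 0" "coeff C 2 = 0" using deg by (simp_all add: coeff_eq_0)
  have smooth: "smooth_surface ?a2 ?a4 ?a6" by (rule smooth_of_disc[OF deg2 D(1)])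
  have a': "top 1 ?a2 0" "top 2 ?a4 (coeff A 1)" "degree ?a6 \<le> 2"
    unfolding c0 by (simp_all add: top_def degree_pCons_eq_if numeral_2_eq_2)
  have a'': "degree ?a2 \<le> 1" "degree ?a4 \<le> 2" "degree ?a6 \<le> 2"
    unfolding c0 by (simp_all add: degree_pCons_eq_if)
  show ?thesis
  proof (rule no_sections[OF smooth])
    fix p q r assume t: "triple ?a2 ?a4 ?a6 p q r" and "degree r = 0"
    then show "degree (double_num ?a2 ?a4 p q r) = 4 + 8 * degree q"
      by (intro low_linear[OF t a' a1])
  next
    fix p q r assume t: "triple ?a2 ?a4 ?a6 p q r" and "2 * degree q + 2 \<le> degree p"
    then show "2 * degree r = 3 * degree p" by (intro degree_r_high[OF t a''])
  next
    fix p q r assume t: "triple ?a2 ?a4 ?a6 p q r" and r: "r \<noteq> 0"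
    show "\<exists>p' q' r'. triple ?a2 ?a4 ?a6 p' q' r' \<and>
        4 * r'\<^sup>2 * q'\<^sup>2 * p = q\<^sup>2 * double_num ?a2 ?a4 p' q' r'"
    proof (rule descent_A[OF A0 deg(1) deg2(2,3) D smooth t r])
      fix n U V S assume eq: "[:A ^ n:] * sec1 p q = [:U:] + [:V:] * ramW A B + surf A B C * S"
      have "(degree p \<ge> 2 * degree q + 2 \<and> even (degree p)) \<or> degree p \<le> 2 * degree q"
      proof (cases "degree p \<ge> 2 * degree q + 2")
        case True
        then have "2 * degree r = 3 * degree p" by (rule degree_r_high[OF t a''])
        then show ?thesis using True by presburger
      next
        case False
        show ?thesis
        proof (rule ccontr)
          assume "\<not> ?thesis"
          then have d: "degree p = 2 * degree q + 1" using False by linarith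
          let ?l = "lead_coeff p" and ?m = "lead_coeff q"
          have "p \<noteq> 0" using d by auto
          then have nz: "?l \<noteq> 0" "?m \<noteq> 0" using tripleD(1)[OF t] by simp_all
          have P: "top (2 * degree q + 1) p ?l" using d by (simp add: top_def)
          have T: "top (6 * degree q + 3) (r\<^sup>2) (?l ^ 3 + coeff A 1 * ?l * ?m ^ 4)"
            using top_r_square[OF t a' P] by simp
          have "?l ^ 3 + coeff A 1 * ?l * ?m ^ 4 = 0"
          proof (rule ccontr)
            assume "?l ^ 3 + coeff A 1 * ?l * ?m ^ 4 \<noteq> 0"
            with T have "degree (r\<^sup>2) = 6 * degree q + 3" by (rule top_nonzero)
            then have "2 * degree r = 6 * degree q + 3" using r by (simp add: degree_power_eq)
            then show False by presburger
          qed
          then have "?l * (?l\<^sup>2 + coeff A 1 * ?m ^ 4) = 0" by (simp add: power2_eq_square power3_eq_cube algebra_simps)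
          then have "?l\<^sup>2 + coeff A 1 * (?m\<^sup>2)\<^sup>2 = 0" using nz by simp
          then have "- coeff A 1 * (?m\<^sup>2)\<^sup>2 = ?l\<^sup>2" by (simp add: add_eq_0_iff2)
          then have "\<exists>s. - coeff A 1 = s\<^sup>2" by (rule square_mult_cancel) (use nz in simp)
          then show False using a1 by blast
        qed
      qed
      then show "even (degree (U\<^sup>2 - disc_AC A B C * V\<^sup>2)) \<and> (\<exists>s. lead_coeff (U\<^sup>2 - disc_AC A B C * V\<^sup>2) = s\<^sup>2)"
        by (rule norm_leading_coeff[OF A0 deg(1) deg2(2,3) tripleD(1)[OF t] _ eq])
    qed
  qed
qed

section \<open>Densities of the good residue vectors\<close>

text \<open>Vectors are presented as lists. \<open>R\<close> says how the parameters can be read off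
  a vector, and this makes the construction injective.\<close>

lemma card_le_residue_vectors:
  assumes "\<And>x. x \<in> A \<Longrightarrow> \<exists>xs. length xs = n \<and> set xs \<subseteq> {0..<int m} \<and> P (restrict (nth xs) {..<n}) \<and> R x (restrict (nth xs) {..<n})"
    and "\<And>x x' v. x \<in> A \<Longrightarrow> x' \<in> A \<Longrightarrow> R x v \<Longrightarrow> R x' v \<Longrightarrow> x = x'"
  shows "card A \<le> card (residue_vectors n m P)"
proof (rule card_le_rel[OF finite_residue_vectors, where R = R])
  fix x assume "x \<in> A"
  then obtain xs where xs: "length xs = n" "set xs \<subseteq> {0..<int m}" "P (restrict (nth xs) {..<n})"
    "R x (restrict (nth xs) {..<n})" using assms(1) by blast
  have "restrict (nth xs) {..<n} \<in> PiE {..<n} (\<lambda>_. {0..<int m})"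
    by (rule restrict_PiE_iff[THEN iffD2]) (use xs(1,2) nth_mem in blast)
  then have "restrict (nth xs) {..<n} \<in> residue_vectors n m P" using xs(3) by (simp only: residue_vectors_def mem_Collect_eq)
  then show "\<exists>v\<in>residue_vectors n m P. R x v" using xs(4) by blast
qed (use assms(2) in blast)

context odd_prime
begin

text \<open>An integer that is a non-square modulo \<open>p\<close> is a non-square over the
  rationals, so both hypotheses of the case \<open>A = 0\<close> follow from these residue
  conditions.\<close>

definition good_0 :: "(nat \<Rightarrow> int) \<Rightarrow> bool" where
  "good_0 v \<longleftrightarrow> nonsq p ((v 1)\<^sup>2 - 4 * v 0 * v 2) \<and> nonsq p (normBC (v 0) (v 1) (v 2) (v 3) (v 4) (v 5))"

lemma normBC_cong:
  assumes "[b0 = b0'] (mod p)" "[b1 = b1'] (mod p)" "[b2 = b2'] (mod p)"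
    "[c0 = c0'] (mod p)" "[c1 = c1'] (mod p)" "[c2 = c2'] (mod p)"
  shows "[normBC b0 b1 b2 c0 c1 c2 = normBC b0' b1' b2' c0' c1' c2'] (mod p)"
  unfolding normBC_def by (intro cong_add cong_diff cong_mult cong_pow cong_refl assms)

lemma int_nat_p: "int (nat p) = p" "nat p = 2 * half + 1"
  using odd_p by simp_all

lemma periodicI:
  assumes "\<And>v w. (\<And>i. i < n \<Longrightarrow> [v i = w i] (mod p)) \<Longrightarrow> P v \<Longrightarrow> P w"
  shows "periodic n (nat p) P"
proof -
  have "P v = P w" if c: "\<forall>i<n. v i mod p = w i mod p" for v w
  proof
    have vw: "[v i = w i] (mod p)" if "i < n" for i unfolding cong_def by (rule c[rule_format, OF that])
    assume "P v"
    show "P w" by (rule assms[OF vw \<open>P v\<close>])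
  next
    have wv: "[w i = v i] (mod p)" if "i < n" for i
      unfolding cong_def by (rule c[rule_format, OF that, symmetric])
    assume "P w"
    show "P v" by (rule assms[OF wv \<open>P w\<close>])
  qed
  then show ?thesis unfolding periodic_def int_nat_p(1) by (intro allI impI)
qed

lemma periodic_good_0: "periodic 6 (nat p) good_0"
proof (rule periodicI)
  fix v w assume c: "\<And>i. i < 6 \<Longrightarrow> [v i = w i] (mod p)" and g: "good_0 v"
  have "[(v 1)\<^sup>2 - 4 * v 0 * v 2 = (w 1)\<^sup>2 - 4 * w 0 * w 2] (mod p)"
    by (intro cong_diff cong_mult cong_pow cong_refl c) simp_all
  moreover have "[normBC (v 0) (v 1) (v 2) (v 3) (v 4) (v 5) = normBC (w 0) (w 1) (w 2) (w 3) (w 4) (w 5)] (mod p)"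
    by (intro normBC_cong c) simp_all
  ultimately show "good_0 w" using g nonsq_cong unfolding good_0_def by blast
qed

lemma p_le_half: "2 * half + 1 \<le> 4 * half"
  using half_ge_2 by simp

text \<open>The coordinates are chosen in the order b0, b1, b2, c2, c1, c0. Then the discriminant is
  linear in b2, \<open>\<tau>\<close> is linear in c1, and the norm is a square minus a unit as a
  function of c0; the requirements that b0 and \<open>\<tau>\<close> be units provide the invertible
  coefficients. The constant 64 comes from four uses of \<open>p \<le> 4 * half\<close>.\<close>

lemma density_good_0: "(nat p) ^ 6 \<le> 64 * card (residue_vectors 6 (nat p) good_0)"
proof -
  define \<Delta> where "\<Delta> b0 b1 b2 = b1\<^sup>2 - 4 * b0 * b2" for b0 b1 b2 :: int
  define \<tau> where "\<tau> b0 b1 b2 c2 c1 = b2\<^sup>2 * c1 + (b1\<^sup>2 - b0 * b2 - c2 * b1 * b2)" for b0 b1 b2 c1 c2 :: int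
  define B2 where "B2 b0 b1 = {b2 \<in> U. nonsq p (\<Delta> b0 b1 b2)}" for b0 b1
  define C1 where "C1 b0 b1 b2 c2 = {c1 \<in> U. \<not> p dvd \<tau> b0 b1 b2 c2 c1}" for b0 b1 b2 c2
  define C0 where "C0 b0 b1 b2 c2 c1 = {c0 \<in> U. nonsq p (normBC b0 b1 b2 c0 c1 c2)}" for b0 b1 b2 c2 c1
  define A where "A = Sigma {1..<p} (\<lambda>b0. Sigma U (\<lambda>b1. Sigma (B2 b0 b1) (\<lambda>b2. Sigma U (\<lambda>c2.
    Sigma (C1 b0 b1 b2 c2) (\<lambda>c1. C0 b0 b1 b2 c2 c1)))))"
  have fin: "finite (B2 b0 b1)" "finite (C1 b0 b1 b2 c2)" "finite (C0 b0 b1 b2 c2 c1)" for b0 b1 b2 c2 c1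
    unfolding B2_def C1_def C0_def by simp_all
  have b2_unit: "\<not> p dvd b2" if "b2 \<in> B2 b0 b1" for b0 b1 b2
  proof
    assume "p dvd b2"
    then have "[\<Delta> b0 b1 b2 = b1\<^sup>2] (mod p)" by (simp add: \<Delta>_def cong_iff_dvd_diff)
    then show False using that unfolding B2_def nonsq_def by blast
  qed
  have B2: "card (B2 b0 b1) = half" if "b0 \<in> {1..<p}" for b0 b1
  proof -
    have nd: "\<not> p dvd (- 4) * b0" using not_dvd_unit[OF that] not_dvd_numerals(3) dvd_mult_iff by simp
    have "B2 b0 b1 = {b2 \<in> U. nonsq p ((- 4) * b0 * b2 + b1\<^sup>2)}" by (simp add: B2_def \<Delta>_def)
    then have "card (B2 b0 b1) = card {y \<in> U. nonsq p y}"
      by (simp only:) (rule card_affine[OF nd], rule nonsq_cong)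
    then show ?thesis by (simp only: card_nonsq)
  qed
  have C1: "2 * half \<le> card (C1 b0 b1 b2 c2)" if "b2 \<in> B2 b0 b1" for b0 b1 b2 c2
  proof -
    have nd: "\<not> p dvd b2\<^sup>2" using b2_unit[OF that] dvd_mult_iff by (simp add: power2_eq_square)
    have "card (C1 b0 b1 b2 c2) = card {y \<in> U. \<not> p dvd y}"
      unfolding C1_def \<tau>_def by (rule card_affine[OF nd]) (simp only: cong_dvd_iff)
    moreover have "{1..<p} \<subseteq> {y \<in> U. \<not> p dvd y}" using not_dvd_unit by auto
    then have "card {1..<p} \<le> card {y \<in> U. \<not> p dvd y}" by (rule card_mono[rotated]) simp
    ultimately show ?thesis by (simp only: card_units)
  qed
  have C0: "half \<le> card (C0 b0 b1 b2 c2 c1)" if b2: "b2 \<in> B2 b0 b1" and c1: "c1 \<in> C1 b0 b1 b2 c2" for b0 b1 b2 c2 c1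
  proof -
    let ?m = "\<Delta> b0 b1 b2 * (\<tau> b0 b1 b2 c2 c1)\<^sup>2"
    let ?c = "2 * b2 * (b0 * b1 - c2 * b0 * b2) - b1 * \<tau> b0 b1 b2 c2 c1"
    have nd: "\<not> p dvd 2 * b2 ^ 3" using b2_unit[OF b2] not_dvd_numerals(1) dvd_mult_iff by (simp add: power3_eq_cube)
    have m: "\<not> p dvd ?m"
      using nonsq_not_dvd[of "\<Delta> b0 b1 b2"] b2 c1 by (simp add: B2_def C1_def dvd_mult_iff power2_eq_square)
    have N: "normBC b0 b1 b2 c0 c1 c2 = (2 * b2 ^ 3 * c0 + ?c)\<^sup>2 - ?m" for c0
      unfolding normBC_def \<Delta>_def \<tau>_def by (simp add: power2_eq_square power3_eq_cube algebra_simps)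
    have "card (C0 b0 b1 b2 c2 c1) = card {y \<in> U. nonsq p (y\<^sup>2 - ?m)}"
      unfolding C0_def N
      by (rule card_affine[OF nd, of "\<lambda>y. nonsq p (y\<^sup>2 - ?m)"]) (intro nonsq_cong cong_diff cong_pow cong_refl)
    then show ?thesis using card_square_minus[OF m] by (simp only:)
  qed
  have "2 * half * ((2 * half + 1) * (half * ((2 * half + 1) * (2 * half * half)))) \<le> card A"
  proof -
    have "2 * half * half \<le> card (Sigma (C1 b0 b1 b2 c2) (\<lambda>c1. C0 b0 b1 b2 c2 c1))" if "b2 \<in> B2 b0 b1" for b0 b1 b2 c2
      by (rule order_trans[OF mult_right_mono[OF C1[OF that, of c2]] card_Sigma_ge]) (use fin C0 that in auto)
    then have 1: "(2 * half + 1) * (2 * half * half)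
        \<le> card (Sigma U (\<lambda>c2. Sigma (C1 b0 b1 b2 c2) (\<lambda>c1. C0 b0 b1 b2 c2 c1)))" if "b2 \<in> B2 b0 b1" for b0 b1 b2
      unfolding card_U[symmetric] by (intro card_Sigma_ge finite_SigmaI fin) (use that in simp_all)
    have 2: "half * ((2 * half + 1) * (2 * half * half))
        \<le> card (Sigma (B2 b0 b1) (\<lambda>b2. Sigma U (\<lambda>c2. Sigma (C1 b0 b1 b2 c2) (\<lambda>c1. C0 b0 b1 b2 c2 c1))))"
      if "b0 \<in> {1..<p}" for b0 b1
      by (subst B2[OF that, of b1, symmetric]) (intro card_Sigma_ge finite_SigmaI fin 1, simp_all)
    have 3: "(2 * half + 1) * (half * ((2 * half + 1) * (2 * half * half)))
        \<le> card (Sigma U (\<lambda>b1. Sigma (B2 b0 b1) (\<lambda>b2. Sigma U (\<lambda>c2. Sigma (C1 b0 b1 b2 c2) (\<lambda>c1. C0 b0 b1 b2 c2 c1)))))"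
      if "b0 \<in> {1..<p}" for b0
      by (subst card_U[symmetric]) (intro card_Sigma_ge finite_SigmaI fin 2 that, simp_all)
    show ?thesis
      unfolding A_def by (subst card_units[symmetric]) (intro card_Sigma_ge finite_SigmaI fin 3, simp_all)
  qed
  also have "card A \<le> card (residue_vectors 6 (nat p) good_0)"
  proof (rule card_le_residue_vectors[where R = "\<lambda>x v. x = (v 0, v 1, v 2, v 5, v 4, v 3)"])
    fix x assume "x \<in> A"
    then obtain b0 b1 b2 c2 c1 c0 where x: "x = (b0, b1, b2, c2, c1, c0)" and
      m: "b0 \<in> {1..<p}" "b1 \<in> U" "b2 \<in> B2 b0 b1" "c2 \<in> U" "c1 \<in> C1 b0 b1 b2 c2" "c0 \<in> C0 b0 b1 b2 c2 c1"
      unfolding A_def by (elim SigmaE) simp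
    have U: "b0 \<in> U" "b2 \<in> U" "c1 \<in> U" "c0 \<in> U" using m by (simp_all add: B2_def C1_def C0_def)
    have "nonsq p (b1\<^sup>2 - 4 * b0 * b2)" "nonsq p (normBC b0 b1 b2 c0 c1 c2)"
      using m(3,6) unfolding B2_def C0_def \<Delta>_def by blast+
    then have "good_0 (restrict (nth [b0, b1, b2, c0, c1, c2]) {..<6})" by (simp add: good_0_def)
    moreover have "set [b0, b1, b2, c0, c1, c2] \<subseteq> {0..<int (nat p)}" using U m(2,4) unfolding int_nat_p(1) by simp
    ultimately show "\<exists>xs. length xs = 6 \<and> set xs \<subseteq> {0..<int (nat p)} \<and> good_0 (restrict (nth xs) {..<6}) \<and>
       x = (restrict (nth xs) {..<6} 0, restrict (nth xs) {..<6} 1, restrict (nth xs) {..<6} 2,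
         restrict (nth xs) {..<6} 5, restrict (nth xs) {..<6} 4, restrict (nth xs) {..<6} 3)"
      by (intro exI[of _ "[b0, b1, b2, c0, c1, c2]"]) (simp add: x)
  qed simp
  finally have le: "2 * half * ((2 * half + 1) * (half * ((2 * half + 1) * (2 * half * half)))) \<le> \<dots>" .
  have "(nat p) ^ 6 = (2 * half + 1) ^ 4 * (2 * half + 1)\<^sup>2" by (simp only: int_nat_p power_add[symmetric]) simp
  also have "\<dots> \<le> (4 * half) ^ 4 * (2 * half + 1)\<^sup>2" by (intro mult_right_mono power_mono p_le_half) simp_all
  also have "\<dots> = 64 * (2 * half * ((2 * half + 1) * (half * ((2 * half + 1) * (2 * half * half)))))"
    by (simp only: power2_eq_square power4_eq_xxxx) (simp add: algebra_simps)
  finally show ?thesis using le by linarith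
qed

text \<open>The polynomial with coefficients \<open>d0\<close> to \<open>d4\<close> is
  \<open>s\<close> times the reciprocal of the monic quartic \<open>e\<close>: the normalising unit
  is its constant term, and reversing the coefficients preserves irreducibility.\<close>

definition matches :: "int \<Rightarrow> int \<times> int \<times> int \<times> int \<Rightarrow> int \<Rightarrow> int \<Rightarrow> int \<Rightarrow> int \<Rightarrow> int \<Rightarrow> bool" where
  "matches s = (\<lambda>(e1, e2, e3, e4) d0 d1 d2 d3 d4. [d0 = s] (mod p) \<and> [d1 = s * e1] (mod p) \<and>
     [d2 = s * e2] (mod p) \<and> [d3 = s * e3] (mod p) \<and> [d4 = s * e4] (mod p))"

definition quartic_irr :: "int \<Rightarrow> int \<Rightarrow> int \<Rightarrow> int \<Rightarrow> int \<Rightarrow> bool" where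
  "quartic_irr d0 d1 d2 d3 d4 \<longleftrightarrow> (\<exists>s e. \<not> p dvd s \<and> irr e \<and> matches s e d0 d1 d2 d3 d4)"

lemma quartic_irrI: "\<not> p dvd s \<Longrightarrow> irr e \<Longrightarrow> matches s e d0 d1 d2 d3 d4 \<Longrightarrow> quartic_irr d0 d1 d2 d3 d4"
  unfolding quartic_irr_def by blast

lemma matches_cong:
  assumes "matches s e d0 d1 d2 d3 d4" "[d0 = d0'] (mod p)" "[d1 = d1'] (mod p)" "[d2 = d2'] (mod p)"
    "[d3 = d3'] (mod p)" "[d4 = d4'] (mod p)"
  shows "matches s e d0' d1' d2' d3' d4'"
proof -
  obtain e1 e2 e3 e4 where e: "e = (e1, e2, e3, e4)" by (rule prod_cases4)
  have m: "[d0 = s] (mod p)" "[d1 = s * e1] (mod p)" "[d2 = s * e2] (mod p)" "[d3 = s * e3] (mod p)"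
    "[d4 = s * e4] (mod p)" using assms(1) by (simp_all add: matches_def e)
  show ?thesis
    unfolding matches_def e prod.case
    using cong_trans[OF cong_sym[OF assms(2)] m(1)] cong_trans[OF cong_sym[OF assms(3)] m(2)]
      cong_trans[OF cong_sym[OF assms(4)] m(3)] cong_trans[OF cong_sym[OF assms(5)] m(4)]
      cong_trans[OF cong_sym[OF assms(6)] m(5)] by (intro conjI)
qed

lemma quartic_irr_cong:
  assumes "quartic_irr d0 d1 d2 d3 d4" "[d0 = d0'] (mod p)" "[d1 = d1'] (mod p)" "[d2 = d2'] (mod p)"
    "[d3 = d3'] (mod p)" "[d4 = d4'] (mod p)"
  shows "quartic_irr d0' d1' d2' d3' d4'"
proof -
  obtain s e where "\<not> p dvd s" "irr e" "matches s e d0 d1 d2 d3 d4" using assms(1) quartic_irr_def by blast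
  then show ?thesis using matches_cong[OF _ assms(2-6)] by (intro quartic_irrI)
qed

text \<open>\<open>d0\<close> fixes \<open>s\<close> modulo \<open>p\<close>, and the unit
  \<open>s\<close> can be cancelled from the other four congruences.\<close>

lemma matches_unique:
  assumes "\<not> p dvd s" "e \<in> Q4" "e' \<in> Q4" "matches s e d0 d1 d2 d3 d4" "matches s' e' d0 d1 d2 d3 d4"
  shows "e = e'"
proof -
  obtain e1 e2 e3 e4 where e: "e = (e1, e2, e3, e4)" by (rule prod_cases4)
  obtain f1 f2 f3 f4 where f: "e' = (f1, f2, f3, f4)" by (rule prod_cases4)
  have m: "[d0 = s] (mod p)" "[d1 = s * e1] (mod p)" "[d2 = s * e2] (mod p)" "[d3 = s * e3] (mod p)"
    "[d4 = s * e4] (mod p)" using assms(4) by (simp_all add: matches_def e)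
  have n: "[d0 = s'] (mod p)" "[d1 = s' * f1] (mod p)" "[d2 = s' * f2] (mod p)" "[d3 = s' * f3] (mod p)"
    "[d4 = s' * f4] (mod p)" using assms(5) by (simp_all add: matches_def f)
  have ss: "[s' = s] (mod p)" using cong_trans[OF cong_sym[OF n(1)] m(1)] .
  have *: "a = b" if "[d = s * a] (mod p)" "[d = s' * b] (mod p)" "a \<in> U" "b \<in> U" for a b d
  proof -
    have "[s * a = s * b] (mod p)"
      using cong_trans[OF cong_sym[OF that(1)] cong_trans[OF that(2) cong_mult[OF ss cong_refl]]] .
    then show ?thesis using cong_cancel[OF assms(1)] residue_eqI that(3,4) by blast
  qed
  have u: "e1 \<in> U" "e2 \<in> U" "e3 \<in> U" "e4 \<in> U" "f1 \<in> U" "f2 \<in> U" "f3 \<in> U" "f4 \<in> U"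
    using assms(2,3) unfolding e f Q4_def by blast+
  show ?thesis
    unfolding e f using *[OF m(2) n(2) u(1,5)] *[OF m(3) n(3) u(2,6)] *[OF m(4) n(4) u(3,7)] *[OF m(5) n(5) u(4,8)]
    by (simp only:)
qed

lemma irr_last_unit: "irr (e1, e2, e3, e4) \<Longrightarrow> \<not> p dvd e4"
proof -
  assume "irr (e1, e2, e3, e4)"
  then have "\<not> p dvd quartic (e1, e2, e3, e4) 0" unfolding irr_def prod.case by blast
  then show ?thesis by (simp add: quartic_def)
qed

text \<open>The arguments are the coefficients of \<open>B\<^sup>2 - 4 a\<^sup>2 C\<close> from the
  constant term upwards, with the vector listing a, b0, b1, b2, c0, c1, c2.\<close>

definition good_square :: "(nat \<Rightarrow> int) \<Rightarrow> bool" where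
  "good_square v \<longleftrightarrow> quartic_irr ((v 1)\<^sup>2 - 4 * (v 0)\<^sup>2 * v 4) (2 * v 1 * v 2 - 4 * (v 0)\<^sup>2 * v 5)
     ((v 2)\<^sup>2 + 2 * v 1 * v 3 - 4 * (v 0)\<^sup>2 * v 6) (2 * v 2 * v 3 - 4 * (v 0)\<^sup>2) ((v 3)\<^sup>2)"

lemma periodic_good_square: "periodic 7 (nat p) good_square"
proof (rule periodicI)
  fix v w assume c: "\<And>i. i < 7 \<Longrightarrow> [v i = w i] (mod p)" and g: "good_square v"
  show "good_square w"
    unfolding good_square_def
    by (rule quartic_irr_cong[OF g[unfolded good_square_def]];
        intro cong_add cong_diff cong_mult cong_pow cong_refl c; simp)
qed

text \<open>For given units a, b2, any b0 and any irreducible \<open>e\<close>, the equations are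
  solved from the top: \<open>s\<close> from \<open>b2\<^sup>2 = s e4\<close>, then b1, c2, c1 and
  c0, each from a linear congruence.\<close>

lemma density_good_square: "(nat p) ^ 7 \<le> 64 * card (residue_vectors 7 (nat p) good_square)"
proof -
  let ?I = "{e \<in> Q4. irr e}"
  define R where "R = (\<lambda>(a, b2, b0, e) v. v 0 = a \<and> v 3 = b2 \<and> v 1 = b0 \<and> (\<exists>s. \<not> p dvd s \<and>
    matches s e ((v 1)\<^sup>2 - 4 * (v 0)\<^sup>2 * v 4) (2 * v 1 * v 2 - 4 * (v 0)\<^sup>2 * v 5)
     ((v 2)\<^sup>2 + 2 * v 1 * v 3 - 4 * (v 0)\<^sup>2 * v 6) (2 * v 2 * v 3 - 4 * (v 0)\<^sup>2) ((v (3::nat))\<^sup>2)))"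
  have "card ({1..<p} \<times> {1..<p} \<times> U \<times> ?I) \<le> card (residue_vectors 7 (nat p) good_square)"
  proof (rule card_le_residue_vectors[where R = R])
    fix x assume "x \<in> {1..<p} \<times> {1..<p} \<times> U \<times> ?I"
    then obtain a b2 b0 e where x: "x = (a, b2, b0, e)" and a: "a \<in> {1..<p}" and b2: "b2 \<in> {1..<p}"
      and b0: "b0 \<in> U" and e: "e \<in> ?I" by (elim SigmaE) simp
    obtain e1 e2 e3 e4 where e': "e = (e1, e2, e3, e4)" by (rule prod_cases4)
    have irr: "irr (e1, e2, e3, e4)" using e unfolding e' by simp
    obtain s where s: "[e4 * s + 0 = b2\<^sup>2] (mod p)" using linear_solve[OF irr_last_unit[OF irr]] by blast
    have nb: "\<not> p dvd b2" "\<not> p dvd b2\<^sup>2" "\<not> p dvd 2 * b2"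
      using not_dvd_unit[OF b2] not_dvd_numerals(1) dvd_mult_iff by (simp_all add: power2_eq_square)
    have na: "\<not> p dvd (- 4) * a\<^sup>2"
      using not_dvd_unit[OF a] not_dvd_numerals(3) dvd_mult_iff by (simp add: power2_eq_square)
    have ns: "\<not> p dvd s" using cong_dvd_iff[OF s] nb(2) by auto
    obtain b1 where b1: "b1 \<in> U" "[2 * b2 * b1 + (- 4) * a\<^sup>2 = s * e3] (mod p)" using linear_solve[OF nb(3)] by blast
    obtain c2 where c2: "c2 \<in> U" "[(- 4) * a\<^sup>2 * c2 + (b1\<^sup>2 + 2 * b0 * b2) = s * e2] (mod p)" using linear_solve[OF na] by blast
    obtain c1 where c1: "c1 \<in> U" "[(- 4) * a\<^sup>2 * c1 + 2 * b0 * b1 = s * e1] (mod p)" using linear_solve[OF na] by blast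
    obtain c0 where c0: "c0 \<in> U" "[(- 4) * a\<^sup>2 * c0 + b0\<^sup>2 = s] (mod p)" using linear_solve[OF na] by blast
    have m: "matches s e (b0\<^sup>2 - 4 * a\<^sup>2 * c0) (2 * b0 * b1 - 4 * a\<^sup>2 * c1) (b1\<^sup>2 + 2 * b0 * b2 - 4 * a\<^sup>2 * c2)
      (2 * b1 * b2 - 4 * a\<^sup>2) (b2\<^sup>2)"
      using b1(2) c2(2) c1(2) c0(2) cong_sym[OF s]
      by (simp add: matches_def e' mult.commute mult.left_commute)
    let ?xs = "[a, b0, b1, b2, c0, c1, c2]"
    have "good_square (restrict (nth ?xs) {..<7})"
      using quartic_irrI[OF ns irr[folded e'] m] by (simp add: good_square_def)
    moreover have "R x (restrict (nth ?xs) {..<7})" using ns m by (auto simp: R_def x)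
    moreover have "set ?xs \<subseteq> {0..<int (nat p)}" using a b2 b0 b1(1) c2(1) c1(1) c0(1) unfolding int_nat_p(1) by simp
    ultimately show "\<exists>xs. length xs = 7 \<and> set xs \<subseteq> {0..<int (nat p)} \<and> good_square (restrict (nth xs) {..<7}) \<and>
       R x (restrict (nth xs) {..<7})"
      by (intro exI[of _ ?xs]) simp
  next
    fix x x' v
    assume x: "x \<in> {1..<p} \<times> {1..<p} \<times> U \<times> ?I" "x' \<in> {1..<p} \<times> {1..<p} \<times> U \<times> ?I" and R: "R x v" "R x' v"
    obtain a b2 b0 e where X: "x = (a, b2, b0, e)" by (rule prod_cases4)
    obtain a' b2' b0' e' where X': "x' = (a', b2', b0', e')" by (rule prod_cases4)
    have e: "e \<in> Q4" "e' \<in> Q4" using x unfolding X X' by blast+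
    have "e = e'" using R e matches_unique unfolding R_def X X' prod.case by blast
    then show "x = x'" using R unfolding R_def X X' prod.case by simp
  qed
  then have le: "(2 * half) * ((2 * half) * ((2 * half + 1) * card ?I)) \<le> card (residue_vectors 7 (nat p) good_square)"
    by (simp only: card_cartesian_product card_units card_U)
  have "(nat p) ^ 7 = (2 * half + 1)\<^sup>2 * ((2 * half + 1) * (2 * half + 1) ^ 4)"
    by (simp only: int_nat_p power_add[symmetric] power_Suc[symmetric]) simp
  also have "\<dots> \<le> (4 * half)\<^sup>2 * ((2 * half + 1) * (16 * card ?I))"
    by (intro mult_mono power_mono p_le_half card_irr order_refl) simp_all
  also have "\<dots> = 64 * ((2 * half) * ((2 * half) * ((2 * half + 1) * card ?I)))"
    by (simp add: power2_eq_square)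
  finally show ?thesis using le by linarith
qed

text \<open>The arguments are the coefficients of the translate \<open>D(X + x)\<close>, which is
  irreducible together with \<open>D\<close>; the translation is left open.\<close>

definition good_l :: "(nat \<Rightarrow> int) \<Rightarrow> bool" where
  "good_l v \<longleftrightarrow> (\<exists>x. quartic_irr
     ((v 2 + v 3 * x)\<^sup>2 - 4 * (v 0 + v 1 * x) * (x ^ 3 + v 5 * x + v 4))
     (2 * v 3 * (v 2 + v 3 * x) - 4 * (v 1 * (x ^ 3 + v 5 * x + v 4) + (v 0 + v 1 * x) * (3 * x\<^sup>2 + v 5)))
     ((v 3)\<^sup>2 - 4 * (v 1 * (3 * x\<^sup>2 + v 5) + 3 * x * (v 0 + v 1 * x)))
     (- 4 * (v 0 + v 1 * x + 3 * x * v 1)) (- 4 * v 1))"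

lemma periodic_good_l: "periodic 6 (nat p) good_l"
proof (rule periodicI)
  fix v w assume c: "\<And>i. i < 6 \<Longrightarrow> [v i = w i] (mod p)" and g: "good_l v"
  obtain x where x: "quartic_irr
     ((v 2 + v 3 * x)\<^sup>2 - 4 * (v 0 + v 1 * x) * (x ^ 3 + v 5 * x + v 4))
     (2 * v 3 * (v 2 + v 3 * x) - 4 * (v 1 * (x ^ 3 + v 5 * x + v 4) + (v 0 + v 1 * x) * (3 * x\<^sup>2 + v 5)))
     ((v 3)\<^sup>2 - 4 * (v 1 * (3 * x\<^sup>2 + v 5) + 3 * x * (v 0 + v 1 * x)))
     (- 4 * (v 0 + v 1 * x + 3 * x * v 1)) (- 4 * v 1)" using g unfolding good_l_def ..
  show "good_l w"
    unfolding good_l_def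
    by (rule exI[of _ x], rule quartic_irr_cong[OF x];
        intro cong_add cong_diff cong_mult cong_pow cong_refl c; simp)
qed

text \<open>The shift \<open>x\<close> is chosen as the root of \<open>A\<close> modulo \<open>p\<close>, which makes the constant coefficient of the
  shifted \<open>D\<close> a square and the other equations linear in the remaining unknowns.\<close>

lemma density_good_l: "(nat p) ^ 6 \<le> 64 * card (residue_vectors 6 (nat p) good_l)"
proof -
  let ?I = "{e \<in> Q4. irr e}"
  define R where "R = (\<lambda>(b1, b, e) v. v 3 = b1 \<and> (\<exists>x s. x \<in> U \<and> \<not> p dvd s \<and> \<not> p dvd v 1 \<and> [v 1 * x + v 0 = 0] (mod p) \<and>
    [b = v 2 + v 3 * x] (mod p) \<and> matches s e
     ((v 2 + v 3 * x)\<^sup>2 - 4 * (v 0 + v 1 * x) * (x ^ 3 + v 5 * x + v 4))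
     (2 * v 3 * (v 2 + v 3 * x) - 4 * (v 1 * (x ^ 3 + v 5 * x + v 4) + (v 0 + v 1 * x) * (3 * x\<^sup>2 + v 5)))
     ((v 3)\<^sup>2 - 4 * (v 1 * (3 * x\<^sup>2 + v 5) + 3 * x * (v 0 + v 1 * x)))
     (- 4 * (v 0 + v 1 * x + 3 * x * v 1)) (- 4 * v (1::nat))))"
  have "card (U \<times> {1..<p} \<times> ?I) \<le> card (residue_vectors 6 (nat p) good_l)"
  proof (rule card_le_residue_vectors[where R = R])
    fix y assume "y \<in> U \<times> {1..<p} \<times> ?I"
    then obtain b1 b e where y: "y = (b1, b, e)" and b1: "b1 \<in> U" and b: "b \<in> {1..<p}" and e: "e \<in> ?I"
      by (elim SigmaE) simp
    obtain e1 e2 e3 e4 where e': "e = (e1, e2, e3, e4)" by (rule prod_cases4)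
    have irr: "irr (e1, e2, e3, e4)" using e unfolding e' by simp
    \<comment> \<open>\<open>b\<close> is to become the value \<open>B(x)\<close>. As
      \<open>A(x)\<close> is to vanish, the constant coefficient of the translated D is then
      \<open>b\<^sup>2\<close>.\<close>
    define s where "s = b\<^sup>2"
    have ns: "\<not> p dvd s" using not_dvd_unit[OF b] dvd_mult_iff by (simp add: s_def power2_eq_square)
    have n4: "\<not> p dvd - 4" using not_dvd_numerals(3) by simp
    obtain a1 where a1: "a1 \<in> U" "[- 4 * a1 + 0 = s * e4] (mod p)" using linear_solve[OF n4] by blast
    have na: "\<not> p dvd - 4 * a1" using cong_dvd_iff[OF a1(2)] ns irr_last_unit[OF irr] dvd_mult_iff by simp
    then have na1: "\<not> p dvd a1" using dvd_mult_iff by blast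
    then have na12: "\<not> p dvd - 12 * a1" using not_dvd_numerals(4) dvd_mult_iff[of "- 12" a1] by simp
    obtain x where x: "x \<in> U" "[- 12 * a1 * x + 0 = s * e3] (mod p)" using linear_solve[OF na12] by blast
    obtain c1 where c1: "c1 \<in> U" "[- 4 * a1 * c1 + (b1\<^sup>2 - 12 * a1 * x\<^sup>2) = s * e2] (mod p)" using linear_solve[OF na] by blast
    obtain c0 where c0: "c0 \<in> U" "[- 4 * a1 * c0 + (2 * b1 * b - 4 * a1 * (x ^ 3 + c1 * x)) = s * e1] (mod p)"
      using linear_solve[OF na] by blast
    \<comment> \<open>Now that the shift \<open>x\<close> is known, \<open>a0\<close> and
      \<open>b0\<close> are adjusted so that modulo \<open>p\<close> A vanishes at \<open>x\<close>
      and B has the value \<open>b\<close> there.\<close>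
    define a0 where "a0 = (- a1 * x) mod p"
    define b0 where "b0 = (b - b1 * x) mod p"
    have U: "a0 \<in> U" "b0 \<in> U" by (simp_all only: a0_def b0_def mod_U)
    have "[a0 + a1 * x = - a1 * x + a1 * x] (mod p)" unfolding a0_def by (rule cong_add) (simp_all add: cong_def)
    then have \<alpha>: "[a0 + a1 * x = 0] (mod p)" by simp
    have "[b0 + b1 * x = (b - b1 * x) + b1 * x] (mod p)" unfolding b0_def by (rule cong_add) (simp_all add: cong_def)
    then have \<beta>: "[b0 + b1 * x = b] (mod p)" by simp
    define \<gamma> where "\<gamma> = x ^ 3 + c1 * x + c0"
    have "matches s e (b\<^sup>2 - 4 * 0 * \<gamma>) (2 * b1 * b - 4 * (a1 * \<gamma> + 0 * (3 * x\<^sup>2 + c1)))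
        (b1\<^sup>2 - 4 * (a1 * (3 * x\<^sup>2 + c1) + 3 * x * 0)) (- 4 * (0 + 3 * x * a1)) (- 4 * a1)"
    proof -
      have "2 * b1 * b - 4 * (a1 * \<gamma> + 0 * (3 * x\<^sup>2 + c1)) = - 4 * a1 * c0 + (2 * b1 * b - 4 * a1 * (x ^ 3 + c1 * x))"
        "b1\<^sup>2 - 4 * (a1 * (3 * x\<^sup>2 + c1) + 3 * x * 0) = - 4 * a1 * c1 + (b1\<^sup>2 - 12 * a1 * x\<^sup>2)"
        "- 4 * (0 + 3 * x * a1) = - 12 * a1 * x + 0" "b\<^sup>2 - 4 * 0 * \<gamma> = s" "- 4 * a1 = - 4 * a1 + 0"
        by (simp_all add: \<gamma>_def s_def algebra_simps)
      then show ?thesis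
        unfolding matches_def e' prod.case using a1(2) x(2) c1(2) c0(2) cong_refl by (simp only: simp_thms)
    qed
    then have m: "matches s e ((b0 + b1 * x)\<^sup>2 - 4 * (a0 + a1 * x) * \<gamma>)
       (2 * b1 * (b0 + b1 * x) - 4 * (a1 * \<gamma> + (a0 + a1 * x) * (3 * x\<^sup>2 + c1)))
       (b1\<^sup>2 - 4 * (a1 * (3 * x\<^sup>2 + c1) + 3 * x * (a0 + a1 * x)))
       (- 4 * (a0 + a1 * x + 3 * x * a1)) (- 4 * a1)"
      by (rule matches_cong)
        (intro cong_add cong_diff cong_mult cong_pow cong_refl cong_sym[OF \<alpha>] cong_sym[OF \<beta>])+
    let ?xs = "[a0, a1, b0, b1, c0, c1]"
    have "good_l (restrict (nth ?xs) {..<6})"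
      unfolding good_l_def
      by (rule exI[of _ x]) (use quartic_irrI[OF ns irr[folded e'] m] in \<open>simp add: \<gamma>_def\<close>)
    moreover have "R y (restrict (nth ?xs) {..<6})"
    proof -
      have "\<exists>x s. x \<in> U \<and> \<not> p dvd s \<and> \<not> p dvd a1 \<and> [a1 * x + a0 = 0] (mod p) \<and> [b = b0 + b1 * x] (mod p) \<and>
         matches s e ((b0 + b1 * x)\<^sup>2 - 4 * (a0 + a1 * x) * (x ^ 3 + c1 * x + c0))
       (2 * b1 * (b0 + b1 * x) - 4 * (a1 * (x ^ 3 + c1 * x + c0) + (a0 + a1 * x) * (3 * x\<^sup>2 + c1)))
       (b1\<^sup>2 - 4 * (a1 * (3 * x\<^sup>2 + c1) + 3 * x * (a0 + a1 * x)))
       (- 4 * (a0 + a1 * x + 3 * x * a1)) (- 4 * a1)"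
        using x(1) ns na1 \<alpha> cong_sym[OF \<beta>] m unfolding \<gamma>_def
        by (intro exI[of _ x] exI[of _ s] conjI) (simp_all only: add.commute not_False_eq_True)
      then show ?thesis by (simp add: R_def y)
    qed
    moreover have "set ?xs \<subseteq> {0..<int (nat p)}" using U a1(1) b1 c0(1) c1(1) unfolding int_nat_p(1) by simp
    ultimately show "\<exists>xs. length xs = 6 \<and> set xs \<subseteq> {0..<int (nat p)} \<and> good_l (restrict (nth xs) {..<6}) \<and>
       R y (restrict (nth xs) {..<6})"
      by (intro exI[of _ ?xs]) simp
  next
    fix y y' v
    assume y: "y \<in> U \<times> {1..<p} \<times> ?I" "y' \<in> U \<times> {1..<p} \<times> ?I" and R: "R y v" "R y' v"
    obtain b1 b e where Y: "y = (b1, b, e)" by (rule prod_cases3)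
    obtain b1' b' e' where Y': "y' = (b1', b', e')" by (rule prod_cases3)
    have m: "e \<in> Q4" "e' \<in> Q4" "b \<in> U" "b' \<in> U" using y unfolding Y Y' by auto
    obtain x s where x: "x \<in> U" "\<not> p dvd s" "\<not> p dvd v 1" "[v 1 * x + v 0 = 0] (mod p)" "[b = v 2 + v 3 * x] (mod p)"
     "matches s e
     ((v 2 + v 3 * x)\<^sup>2 - 4 * (v 0 + v 1 * x) * (x ^ 3 + v 5 * x + v 4))
     (2 * v 3 * (v 2 + v 3 * x) - 4 * (v 1 * (x ^ 3 + v 5 * x + v 4) + (v 0 + v 1 * x) * (3 * x\<^sup>2 + v 5)))
     ((v 3)\<^sup>2 - 4 * (v 1 * (3 * x\<^sup>2 + v 5) + 3 * x * (v 0 + v 1 * x)))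
     (- 4 * (v 0 + v 1 * x + 3 * x * v 1)) (- 4 * v (1::nat))"
      using R(1) unfolding R_def Y prod.case by blast
    obtain x' s' where x': "x' \<in> U" "[v 1 * x' + v 0 = 0] (mod p)" "[b' = v 2 + v 3 * x'] (mod p)"
     "matches s' e'
     ((v 2 + v 3 * x')\<^sup>2 - 4 * (v 0 + v 1 * x') * (x' ^ 3 + v 5 * x' + v 4))
     (2 * v 3 * (v 2 + v 3 * x') - 4 * (v 1 * (x' ^ 3 + v 5 * x' + v 4) + (v 0 + v 1 * x') * (3 * x'\<^sup>2 + v 5)))
     ((v 3)\<^sup>2 - 4 * (v 1 * (3 * x'\<^sup>2 + v 5) + 3 * x' * (v 0 + v 1 * x')))
     (- 4 * (v 0 + v 1 * x' + 3 * x' * v 1)) (- 4 * v (1::nat))"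
      using R(2) unfolding R_def Y' prod.case by blast
    have xx: "x' = x" by (rule linear_inj[OF x(3) x'(1) x(1) cong_trans[OF x'(2) cong_sym[OF x(4)]]])
    have "e = e'" by (rule matches_unique[OF x(2) m(1,2) x(6) x'(4)[unfolded xx]])
    moreover have "b = b'" by (rule residue_eqI[OF m(3,4) cong_trans[OF x(5) cong_sym[OF x'(3)[unfolded xx]]]])
    moreover have "b1 = b1'" using R unfolding R_def Y Y' prod.case by simp
    ultimately show "y = y'" by (simp only: Y Y')
  qed
  then have le: "(2 * half + 1) * ((2 * half) * card ?I) \<le> card (residue_vectors 6 (nat p) good_l)"
    by (simp only: card_cartesian_product card_units card_U)
  have "(nat p) ^ 6 = (2 * half + 1) * ((2 * half + 1) * (2 * half + 1) ^ 4)"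
    by (simp only: int_nat_p power_add[symmetric] power_Suc[symmetric]) simp
  also have "\<dots> \<le> (2 * half + 1) * ((4 * half) * (16 * card ?I))"
    by (intro mult_mono p_le_half card_irr order_refl) simp_all
  also have "\<dots> = 32 * ((2 * half + 1) * ((2 * half) * card ?I))" by simp
  finally show ?thesis using le by linarith
qed

end

section \<open>From residues modulo a prime to the rational numbers\<close>

abbreviation rat_poly :: "int poly \<Rightarrow> rat poly" where
  "rat_poly \<equiv> map_poly of_int"

lemma coeff_rat_poly [simp]: "coeff (rat_poly f) i = of_int (coeff f i)"
  by (simp add: coeff_map_poly)

lemma degree_rat_poly [simp]: "degree (rat_poly f) = degree f"
  by (rule degree_map_poly) simp

lemma rat_poly_mult: "rat_poly (f * g) = rat_poly f * rat_poly g"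
  by (rule poly_eqI) (simp add: coeff_mult)

lemma rat_poly_diff: "rat_poly (f - g) = rat_poly f - rat_poly g"
  by (rule poly_eqI) simp

lemma rat_poly_smult: "rat_poly (smult c f) = smult (of_int c) (rat_poly f)"
  by (rule poly_eqI) simp

lemma rat_poly_inject: "rat_poly f = rat_poly g \<longleftrightarrow> f = g"
  by (simp add: poly_eq_iff)

lemma clear_denominators:
  fixes F :: "rat poly"
  obtains m f where "m > 0" "rat_poly f = smult (of_int m) F"
proof -
  have "\<exists>m f. m > 0 \<and> rat_poly f = smult (of_int m) F"
  proof (induction F)
    case 0
    show ?case by (rule exI[of _ 1], rule exI[of _ 0]) simp
  next
    case (pCons a F)
    then obtain m f where m: "m > 0" and f: "rat_poly f = smult (of_int m) F" by blast
    obtain x y where xy: "quotient_of a = (x, y)" by (cases "quotient_of a")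
    have y: "y > 0" using quotient_of_denom_pos[OF xy] .
    have a: "of_int y * a = of_int x" using quotient_of_div[OF xy] y by simp
    have "rat_poly (pCons (x * m) (smult y f)) = pCons (of_int x * of_int m) (smult (of_int y) (rat_poly f))"
      by (simp add: map_poly_pCons rat_poly_smult)
    also have "\<dots> = smult (of_int (m * y)) (pCons a F)"
      unfolding f a[symmetric] by (simp add: mult.commute mult.left_commute)
    finally show ?case using m y by (intro exI[of _ "m * y"] exI[of _ "pCons (x * m) (smult y f)"]) simp
  qed
  then show ?thesis using that by blast
qed

text \<open>Gauss's lemma: after clearing denominators the primitive parts are compared, and the
  content of \<open>D\<close> is given to the first factor.\<close>

lemma integer_factorization:
  assumes "rat_poly D = F * G"
  obtains f g where "D = f * g" "degree f = degree F" "degree g = degree G"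
proof -
  obtain m f where m: "m > 0" and f: "rat_poly f = smult (of_int m) F" by (rule clear_denominators)
  obtain n g where n: "n > 0" and g: "rat_poly g = smult (of_int n) G" by (rule clear_denominators)
  have "rat_poly (smult (m * n) D) = rat_poly (f * g)"
    by (simp add: rat_poly_smult rat_poly_mult f g assms mult.commute)
  then have "smult (m * n) D = f * g" by (simp only: rat_poly_inject)
  then have "primitive_part (smult (m * n) D) = primitive_part (f * g)" by (rule arg_cong)
  moreover have "unit_factor (m * n) = 1" using m n by simp
  ultimately have "primitive_part D = primitive_part f * primitive_part g"
    by (simp add: primitive_part_smult primitive_part_mult)
  then have "D = smult (content D) (primitive_part f * primitive_part g)"
    by (metis content_times_primitive_part)
  then have D: "D = smult (content D) (primitive_part f) * primitive_part g" by (simp only: mult_smult_left)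
  have "degree (rat_poly f) = degree F" "degree (rat_poly g) = degree G" unfolding f g using m n by simp_all
  then have deg: "degree (primitive_part f) = degree F" "degree (primitive_part g) = degree G" by simp_all
  show ?thesis
  proof (cases "D = 0")
    case True
    then have "F * G = 0" using assms by simp
    then have "F = 0 \<or> G = 0" by simp
    then show ?thesis
    proof
      assume "F = 0"
      then show ?thesis using that[of 0 g] deg(2) True by simp
    next
      assume "G = 0"
      then show ?thesis using that[of f 0] deg(1) True by simp
    qed
  next
    case False
    then have "content D \<noteq> 0" by simp
    then show ?thesis using that[OF D] deg by simp
  qed
qed

lemma int_square_if_rat_square:
  assumes "(of_int n :: rat) = s\<^sup>2"
  shows "\<exists>m. n = m\<^sup>2"
proof -
  obtain a b where ab: "quotient_of s = (a, b)" by (cases "quotient_of s")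
  have b: "b > 0" using quotient_of_denom_pos[OF ab] .
  have s: "s = of_int a / of_int b" using quotient_of_div[OF ab] .
  have "(of_int (n * b\<^sup>2) :: rat) = of_int (a\<^sup>2)" using assms b unfolding s by (simp add: power_divide)
  then have eq: "n * b\<^sup>2 = a\<^sup>2" by (simp only: of_int_eq_iff)
  then have "b\<^sup>2 dvd a\<^sup>2" by (metis dvd_triv_right)
  moreover have "coprime (b\<^sup>2) (a\<^sup>2)" using quotient_of_coprime[OF ab] by (simp add: coprime_commute)
  ultimately have "b\<^sup>2 dvd 1" using coprime_absorb_left by blast
  then have "b\<^sup>2 = 1" using b by (simp add: zdvd1_eq)
  then show ?thesis using eq by auto
qed

lemma cubic_form:
  fixes g :: "'a::zero poly"
  assumes "degree g \<le> 3"
  shows "g = [:coeff g 0, coeff g 1, coeff g 2, coeff g 3:]"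
  by (rule poly_eqI) (use assms in \<open>auto simp: coeff_pCons coeff_eq_0 numeral_2_eq_2 numeral_3_eq_3 split: nat.split\<close>)

lemma quadratic_form:
  fixes g :: "'a::zero poly"
  assumes "degree g \<le> 2"
  shows "g = [:coeff g 0, coeff g 1, coeff g 2:]"
  by (rule poly_eqI) (use assms in \<open>auto simp: coeff_pCons coeff_eq_0 numeral_2_eq_2 split: nat.split\<close>)

lemma linear_form:
  fixes g :: "'a::zero poly"
  assumes "degree g \<le> 1"
  shows "g = [:coeff g 0, coeff g 1:]"
  by (rule poly_eqI) (use assms in \<open>auto simp: coeff_pCons coeff_eq_0 split: nat.split\<close>)

context odd_prime
begin

lemma not_rat_square: "nonsq p n \<Longrightarrow> (of_int n :: rat) \<noteq> s\<^sup>2"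
  using int_square_if_rat_square unfolding nonsq_def by (metis cong_refl)

lemma not_int_square: "nonsq p n \<Longrightarrow> n \<noteq> s\<^sup>2"
  unfolding nonsq_def by (metis cong_refl)

text \<open>The coefficients of \<open>quartic_irr\<close> are listed from the constant term upwards, so the roots and
  factors below are those of the reciprocal polynomial.\<close>

lemma quartic_irr_no_linear_factor:
  assumes q: "quartic_irr (f0 * g0) (f0 * g1 + f1 * g0) (f0 * g2 + f1 * g1) (f0 * g3 + f1 * g2) (f1 * g3)"
  shows False
proof -
  obtain s e where s: "\<not> p dvd s" and e: "irr e"
    and m: "matches s e (f0 * g0) (f0 * g1 + f1 * g0) (f0 * g2 + f1 * g1) (f0 * g3 + f1 * g2) (f1 * g3)"
    using q unfolding quartic_irr_def by blast
  obtain e1 e2 e3 e4 where e': "e = (e1, e2, e3, e4)" by (rule prod_cases4)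
  have c: "[f0 * g0 = s] (mod p)" "[f0 * g1 + f1 * g0 = s * e1] (mod p)" "[f0 * g2 + f1 * g1 = s * e2] (mod p)"
    "[f0 * g3 + f1 * g2 = s * e3] (mod p)" "[f1 * g3 = s * e4] (mod p)"
    using m unfolding matches_def e' prod.case by blast+
  have "\<not> p dvd f0" using cong_dvd_iff[OF c(1)] s dvd_mult_iff by blast
  then obtain y where y: "[f0 * y + f1 = 0] (mod p)" using linear_solve by blast
  have "[s * y ^ 4 + s * e1 * y ^ 3 + s * e2 * y\<^sup>2 + s * e3 * y + s * e4
    = f0 * g0 * y ^ 4 + (f0 * g1 + f1 * g0) * y ^ 3 + (f0 * g2 + f1 * g1) * y\<^sup>2 + (f0 * g3 + f1 * g2) * y + f1 * g3] (mod p)"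
    by (intro cong_add cong_mult cong_refl cong_sym[OF c(1)] cong_sym[OF c(2)] cong_sym[OF c(3)]
        cong_sym[OF c(4)] cong_sym[OF c(5)])
  also have "f0 * g0 * y ^ 4 + (f0 * g1 + f1 * g0) * y ^ 3 + (f0 * g2 + f1 * g1) * y\<^sup>2 + (f0 * g3 + f1 * g2) * y + f1 * g3
    = (f0 * y + f1) * (g0 * y ^ 3 + g1 * y\<^sup>2 + g2 * y + g3)"
    by (simp add: power2_eq_square power3_eq_cube power4_eq_xxxx algebra_simps)
  also have "[\<dots> = 0 * (g0 * y ^ 3 + g1 * y\<^sup>2 + g2 * y + g3)] (mod p)" by (intro cong_mult y cong_refl)
  also have "s * y ^ 4 + s * e1 * y ^ 3 + s * e2 * y\<^sup>2 + s * e3 * y + s * e4 = s * quartic e y"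
    by (simp add: quartic_def e' algebra_simps)
  finally have "p dvd s * quartic e y" by (simp add: cong_0_iff)
  then have "p dvd quartic e y" using s dvd_mult_iff by blast
  then show False using e unfolding irr_def e' prod.case by blast
qed

lemma quartic_irr_no_quadratic_factor:
  assumes q: "quartic_irr (f0 * g0) (f0 * g1 + f1 * g0) (f0 * g2 + f1 * g1 + f2 * g0) (f1 * g2 + f2 * g1) (f2 * g2)"
  shows False
proof -
  obtain s e where s: "\<not> p dvd s" and e: "irr e"
    and m: "matches s e (f0 * g0) (f0 * g1 + f1 * g0) (f0 * g2 + f1 * g1 + f2 * g0) (f1 * g2 + f2 * g1) (f2 * g2)"
    using q unfolding quartic_irr_def by blast
  obtain e1 e2 e3 e4 where e': "e = (e1, e2, e3, e4)" by (rule prod_cases4)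
  have h: "[f0 * g0 = s] (mod p)" "[f0 * g1 + f1 * g0 = s * e1] (mod p)" "[f0 * g2 + f1 * g1 + f2 * g0 = s * e2] (mod p)"
    "[f1 * g2 + f2 * g1 = s * e3] (mod p)" "[f2 * g2 = s * e4] (mod p)"
    using m unfolding matches_def e' prod.case by blast+
  have nd: "\<not> p dvd f0" "\<not> p dvd g0" using cong_dvd_iff[OF h(1)] s dvd_mult_iff by blast+
  obtain a where a: "[f0 * a + 0 = f1] (mod p)" using linear_solve[OF nd(1)] by blast
  obtain b where b: "[f0 * b + 0 = f2] (mod p)" using linear_solve[OF nd(1)] by blast
  obtain c where c: "[g0 * c + 0 = g1] (mod p)" using linear_solve[OF nd(2)] by blast
  obtain d where d: "[g0 * d + 0 = g2] (mod p)" using linear_solve[OF nd(2)] by blast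
  note [simplified] = a b c d
  have key: "[ei = t] (mod p)" if "[u = s * ei] (mod p)" "[f0 * g0 * t = u] (mod p)" for ei t u
  proof -
    have "[s * t = f0 * g0 * t] (mod p)" by (intro cong_mult cong_sym[OF h(1)] cong_refl)
    from cong_trans[OF this cong_trans[OF that(2,1)]] have "[s * t = s * ei] (mod p)" .
    from cong_cancel[OF s this] show ?thesis by (rule cong_sym)
  qed
  have "[e1 = a + c] (mod p)"
  proof (rule key[OF h(2)])
    have "[f0 * (g0 * c + 0) + (f0 * a + 0) * g0 = f0 * g1 + f1 * g0] (mod p)" by (intro cong_add cong_mult a b c d cong_refl)
    then show "[f0 * g0 * (a + c) = f0 * g1 + f1 * g0] (mod p)" by (simp add: algebra_simps)
  qed
  moreover have "[e2 = a * c + b + d] (mod p)"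
  proof (rule key[OF h(3)])
    have "[f0 * (g0 * d + 0) + (f0 * a + 0) * (g0 * c + 0) + (f0 * b + 0) * g0 = f0 * g2 + f1 * g1 + f2 * g0] (mod p)"
      by (intro cong_add cong_mult a b c d cong_refl)
    then show "[f0 * g0 * (a * c + b + d) = f0 * g2 + f1 * g1 + f2 * g0] (mod p)" by (simp add: algebra_simps)
  qed
  moreover have "[e3 = a * d + b * c] (mod p)"
  proof (rule key[OF h(4)])
    have "[(f0 * a + 0) * (g0 * d + 0) + (f0 * b + 0) * (g0 * c + 0) = f1 * g2 + f2 * g1] (mod p)"
      by (intro cong_add cong_mult a b c d cong_refl)
    then show "[f0 * g0 * (a * d + b * c) = f1 * g2 + f2 * g1] (mod p)" by (simp add: algebra_simps)
  qed
  moreover have "[e4 = b * d] (mod p)"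
  proof (rule key[OF h(5)])
    have "[(f0 * b + 0) * (g0 * d + 0) = f2 * g2] (mod p)" by (intro cong_add cong_mult a b c d cong_refl)
    then show "[f0 * g0 * (b * d) = f2 * g2] (mod p)" by (simp add: algebra_simps)
  qed
  ultimately show False using e unfolding irr_def e' prod.case by blast
qed

text \<open>A factorisation over the rationals yields one over the integers with the same degrees,
  and after the translation its coefficients satisfy modulo \<open>p\<close> the equations excluded
  by \<open>irr\<close>. The degree is 4 because the last coefficient of an irreducible quartic is a
  unit.\<close>

lemma irreducible_of_quartic_irr:
  assumes D: "pcompose D [:x, 1:] = [:d0, d1, d2, d3, d4:]" and q: "quartic_irr d0 d1 d2 d3 d4"
  shows "irreducible (rat_poly D)" "degree (rat_poly D) = 4"
proof -
  have "d4 \<noteq> 0"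
  proof
    assume "d4 = 0"
    obtain s e where s: "\<not> p dvd s" and e: "irr e" and m: "matches s e d0 d1 d2 d3 d4"
      using q unfolding quartic_irr_def by blast
    obtain e1 e2 e3 e4 where e': "e = (e1, e2, e3, e4)" by (rule prod_cases4)
    have "[s * e4 = 0] (mod p)" using m \<open>d4 = 0\<close> by (simp add: matches_def e' cong_sym_eq)
    then show False using s irr_last_unit[of e1 e2 e3 e4] e unfolding e' cong_0_iff dvd_mult_iff by blast
  qed
  then have "degree (pcompose D [:x, 1:]) = 4" unfolding D by simp
  then have deg: "degree D = 4" by (simp add: degree_pcompose)
  then show "degree (rat_poly D) = 4" by simp
  show "irreducible (rat_poly D)"
  proof (rule irreducibleI)
    show "rat_poly D \<noteq> 0" using deg by (metis degree_0 degree_rat_poly zero_neq_numeral)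
    then show "\<not> is_unit (rat_poly D)" using deg by (simp add: is_unit_iff_degree)
    fix F G assume FG: "rat_poly D = F * G"
    then have nz: "F \<noteq> 0" "G \<noteq> 0" using \<open>rat_poly D \<noteq> 0\<close> by auto
    have sum: "degree F + degree G = 4" using degree_mult_eq[OF nz] deg FG by (metis degree_rat_poly)
    obtain f' g' where fg': "D = f' * g'" "degree f' = degree F" "degree g' = degree G"
      by (rule integer_factorization[OF FG])
    define f where "f = pcompose f' [:x, 1:]"
    define g where "g = pcompose g' [:x, 1:]"
    have degs: "degree f = degree F" "degree g = degree G" using fg' by (simp_all add: f_def g_def degree_pcompose)
    have fg: "f * g = [:d0, d1, d2, d3, d4:]" unfolding D[symmetric] fg'(1) f_def g_def by (rule pcompose_mult[symmetric])
    have lin: False if a: "f * g = [:d0, d1, d2, d3, d4:]" "degree f = 1" "degree g = 3" for f g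
    proof -
      obtain f0 f1 where f: "f = [:f0, f1:]" using linear_form[of f] a(2) by auto
      obtain g0 g1 g2 g3 where g: "g = [:g0, g1, g2, g3:]" using cubic_form[of g] a(3) by auto
      have "d0 = f0 * g0" "d1 = f0 * g1 + f1 * g0" "d2 = f0 * g2 + f1 * g1" "d3 = f0 * g3 + f1 * g2" "d4 = f1 * g3"
        using a(1) unfolding f g by (simp_all add: algebra_simps)
      then show False using quartic_irr_no_linear_factor q by metis
    qed
    have "\<not> (degree F \<noteq> 0 \<and> degree G \<noteq> 0)"
    proof
      assume "degree F \<noteq> 0 \<and> degree G \<noteq> 0"
      then consider "degree f = 1" "degree g = 3" | "degree f = 2" "degree g = 2" | "degree f = 3" "degree g = 1"
        using sum degs by fastforce
      then show False
      proof cases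
        case 1
        then show ?thesis using lin fg by blast
      next
        case 2
        obtain f0 f1 f2 where f: "f = [:f0, f1, f2:]" using quadratic_form[of f] 2 by auto
        obtain g0 g1 g2 where g: "g = [:g0, g1, g2:]" using quadratic_form[of g] 2 by auto
        have "d0 = f0 * g0" "d1 = f0 * g1 + f1 * g0" "d2 = f0 * g2 + f1 * g1 + f2 * g0" "d3 = f1 * g2 + f2 * g1" "d4 = f2 * g2"
          using fg unfolding f g by (simp_all add: algebra_simps)
        then show ?thesis using quartic_irr_no_quadratic_factor q by metis
      next
        case 3
        then show ?thesis using lin[of g f] fg by (simp add: mult.commute)
      qed
    qed
    then show "is_unit F \<or> is_unit G" using nz is_unit_iff_degree by blast
  qed
qed

end

lemma to_QT_eq: "to_QT f = to_fract (rat_poly f)"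
  by (simp add: to_QT_def to_fract_def)

lemma EC_eq: "EC A B C = WCurve (to_QT (X_coeff A B C 2)) (to_QT (X_coeff A B C 1)) (to_QT (X_coeff A B C 0))"
  by (simp add: EC_def int_model_def)

lemma rank_zero_of_no_triple:
  fixes A B C :: "int poly"
  defines "A' \<equiv> rat_poly A" and "B' \<equiv> rat_poly B" and "C' \<equiv> rat_poly C"
  assumes no: "\<And>p q r. \<not> triple [:coeff C' 2, coeff B' 2, coeff A' 2:] [:coeff C' 1, coeff B' 1, coeff A' 1:]
    [:coeff C' 0, coeff B' 0, coeff A' 0:] p q r"
  shows "\<not> ec_rank (EC A B C) \<ge> 1"
proof (rule point_group_rank_zero, rule notI)
  fix x y assume "on_curve (EC A B C) (Affine x y)"
  moreover have X: "to_QT (X_coeff A B C i) = to_fract [:coeff C' i, coeff B' i, coeff A' i:]" for i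
    by (simp add: to_QT_eq X_coeff_def map_poly_pCons A'_def B'_def C'_def)
  ultimately have "y\<^sup>2 = x ^ 3 + to_fract [:coeff C' 2, coeff B' 2, coeff A' 2:] * x\<^sup>2
      + to_fract [:coeff C' 1, coeff B' 1, coeff A' 1:] * x + to_fract [:coeff C' 0, coeff B' 0, coeff A' 0:]"
    unfolding EC_eq X by simp
  from triple_of_point[OF this] show False using no by metis
qed

lemma degree_minus_monom:
  "degree ([:c0, c1, c2, 1:] - monom 1 3 :: 'a::comm_ring_1 poly) \<le> 2" "degree ([:c0, c1, 0, 1:] - monom 1 3 :: 'a poly) \<le> 1"
proof -
  have "monom 1 3 = ([:0, 0, 0, 1:] :: 'a poly)" by (simp add: monom_Suc numeral_3_eq_3 monom_0)
  then show "degree ([:c0, c1, c2, 1:] - monom 1 3 :: 'a poly) \<le> 2" "degree ([:c0, c1, 0, 1:] - monom 1 3 :: 'a poly) \<le> 1"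
    by (simp_all add: degree_pCons_le order_trans[OF degree_pCons_le])
qed

context odd_prime
begin

lemma rank_zero_0:
  assumes "good_0 v"
  shows "\<not> ec_rank (EC 0 [:v 0, v 1, v 2:] [:v 3, v 4, v 5, 1:]) \<ge> 1"
proof -
  have g: "nonsq p ((v 1)\<^sup>2 - 4 * v 0 * v 2)" "nonsq p (normBC (v 0) (v 1) (v 2) (v 3) (v 4) (v 5))"
    using assms unfolding good_0_def by blast+
  have "v 2 \<noteq> 0" using not_int_square[OF g(1), of "v 1"] by auto
  let ?B = "rat_poly [:v 0, v 1, v 2:]" and ?C = "rat_poly [:v 3, v 4, v 5, 1:]"
  have C: "?C = [:of_int (v 3), of_int (v 4), of_int (v 5), 1:]" by (simp add: map_poly_pCons)
  have "\<not> triple [:coeff ?C 2, coeff ?B 2:] [:coeff ?C 1, coeff ?B 1:] [:coeff ?C 0, coeff ?B 0:] p q r" for p q r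
  proof (rule no_triple_A0)
    show "degree ?B = 2" using \<open>v 2 \<noteq> 0\<close> by simp
    show "degree (?C - monom 1 3) \<le> 2" unfolding C by (rule degree_minus_monom)
    show "(coeff ?B 1)\<^sup>2 - 4 * coeff ?B 0 * coeff ?B 2 \<noteq> s\<^sup>2" for s
      using not_rat_square[OF g(1), of s] by (simp add: numeral_2_eq_2)
    show "normBC (coeff ?B 0) (coeff ?B 1) (coeff ?B 2) (coeff ?C 0) (coeff ?C 1) (coeff ?C 2) \<noteq> s\<^sup>2" for s
      using not_rat_square[OF g(2), of s] by (simp add: normBC_def numeral_2_eq_2)
  qed
  then show ?thesis by (intro rank_zero_of_no_triple) simp
qed

lemma rat_disc: "disc_AC (rat_poly A) (rat_poly B) (rat_poly C) = rat_poly (B * B - smult 4 (A * C))"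
  by (simp add: disc_AC_def rat_poly_diff rat_poly_mult rat_poly_smult power2_eq_square)

lemma rank_zero_square:
  assumes good: "good_square v" and v0: "v 0 \<noteq> 0"
  shows "\<not> ec_rank (EC ([:v 0:]\<^sup>2) [:v 1, v 2, v 3:] [:v 4, v 5, v 6, 1:]) \<ge> 1"
proof -
  let ?A = "[:v 0:]\<^sup>2" and ?B = "[:v 1, v 2, v 3:]" and ?C = "[:v 4, v 5, v 6, 1:]"
  let ?D = "?B * ?B - smult 4 (?A * ?C)"
  have "pcompose ?D [:0, 1:] = [:(v 1)\<^sup>2 - 4 * (v 0)\<^sup>2 * v 4, 2 * v 1 * v 2 - 4 * (v 0)\<^sup>2 * v 5,
     (v 2)\<^sup>2 + 2 * v 1 * v 3 - 4 * (v 0)\<^sup>2 * v 6, 2 * v 2 * v 3 - 4 * (v 0)\<^sup>2, (v 3)\<^sup>2:]"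
    by (simp add: pcompose_idR power2_eq_square algebra_simps)
  note irr = irreducible_of_quartic_irr[OF this good[unfolded good_square_def]]
  have A: "rat_poly ?A = [:(of_int (v 0))\<^sup>2:]" by (simp add: power2_eq_square map_poly_pCons)
  have C: "rat_poly ?C = [:of_int (v 4), of_int (v 5), of_int (v 6), 1:]" by (simp add: map_poly_pCons)
  have "v 3 \<noteq> 0"
  proof
    assume "v 3 = 0"
    then have "degree ?D \<le> 3"
      by (simp add: power2_eq_square order_trans[OF degree_pCons_le])
    then show False using irr(2) by simp
  qed
  then have B: "degree (rat_poly ?B) = 2" by simp
  show ?thesis
  proof (rule rank_zero_of_no_triple)
    fix P Q R
    show "\<not> triple [:coeff (rat_poly ?C) 2, coeff (rat_poly ?B) 2, coeff (rat_poly ?A) 2:]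
      [:coeff (rat_poly ?C) 1, coeff (rat_poly ?B) 1, coeff (rat_poly ?A) 1:]
      [:coeff (rat_poly ?C) 0, coeff (rat_poly ?B) 0, coeff (rat_poly ?A) 0:] P Q R"
      unfolding A
    proof (rule no_triple_square[OF _ B])
      show "(of_int (v 0) :: rat) \<noteq> 0" using v0 by simp
      show "degree (rat_poly ?C - monom 1 3) \<le> 2" unfolding C by (rule degree_minus_monom)
      show "irreducible (disc_AC [:(of_int (v 0))\<^sup>2:] (rat_poly ?B) (rat_poly ?C))"
        using irr(1) unfolding A[symmetric] rat_disc .
      show "degree (disc_AC [:(of_int (v 0))\<^sup>2:] (rat_poly ?B) (rat_poly ?C)) > 1"
        using irr(2) unfolding A[symmetric] rat_disc by linarith
    qed
  qed
qed

text \<open>The condition on \<open>- v 1\<close> belongs to the place \<open>T = infinity\<close>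
  and is independent of the prime; its exceptions are counted on their own.\<close>

lemma rank_zero_linear:
  assumes good: "good_l v" and v1: "\<And>s. - v 1 \<noteq> s\<^sup>2"
  shows "\<not> ec_rank (EC [:v 0, v 1:] [:v 2, v 3:] [:v 4, v 5, 0, 1:]) \<ge> 1"
proof -
  let ?A = "[:v 0, v 1:]" and ?B = "[:v 2, v 3:]" and ?C = "[:v 4, v 5, 0, 1:]"
  let ?D = "?B * ?B - smult 4 (?A * ?C)"
  obtain x where x: "quartic_irr
     ((v 2 + v 3 * x)\<^sup>2 - 4 * (v 0 + v 1 * x) * (x ^ 3 + v 5 * x + v 4))
     (2 * v 3 * (v 2 + v 3 * x) - 4 * (v 1 * (x ^ 3 + v 5 * x + v 4) + (v 0 + v 1 * x) * (3 * x\<^sup>2 + v 5)))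
     ((v 3)\<^sup>2 - 4 * (v 1 * (3 * x\<^sup>2 + v 5) + 3 * x * (v 0 + v 1 * x)))
     (- 4 * (v 0 + v 1 * x + 3 * x * v 1)) (- 4 * v 1)" using good unfolding good_l_def ..
  have "pcompose ?D [:x, 1:] = pcompose ?B [:x, 1:] * pcompose ?B [:x, 1:] - smult 4 (pcompose ?A [:x, 1:] * pcompose ?C [:x, 1:])"
    by (simp only: pcompose_diff pcompose_mult pcompose_smult)
  also have "pcompose ?B [:x, 1:] = [:v 2 + v 3 * x, v 3:]" by (simp add: pcompose_pCons algebra_simps)
  also have "pcompose ?A [:x, 1:] = [:v 0 + v 1 * x, v 1:]" by (simp add: pcompose_pCons algebra_simps)
  also have "pcompose ?C [:x, 1:] = [:x ^ 3 + v 5 * x + v 4, 3 * x\<^sup>2 + v 5, 3 * x, 1:]"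
    by (simp add: pcompose_pCons power2_eq_square power3_eq_cube algebra_simps)
  also have "[:v 2 + v 3 * x, v 3:] * [:v 2 + v 3 * x, v 3:]
      - smult 4 ([:v 0 + v 1 * x, v 1:] * [:x ^ 3 + v 5 * x + v 4, 3 * x\<^sup>2 + v 5, 3 * x, 1:])
    = [:(v 2 + v 3 * x)\<^sup>2 - 4 * (v 0 + v 1 * x) * (x ^ 3 + v 5 * x + v 4),
     2 * v 3 * (v 2 + v 3 * x) - 4 * (v 1 * (x ^ 3 + v 5 * x + v 4) + (v 0 + v 1 * x) * (3 * x\<^sup>2 + v 5)),
     (v 3)\<^sup>2 - 4 * (v 1 * (3 * x\<^sup>2 + v 5) + 3 * x * (v 0 + v 1 * x)),
     - 4 * (v 0 + v 1 * x + 3 * x * v 1), - 4 * v 1:]"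
    by (simp add: power2_eq_square algebra_simps)
  finally have D: "pcompose ?D [:x, 1:] = \<dots>" .
  note irr = irreducible_of_quartic_irr[OF D x]
  have C: "rat_poly ?C = [:of_int (v 4), of_int (v 5), 0, 1:]" by (simp add: map_poly_pCons)
  show ?thesis
  proof (rule rank_zero_of_no_triple, rule no_triple_linear)
    show "degree (rat_poly ?A) \<le> 1" "degree (rat_poly ?B) \<le> 1" by simp_all
    show "degree (rat_poly ?C - monom 1 3) \<le> 1" unfolding C by (rule degree_minus_monom)
    show "- coeff (rat_poly ?A) 1 \<noteq> s\<^sup>2" for s
    proof
      assume "- coeff (rat_poly ?A) 1 = s\<^sup>2"
      then have "of_int (- v 1) = s\<^sup>2" by simp
      from int_square_if_rat_square[OF this] show False using v1 by blast
    qed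
    show "irreducible (disc_AC (rat_poly ?A) (rat_poly ?B) (rat_poly ?C))" unfolding rat_disc by (rule irr(1))
    show "1 < degree (disc_AC (rat_poly ?A) (rat_poly ?B) (rat_poly ?C))" unfolding rat_disc irr(2) by simp
  qed
qed

end

lemma odd_prime_int: "prime q \<Longrightarrow> q \<ge> 5 \<Longrightarrow> odd_prime (int q)"
  by unfold_locales simp_all

subsection \<open>Parametrising the curves\<close>

definition curve_0 :: "(nat \<Rightarrow> int) \<Rightarrow> rat poly fract wcurve" where
  "curve_0 v = EC 0 [:v 0, v 1, v 2:] [:v 3, v 4, v 5, 1:]"

definition curve_square :: "(nat \<Rightarrow> int) \<Rightarrow> rat poly fract wcurve" where
  "curve_square v = EC ([:v 0:]\<^sup>2) [:v 1, v 2, v 3:] [:v 4, v 5, v 6, 1:]"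

definition curve_l :: "(nat \<Rightarrow> int) \<Rightarrow> rat poly fract wcurve" where
  "curve_l v = EC [:v 0, v 1:] [:v 2, v 3:] [:v 4, v 5, 0, 1:]"

lemma heights_le_iff:
  assumes "Ps \<noteq> []"
  shows "of_int (heights Ps) \<le> (H::real) \<longleftrightarrow> (\<forall>P\<in>set Ps. \<forall>i. \<bar>coeff P i\<bar> \<le> \<lfloor>H\<rfloor>)"
proof
  assume H: "of_int (heights Ps) \<le> H"
  show "\<forall>P\<in>set Ps. \<forall>i. \<bar>coeff P i\<bar> \<le> \<lfloor>H\<rfloor>"
  proof (intro ballI allI)
    fix P i assume "P \<in> set Ps"
    then show "\<bar>coeff P i\<bar> \<le> \<lfloor>H\<rfloor>"
      using abs_coeff_le_poly_height[of P i] poly_height_le_heights[of P Ps] H by (simp add: le_floor_iff)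
  qed
next
  assume c: "\<forall>P\<in>set Ps. \<forall>i. \<bar>coeff P i\<bar> \<le> \<lfloor>H\<rfloor>"
  have "poly_height P \<le> \<lfloor>H\<rfloor>" if "P \<in> set Ps" for P
    unfolding poly_height_def using c that by (intro Max.boundedI) auto
  then have "heights Ps \<le> \<lfloor>H\<rfloor>"
    unfolding heights_def using assms by (intro Max.boundedI) auto
  then show "of_int (heights Ps) \<le> H" by (simp add: le_floor_iff)
qed

lemma EC_coeff_eq:
  assumes "EC A B C = EC A' B' C'" "i \<le> 2"
  shows "coeff A i = coeff A' i" "coeff B i = coeff B' i" "coeff C i = coeff C' i"
proof -
  have inj: "f = g" if "to_QT f = to_QT g" for f g
    using that by (simp add: to_QT_eq rat_poly_inject)
  have "i = 0 \<or> i = 1 \<or> i = 2" using assms(2) by linarith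
  then have "X_coeff A B C i = X_coeff A' B' C' i"
    using assms(1) inj unfolding EC_eq wcurve.inject by blast
  then show "coeff A i = coeff A' i" "coeff B i = coeff B' i" "coeff C i = coeff C' i"
    by (simp_all add: X_coeff_def)
qed

text \<open>For \<open>T = 0\<close> and modulo 2 the discriminant of the cubic is \<open>c\<^sub>2\<^sup>2 c\<^sub>1\<^sup>2 + c\<^sub>0\<^sup>2\<close>.\<close>

lemma nonsingular_if_odd:
  assumes "odd (coeff C 0)" "even (coeff C 1)"
  shows "nonsingular A B C"
proof -
  let ?c = "coeff C"
  have "poly (discriminant (int_model A B C)) 0 = 16 * ((?c 2)\<^sup>2 * (?c 1)\<^sup>2 - 4 * (?c 1) ^ 3
      - 4 * (?c 2) ^ 3 * ?c 0 + 18 * ?c 2 * ?c 1 * ?c 0 - 27 * (?c 0)\<^sup>2)"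
    by (simp add: discriminant_def int_model_def X_coeff_def)
  moreover have "odd ((?c 2)\<^sup>2 * (?c 1)\<^sup>2 - 4 * (?c 1) ^ 3 - 4 * (?c 2) ^ 3 * ?c 0 + 18 * ?c 2 * ?c 1 * ?c 0 - 27 * (?c 0)\<^sup>2)"
    using assms by simp
  then have "(?c 2)\<^sup>2 * (?c 1)\<^sup>2 - 4 * (?c 1) ^ 3 - 4 * (?c 2) ^ 3 * ?c 0 + 18 * ?c 2 * ?c 1 * ?c 0 - 27 * (?c 0)\<^sup>2 \<noteq> 0"
    using even_zero by metis
  ultimately have "poly (discriminant (int_model A B C)) 0 \<noteq> 0" by (simp only: mult_eq_0_iff) simp
  then show ?thesis unfolding nonsingular_def by (metis poly_0)
qed

lemma box_component: "v \<in> box n K \<Longrightarrow> i < n \<Longrightarrow> \<bar>v i\<bar> \<le> K"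
  unfolding box_def by (drule PiE_mem[of _ _ _ i]) auto

lemma box_ext: "v \<in> box n K \<Longrightarrow> w \<in> box n K \<Longrightarrow> (\<And>i. i < n \<Longrightarrow> v i = w i) \<Longrightarrow> v = w"
  unfolding box_def by (rule PiE_ext) auto

lemma vec_in_box:
  assumes "length xs = n" "\<forall>x\<in>set xs. \<bar>x\<bar> \<le> K"
  shows "restrict (nth xs) {..<n} \<in> box n K"
  unfolding box_def
proof (rule restrict_PiE_iff[THEN iffD2], rule ballI)
  fix i assume "i \<in> {..<n}"
  then have "\<bar>xs ! i\<bar> \<le> K" using assms nth_mem by simp
  then show "xs ! i \<in> {- K..K}" by auto
qed

lemma cubic_of_degree:
  fixes C :: "int poly"
  assumes "degree (C - monom 1 3) \<le> 2"
  shows "C = [:coeff C 0, coeff C 1, coeff C 2, 1:]"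
proof (rule poly_eqI)
  fix i
  have "coeff C j = coeff (monom 1 3) j" if "j > 2" for j
    using coeff_eq_0[of "C - monom 1 3" j] assms that by simp
  then show "coeff C i = coeff [:coeff C 0, coeff C 1, coeff C 2, 1:] i"
    by (auto simp: coeff_pCons numeral_2_eq_2 numeral_3_eq_3 split: nat.split)
qed

text \<open>A single good prime forces rank 0, so the coefficient vector of a curve of positive rank
  is bad at every prime of \<open>Q\<close>. For an upper bound it is enough that the vectors map
  onto the curves.\<close>

lemma positive_rank_0_le:
  assumes Q: "\<And>q. q \<in> Q \<Longrightarrow> odd_prime (int q)"
  shows "card (positive_rank_curves Family_0 H) \<le> card {v \<in> box 6 \<lfloor>H\<rfloor>. \<forall>q\<in>Q. \<not> odd_prime.good_0 (int q) v}"
proof -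
  have "positive_rank_curves Family_0 H \<subseteq> curve_0 ` {v \<in> box 6 \<lfloor>H\<rfloor>. \<forall>q\<in>Q. \<not> odd_prime.good_0 (int q) v}"
  proof
    fix E assume "E \<in> positive_rank_curves Family_0 H"
    then obtain B C where E: "E = EC 0 B C" and rank: "ec_rank E \<ge> 1"
      and B: "degree B \<le> 2" and C: "degree (C - monom 1 3) \<le> 2" and h: "of_int (heights [B, C]) \<le> H"
      by (auto simp: positive_rank_curves_def)
    let ?xs = "[coeff B 0, coeff B 1, coeff B 2, coeff C 0, coeff C 1, coeff C 2]"
    define v where "v = restrict (nth ?xs) {..<6}"
    have v: "v \<in> box 6 \<lfloor>H\<rfloor>"
      unfolding v_def by (rule vec_in_box) (use h in \<open>simp_all add: heights_le_iff\<close>)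
    have "curve_0 v = EC 0 [:coeff B 0, coeff B 1, coeff B 2:] [:coeff C 0, coeff C 1, coeff C 2, 1:]"
      by (simp add: curve_0_def v_def)
    then have Ev: "E = curve_0 v" using quadratic_form[OF B] cubic_of_degree[OF C] E by simp
    have "\<not> odd_prime.good_0 (int q) v" if "q \<in> Q" for q
      using odd_prime.rank_zero_0[OF Q[OF that], of v] rank unfolding Ev curve_0_def by blast
    then show "E \<in> curve_0 ` {v \<in> box 6 \<lfloor>H\<rfloor>. \<forall>q\<in>Q. \<not> odd_prime.good_0 (int q) v}"
      using Ev v by blast
  qed
  then show ?thesis by (rule surj_card_le[rotated]) (simp add: finite_box)
qed

lemma positive_rank_square_le:
  assumes Q: "\<And>q. q \<in> Q \<Longrightarrow> odd_prime (int q)"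
  shows "card (positive_rank_curves Family_square H) \<le> card {v \<in> box 7 \<lfloor>H\<rfloor>. \<forall>q\<in>Q. \<not> odd_prime.good_square (int q) v}"
proof -
  have "positive_rank_curves Family_square H \<subseteq> curve_square ` {v \<in> box 7 \<lfloor>H\<rfloor>. \<forall>q\<in>Q. \<not> odd_prime.good_square (int q) v}"
  proof
    fix E assume "E \<in> positive_rank_curves Family_square H"
    then obtain A B C where E: "E = EC (A\<^sup>2) B C" and rank: "ec_rank E \<ge> 1" and A: "degree A = 0" "A \<noteq> 0"
      and B: "degree B \<le> 2" and C: "degree (C - monom 1 3) \<le> 2" and h: "of_int (heights [A, B, C]) \<le> H"
      by (auto simp: positive_rank_curves_def)
    let ?xs = "[coeff A 0, coeff B 0, coeff B 1, coeff B 2, coeff C 0, coeff C 1, coeff C 2]"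
    define v where "v = restrict (nth ?xs) {..<7}"
    have v: "v \<in> box 7 \<lfloor>H\<rfloor>"
      unfolding v_def by (rule vec_in_box) (use h in \<open>simp_all add: heights_le_iff\<close>)
    have A': "A = [:coeff A 0:]" using A(1) by (metis degree_eq_zeroE coeff_pCons_0)
    have v0: "v 0 \<noteq> 0" using A(2) A' by (simp add: v_def) (metis pCons_0_0)
    have "curve_square v = EC ([:coeff A 0:]\<^sup>2) [:coeff B 0, coeff B 1, coeff B 2:] [:coeff C 0, coeff C 1, coeff C 2, 1:]"
      by (simp add: curve_square_def v_def)
    then have Ev: "E = curve_square v" using quadratic_form[OF B] cubic_of_degree[OF C] E A' by simp
    have "\<not> odd_prime.good_square (int q) v" if "q \<in> Q" for q
      using odd_prime.rank_zero_square[OF Q[OF that], of v] v0 rank unfolding Ev curve_square_def by blast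
    then show "E \<in> curve_square ` {v \<in> box 7 \<lfloor>H\<rfloor>. \<forall>q\<in>Q. \<not> odd_prime.good_square (int q) v}"
      using Ev v by blast
  qed
  then show ?thesis by (rule surj_card_le[rotated]) (simp add: finite_box)
qed

lemma positive_rank_l_le:
  assumes Q: "\<And>q. q \<in> Q \<Longrightarrow> odd_prime (int q)"
  shows "card (positive_rank_curves Family_l H) \<le> card {v \<in> box 6 \<lfloor>H\<rfloor>. \<forall>q\<in>Q. \<not> odd_prime.good_l (int q) v}
    + card {v \<in> box 6 \<lfloor>H\<rfloor>. \<exists>s. - v 1 = s\<^sup>2}"
proof -
  let ?V = "{v \<in> box 6 \<lfloor>H\<rfloor>. \<forall>q\<in>Q. \<not> odd_prime.good_l (int q) v} \<union> {v \<in> box 6 \<lfloor>H\<rfloor>. \<exists>s. - v 1 = s\<^sup>2}"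
  have "positive_rank_curves Family_l H \<subseteq> curve_l ` ?V"
  proof
    fix E assume "E \<in> positive_rank_curves Family_l H"
    then obtain A B C where E: "E = EC A B C" and rank: "ec_rank E \<ge> 1" and A: "degree A \<le> 1"
      and B: "degree B \<le> 1" and C: "degree (C - monom 1 3) \<le> 1" and h: "of_int (heights [A, B, C]) \<le> H"
      by (auto simp: positive_rank_curves_def)
    let ?xs = "[coeff A 0, coeff A 1, coeff B 0, coeff B 1, coeff C 0, coeff C 1]"
    define v where "v = restrict (nth ?xs) {..<6}"
    have v: "v \<in> box 6 \<lfloor>H\<rfloor>"
      unfolding v_def by (rule vec_in_box) (use h in \<open>simp_all add: heights_le_iff\<close>)
    have "coeff (C - monom 1 3) 2 = 0" using C by (intro coeff_eq_0) simp
    then have C2: "coeff C 2 = 0" by simp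
    have "degree (C - monom 1 3) \<le> 2" using C by simp
    from cubic_of_degree[OF this] have C': "C = [:coeff C 0, coeff C 1, 0, 1:]" unfolding C2 .
    have "curve_l v = EC [:coeff A 0, coeff A 1:] [:coeff B 0, coeff B 1:] [:coeff C 0, coeff C 1, 0, 1:]"
      by (simp add: curve_l_def v_def)
    then have Ev: "E = curve_l v" using linear_form[OF A] linear_form[OF B] C' E by simp
    have "\<not> odd_prime.good_l (int q) v" if "q \<in> Q" "\<nexists>s. - v 1 = s\<^sup>2" for q
      using odd_prime.rank_zero_linear[OF Q[OF that(1)], of v] that(2) rank unfolding Ev curve_l_def by blast
    then show "E \<in> curve_l ` ?V" using Ev v by blast
  qed
  then have "card (positive_rank_curves Family_l H) \<le> card ?V" by (rule surj_card_le[rotated]) (simp add: finite_box)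
  also have "\<dots> \<le> card {v \<in> box 6 \<lfloor>H\<rfloor>. \<forall>q\<in>Q. \<not> odd_prime.good_l (int q) v} + card {v \<in> box 6 \<lfloor>H\<rfloor>. \<exists>s. - v 1 = s\<^sup>2}"
    by (rule card_Un_le)
  finally show ?thesis .
qed

subsection \<open>A lower bound for the number of curves\<close>

text \<open>A smaller box is mapped injectively into the family. Odd constant and even linear
  coefficients of C guarantee non-singularity, and in the square family the shift by
  \<open>L + 1\<close> makes A positive, since A and -A give the same curve.\<close>

lemma card_curves_ge:
  fixes H :: real
  assumes H: "H \<ge> 2" and n: "n = (if fam = Family_square then 7 else 6)"
  shows "((2 * real_of_int \<lfloor>H\<rfloor> + 1) / 5) ^ n \<le> real (card (curves fam H))"
proof -
  define K where "K = \<lfloor>H\<rfloor>"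
  \<comment> \<open>The largest \<open>L\<close> for which \<open>2 * c + 1\<close> stays within
    \<open>K\<close> whenever \<open>c\<close> is at most \<open>L\<close> in absolute value.
    Conversely \<open>2 * K + 1 \<le> 5 * (2 * L + 1)\<close>, which is the origin of the 5.\<close>
  define L where "L = (K - 1) div 2"
  have K: "K \<ge> 2" using H by (simp add: K_def le_floor_iff)
  have "L \<ge> 0" "2 * L + 1 \<le> K" "K - 2 \<le> 2 * L" using K unfolding L_def by simp_all
  moreover from this(3) have "2 * K + 1 \<le> 5 * (2 * L + 1)" using K by simp
  ultimately have L: "L \<ge> 0" "2 * L + 1 \<le> K" "2 * K + 1 \<le> 5 * (2 * L + 1)" by blast+
  define g where "g w = (case fam of Family_0 \<Rightarrow> EC 0 [:w 0, w 1, w 2:] [:2 * w 3 + 1, 2 * w 4, w 5, 1:]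
     | Family_square \<Rightarrow> EC ([:w 0 + L + 1:]\<^sup>2) [:w 1, w 2, w 3:] [:2 * w 4 + 1, 2 * w 5, w 6, 1:]
     | Family_l \<Rightarrow> EC [:w 0, w 1:] [:w 2, w 3:] [:2 * w 4 + 1, 2 * w 5, 0, 1:])" for w :: "nat \<Rightarrow> int"
  have small: "\<bar>c\<bar> \<le> \<lfloor>H\<rfloor> \<and> \<bar>2 * c\<bar> \<le> \<lfloor>H\<rfloor> \<and> \<bar>2 * c + 1\<bar> \<le> \<lfloor>H\<rfloor> \<and> \<bar>c + L + 1\<bar> \<le> \<lfloor>H\<rfloor>" if "\<bar>c\<bar> \<le> L" for c
    using that L unfolding K_def by linarith
  have coeff4: "\<bar>coeff [:a, b, c, d:] i\<bar> \<le> M"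
    if "\<bar>a\<bar> \<le> M" "\<bar>b\<bar> \<le> M" "\<bar>c\<bar> \<le> M" "\<bar>d\<bar> \<le> M" for a b c d M :: int and i
    using that by (auto simp: coeff_pCons split: nat.split)
  have coeff3: "\<bar>coeff [:a, b, c:] i\<bar> \<le> M" if "\<bar>a\<bar> \<le> M" "\<bar>b\<bar> \<le> M" "\<bar>c\<bar> \<le> M" for a b c M :: int and i
    using that by (auto simp: coeff_pCons split: nat.split)
  have coeff2: "\<bar>coeff [:a, b:] i\<bar> \<le> M" if "\<bar>a\<bar> \<le> M" "\<bar>b\<bar> \<le> M" for a b M :: int and i
    using that by (auto simp: coeff_pCons split: nat.split)
  have coeff1: "\<bar>coeff [:a:] i\<bar> \<le> M" if "\<bar>a\<bar> \<le> M" for a M :: int and i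
    using that by (auto simp: coeff_pCons split: nat.split)
  have one: "\<bar>1\<bar> \<le> \<lfloor>H\<rfloor>" "\<bar>0\<bar> \<le> \<lfloor>H\<rfloor>" using K unfolding K_def by simp_all
  have "card (box n L) \<le> card (curves fam H)"
  proof (rule card_inj_on_le[OF _ _ finite_curves])
    show "inj_on g (box n L)"
    proof (rule inj_onI, rule box_ext)
      fix w w' i assume w: "w \<in> box n L" "w' \<in> box n L" and eq: "g w = g w'" and i: "i < n"
      show "w i = w' i"
      proof (cases fam)
        case Family_0
        note c = EC_coeff_eq[OF eq[unfolded g_def Family_0 family.case]]
        have "w 0 = w' 0" "w 1 = w' 1" "w 2 = w' 2" "w 3 = w' 3" "w 4 = w' 4" "w 5 = w' 5"
          using c[of 0] c[of 1] c[of 2] by (simp_all add: numeral_2_eq_2)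
        moreover have "i = 0 \<or> i = 1 \<or> i = 2 \<or> i = 3 \<or> i = 4 \<or> i = 5" using i n Family_0 by simp linarith
        ultimately show ?thesis by blast
      next
        case Family_l
        note c = EC_coeff_eq[OF eq[unfolded g_def Family_l family.case]]
        have "w 0 = w' 0" "w 1 = w' 1" "w 2 = w' 2" "w 3 = w' 3" "w 4 = w' 4" "w 5 = w' 5"
          using c[of 0] c[of 1] c[of 2] by (simp_all add: numeral_2_eq_2)
        moreover have "i = 0 \<or> i = 1 \<or> i = 2 \<or> i = 3 \<or> i = 4 \<or> i = 5" using i n Family_l by simp linarith
        ultimately show ?thesis by blast
      next
        case Family_square
        note c = EC_coeff_eq[OF eq[unfolded g_def Family_square family.case]]
        have "w 1 = w' 1" "w 2 = w' 2" "w 3 = w' 3" "w 4 = w' 4" "w 5 = w' 5" "w 6 = w' 6"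
          using c(2,3)[of 0] c(2,3)[of 1] c(2,3)[of 2] by (simp_all add: numeral_2_eq_2)
        moreover have "w 0 = w' 0"
        proof -
          have "(w 0 + L + 1)\<^sup>2 = (w' 0 + L + 1)\<^sup>2" using c(1)[of 0] by (simp add: power2_eq_square)
          moreover have "w 0 + L + 1 \<ge> 0" "w' 0 + L + 1 \<ge> 0"
            using box_component[OF w(1), of 0] box_component[OF w(2), of 0] n Family_square by simp_all
          ultimately have "w 0 + L + 1 = w' 0 + L + 1" by (simp only: power2_eq_iff_nonneg)
          then show ?thesis by simp
        qed
        moreover have "i = 0 \<or> i = 1 \<or> i = 2 \<or> i = 3 \<or> i = 4 \<or> i = 5 \<or> i = 6" using i n Family_square by simp linarith
        ultimately show ?thesis by blast
      qed
    qed
    show "g ` box n L \<subseteq> curves fam H"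
    proof (rule image_subsetI)
      fix w assume "w \<in> box n L"
      then have w: "\<bar>w i\<bar> \<le> L" if "i < n" for i using box_component that by blast
      show "g w \<in> curves fam H"
      proof (cases fam)
        case Family_0
        have b: "\<bar>w 0\<bar> \<le> L" "\<bar>w 1\<bar> \<le> L" "\<bar>w 2\<bar> \<le> L" "\<bar>w 3\<bar> \<le> L" "\<bar>w 4\<bar> \<le> L" "\<bar>w 5\<bar> \<le> L"
          using w n Family_0 by simp_all
        let ?B = "[:w 0, w 1, w 2:]" and ?C = "[:2 * w 3 + 1, 2 * w 4, w 5, 1:]"
        have "of_int (heights [?B, ?C]) \<le> H"
          unfolding heights_le_iff[OF list.distinct(2)] list.set ball_simps
          by (intro conjI allI TrueI coeff3 coeff4 one) (use small b in blast)+
        moreover have "degree ?B \<le> 2" "degree (?C - monom 1 3) \<le> 2" "nonsingular 0 ?B ?C"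
          by (simp add: order_trans[OF degree_pCons_le], rule degree_minus_monom, rule nonsingular_if_odd, simp_all)
        ultimately show ?thesis unfolding Family_0 g_def family.case curves.simps by blast
      next
        case Family_l
        have b: "\<bar>w 0\<bar> \<le> L" "\<bar>w 1\<bar> \<le> L" "\<bar>w 2\<bar> \<le> L" "\<bar>w 3\<bar> \<le> L" "\<bar>w 4\<bar> \<le> L" "\<bar>w 5\<bar> \<le> L"
          using w n Family_l by simp_all
        let ?A = "[:w 0, w 1:]" and ?B = "[:w 2, w 3:]" and ?C = "[:2 * w 4 + 1, 2 * w 5, 0, 1:]"
        have "of_int (heights [?A, ?B, ?C]) \<le> H"
          unfolding heights_le_iff[OF list.distinct(2)] list.set ball_simps
          by (intro conjI allI TrueI coeff2 coeff4 one) (use small b in blast)+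
        moreover have "degree ?A \<le> 1" "degree ?B \<le> 1" "degree (?C - monom 1 3) \<le> 1" "nonsingular ?A ?B ?C"
          by (simp, simp, rule degree_minus_monom, rule nonsingular_if_odd, simp_all)
        ultimately show ?thesis unfolding Family_l g_def family.case curves.simps by blast
      next
        case Family_square
        have b: "\<bar>w 0\<bar> \<le> L" "\<bar>w 1\<bar> \<le> L" "\<bar>w 2\<bar> \<le> L" "\<bar>w 3\<bar> \<le> L" "\<bar>w 4\<bar> \<le> L" "\<bar>w 5\<bar> \<le> L" "\<bar>w 6\<bar> \<le> L"
          using w n Family_square by simp_all
        let ?A = "[:w 0 + L + 1:]" and ?B = "[:w 1, w 2, w 3:]" and ?C = "[:2 * w 4 + 1, 2 * w 5, w 6, 1:]"
        have "of_int (heights [?A, ?B, ?C]) \<le> H"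
          unfolding heights_le_iff[OF list.distinct(2)] list.set ball_simps
          by (intro conjI allI TrueI coeff1 coeff3 coeff4 one) (use small b in blast)+
        moreover have "degree ?A = 0" "degree ?B \<le> 2" "degree (?C - monom 1 3) \<le> 2" "nonsingular (?A\<^sup>2) ?B ?C"
          by (simp, simp add: order_trans[OF degree_pCons_le], rule degree_minus_monom, rule nonsingular_if_odd, simp_all)
        moreover have "?A \<noteq> 0" using b(1) by simp
        ultimately show ?thesis unfolding Family_square g_def family.case curves.simps by blast
      qed
    qed
  qed
  then have "real (card (box n L)) \<le> real (card (curves fam H))" by (simp only: of_nat_le_iff)
  moreover have "((2 * real_of_int K + 1) / 5) ^ n \<le> real_of_int (2 * L + 1) ^ n"
  proof (rule power_mono)
    have "real_of_int (2 * K + 1) \<le> real_of_int (5 * (2 * L + 1))" using L(3) by (simp only: of_int_le_iff)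
    then show "(2 * real_of_int K + 1) / 5 \<le> real_of_int (2 * L + 1)" by simp
  qed (use K in simp)
  ultimately show ?thesis unfolding K_def card_box[OF L(1)] by linarith
qed

section \<open>Asymptotics\<close>

text \<open>The order that the sieve reaches. It is smaller than the claimed one by the factor
  \<open>ln (ln H) powr (2/3)\<close>.\<close>

definition decay :: "real \<Rightarrow> real" where
  "decay H = H powr (-1/3) * ln H powr (2/3)"

definition sieve_level :: "real \<Rightarrow> real" where
  "sieve_level H = (H * ln H) powr (1/3)"

definition sieve_primes :: "real \<Rightarrow> nat set" where
  "sieve_primes H = {q. prime q \<and> q \<ge> 5 \<and> real q \<le> sieve_level H}"

text \<open>\<open>512 = 64 * 8\<close>: the 64 is the inverse of the density of good residues, and
  the 8 comes from the lower bound \<open>z / (8 * ln z)\<close> for the number of sieving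
  primes.\<close>

definition sieve_const :: "nat \<Rightarrow> real" where
  "sieve_const n = 2 ^ n + 2 * real n + 512 * 2 ^ n"

text \<open>\<open>z / (8 * ln z) \<ge> 2\<close> lets half of the Chebyshev bound absorb the
  omitted primes 2 and 3, and \<open>ln (ln H) \<ge> 1\<close> is for the comparison with the
  claimed order.\<close>

definition large :: "real \<Rightarrow> bool" where
  "large H \<longleftrightarrow> H \<ge> 3 \<and> ln H \<ge> 1 \<and> sieve_level H \<ge> 6 \<and> (sieve_level H)\<^sup>2 \<le> H \<and>
     sieve_level H / (8 * ln (sieve_level H)) \<ge> 2 \<and> ln (ln H) \<ge> 1"

lemma eventually_large: "eventually large at_top"
  unfolding large_def sieve_level_def by (intro eventually_conj; real_asymp)

text \<open>At this level \<open>z\<^sup>2 / H\<close> and \<open>ln H / z\<close> are both equal to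
  \<open>decay H\<close>.\<close>

lemma sieve_bound:
  fixes P :: "nat \<Rightarrow> (nat \<Rightarrow> int) \<Rightarrow> bool"
  assumes H: "large H"
    and per: "\<And>q. prime q \<Longrightarrow> q \<ge> 5 \<Longrightarrow> periodic n q (P q)"
    and dens: "\<And>q. prime q \<Longrightarrow> q \<ge> 5 \<Longrightarrow> q ^ n \<le> 64 * card (residue_vectors n q (P q))"
  shows "real (card {v \<in> box n \<lfloor>H\<rfloor>. \<forall>q\<in>sieve_primes H. \<not> P q v})
    \<le> (2 * real_of_int \<lfloor>H\<rfloor> + 1) ^ n * (sieve_const n * decay H)"
proof -
  let ?z = "sieve_level H" and ?Q = "sieve_primes H"
  define N where "N = real_of_int (2 * \<lfloor>H\<rfloor> + 1)"
  have large: "H \<ge> 3" "ln H \<ge> 1" "?z \<ge> 6" "?z\<^sup>2 \<le> H" "?z / (8 * ln ?z) \<ge> 2" using H by (simp_all add: large_def)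
  have NH: "H \<le> N" using large(1) unfolding N_def by linarith
  have Npos: "N > 0" using NH large(1) by linarith
  have "?z \<le> ?z\<^sup>2" using large(3) by (simp add: self_le_power)
  then have zH: "?z \<le> H" using large(4) by linarith
  have lnz: "ln ?z > 0" using large(3) by simp
  have lnzH: "ln ?z \<le> ln H" using zH large(3) by simp
  have all: "{p. prime p \<and> real p \<le> ?z} \<subseteq> ?Q \<union> {2, 3}"
  proof
    fix p assume "p \<in> {p. prime p \<and> real p \<le> ?z}"
    then have p: "prime p" "real p \<le> ?z" by simp_all
    show "p \<in> ?Q \<union> {2, 3}"
    proof (cases "p \<ge> 5")
      case False
      have "p \<ge> 2" using p(1) by (rule prime_ge_2_nat)
      moreover have "p \<noteq> 4"
      proof
        assume "p = 4"
        then have "prime (2 * 2 :: nat)" using p(1) by simp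
        then show False using prime_product[of 2 2] by simp
      qed
      ultimately show ?thesis using False by simp linarith
    qed (use p in \<open>simp add: sieve_primes_def\<close>)
  qed
  have fin: "finite ?Q"
  proof (rule finite_subset)
    show "?Q \<subseteq> {..nat \<lfloor>?z\<rfloor>}" by (auto simp: sieve_primes_def le_nat_floor)
  qed simp
  have "card {p. prime p \<and> real p \<le> ?z} \<le> card (?Q \<union> {2, 3})" by (rule card_mono[OF _ all]) (simp add: fin)
  also have "\<dots> \<le> card ?Q + card {2, 3 :: nat}" by (rule card_Un_le)
  finally have "card {p. prime p \<and> real p \<le> ?z} \<le> card ?Q + 2" by simp
  then have "real (card {p. prime p \<and> real p \<le> ?z}) \<le> real (card ?Q + 2)" by (simp only: of_nat_le_iff)
  then have "?z / (4 * ln ?z) \<le> real (card ?Q) + 2" using chebyshev_lower_bound[OF large(3)] by simp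
  moreover have "?z / (4 * ln ?z) = 2 * (?z / (8 * ln ?z))" by simp
  ultimately have cQ: "?z / (8 * ln ?z) \<le> real (card ?Q)" using large(5) by linarith
  then have Qpos: "real (card ?Q) > 0" using large(5) by linarith
  have z2: "?z\<^sup>2 / N \<le> decay H"
  proof -
    have "?z\<^sup>2 / N \<le> ?z\<^sup>2 / H" using NH large(1) by (intro divide_left_mono) (simp_all add: mult_pos_pos)
    also have "?z\<^sup>2 / H = decay H"
    proof -
      have z: "?z\<^sup>2 = (H * ln H) powr (2/3)"
        unfolding sieve_level_def power2_eq_square powr_add[symmetric] by simp
      have "H powr (2/3) / H powr 1 = H powr (-1/3)" unfolding powr_diff[symmetric] by simp
      then have "H powr (2/3) / H = H powr (-1/3)" using large(1) by simp
      moreover have "?z\<^sup>2 / H = (H powr (2/3) / H) * ln H powr (2/3)"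
        unfolding z using large(1,2) by (simp add: powr_mult)
      ultimately show ?thesis by (simp only: decay_def)
    qed
    finally show ?thesis .
  qed
  have inv: "1 / real (card ?Q) \<le> 8 * decay H"
  proof -
    have "1 / real (card ?Q) \<le> 1 / (?z / (8 * ln ?z))"
      using cQ large(5) by (intro divide_left_mono mult_pos_pos) linarith+
    also have "\<dots> = 8 * (ln ?z / ?z)" by simp
    also have "\<dots> \<le> 8 * (ln H / ?z)" using lnzH large(3) by (intro mult_left_mono divide_right_mono) simp_all
    also have "ln H / ?z = decay H"
    proof -
      have "ln H powr 1 / ln H powr (1/3) = ln H powr (2/3)" unfolding powr_diff[symmetric] by simp
      then have "ln H / ln H powr (1/3) = ln H powr (2/3)" using large(2) by simp
      moreover have "ln H / ?z = (1 / H powr (1/3)) * (ln H / ln H powr (1/3))"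
        unfolding sieve_level_def using large(1,2) by (simp add: powr_mult)
      moreover have "1 / H powr (1/3) = H powr (-1/3)" using powr_minus_divide[of H "1/3"] by simp
      ultimately show ?thesis by (simp only: decay_def)
    qed
    finally show ?thesis .
  qed
  have "real (card {v \<in> box n \<lfloor>H\<rfloor>. \<forall>q\<in>?Q. \<not> P q v})
    \<le> real_of_int (2 * \<lfloor>H\<rfloor> + 1) ^ n * ((2 ^ n + 2 * real n) * (?z\<^sup>2 / real_of_int (2 * \<lfloor>H\<rfloor> + 1)) + 2 ^ n / ((1/64) * real (card ?Q)))"
  proof (rule turan_sieve)
    show "0 \<le> \<lfloor>H\<rfloor>" using large(1) by simp
    show "1 \<le> ?z" using large(3) by simp
    show "?z\<^sup>2 \<le> real_of_int (2 * \<lfloor>H\<rfloor> + 1)" using large(4) NH unfolding N_def by linarith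
    show "(0::real) < 1/64" by simp
    show "finite ?Q" by (rule fin)
    show "?Q \<noteq> {}" using Qpos by auto
    fix q assume "q \<in> ?Q"
    then have q: "prime q" "q \<ge> 5" "real q \<le> ?z" by (simp_all add: sieve_primes_def)
    show "prime q" "real q \<le> ?z" by (fact q)+
    show "periodic n q (P q)" by (rule per[OF q(1,2)])
    have "real (q ^ n) \<le> real (64 * card (residue_vectors n q (P q)))" using dens[OF q(1,2)] by (simp only: of_nat_le_iff)
    then show "(1/64) * real q ^ n \<le> real (card (residue_vectors n q (P q)))" by simp
  qed
  also have "\<dots> = N ^ n * ((2 ^ n + 2 * real n) * (?z\<^sup>2 / N) + 64 * 2 ^ n * (1 / real (card ?Q)))"
    by (simp add: N_def)
  also have "\<dots> \<le> N ^ n * ((2 ^ n + 2 * real n) * decay H + 64 * 2 ^ n * (8 * decay H))"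
    using Npos by (intro mult_left_mono add_mono z2 inv) simp_all
  also have "(2 ^ n + 2 * real n) * decay H + 64 * 2 ^ n * (8 * decay H) = sieve_const n * decay H"
    by (simp add: sieve_const_def algebra_simps)
  finally show ?thesis by (simp add: N_def)
qed

text \<open>The coordinate \<open>v 1\<close> is restricted to at most \<open>sqrt H + 1\<close>
  values. This saves a factor of order \<open>H powr (-1/2)\<close>, which is below
  \<open>decay H\<close>.\<close>

lemma card_square_component:
  fixes H :: real
  assumes H: "large H"
  shows "real (card {v \<in> box 6 \<lfloor>H\<rfloor>. \<exists>s. - v 1 = s\<^sup>2}) \<le> (2 * real_of_int \<lfloor>H\<rfloor> + 1) ^ 6 * (2 * decay H)"
proof -
  define K where "K = \<lfloor>H\<rfloor>"
  define r where "r = \<lfloor>sqrt H\<rfloor>"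
  have large: "H \<ge> 3" "ln H \<ge> 1" using H by (simp_all add: large_def)
  have K: "K \<ge> 0" using large(1) by (simp add: K_def)
  have r: "r \<ge> 0" using large(1) by (simp add: r_def)
  have "{v \<in> box 6 K. \<exists>s. - v 1 = s\<^sup>2} \<subseteq> PiE {..<6} (\<lambda>i. if i = 1 then (\<lambda>s. - s\<^sup>2) ` {0..r} else {- K..K})"
  proof
    fix v assume "v \<in> {v \<in> box 6 K. \<exists>s. - v 1 = s\<^sup>2}"
    then obtain s where v: "v \<in> box 6 K" and s: "- v 1 = s\<^sup>2" by blast
    have "\<bar>v 1\<bar> \<le> K" by (rule box_component[OF v]) simp
    then have "s\<^sup>2 \<le> K" using s by linarith
    then have "real_of_int (s\<^sup>2) \<le> H" unfolding K_def by (simp add: le_floor_iff)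
    then have "(real_of_int \<bar>s\<bar>)\<^sup>2 \<le> H" by simp
    then have "real_of_int \<bar>s\<bar> \<le> sqrt H" by (rule real_le_rsqrt)
    then have "\<bar>s\<bar> \<le> r" unfolding r_def by (simp only: le_floor_iff)
    moreover have "v 1 = - \<bar>s\<bar>\<^sup>2" using s by simp
    ultimately have "v 1 \<in> (\<lambda>s. - s\<^sup>2) ` {0..r}" by (intro image_eqI[of _ _ "\<bar>s\<bar>"]) simp_all
    then show "v \<in> PiE {..<6} (\<lambda>i. if i = 1 then (\<lambda>s. - s\<^sup>2) ` {0..r} else {- K..K})"
      using v unfolding box_def PiE_iff by simp
  qed
  then have "card {v \<in> box 6 K. \<exists>s. - v 1 = s\<^sup>2}
      \<le> card (PiE {..<6} (\<lambda>i. if i = (1::nat) then (\<lambda>s. - s\<^sup>2) ` {0..r} else {- K..K}))"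
    by (rule card_mono[rotated]) (intro finite_PiE, simp_all)
  also have "\<dots> = (\<Prod>i<6. card (if i = (1::nat) then (\<lambda>s. - s\<^sup>2) ` {0..r} else {- K..K}))"
    by (rule card_PiE) simp
  also have "\<dots> = card ((\<lambda>s. - s\<^sup>2) ` {0..r}) * nat (2 * K + 1) ^ 5"
    by (simp add: eval_nat_numeral lessThan_Suc mult.commute)
  also have "\<dots> \<le> nat (r + 1) * nat (2 * K + 1) ^ 5"
    using card_image_le[of "{0..r}" "\<lambda>s. - s\<^sup>2"] by (intro mult_right_mono) simp_all
  finally have "real (card {v \<in> box 6 K. \<exists>s. - v 1 = s\<^sup>2}) \<le> real (nat (r + 1) * nat (2 * K + 1) ^ 5)"
    by (simp only: of_nat_le_iff)
  also have "\<dots> = real_of_int (r + 1) * real_of_int (2 * K + 1) ^ 5" using K r by simp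
  also have "\<dots> \<le> real_of_int (2 * K + 1) ^ 6 * (2 * decay H)"
  proof -
    let ?N = "real_of_int (2 * K + 1)"
    have NH: "H \<le> ?N" using large(1) unfolding K_def by linarith
    have sq: "sqrt H \<ge> 1" "sqrt H > 0" using large(1) by simp_all
    have d: "H powr (-1/2) \<le> decay H"
    proof -
      have "H powr (-1/2) \<le> H powr (-1/3)" using large(1) by (intro powr_mono) simp_all
      moreover have "1 \<le> ln H powr (2/3)" using large(2) by (intro ge_one_powr_ge_zero) simp_all
      then have "H powr (-1/3) * 1 \<le> H powr (-1/3) * ln H powr (2/3)" by (intro mult_left_mono) simp_all
      ultimately show ?thesis unfolding decay_def by linarith
    qed
    have "real_of_int (r + 1) \<le> sqrt H + 1" unfolding r_def by simp
    also have "\<dots> \<le> 2 * sqrt H" using sq by simp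
    also have "sqrt H = H * H powr (-1/2)"
    proof -
      have "H * H powr (-1/2) = H powr 1 * H powr (-1/2)" using large(1) by simp
      also have "\<dots> = H powr (1/2)" unfolding powr_add[symmetric] by simp
      finally show ?thesis using large(1) by (simp add: powr_half_sqrt)
    qed
    also have "2 * (H * H powr (-1/2)) \<le> 2 * (?N * decay H)"
      using NH d large(1) by (intro mult_left_mono mult_mono) simp_all
    finally have "real_of_int (r + 1) \<le> 2 * (?N * decay H)" .
    then have "real_of_int (r + 1) * ?N ^ 5 \<le> 2 * (?N * decay H) * ?N ^ 5"
      by (rule mult_right_mono) (use K in simp)
    also have "\<dots> = ?N ^ 6 * (2 * decay H)" by (simp add: eval_nat_numeral)
    finally show ?thesis .
  qed
  finally show ?thesis by (simp add: K_def)
qed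

lemma positive_rank_bound:
  assumes H: "large H" and n: "n = (if fam = Family_square then 7 else 6)"
  shows "real (card (positive_rank_curves fam H))
    \<le> (2 * real_of_int \<lfloor>H\<rfloor> + 1) ^ n * ((sieve_const n + 2) * decay H)"
proof -
  have Q: "odd_prime (int q)" if "q \<in> sieve_primes H" for q
    using that by (intro odd_prime_int) (simp_all add: sieve_primes_def)
  have N: "2 * real_of_int \<lfloor>H\<rfloor> + 1 \<ge> 0" using H by (simp add: large_def)
  have dec: "decay H \<ge> 0" by (simp add: decay_def)
  have weaken: "X \<le> (2 * real_of_int \<lfloor>H\<rfloor> + 1) ^ n * ((sieve_const n + 2) * decay H)"
    if "X \<le> (2 * real_of_int \<lfloor>H\<rfloor> + 1) ^ n * (sieve_const n * decay H)" for X
    by (rule order_trans[OF that]) (intro mult_left_mono mult_right_mono, simp_all add: N dec)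
  show ?thesis
  proof (cases fam)
    case Family_0
    then have n: "n = 6" using n by simp
    have "real (card (positive_rank_curves fam H))
        \<le> real (card {v \<in> box n \<lfloor>H\<rfloor>. \<forall>q\<in>sieve_primes H. \<not> odd_prime.good_0 (int q) v})"
      unfolding Family_0 n of_nat_le_iff by (rule positive_rank_0_le[OF Q])
    also have "\<dots> \<le> (2 * real_of_int \<lfloor>H\<rfloor> + 1) ^ n * (sieve_const n * decay H)"
    proof (rule sieve_bound[OF H])
      fix q :: nat assume q: "prime q" "q \<ge> 5"
      show "periodic n q (odd_prime.good_0 (int q))"
        using odd_prime.periodic_good_0[OF odd_prime_int[OF q]] unfolding n nat_int .
      show "q ^ n \<le> 64 * card (residue_vectors n q (odd_prime.good_0 (int q)))"
        using odd_prime.density_good_0[OF odd_prime_int[OF q]] unfolding n nat_int .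
    qed
    finally show ?thesis by (rule weaken)
  next
    case Family_square
    then have n: "n = 7" using n by simp
    have "real (card (positive_rank_curves fam H))
        \<le> real (card {v \<in> box n \<lfloor>H\<rfloor>. \<forall>q\<in>sieve_primes H. \<not> odd_prime.good_square (int q) v})"
      unfolding Family_square n of_nat_le_iff by (rule positive_rank_square_le[OF Q])
    also have "\<dots> \<le> (2 * real_of_int \<lfloor>H\<rfloor> + 1) ^ n * (sieve_const n * decay H)"
    proof (rule sieve_bound[OF H])
      fix q :: nat assume q: "prime q" "q \<ge> 5"
      show "periodic n q (odd_prime.good_square (int q))"
        using odd_prime.periodic_good_square[OF odd_prime_int[OF q]] unfolding n nat_int .
      show "q ^ n \<le> 64 * card (residue_vectors n q (odd_prime.good_square (int q)))"
        using odd_prime.density_good_square[OF odd_prime_int[OF q]] unfolding n nat_int .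
    qed
    finally show ?thesis by (rule weaken)
  next
    case Family_l
    then have n: "n = 6" using n by simp
    have "card (positive_rank_curves fam H)
        \<le> card {v \<in> box n \<lfloor>H\<rfloor>. \<forall>q\<in>sieve_primes H. \<not> odd_prime.good_l (int q) v}
          + card {v \<in> box 6 \<lfloor>H\<rfloor>. \<exists>s. - v 1 = s\<^sup>2}"
      unfolding Family_l n by (rule positive_rank_l_le[OF Q])
    then have "real (card (positive_rank_curves fam H))
        \<le> real (card {v \<in> box n \<lfloor>H\<rfloor>. \<forall>q\<in>sieve_primes H. \<not> odd_prime.good_l (int q) v}
          + card {v \<in> box 6 \<lfloor>H\<rfloor>. \<exists>s. - v 1 = s\<^sup>2})" by (simp only: of_nat_le_iff)
    moreover have "real (card {v \<in> box n \<lfloor>H\<rfloor>. \<forall>q\<in>sieve_primes H. \<not> odd_prime.good_l (int q) v})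
        \<le> (2 * real_of_int \<lfloor>H\<rfloor> + 1) ^ n * (sieve_const n * decay H)"
    proof (rule sieve_bound[OF H])
      fix q :: nat assume q: "prime q" "q \<ge> 5"
      show "periodic n q (odd_prime.good_l (int q))"
        using odd_prime.periodic_good_l[OF odd_prime_int[OF q]] unfolding n nat_int .
      show "q ^ n \<le> 64 * card (residue_vectors n q (odd_prime.good_l (int q)))"
        using odd_prime.density_good_l[OF odd_prime_int[OF q]] unfolding n nat_int .
    qed
    moreover have "real (card {v \<in> box 6 \<lfloor>H\<rfloor>. \<exists>s. - v 1 = s\<^sup>2}) \<le> (2 * real_of_int \<lfloor>H\<rfloor> + 1) ^ n * (2 * decay H)"
      unfolding n by (rule card_square_component[OF H])
    moreover have "(2 * real_of_int \<lfloor>H\<rfloor> + 1) ^ n * ((sieve_const n + 2) * decay H)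
      = (2 * real_of_int \<lfloor>H\<rfloor> + 1) ^ n * (sieve_const n * decay H)
        + (2 * real_of_int \<lfloor>H\<rfloor> + 1) ^ n * (2 * decay H)"
      by (simp only: distrib_left distrib_right)
    ultimately show ?thesis by (simp only: of_nat_add)
  qed
qed

theorem mainTheorem3:
  fixes fam :: family
  shows "(\<lambda>H::real. real (card (positive_rank_curves fam H)) / real (card (curves fam H)))
    \<in> O[at_top](\<lambda>H. H powr (-1/3) * (ln H * ln (ln H)) powr (2/3))"
proof -
  define n :: nat where "n = (if fam = Family_square then 7 else 6)"
  define c :: real where "c = sieve_const n + 2"
  have *: "norm (real (card (positive_rank_curves fam H)) / real (card (curves fam H)))
      \<le> 5 ^ n * c * norm (H powr (-1/3) * (ln H * ln (ln H)) powr (2/3))" if H: "large H" for H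
  proof -
  define N where "N = 2 * real_of_int \<lfloor>H\<rfloor> + 1"
  let ?r = "real (card (positive_rank_curves fam H)) / real (card (curves fam H))"
  have large: "H \<ge> 3" "ln H \<ge> 1" "ln (ln H) \<ge> 1" using H by (simp_all add: large_def)
  have N: "N > 0" using large(1) unfolding N_def by linarith
  have low: "(N / 5) ^ n \<le> real (card (curves fam H))"
    unfolding N_def by (rule card_curves_ge[OF _ n_def]) (use large(1) in simp)
  have up: "real (card (positive_rank_curves fam H)) \<le> N ^ n * (c * decay H)"
    unfolding N_def c_def by (rule positive_rank_bound[OF H n_def])
  have dec: "decay H \<ge> 0" "c \<ge> 0" by (simp_all add: decay_def c_def sieve_const_def)
  have "?r \<le> (N ^ n * (c * decay H)) / ((N / 5) ^ n)"
    by (rule frac_le) (use low up N dec in \<open>simp_all add: zero_less_power\<close>)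
  also have "\<dots> = 5 ^ n * c * decay H" using N by (simp add: power_divide)
  also have "\<dots> \<le> 5 ^ n * c * (H powr (-1/3) * (ln H * ln (ln H)) powr (2/3))"
  proof (rule mult_left_mono)
    have "ln H * 1 \<le> ln H * ln (ln H)" using large by (intro mult_left_mono) simp_all
    then have "ln H powr (2/3) \<le> (ln H * ln (ln H)) powr (2/3)" using large by (intro powr_mono2) simp_all
    then show "decay H \<le> H powr (-1/3) * (ln H * ln (ln H)) powr (2/3)"
      unfolding decay_def by (rule mult_left_mono) simp
  qed (use dec in simp)
  finally have r: "?r \<le> 5 ^ n * c * (H powr (-1/3) * (ln H * ln (ln H)) powr (2/3))" .
  show "norm ?r \<le> 5 ^ n * c * norm (H powr (-1/3) * (ln H * ln (ln H)) powr (2/3))"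
    using r by simp
  qed
  show ?thesis by (rule bigoI[OF eventually_mono[OF eventually_large *]])
qed

end
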